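(* Let $0<\varepsilon\le R$, $0<\lambda\le1$, $\sigma\in\mathbb{R}$, and let $y_{0,1}$ be the first positive zero of $Y_0$. Then $$\sup_{\omega>0}\left\Vert u_\varepsilon^s(|x|=R)\right\Vert_{H^\sigma}\le\frac52\sqrt{\frac{\varepsilon}{R}}\;\mathcal{N}^\sigma(u^i)+\sqrt{2\pi}\,|u^i(0)|\left|H_0^{(1)}\!\left(y_{0,1}\frac R\varepsilon\right)\right|.$$ Furthermore, if $\lambda<1$ and $n_0$ is the smallest positive integer such that $\lambda^2\le1-\frac{49}{9n^{2/3}}$ for all $n\ge n_0$, then $$\sup_{\omega>0}\left\Vert u_\varepsilon^s(|x|=\varepsilon)\right\Vert_{H_*^\sigma}\ge\frac1{\sqrt{10}}\,\mathbf{N}^\sigma_{n_0}(u^i).$$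
   Context: Setting: $\varepsilon,\omega,q,q_0>0$; $q_\varepsilon=q$ for $|x|<\varepsilon$ and $q_\varepsilon=q_0$ for $|x|>\varepsilon$ in $\mathbb{R}^2$; $\omega_\varepsilon=\sqrt{q_0}\,\omega\varepsilon$ and $\lambda=\sqrt{q/q_0}$. $(r,\theta)$ are polar coordinates; $J_n,Y_n$ are Bessel functions and $H_n^{(1)}=J_n+iY_n$. The incident field, a non-singular solution of $\Delta u^i+\omega^2q_0u^i=0$ in $\mathbb{R}^2$, is $u^i=\sum_{n\in\mathbb{Z}}a_nJ_n(\sqrt{q_0}\,\omega r)e^{in\theta}$ (so $u^i(0)=a_0$); when $\omega$ varies, the coefficients $a_n$, and $\varepsilon,q,q_0$, are kept fixed. $u_\varepsilon\in H^1_{loc}(\mathbb{R}^2)$ solves $\Delta u_\varepsilon+\omega^2q_\varepsilon u_\varepsilon=0$, with $u_\varepsilon=u^i+u^s_\varepsilon$ for $|x|>\varepsilon$, where $u_\varepsilon^s$ satisfies the outgoing radiation condition $\partial_ru^s_\varepsilon-i\omega\sqrt{q_0}u^s_\varepsilon=o(r^{-1/2})$. Equivalently, for $r\ge\varepsilon$, $u^s_\varepsilon=\sum_{n}a_nR_n(\omega_\varepsilon,\lambda)H^{(1)}_n(\sqrt{q_0}\,\omega r)e^{in\theta}$, with $$R_n(x,\lambda)=-\frac{\Re D_n}{D_n},\quad D_n=H_n^{(1)\prime}(x)J_n(\lambda x)-\lambda J_n'(\lambda x)H^{(1)}_n(x).$$ Norms: for $f$ on the circle $|x|=R$ with Fourier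 coefficients $c_n=\frac1{2\pi}\int_0^{2\pi}f(R,\theta)e^{-in\theta}d\theta$, $\Vert f(|x|=R)\Vert_{H^\sigma}=\sqrt{2\pi}\big(\sum_{n}|c_n|^2(1+|n|)^{2\sigma}\big)^{1/2}$, and $\Vert f(|x|=R)\Vert_{H^\sigma_*}$ is the same with the sum over $n\ne0$. Moreover $$\mathcal{N}^\sigma(u^i)=\sqrt{2\pi}\Big(\sum_{n\ne0}|a_n|^2\sup_{x>0}|J_n(x)|^2(1+|n|)^{2\sigma}\Big)^{1/2},\quad \mathbf{N}^\sigma_p(u^i)=\sqrt{2\pi}\sup_{|n|\ge p}|a_n|\sup_{x>0}|J_n(x)|(1+|n|)^\sigma .$$ Values $+\infty$ are allowed. *)

theory Defs
  imports "HOL-Analysis.Analysis"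
begin

section \<open>Bessel and Hankel functions of integer order\<close>

definition bessel_J_nat :: "nat \<Rightarrow> real \<Rightarrow> real" where
  "bessel_J_nat n x =
     (\<Sum>k. (-1) ^ k / (fact k * fact (n + k)) * (x / 2) ^ (2 * k + n))"

text \<open>The Neumann expansion (DLMF 10.8.1), i.e. the value of
  \<open>(J \<nu> x * cos (\<nu> * pi) - J (-\<nu>) x) / sin (\<nu> * pi)\<close> in the limit \<open>\<nu> \<rightarrow> n\<close>;
  only meaningful for \<open>x > 0\<close>.\<close>

definition bessel_Y_nat :: "nat \<Rightarrow> real \<Rightarrow> real" where
  "bessel_Y_nat n x =
     2 / pi * ln (x / 2) * bessel_J_nat n x
     - 1 / pi * (\<Sum>k<n. fact (n - 1 - k) / fact k * (x / 2) ^ (2 * k)) / (x / 2) ^ n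
     - 1 / pi * (\<Sum>k. (Digamma (real k + 1) + Digamma (real (n + k) + 1)) * (-1) ^ k
                        / (fact k * fact (n + k)) * (x / 2) ^ (2 * k + n))"

text \<open>Negative orders: \<open>J (-n) = (-1)^n * J n\<close> and \<open>Y (-n) = (-1)^n * Y n\<close>.\<close>

definition bessel_J :: "int \<Rightarrow> real \<Rightarrow> real" where
  "bessel_J n x = (if 0 \<le> n then bessel_J_nat (nat n) x
                   else (-1) ^ nat (- n) * bessel_J_nat (nat (- n)) x)"

definition bessel_Y :: "int \<Rightarrow> real \<Rightarrow> real" where
  "bessel_Y n x = (if 0 \<le> n then bessel_Y_nat (nat n) x
                   else (-1) ^ nat (- n) * bessel_Y_nat (nat (- n)) x)"

definition hankel1 :: "int \<Rightarrow> real \<Rightarrow> complex" where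
  "hankel1 n x = complex_of_real (bessel_J n x) + \<i> * complex_of_real (bessel_Y n x)"

definition first_positive_zero :: "(real \<Rightarrow> real) \<Rightarrow> real \<Rightarrow> bool" where
  "first_positive_zero f y \<longleftrightarrow> 0 < y \<and> f y = 0 \<and> (\<forall>x. 0 < x \<and> x < y \<longrightarrow> f x \<noteq> 0)"


section \<open>Weak solutions of the Helmholtz equation in the plane\<close>

definition polar :: "real \<Rightarrow> real \<Rightarrow> real ^ 2" where
  "polar r \<theta> = vector [r * cos \<theta>, r * sin \<theta>]"

definition pderiv_at :: "2 \<Rightarrow> (real ^ 2 \<Rightarrow> complex) \<Rightarrow> real ^ 2 \<Rightarrow> complex" where
  "pderiv_at j \<phi> x = frechet_derivative \<phi> (at x) (axis j 1)"

text \<open>Test functions are \<open>C\<^sup>1\<close> with compact support.  For locally square integrable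
  functions and gradients this gives the same weak derivatives and weak solutions as smooth
  test functions, by density.\<close>

definition test_function :: "(real ^ 2 \<Rightarrow> complex) \<Rightarrow> bool" where
  "test_function \<phi> \<longleftrightarrow>
     (\<forall>x. \<phi> differentiable (at x)) \<and>
     (\<forall>j. continuous_on UNIV (pderiv_at j \<phi>)) \<and>
     (\<exists>K. compact K \<and> (\<forall>x. x \<notin> K \<longrightarrow> \<phi> x = 0))"

definition L2_loc :: "(real ^ 2 \<Rightarrow> 'b::euclidean_space) \<Rightarrow> bool" where
  "L2_loc f \<longleftrightarrow> f \<in> borel_measurable lborel \<and>
     (\<forall>K. compact K \<longrightarrow> set_integrable lborel K (\<lambda>x. (norm (f x))\<^sup>2))"

definition weak_gradient :: "(real ^ 2 \<Rightarrow> complex) \<Rightarrow> (real ^ 2 \<Rightarrow> complex ^ 2) \<Rightarrow> bool" where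
  "weak_gradient u g \<longleftrightarrow>
     (\<forall>\<phi> j. test_function \<phi> \<longrightarrow>
        (LINT x|lborel. u x * pderiv_at j \<phi> x) = - (LINT x|lborel. g x $ j * \<phi> x))"

text \<open>\<open>u\<close> belongs to \<open>H\<^sup>1\<close> locally and solves \<open>\<Delta>u + V u = 0\<close> weakly.  For bounded \<open>V\<close> elliptic
  regularity provides a continuous representative of \<open>u\<close>; we take \<open>u\<close> to be that one, so that
  its values on circles are well defined (they are its traces).\<close>

definition helmholtz_solution :: "(real ^ 2 \<Rightarrow> real) \<Rightarrow> (real ^ 2 \<Rightarrow> complex) \<Rightarrow> bool" where
  "helmholtz_solution V u \<longleftrightarrow>
     continuous_on UNIV u \<and> L2_loc u \<and>
     (\<exists>g. L2_loc g \<and> weak_gradient u g \<and>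
        (\<forall>\<phi>. test_function \<phi> \<longrightarrow>
           (LINT x|lborel. (\<Sum>j\<in>UNIV. g x $ j * pderiv_at j \<phi> x))
             = (LINT x|lborel. complex_of_real (V x) * u x * \<phi> x)))"


section \<open>The scattering problem\<close>

text \<open>The non-singular incident field with coefficients \<open>a\<close>.  Summation over \<open>n :: int\<close> is
  unconditional; the series converges in this sense because an entire solution is smooth
  on every circle.\<close>

definition incident_field ::
    "real \<Rightarrow> real \<Rightarrow> (int \<Rightarrow> complex) \<Rightarrow> (real ^ 2 \<Rightarrow> complex) \<Rightarrow> bool" where
  "incident_field q0 \<omega> a ui \<longleftrightarrow>
     helmholtz_solution (\<lambda>x. \<omega>\<^sup>2 * q0) ui \<and>
     (\<forall>r\<ge>0. \<forall>\<theta>. ((\<lambda>n. a n * complex_of_real (bessel_J n (sqrt q0 * \<omega> * r))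
                          * cis (of_int n * \<theta>)) has_sum ui (polar r \<theta>)) UNIV)"

text \<open>Outgoing radiation condition \<open>\<partial>\<^sub>r w - \<i> \<kappa> w = o(r powr (-1/2))\<close>, uniformly in the direction.\<close>

definition radiating :: "real \<Rightarrow> (real ^ 2 \<Rightarrow> complex) \<Rightarrow> bool" where
  "radiating \<kappa> w \<longleftrightarrow>
     (\<forall>e>0. \<forall>\<^sub>F r in at_top. \<forall>\<theta>. \<exists>d.
        ((\<lambda>s. w (polar s \<theta>)) has_vector_derivative d) (at r) \<and>
        norm (d - \<i> * complex_of_real \<kappa> * w (polar r \<theta>)) \<le> e * r powr (- 1 / 2))"

definition disc_index :: "real \<Rightarrow> real \<Rightarrow> real \<Rightarrow> real ^ 2 \<Rightarrow> real" where
  "disc_index \<epsilon> q q0 x = (if norm x < \<epsilon> then q else q0)"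

text \<open>The scattered field is \<open>u - ui\<close>; it is used for \<open>norm x \<ge> \<epsilon>\<close> only.\<close>

definition total_field ::
    "real \<Rightarrow> real \<Rightarrow> real \<Rightarrow> real \<Rightarrow> (real ^ 2 \<Rightarrow> complex) \<Rightarrow> (real ^ 2 \<Rightarrow> complex) \<Rightarrow> bool" where
  "total_field \<epsilon> q q0 \<omega> ui u \<longleftrightarrow>
     helmholtz_solution (\<lambda>x. \<omega>\<^sup>2 * disc_index \<epsilon> q q0 x) u \<and>
     radiating (\<omega> * sqrt q0) (\<lambda>x. u x - ui x)"


section \<open>Norms, with values in \<open>[0, \<infinity>]\<close>\<close>

definition esqrt :: "ennreal \<Rightarrow> ennreal" where
  "esqrt t = (if t = \<infinity> then \<infinity> else ennreal (sqrt (enn2real t)))"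

definition circle_coeff :: "(real ^ 2 \<Rightarrow> complex) \<Rightarrow> real \<Rightarrow> int \<Rightarrow> complex" where
  "circle_coeff f R n =
     1 / (2 * pi) * integral {0..2 * pi} (\<lambda>\<theta>. f (polar R \<theta>) * cis (- of_int n * \<theta>))"

definition weight :: "real \<Rightarrow> int \<Rightarrow> real" where
  "weight s n = (1 + \<bar>of_int n\<bar>) powr s"

definition Hs_norm :: "real \<Rightarrow> (real ^ 2 \<Rightarrow> complex) \<Rightarrow> real \<Rightarrow> ennreal" where
  "Hs_norm \<sigma> f R = ennreal (sqrt (2 * pi)) *
     esqrt (\<Sum>\<^sub>\<infinity>n. ennreal ((norm (circle_coeff f R n))\<^sup>2 * weight (2 * \<sigma>) n))"

definition Hs_star_norm :: "real \<Rightarrow> (real ^ 2 \<Rightarrow> complex) \<Rightarrow> real \<Rightarrow> ennreal" where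
  "Hs_star_norm \<sigma> f R = ennreal (sqrt (2 * pi)) *
     esqrt (\<Sum>\<^sub>\<infinity>n\<in>UNIV - {0}. ennreal ((norm (circle_coeff f R n))\<^sup>2 * weight (2 * \<sigma>) n))"

definition sup_J :: "int \<Rightarrow> ennreal" where
  "sup_J n = (SUP x\<in>{0<..}. ennreal \<bar>bessel_J n x\<bar>)"

definition N_sum :: "real \<Rightarrow> (int \<Rightarrow> complex) \<Rightarrow> ennreal" where
  "N_sum \<sigma> a = ennreal (sqrt (2 * pi)) *
     esqrt (\<Sum>\<^sub>\<infinity>n\<in>UNIV - {0}. ennreal ((norm (a n))\<^sup>2) * (sup_J n)\<^sup>2 * ennreal (weight (2 * \<sigma>) n))"

definition N_sup :: "real \<Rightarrow> nat \<Rightarrow> (int \<Rightarrow> complex) \<Rightarrow> ennreal" where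
  "N_sup \<sigma> p a = ennreal (sqrt (2 * pi)) *
     (SUP n\<in>{n. int p \<le> \<bar>n\<bar>}. ennreal (norm (a n)) * sup_J n * ennreal (weight \<sigma> n))"

end

theory Submission
  imports Defs "HOL-Real_Asymp.Real_Asymp"
begin

text \<open>Testing the weak equation against a radial profile times \<open>(x \<plusminus> \<i> y) ^ m\<close> and averaging over
  rotations shows that each Fourier coefficient of \<open>u\<close> solves a Bessel equation inside and outside the
  disc, with matching data at \<open>\<epsilon>\<close>.  The Wronskian with \<open>J m\<close> at the origin and with \<open>H m\<close> at
  infinity (through the radiation condition) leaves exactly the coefficient \<open>- Re D / D\<close>.

  With \<open>W = 2 / \<pi>\<close> the Wronskian of \<open>J\<close> and \<open>Y\<close>, one has \<open>J Im D - Y Re D = W J(\<lambda> x)\<close>.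
  For \<open>n > 0\<close>, as long as \<open>Y < 0\<close> this gives \<open>\<bar>Re D\<bar> \<bar>H\<bar> \<le> J \<bar>D\<bar>\<close>, and once \<open>Y\<close> has
  had a zero \<open>y\<close>, monotonicity of \<open>\<bar>H\<bar>\<close> gives \<open>\<bar>H x\<bar> \<le> \<bar>H y\<bar> = \<bar>J y\<bar>\<close>; either way the mode is
  dominated by \<open>sup \<bar>J\<bar>\<close>, and the decay factor \<open>sqrt (\<epsilon> / R)\<close> comes from Nicholson's monotonicity
  of \<open>x \<bar>H x\<bar>\<^sup>2\<close>.  This is decreasing for \<open>n > 0\<close> and increasing for \<open>n = 0\<close>; both follow from
  the third order (Appell) equation it satisfies.  For \<open>n = 0\<close> and \<open>x < y01\<close> the increase of
  \<open>x \<bar>H x\<bar>\<^sup>2\<close> is compensated by \<open>\<bar>R\<bar> \<le> sqrt (x / y01)\<close>.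

  For the lower bound, \<open>Im D\<close> vanishes somewhere between the first zero of \<open>Y\<close> and the first zero
  \<open>j\<close> of \<open>J\<close>, and there \<open>\<bar>R\<bar> = 1\<close> and \<open>\<bar>H\<bar> \<ge> \<bar>H j\<bar> = W / \<bar>j J' j\<bar>\<close>.  In the variable
  \<open>x = n exp (n powr (- 2/3) t)\<close> the Bessel equation becomes a perturbation of Airy's, and
  comparison with explicit quadratic test functions locates \<open>j\<close> and the next critical point
  accurately enough to bound \<open>sup \<bar>J\<bar>\<close> by \<open>sqrt 10 * \<bar>H j\<bar>\<close>.\<close>

section \<open>Bessel functions as solutions of a first order system\<close>

text \<open>Two obstacles shape the proof. The series of J and Y say nothing about infinity, where
  the outgoing condition and the monotonicity of the modulus are decided. Hence H_0 is built a
  second time as a Laplace integral with visible decay and identified with J_0 + i Y_0 by its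
  logarithmic behaviour at 0; higher orders follow by the three-term recurrence. Secondly, u is only
  a continuous weak solution, so its modes cannot be differentiated beforehand: all derivatives are
  moved to the test function, and the modes regain their regularity by a du Bois-Reymond argument.
  The transmission condition comes out of the same step, because the test functions see both sides
  of the circle. In the lower bound, 10 bounds the rescaled potential at the critical point of J_n
  that follows its first zero. The constant 49/9 keeps lam times that first zero in (0, n], where
  J_n and its derivative are positive.\<close>

text \<open>The system for \<open>(f, x f')\<close>: in these variables Wronskians are constant.\<close>
definition bessel_pair :: "nat \<Rightarrow> (real \<Rightarrow> 'a::real_normed_vector) \<Rightarrow> (real \<Rightarrow> 'a) \<Rightarrow> bool" where
  "bessel_pair n f g \<longleftrightarrow> (\<forall>x>0.
     (f has_vector_derivative (1 / x) *\<^sub>R g x) (at x) \<and>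
     (g has_vector_derivative (((real n)\<^sup>2 - x\<^sup>2) / x) *\<^sub>R f x) (at x))"

text \<open>With y = (x/2)^2 this is the entire factor E_n in J_n(x) = (x/2)^n E_n(y). Derivative
  and recurrence become identities between coefficients, and the behaviour at 0 can be read
  off.\<close>

definition bessel_series :: "nat \<Rightarrow> real \<Rightarrow> real" where
  "bessel_series n y = (\<Sum>k. (-1) ^ k / (fact k * fact (n + k)) * y ^ k)"

lemma summable_bessel_series:
  "summable (\<lambda>k. (-1) ^ k / (fact k * fact (n + k)) * (y::real) ^ k)"
proof (rule summable_comparison_test')
  show "summable (\<lambda>k. norm y ^ k / fact k)"
    using summable_exp[of "norm y"] by (simp add: field_simps)
  fix k :: nat
  have f: "(1::real) \<le> fact (n + k)" by (rule fact_ge_1)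
  have "norm y ^ k * 1 \<le> norm y ^ k * fact (n + k)"
    using f by (intro mult_left_mono) auto
  then show "norm ((-1) ^ k / (fact k * fact (n + k)) * y ^ k) \<le> norm y ^ k / fact k"
    by (simp add: abs_mult power_abs divide_simps)
qed

lemma bessel_series_deriv:
  "(bessel_series n has_field_derivative - bessel_series (Suc n) y) (at y)"
proof -
  define c :: "nat \<Rightarrow> real" where "c = (\<lambda>k. (-1) ^ k / (fact k * fact (n + k)))"
  have d: "diffs c k = - ((-1) ^ k / (fact k * fact (Suc n + k)))" for k
  proof -
    have "fact (Suc k) = (real k + 1) * fact k" by simp
    then show ?thesis
      by (simp add: diffs_def c_def divide_simps del: fact_Suc)
  qed
  have "((\<lambda>y. \<Sum>k. c k * y ^ k) has_field_derivative (\<Sum>k. diffs c k * y ^ k)) (at y)"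
    by (rule termdiffs_strong_converges_everywhere) (unfold c_def, rule summable_bessel_series)
  moreover have "(\<Sum>k. diffs c k * y ^ k) = - bessel_series (Suc n) y"
    unfolding d bessel_series_def using suminf_minus[OF summable_bessel_series[of "Suc n" y]] by simp
  moreover have "(\<lambda>y. \<Sum>k. c k * y ^ k) = bessel_series n"
    by (rule ext) (simp add: bessel_series_def c_def)
  ultimately show ?thesis by simp
qed

text \<open>Multiplication by y shifts the index, so the coefficient at k of E_n is compared with
  the one at k of E_{n+1} and the one at k - 1 of E_{n+2}. The term k = 0 has no partner and is
  treated apart.\<close>

lemma bessel_series_recurrence:
  "bessel_series n y = (real n + 1) * bessel_series (Suc n) y - y * bessel_series (Suc (Suc n)) y"
proof -
  define b :: "nat \<Rightarrow> nat \<Rightarrow> real" where "b m k = (-1) ^ k / (fact k * fact (m + k))" for m k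
  have s: "(\<lambda>k. b m k * y ^ k) sums bessel_series m y" for m
    unfolding b_def bessel_series_def by (rule summable_sums[OF summable_bessel_series])
  have "(\<lambda>k. y * (b (Suc (Suc n)) k * y ^ k)) sums (y * bessel_series (Suc (Suc n)) y)"
    by (intro sums_mult s)
  then have "(\<lambda>k. (case k of 0 \<Rightarrow> 0 | Suc j \<Rightarrow> y * (b (Suc (Suc n)) j * y ^ j)))
      sums (y * bessel_series (Suc (Suc n)) y)"
    by (subst sums_Suc_iff[symmetric, where f = "\<lambda>k. (case k of 0 \<Rightarrow> 0 | Suc j \<Rightarrow> _ j)", simplified]) simp
  then have "(\<lambda>k. (real n + 1) * (b (Suc n) k * y ^ k)
      - (case k of 0 \<Rightarrow> 0 | Suc j \<Rightarrow> y * (b (Suc (Suc n)) j * y ^ j)))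
      sums ((real n + 1) * bessel_series (Suc n) y - y * bessel_series (Suc (Suc n)) y)"
    by (intro sums_diff sums_mult s)
  moreover have "(real n + 1) * (b (Suc n) k * y ^ k)
      - (case k of 0 \<Rightarrow> 0 | Suc j \<Rightarrow> y * (b (Suc (Suc n)) j * y ^ j)) = b n k * y ^ k" for k
  proof (cases k)
    case 0
    have "fact (Suc n) = (real n + 1) * fact n" by simp
    then show ?thesis unfolding 0 b_def by (simp add: divide_simps del: fact_Suc)
  next
    case (Suc j)
    have f: "fact (Suc (n + Suc j)) = (real n + real j + 2) * fact (n + Suc j)"
      by (simp add: algebra_simps)
    show ?thesis unfolding Suc b_def
      using f by (simp add: divide_simps del: fact_Suc) (simp add: algebra_simps)
  qed
  ultimately show ?thesis using sums_unique2[OF _ s[of n]] by auto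
qed

lemma isCont_bessel_series: "isCont (bessel_series n) y"
  by (rule DERIV_isCont[OF bessel_series_deriv])

lemma bessel_series_0: "bessel_series n 0 = 1 / fact n"
  unfolding bessel_series_def
  by (subst powser_zero[of "\<lambda>k. (-1) ^ k / (fact k * fact (n + k))"]) simp

lemma bessel_J_nat_series: "bessel_J_nat n x = (x / 2) ^ n * bessel_series n ((x / 2)\<^sup>2)"
proof -
  have "bessel_J_nat n x
      = (\<Sum>k. (x / 2) ^ n * ((-1) ^ k / (fact k * fact (n + k)) * ((x / 2)\<^sup>2) ^ k))"
    unfolding bessel_J_nat_def power_add power_mult by (simp only: mult_ac)
  also have "\<dots> = (x / 2) ^ n * bessel_series n ((x / 2)\<^sup>2)"
    unfolding bessel_series_def by (rule suminf_mult[OF summable_bessel_series])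
  finally show ?thesis .
qed

lemma bessel_J_nat_recurrence:
  "x > 0 \<Longrightarrow> bessel_J_nat (Suc (Suc n)) x = 2 * (real n + 1) / x * bessel_J_nat (Suc n) x - bessel_J_nat n x"
  using arg_cong[OF bessel_series_recurrence[of n "(x / 2)\<^sup>2"], of "\<lambda>t. (x / 2) ^ n * t"]
  by (simp add: bessel_J_nat_series right_diff_distrib power2_eq_square mult_ac)

lemma bessel_J_nat_deriv:
  assumes x: "x > 0"
  shows "(bessel_J_nat n has_field_derivative
           real n / x * bessel_J_nat n x - bessel_J_nat (Suc n) x) (at x)"
proof -
  have "((\<lambda>x. (x / 2) ^ n * bessel_series n ((x / 2)\<^sup>2)) has_field_derivative
      (real n * (x / 2) ^ (n - 1) / 2) * bessel_series n ((x / 2)\<^sup>2)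
      + (x / 2) ^ n * (- bessel_series (Suc n) ((x / 2)\<^sup>2) * (x / 2))) (at x)"
    by (rule derivative_eq_intros refl DERIV_chain2[OF bessel_series_deriv] | simp add: field_simps)+
  moreover have "(real n * (x / 2) ^ (n - 1) / 2) = real n / x * (x / 2) ^ n"
    using x by (cases n) (auto simp: field_simps)
  ultimately show ?thesis
    unfolding bessel_J_nat_series[abs_def] by (elim DERIV_cong) (simp add: algebra_simps)
qed

lemma bessel_J_nat_deriv_Suc:
  assumes x: "x > 0"
  shows "(bessel_J_nat (Suc n) has_field_derivative
           bessel_J_nat n x - (real n + 1) / x * bessel_J_nat (Suc n) x) (at x)"
  using bessel_J_nat_deriv[OF x, of "Suc n"] bessel_J_nat_recurrence[OF x, of n]
  by (simp add: algebra_simps add_divide_distrib)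

text \<open>This is x times the derivative of J_n, with the derivative eliminated through the ladder
  relation.\<close>

definition DJ :: "nat \<Rightarrow> real \<Rightarrow> real" where
  "DJ n x = real n * bessel_J_nat n x - x * bessel_J_nat (Suc n) x"

lemma bessel_pair_J: "bessel_pair n (bessel_J_nat n) (DJ n)"
proof -
  have "(bessel_J_nat n has_field_derivative (1 / x) *\<^sub>R DJ n x) (at x)"
       "(DJ n has_field_derivative (((real n)\<^sup>2 - x\<^sup>2) / x) *\<^sub>R bessel_J_nat n x) (at x)"
    if x: "x > 0" for x
  proof -
    show "(bessel_J_nat n has_field_derivative (1 / x) *\<^sub>R DJ n x) (at x)"
      using bessel_J_nat_deriv[OF x, of n] x by (simp add: DJ_def field_simps)
    show "(DJ n has_field_derivative (((real n)\<^sup>2 - x\<^sup>2) / x) *\<^sub>R bessel_J_nat n x) (at x)"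
      unfolding DJ_def[abs_def]
      by (rule derivative_eq_intros refl bessel_J_nat_deriv[OF x] bessel_J_nat_deriv_Suc[OF x])+
         (use x in \<open>simp add: field_simps power2_eq_square\<close>)
  qed
  then show ?thesis
    unfolding bessel_pair_def has_real_derivative_iff_has_vector_derivative by blast
qed

lemma tendsto_half_square: "((\<lambda>x::real. (x / 2)\<^sup>2) \<longlongrightarrow> 0) (at_right 0)"
  by (rule tendsto_eq_intros refl | simp)+

lemma tendsto_bessel_series_0:
  "((\<lambda>x. bessel_series n ((x / 2)\<^sup>2)) \<longlongrightarrow> 1 / fact n) (at_right 0)"
  using isCont_tendsto_compose[OF isCont_bessel_series tendsto_half_square] by (simp add: bessel_series_0)

lemma tendsto_J_0: "(bessel_J_nat n \<longlongrightarrow> (if n = 0 then 1 else 0)) (at_right 0)"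
proof -
  have "((\<lambda>x::real. (x / 2) ^ n * bessel_series n ((x / 2)\<^sup>2)) \<longlongrightarrow> (0 / 2) ^ n * (1 / fact n)) (at_right 0)"
    by (intro tendsto_intros tendsto_bessel_series_0) auto
  moreover have "bessel_J_nat n = (\<lambda>x. (x / 2) ^ n * bessel_series n ((x / 2)\<^sup>2))"
    by (rule ext) (rule bessel_J_nat_series)
  ultimately show ?thesis by (auto simp: power_0_left)
qed

lemma tendsto_DJ_0: "(DJ n \<longlongrightarrow> 0) (at_right 0)"
proof -
  have "((\<lambda>x. real n * bessel_J_nat n x - x * bessel_J_nat (Suc n) x) \<longlongrightarrow>
       real n * (if n = 0 then 1 else 0) - 0 * (if Suc n = 0 then 1 else 0)) (at_right 0)"
    by (intro tendsto_intros tendsto_J_0)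
  then show ?thesis by (simp add: DJ_def[abs_def] split: if_splits)
qed

lemma J_pos_near_0: "eventually (\<lambda>x. bessel_J_nat n x > 0) (at_right 0)"
proof -
  have "eventually (\<lambda>x. bessel_series n ((x / 2)\<^sup>2) > 0) (at_right 0)"
    by (rule order_tendstoD(1)[OF tendsto_bessel_series_0]) simp
  moreover have "eventually (\<lambda>x::real. x > 0) (at_right 0)" by (rule eventually_at_right_less)
  ultimately show ?thesis by eventually_elim (simp add: bessel_J_nat_series)
qed

text \<open>The quotient of \<open>DJ n x\<close> by (x/2)^n tends to n / n!, which is positive
  because n > 0.\<close>

lemma DJ_pos_near_0:
  assumes "n > 0"
  shows "eventually (\<lambda>x. DJ n x > 0) (at_right 0)"
proof -
  have "((\<lambda>x. real n * bessel_series n ((x / 2)\<^sup>2) - x\<^sup>2 / 2 * bessel_series (Suc n) ((x / 2)\<^sup>2))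
     \<longlongrightarrow> real n * (1 / fact n) - 0\<^sup>2 / 2 * (1 / fact (Suc n))) (at_right 0)"
    by (intro tendsto_intros tendsto_bessel_series_0) auto
  then have "eventually (\<lambda>x. real n * bessel_series n ((x / 2)\<^sup>2)
      - x\<^sup>2 / 2 * bessel_series (Suc n) ((x / 2)\<^sup>2) > 0) (at_right 0)"
    by (rule order_tendstoD(1)) (use assms in auto)
  moreover have "eventually (\<lambda>x::real. x > 0) (at_right 0)" by (rule eventually_at_right_less)
  ultimately show ?thesis
  proof eventually_elim
    case (elim x)
    have "DJ n x = (x / 2) ^ n * (real n * bessel_series n ((x / 2)\<^sup>2)
      - x\<^sup>2 / 2 * bessel_series (Suc n) ((x / 2)\<^sup>2))"
      by (simp add: DJ_def bessel_J_nat_series algebra_simps power2_eq_square)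
    then show ?case using elim by simp
  qed
qed

section \<open>The Neumann series of order zero\<close>

text \<open>For order zero the finite sum in \<open>bessel_Y_nat\<close> is empty and its two
  digamma terms coincide. What remains besides the logarithm is the power series
  \<open>bessel_U\<close> in (x/2)^2 with these coefficients.\<close>

definition bessel_psi :: "nat \<Rightarrow> real" where
  "bessel_psi k = Digamma (real k + 1) * (-1) ^ k / (fact k * fact k)"

definition bessel_U :: "real \<Rightarrow> real" where
  "bessel_U y = (\<Sum>k. bessel_psi k * y ^ k)"

text \<open>The Euler derivative y U'(y). With a series of its own, it reduces Bessel's equation for
  Y_0 to a single further differentiation.\<close>

definition bessel_S :: "real \<Rightarrow> real" where
  "bessel_S y = (\<Sum>k. real k * bessel_psi k * y ^ k)"

lemma abs_Digamma_le: "\<bar>Digamma (real k + 1)\<bar> \<le> real k + 1"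
proof -
  have g: "0 < (euler_mascheroni::real)" "(euler_mascheroni::real) < 1"
    using euler_mascheroni_pos euler_mascheroni_less_13_over_22 by auto
  have h: "harm k \<ge> (0::real)" "harm k \<le> real k"
  proof -
    show "harm k \<ge> (0::real)" unfolding harm_def by (intro sum_nonneg) auto
    have "harm k \<le> (\<Sum>i=1..k. 1::real)" unfolding harm_def
      by (intro sum_mono) (auto simp: field_simps)
    then show "harm k \<le> real k" by simp
  qed
  have "Digamma (real k + 1) = harm k - euler_mascheroni"
    using Digamma_of_nat[of k] by (simp add: add.commute)
  then show ?thesis using g h by linarith
qed

lemma summable_bessel_S: "summable (\<lambda>k. real k * bessel_psi k * y ^ k)"
  and summable_bessel_U: "summable (\<lambda>k. bessel_psi k * y ^ k)"
proof -
  have bound: "(real k + 1) * \<bar>Digamma (real k + 1)\<bar> / (fact k * fact k) \<le> 2 * 2 ^ k / fact k" for k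
  proof -
    have "real k + 1 \<le> 2 ^ k"
    proof -
      have "real (Suc k) \<le> real (2 ^ k)" using less_exp[of k] by (simp only: of_nat_le_iff Suc_le_eq)
      then show ?thesis by simp
    qed
    moreover have f: "real k + 1 \<le> 2 * fact k"
    proof -
      have "real k \<le> real (fact k)" using fact_ge_self[of k] by (simp only: of_nat_le_iff)
      then have "real k \<le> fact k" by (simp only: of_nat_fact)
      moreover have "(1::real) \<le> fact k" by (rule fact_ge_1)
      ultimately show ?thesis by linarith
    qed
    ultimately have "(real k + 1) * \<bar>Digamma (real k + 1)\<bar> \<le> 2 ^ k * (2 * fact k)"
      by (intro mult_mono order_trans[OF abs_Digamma_le]) auto
    then have "(real k + 1) * \<bar>Digamma (real k + 1)\<bar> / (fact k * fact k) \<le> 2 ^ k * (2 * fact k) / (fact k * fact k)"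
      by (intro divide_right_mono) auto
    then show ?thesis by (simp add: mult_ac)
  qed
  have sm: "summable (\<lambda>k. 2 * (2 * \<bar>y\<bar>) ^ k / fact k)"
    using summable_mult[OF summable_exp[of "2 * \<bar>y\<bar>"], of 2] by (simp add: field_simps)
  have n: "norm (c * bessel_psi k * y ^ k) \<le> 2 * (2 * \<bar>y\<bar>) ^ k / fact k"
    if "\<bar>c\<bar> \<le> real k + 1" for c k
  proof -
    have "norm (c * bessel_psi k * y ^ k)
        = \<bar>c\<bar> * \<bar>Digamma (real k + 1)\<bar> / (fact k * fact k) * \<bar>y\<bar> ^ k"
      by (simp add: bessel_psi_def abs_mult abs_divide power_abs)
    also have "\<dots> \<le> (real k + 1) * \<bar>Digamma (real k + 1)\<bar> / (fact k * fact k) * \<bar>y\<bar> ^ k"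
      using that by (intro mult_right_mono divide_right_mono) auto
    also have "\<dots> \<le> (2 * 2 ^ k / fact k) * \<bar>y\<bar> ^ k"
      by (intro mult_right_mono bound) auto
    finally show ?thesis by (simp add: power_mult_distrib)
  qed
  show "summable (\<lambda>k. real k * bessel_psi k * y ^ k)"
    by (rule summable_comparison_test'[OF sm, where N = 0]) (rule n, simp)
  show "summable (\<lambda>k. bessel_psi k * y ^ k)"
    by (rule summable_comparison_test'[OF sm, where N = 0]) (use n[of 1] in simp)
qed

lemma bessel_U_deriv: "(bessel_U has_field_derivative bessel_S y / y) (at y)" if "y \<noteq> 0"
proof -
  have "((\<lambda>y. \<Sum>k. bessel_psi k * y ^ k) has_field_derivative (\<Sum>k. diffs bessel_psi k * y ^ k)) (at y)"
    by (rule termdiffs_strong_converges_everywhere[OF summable_bessel_U])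
  moreover have "bessel_S y = y * (\<Sum>k. diffs bessel_psi k * y ^ k)"
  proof -
    have s: "summable (\<lambda>k. diffs bessel_psi k * y ^ k)"
      by (rule termdiff_converges_all[OF summable_bessel_U])
    have "bessel_S y = (\<Sum>k. y * (diffs bessel_psi k * y ^ k))"
      unfolding bessel_S_def using suminf_split_head[OF summable_bessel_S[of y]]
      by (simp add: diffs_def mult_ac)
    also have "\<dots> = y * (\<Sum>k. diffs bessel_psi k * y ^ k)" by (rule suminf_mult[OF s])
    finally show ?thesis .
  qed
  ultimately show ?thesis using that by (simp add: bessel_U_def[abs_def])
qed

text \<open>The digamma recurrence psi(k+2) = psi(k+1) + 1/(k+1) splits the shifted coefficient into
  the old one and a rational rest, which is a coefficient of \<open>bessel_series 1\<close>. In
  Bessel's equation for Y_0 this rest cancels the terms that stem from differentiating the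
  logarithm.\<close>

lemma bessel_S_deriv: "(bessel_S has_field_derivative - bessel_U y - bessel_series 1 y) (at y)"
proof -
  define c where "c = (\<lambda>k. real k * bessel_psi k)"
  have "((\<lambda>y. \<Sum>k. c k * y ^ k) has_field_derivative (\<Sum>k. diffs c k * y ^ k)) (at y)"
    by (rule termdiffs_strong_converges_everywhere) (use summable_bessel_S in \<open>simp add: c_def\<close>)
  moreover have d: "diffs c k = - bessel_psi k - (-1) ^ k / (fact k * fact (1 + k))" for k
  proof -
    have D: "Digamma (real (Suc k) + 1) = Digamma (real k + 1) + 1 / (real k + 1)"
      using Digamma_plus1[of "real k + 1"] by (simp add: add_ac)
    have f: "fact (Suc k) = (real k + 1) * fact k" "fact (1 + k) = (real k + 1) * fact k" by simp_all
    show ?thesis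
      unfolding diffs_def c_def bessel_psi_def D f by (simp add: divide_simps) (simp add: algebra_simps)
  qed
  moreover have "(\<Sum>k. diffs c k * y ^ k) = - bessel_U y - bessel_series 1 y"
  proof -
    have "(\<lambda>k. - (bessel_psi k * y ^ k) - ((-1) ^ k / (fact k * fact (1 + k))) * y ^ k)
        sums (- bessel_U y - bessel_series 1 y)"
      unfolding bessel_U_def bessel_series_def
      by (intro sums_diff sums_minus summable_sums summable_bessel_U summable_bessel_series)
    then show ?thesis unfolding d by (simp add: left_diff_distrib sums_iff)
  qed
  ultimately show ?thesis by (simp add: bessel_S_def[abs_def] c_def)
qed

lemma bessel_Y_0_eq:
  "bessel_Y_nat 0 x = 2 / pi * (ln (x / 2) * bessel_J_nat 0 x - bessel_U ((x / 2)\<^sup>2))"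
proof -
  have "(\<Sum>k. (Digamma (real k + 1) + Digamma (real (0 + k) + 1)) * (-1) ^ k
       / (fact k * fact (0 + k)) * (x / 2) ^ (2 * k + 0))
      = (\<Sum>k. 2 * (bessel_psi k * ((x / 2)\<^sup>2) ^ k))"
    by (intro suminf_cong) (simp add: bessel_psi_def power_mult)
  also have "\<dots> = 2 * bessel_U ((x / 2)\<^sup>2)"
    unfolding bessel_U_def by (rule suminf_mult[OF summable_bessel_U])
  finally show ?thesis by (simp add: bessel_Y_nat_def algebra_simps)
qed

definition DY0 :: "real \<Rightarrow> real" where
  "DY0 x = 2 / pi * (bessel_J_nat 0 x + ln (x / 2) * DJ 0 x - 2 * bessel_S ((x / 2)\<^sup>2))"

lemma bessel_pair_Y0: "bessel_pair 0 (bessel_Y_nat 0) DY0"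
proof -
  have J: "(bessel_J_nat 0 has_field_derivative DJ 0 x / x) (at x)"
    "(DJ 0 has_field_derivative - x * bessel_J_nat 0 x) (at x)" if "x > 0" for x
    using bessel_pair_J[of 0] that
    by (auto simp: bessel_pair_def has_real_derivative_iff_has_vector_derivative power2_eq_square)
  have "(bessel_Y_nat 0 has_field_derivative (1 / x) *\<^sub>R DY0 x) (at x)"
       "(DY0 has_field_derivative (((real 0)\<^sup>2 - x\<^sup>2) / x) *\<^sub>R bessel_Y_nat 0 x) (at x)"
    if x: "x > 0" for x
  proof -
    have y0: "(x / 2)\<^sup>2 \<noteq> 0" using x by simp
    have g: "((\<lambda>x::real. (x / 2)\<^sup>2) has_field_derivative x / 2) (at x)"
      by (rule derivative_eq_intros refl | simp)+
    have l: "((\<lambda>x::real. ln (x / 2)) has_field_derivative 1 / x) (at x)"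
      by (rule derivative_eq_intros refl | (use x in simp))+
    have U: "((\<lambda>x. bessel_U ((x / 2)\<^sup>2)) has_field_derivative bessel_S ((x / 2)\<^sup>2) / (x / 2)\<^sup>2 * (x / 2)) (at x)"
      by (rule DERIV_chain2[where g = "\<lambda>x. (x / 2)\<^sup>2", OF bessel_U_deriv[OF y0] g])
    have S: "((\<lambda>x. bessel_S ((x / 2)\<^sup>2)) has_field_derivative
        (- bessel_U ((x / 2)\<^sup>2) - bessel_series 1 ((x / 2)\<^sup>2)) * (x / 2)) (at x)"
      by (rule DERIV_chain2[where g = "\<lambda>x. (x / 2)\<^sup>2", OF bessel_S_deriv g])
    have "((\<lambda>x. 2 / pi * (ln (x / 2) * bessel_J_nat 0 x - bessel_U ((x / 2)\<^sup>2))) has_field_derivative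
        2 / pi * ((1 / x * bessel_J_nat 0 x + DJ 0 x / x * ln (x / 2)) - bessel_S ((x / 2)\<^sup>2) / (x / 2)\<^sup>2 * (x / 2))) (at x)"
      by (intro DERIV_cmult DERIV_diff DERIV_mult U l J x)
    moreover have "2 / pi * ((1 / x * bessel_J_nat 0 x + DJ 0 x / x * ln (x / 2)) - bessel_S ((x / 2)\<^sup>2) / (x / 2)\<^sup>2 * (x / 2))
        = (1 / x) *\<^sub>R DY0 x"
      using x by (simp add: DY0_def divide_simps) (simp add: power2_eq_square algebra_simps)
    ultimately show "(bessel_Y_nat 0 has_field_derivative (1 / x) *\<^sub>R DY0 x) (at x)"
      unfolding bessel_Y_0_eq[abs_def] by (simp only:)
    have "((\<lambda>x. 2 / pi * (bessel_J_nat 0 x + ln (x / 2) * DJ 0 x - 2 * bessel_S ((x / 2)\<^sup>2))) has_field_derivative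
        2 / pi * (DJ 0 x / x + (1 / x * DJ 0 x + (- x * bessel_J_nat 0 x) * ln (x / 2))
          - 2 * ((- bessel_U ((x / 2)\<^sup>2) - bessel_series 1 ((x / 2)\<^sup>2)) * (x / 2)))) (at x)"
      by (intro DERIV_cmult DERIV_diff DERIV_add DERIV_mult S l J x)
    moreover have "2 / pi * (DJ 0 x / x + (1 / x * DJ 0 x + (- x * bessel_J_nat 0 x) * ln (x / 2))
          - 2 * ((- bessel_U ((x / 2)\<^sup>2) - bessel_series 1 ((x / 2)\<^sup>2)) * (x / 2)))
        = (((real 0)\<^sup>2 - x\<^sup>2) / x) *\<^sub>R bessel_Y_nat 0 x"
    proof -
      have "DJ 0 x = - x * (x / 2) * bessel_series 1 ((x / 2)\<^sup>2)"
        by (simp add: DJ_def bessel_J_nat_series)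
      then have e: "DJ 0 x / x = - (x / 2) * bessel_series 1 ((x / 2)\<^sup>2)" "1 / x * DJ 0 x = - (x / 2) * bessel_series 1 ((x / 2)\<^sup>2)"
        using x by simp_all
      have q: "((real 0)\<^sup>2 - x\<^sup>2) / x = - x" using x by (simp add: power2_eq_square)
      show ?thesis unfolding e q bessel_Y_0_eq real_scaleR_def by (simp add: algebra_simps)
    qed
    ultimately show "(DY0 has_field_derivative (((real 0)\<^sup>2 - x\<^sup>2) / x) *\<^sub>R bessel_Y_nat 0 x) (at x)"
      unfolding DY0_def[abs_def] by (simp only:)
  qed
  then show ?thesis
    unfolding bessel_pair_def has_real_derivative_iff_has_vector_derivative by blast
qed

lemma bessel_U_0: "bessel_U 0 = - euler_mascheroni"
  unfolding bessel_U_def using powser_zero[of bessel_psi] by (simp add: bessel_psi_def)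

lemma tendsto_bessel_U: "((\<lambda>x. bessel_U ((x / 2)\<^sup>2)) \<longlongrightarrow> - euler_mascheroni) (at_right 0)"
proof -
  have "isCont bessel_U 0"
    unfolding bessel_U_def[abs_def]
    by (rule DERIV_isCont[OF termdiffs_strong_converges_everywhere[OF summable_bessel_U]])
  from isCont_tendsto_compose[OF this tendsto_half_square] show ?thesis by (simp add: bessel_U_0)
qed

lemma tendsto_bessel_S: "((\<lambda>x. bessel_S ((x / 2)\<^sup>2)) \<longlongrightarrow> 0) (at_right 0)"
proof -
  have "bessel_S 0 = 0"
    unfolding bessel_S_def using powser_zero[of "\<lambda>k. real k * bessel_psi k"] by simp
  with isCont_tendsto_compose[OF DERIV_isCont[OF bessel_S_deriv] tendsto_half_square] show ?thesis by simp
qed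

lemma tendsto_x_ln_0: "((\<lambda>x::real. x * ln (x / 2)) \<longlongrightarrow> 0) (at_right 0)"
  by real_asymp


text \<open>J_0 - 1 vanishes to second order at 0 and so beats the logarithm; the difference
  quotient of \<open>bessel_series 0\<close> in the variable (x/2)^2 makes this precise.\<close>

lemma tendsto_ln_J0: "((\<lambda>x. ln (x / 2) * (bessel_J_nat 0 x - 1)) \<longlongrightarrow> 0) (at_right 0)"
proof -
  have "((\<lambda>h. (bessel_series 0 (0 + h) - bessel_series 0 0) / h) \<longlongrightarrow> - bessel_series (Suc 0) 0) (at 0)"
    using bessel_series_deriv[of 0 0] unfolding DERIV_def .
  moreover have "filterlim (\<lambda>x::real. (x / 2)\<^sup>2) (at 0) (at_right 0)"
    unfolding filterlim_at using tendsto_half_square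
    by (auto simp: eventually_at_filter)
  ultimately have "((\<lambda>x. (bessel_series 0 ((x / 2)\<^sup>2) - 1) / (x / 2)\<^sup>2) \<longlongrightarrow> - bessel_series (Suc 0) 0) (at_right 0)"
    by (auto dest: filterlim_compose simp: bessel_series_0)
  then have "((\<lambda>x. (x * ln (x / 2)) * (x / 4) * ((bessel_series 0 ((x / 2)\<^sup>2) - 1) / (x / 2)\<^sup>2))
     \<longlongrightarrow> 0 * (0 / 4) * - bessel_series (Suc 0) 0) (at_right 0)"
    by (intro tendsto_intros tendsto_x_ln_0) auto
  then have "((\<lambda>x. (x * ln (x / 2)) * (x / 4) * ((bessel_series 0 ((x / 2)\<^sup>2) - 1) / (x / 2)\<^sup>2))
     \<longlongrightarrow> 0) (at_right 0)" by simp
  then show ?thesis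
    by (rule Lim_transform_eventually)
       (use eventually_at_right_less[of "0::real"] in eventually_elim,
         simp add: bessel_J_nat_series field_simps power2_eq_square)
qed

lemma tendsto_Y0_0:
  "((\<lambda>x. bessel_Y_nat 0 x - 2 / pi * (ln (x / 2) + euler_mascheroni)) \<longlongrightarrow> 0) (at_right 0)"
proof -
  have "((\<lambda>x. 2 / pi * (ln (x / 2) * (bessel_J_nat 0 x - 1) - (bessel_U ((x / 2)\<^sup>2) + euler_mascheroni)))
     \<longlongrightarrow> 2 / pi * (0 - (- euler_mascheroni + euler_mascheroni))) (at_right 0)"
    by (intro tendsto_intros tendsto_ln_J0 tendsto_bessel_U)
  then show ?thesis by (simp add: bessel_Y_0_eq algebra_simps)
qed

lemma tendsto_ln_DJ0: "((\<lambda>x. ln (x / 2) * DJ 0 x) \<longlongrightarrow> 0) (at_right 0)"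
proof -
  have "((\<lambda>x. (x * ln (x / 2)) * (- bessel_J_nat (Suc 0) x)) \<longlongrightarrow> 0 * (- (if Suc 0 = 0 then 1 else 0))) (at_right 0)"
    by (intro tendsto_intros tendsto_x_ln_0 tendsto_J_0)
  then show ?thesis by (simp add: DJ_def[abs_def] mult_ac)
qed

lemma tendsto_DY0_0: "(DY0 \<longlongrightarrow> 2 / pi) (at_right 0)"
proof -
  have "((\<lambda>x. 2 / pi * (bessel_J_nat 0 x + ln (x / 2) * DJ 0 x - 2 * bessel_S ((x / 2)\<^sup>2)))
     \<longlongrightarrow> 2 / pi * ((if (0::nat) = 0 then 1 else 0) + 0 - 2 * 0)) (at_right 0)"
    by (intro tendsto_intros tendsto_ln_DJ0 tendsto_bessel_S tendsto_J_0)
  then show ?thesis by (simp add: DY0_def[abs_def])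
qed

section \<open>Laplace integrals\<close>

lemma set_integral_scale:
  fixes f :: "real \<Rightarrow> 'a::euclidean_space"
  assumes "x > 0"
  shows "(LBINT s:{0<..}. f s) = (1 / x) *\<^sub>R (LBINT u:{0<..}. f (u / x))"
proof -
  have "(LBINT s:{0<..}. f s) = \<bar>1 / x\<bar> *\<^sub>R (LINT u|lborel. indicator {0<..} (0 + (1 / x) * u) *\<^sub>R f (0 + (1 / x) * u))"
    unfolding set_lebesgue_integral_def using assms by (intro lborel_integral_real_affine) auto
  also have "(\<lambda>u. indicator {0<..} (0 + (1 / x) * u) *\<^sub>R f (0 + (1 / x) * u)) = (\<lambda>u. indicator {0<..} u *\<^sub>R f (u / x))"
    using assms by (auto simp: indicator_def zero_less_divide_iff)
  finally show ?thesis using assms by (simp add: set_lebesgue_integral_def)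
qed

lemma Gamma_set_integrable:
  fixes a x :: real
  assumes "a > 0" "x > 0"
  shows "set_integrable lborel {0<..} (\<lambda>s. s powr (a - 1) * exp (- x * s))"
proof -
  have "(\<lambda>t. complex_of_real t powr (complex_of_real a - 1) / of_real (exp (x * t))) absolutely_integrable_on {0<..}"
    using assms by (intro absolutely_integrable_Gamma_integral) auto
  then have "(\<lambda>t. norm (complex_of_real t powr (complex_of_real a - 1) / of_real (exp (x * t)))) absolutely_integrable_on {0<..}"
    by (rule absolutely_integrable_norm[unfolded o_def])
  then have "(\<lambda>s. s powr (a - 1) * exp (- x * s)) absolutely_integrable_on {0<..}"
    by (rule set_integrable_cong[THEN iffD1, rotated -1])
       (auto simp: norm_divide norm_powr_real_powr exp_minus field_simps)
  then have "integrable lebesgue (\<lambda>s. indicator {0<..} s *\<^sub>R (s powr (a - 1) * exp (- x * s)))"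
    by (simp add: set_integrable_def)
  moreover have "(\<lambda>s. indicator {0<..} s *\<^sub>R (s powr (a - 1) * exp (- x * s))) \<in> borel_measurable lborel"
    by measurable
  ultimately show ?thesis unfolding set_integrable_def by (simp only: integrable_completion)
qed

lemma Gamma_set_integral:
  fixes a x :: real
  assumes "a > 0" "x > 0"
  shows "(LBINT s:{0<..}. s powr (a - 1) * exp (- x * s)) = Gamma a * x powr (- a)"
proof -
  have "((\<lambda>t. t powr (a - 1) / exp t) has_integral Gamma a) {0<..}"
    using Gamma_integral_real[OF assms(1)]
    by (rule has_integral_spike_set_eq[THEN iffD1, rotated -1])
       (auto intro: negligible_subset[of "{0}"])
  then have "integral {0<..} (\<lambda>s. s powr (a - 1) * exp (- 1 * s)) = Gamma a"
    by (simp add: exp_minus field_simps integral_unique)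
  then have 1: "(LBINT s:{0<..}. s powr (a - 1) * exp (- 1 * s)) = Gamma a"
    using set_borel_integral_eq_integral(2)[OF Gamma_set_integrable[OF assms(1) zero_less_one]] by simp
  have "(LBINT s:{0<..}. s powr (a - 1) * exp (- x * s))
      = (1 / x) *\<^sub>R (LBINT u:{0<..}. (u / x) powr (a - 1) * exp (- x * (u / x)))"
    by (rule set_integral_scale[OF assms(2)])
  also have "(LBINT u:{0<..}. (u / x) powr (a - 1) * exp (- x * (u / x)))
      = (LBINT u:{0<..}. x powr (1 - a) * (u powr (a - 1) * exp (- 1 * u)))"
    using assms by (intro set_lebesgue_integral_cong) (auto simp: powr_divide powr_diff field_simps)
  also have "\<dots> = x powr (1 - a) * Gamma a" by (simp only: set_integral_mult_right 1)
  finally show ?thesis using assms by (simp add: powr_diff powr_minus field_simps)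
qed

text \<open>Domination by a Gamma density gives existence and the rate x^(-a) together. The
  integrals of \<open>hk\<close>, of \<open>hk2\<close> and of the remainders are estimated this
  way, a - 1 being the exponent of the power that bounds the integrand.\<close>

lemma Laplace_bound:
  fixes f :: "real \<Rightarrow> 'a::euclidean_space"
  assumes "a > 0" "x > 0" and c: "continuous_on {0<..} f"
    and b: "\<And>s. s > 0 \<Longrightarrow> norm (f s) \<le> K * (s powr (a - 1) * exp (- x * s))"
  shows "set_integrable lborel {0<..} f"
    and "norm (LBINT s:{0<..}. f s) \<le> K * Gamma a * x powr (- a)"
proof -
  have K: "set_integrable lborel {0<..} (\<lambda>s. K * (s powr (a - 1) * exp (- x * s)))"
    using Gamma_set_integrable[OF assms(1,2)] by (rule set_integrable_mult_right)
  show i: "set_integrable lborel {0<..} f"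
  proof (rule set_integrable_bound[OF K])
    show "set_borel_measurable lborel {0<..} f"
      unfolding set_borel_measurable_def
      using borel_measurable_continuous_on_indicator[OF _ c] by simp
    show "AE s in lborel. s \<in> {0<..} \<longrightarrow> norm (f s) \<le> norm (K * (s powr (a - 1) * exp (- x * s)))"
      by (rule AE_I2) (use b abs_ge_self order_trans in \<open>fastforce simp: real_norm_def\<close>)
  qed
  have "norm (LBINT s:{0<..}. f s) \<le> (LBINT s:{0<..}. K * (s powr (a - 1) * exp (- x * s)))"
    unfolding set_lebesgue_integral_def
  proof (rule order_trans[OF integral_norm_bound integral_mono])
    show "integrable lborel (\<lambda>s. norm (indicator {0<..} s *\<^sub>R f s))"
      using i unfolding set_integrable_def by (rule integrable_norm)
    show "integrable lborel (\<lambda>s. indicator {0<..} s *\<^sub>R (K * (s powr (a - 1) * exp (- x * s))))"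
      using K unfolding set_integrable_def .
    show "norm (indicator {0<..} s *\<^sub>R f s) \<le> indicator {0<..} s *\<^sub>R (K * (s powr (a - 1) * exp (- x * s)))" for s
      using b[of s] by (auto simp: indicator_def)
  qed
  then show "norm (LBINT s:{0<..}. f s) \<le> K * Gamma a * x powr (- a)"
    by (simp only: set_integral_mult_right Gamma_set_integral[OF assms(1,2)] mult.assoc)
qed

text \<open>Applied below to primitives that vanish at both ends: each integral identity is the
  vanishing integral of a derivative.\<close>

lemma FTC_0_inf:
  fixes F :: "real \<Rightarrow> 'a::euclidean_space"
  assumes "\<And>s. s > 0 \<Longrightarrow> (F has_vector_derivative f s) (at s)"
    and c: "continuous_on {0<..} f" and "set_integrable lborel {0<..} f"
    and "(F \<longlongrightarrow> A) (at_right 0)" and "(F \<longlongrightarrow> B) at_top"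
  shows "(LBINT s:{0<..}. f s) = B - A"
proof -
  have e: "einterval 0 \<infinity> = {0<..}" by (auto simp: einterval_def)
  have "(LBINT s=0..\<infinity>. f s) = B - A"
  proof (rule interval_integral_FTC_integrable)
    show "isCont f s" if "0 < ereal s" for s
      using c that by (auto simp: continuous_on_eq_continuous_at)
    show "((F \<circ> real_of_ereal) \<longlongrightarrow> A) (at_right 0)"
      using assms(4) by (simp add: zero_ereal_def ereal_tendsto_simps1)
    show "((F \<circ> real_of_ereal) \<longlongrightarrow> B) (at_left \<infinity>)"
      using assms(5) by (simp add: ereal_tendsto_simps1)
  qed (use assms e in auto)
  then show ?thesis by (simp add: interval_lebesgue_integral_def e)
qed

text \<open>The value is Gamma'(1), found without differentiating under the integral. Writing E for
  the integral, u^a >= 1 + a ln u gives Gamma(1 + a) >= 1 + a E with equality at a = 0; the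
  difference has a local minimum there, so its derivative vanishes.\<close>

lemma Laplace_ln:
  "set_integrable lborel {0<..} (\<lambda>u::real. ln u * exp (- u))"
  "(LBINT u:{0<..}. ln u * exp (- u::real)) = - euler_mascheroni"
proof -
  \<comment> \<open>The two half powers dominate the logarithm at infinity and at 0, and both lead
    to Gamma densities.\<close>
  have l: "\<bar>ln u\<bar> \<le> 2 * (u powr (1/2) + u powr (- 1/2))" if "u > 0" for u :: real
  proof -
    have "ln (u powr (1/2)) \<le> u powr (1/2) - 1" "ln (u powr (-1/2)) \<le> u powr (-1/2) - 1"
      by (rule ln_le_minus_one, use that in simp)+
    then have "ln u \<le> 2 * u powr (1/2)" "- ln u \<le> 2 * u powr (-1/2)" using that by (auto simp: ln_powr)
    moreover have "0 \<le> u powr (1/2)" "0 \<le> u powr (-1/2)" by simp_all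
    ultimately show ?thesis unfolding abs_le_iff distrib_left by linarith
  qed
  have I2: "set_integrable lborel {0<..} (\<lambda>u::real. 2 * (u powr (3/2 - 1) * exp (- 1 * u)) + 2 * (u powr (1/2 - 1) * exp (- 1 * u)))"
    by (intro set_integral_add set_integrable_mult_right Gamma_set_integrable) auto
  show I: "set_integrable lborel {0<..} (\<lambda>u::real. ln u * exp (- u))"
  proof (rule set_integrable_bound[OF I2])
    show "set_borel_measurable lborel {0<..} (\<lambda>u::real. ln u * exp (- u))"
      unfolding set_borel_measurable_def by measurable
    show "AE u::real in lborel. u \<in> {0<..} \<longrightarrow> norm (ln u * exp (- u))
        \<le> norm (2 * (u powr (3/2 - 1) * exp (- 1 * u)) + 2 * (u powr (1/2 - 1) * exp (- 1 * u)))"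
    proof (rule AE_I2, rule impI)
      fix u :: real assume "u \<in> {0<..}"
      then have "\<bar>ln u\<bar> * exp (- u) \<le> 2 * (u powr (1/2) + u powr (- 1/2)) * exp (- u)"
        by (intro mult_right_mono l) auto
      also have "\<dots> = norm (2 * (u powr (3/2 - 1) * exp (- 1 * u)) + 2 * (u powr (1/2 - 1) * exp (- 1 * u)))"
        by (simp add: algebra_simps)
      finally show "norm (ln u * exp (- u)) \<le> norm (2 * (u powr (3/2 - 1) * exp (- 1 * u)) + 2 * (u powr (1/2 - 1) * exp (- 1 * u)))"
        by (simp add: abs_mult)
    qed
  qed
  define E where "E = (LBINT u:{0<..}. ln u * exp (- u::real))"
  have ge: "Gamma (1 + a) \<ge> 1 + a * E" if "\<bar>a\<bar> < 1" for a :: real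
  proof -
    have a: "1 + a > 0" using that by auto
    have one: "(LBINT u:{0<..}. u powr (1 - 1) * exp (- 1 * u)) = (1::real)"
      by (subst Gamma_set_integral) auto
    have i1: "set_integrable lborel {0<..} (\<lambda>u::real. u powr (1 - 1) * exp (- 1 * u))"
      by (intro Gamma_set_integrable) auto
    have "1 + a * E = (LBINT u:{0<..}. u powr (1 - 1) * exp (- 1 * u) + a * (ln u * exp (- u)))"
      unfolding E_def
      by (subst set_integral_add(2)[OF i1]) (use I one in \<open>auto intro!: set_integrable_mult_right\<close>)
    also have "\<dots> \<le> (LBINT u:{0<..}. u powr (1 + a - 1) * exp (- 1 * u))"
    proof (rule set_integral_mono)
      show "set_integrable lborel {0<..} (\<lambda>u. u powr (1 - 1) * exp (- 1 * u) + a * (ln u * exp (- u)))"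
        using i1 I by (intro set_integral_add set_integrable_mult_right) auto
      show "set_integrable lborel {0<..} (\<lambda>u. u powr (1 + a - 1) * exp (- 1 * u))"
        using a by (intro Gamma_set_integrable) auto
      fix u :: real assume u: "u \<in> {0<..}"
      have "1 + a * ln u \<le> u powr a"
        using exp_ge_add_one_self[of "a * ln u"] u by (simp add: powr_def)
      then have "(1 + a * ln u) * exp (- u) \<le> u powr a * exp (- u)" by (intro mult_right_mono) auto
      then show "u powr (1 - 1) * exp (- 1 * u) + a * (ln u * exp (- u)) \<le> u powr (1 + a - 1) * exp (- 1 * u)"
        using u by (simp add: algebra_simps)
    qed
    also have "\<dots> = Gamma (1 + a)" using a by (subst Gamma_set_integral) auto
    finally show ?thesis .
  qed
  have d: "((\<lambda>a. Gamma (1 + a) - (1 + a * E)) has_field_derivative (- euler_mascheroni - E)) (at 0)"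
    by (rule derivative_eq_intros refl | simp)+
  have "- euler_mascheroni - E = 0"
    by (rule DERIV_local_min[OF d, of 1]) (use ge in auto)
  then show "(LBINT u:{0<..}. ln u * exp (- u::real)) = - euler_mascheroni" by (simp add: E_def)
qed

text \<open>In \<open>Laplace_deriv\<close> this replaces a convergence theorem for differentiation
  under the integral: the remainder is estimated explicitly to second order.\<close>

lemma quadratic_bound_imp_has_vector_derivative:
  fixes f :: "real \<Rightarrow> 'a::real_normed_vector"
  assumes "d > 0" and b: "\<And>h. \<bar>h\<bar> \<le> d \<Longrightarrow> norm (f (x + h) - f x - h *\<^sub>R f') \<le> K * h\<^sup>2"
  shows "(f has_vector_derivative f') (at x)"
  unfolding has_vector_derivative_def has_derivative_at_alt
proof (intro conjI allI impI)
  show "bounded_linear (\<lambda>h. h *\<^sub>R f')" by (rule bounded_linear_scaleR_left)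
  fix e :: real assume e: "e > 0"
  define r where "r = min d (e / (\<bar>K\<bar> + 1))"
  have "r > 0" using e assms by (simp add: r_def)
  moreover have "norm (f y - f x - (y - x) *\<^sub>R f') \<le> e * norm (y - x)" if y: "norm (y - x) < r" for y
  proof -
    have "norm (f y - f x - (y - x) *\<^sub>R f') \<le> K * (y - x)\<^sup>2"
      using b[of "y - x"] y by (simp add: r_def)
    also have "\<dots> \<le> (\<bar>K\<bar> + 1) * (y - x)\<^sup>2" by (intro mult_right_mono) auto
    also have "\<dots> = ((\<bar>K\<bar> + 1) * \<bar>y - x\<bar>) * \<bar>y - x\<bar>" by (simp add: power2_eq_square)
    also have "\<dots> \<le> e * \<bar>y - x\<bar>"
    proof (rule mult_right_mono)
      have "\<bar>y - x\<bar> \<le> e / (\<bar>K\<bar> + 1)" using y by (simp add: r_def)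
      then show "(\<bar>K\<bar> + 1) * \<bar>y - x\<bar> \<le> e" by (simp add: field_simps)
    qed auto
    finally show ?thesis by simp
  qed
  ultimately show "\<exists>r>0. \<forall>y. norm (y - x) < r \<longrightarrow> norm (f y - f x - (y - x) *\<^sub>R f') \<le> e * norm (y - x)" by blast
qed

lemma exp_remainder_bound: "\<bar>exp u - 1 - u\<bar> \<le> u\<^sup>2 * exp \<bar>u\<bar>" for u :: real
proof -
  have lo: "0 \<le> exp u - 1 - u" using exp_ge_add_one_self[of u] by linarith
  have "(1 - u) * exp u \<le> exp (- u) * exp u"
    using exp_ge_add_one_self[of "- u"] by (intro mult_right_mono) auto
  then have "exp u - 1 \<le> u * exp u" by (simp add: exp_minus algebra_simps)
  then have a: "exp u - 1 - u \<le> u * (exp u - 1)" by (simp add: algebra_simps)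
  have "u * (exp u - 1) \<le> u\<^sup>2 * exp \<bar>u\<bar>"
  proof (cases "u \<ge> 0")
    case True
    then have "u * (exp u - 1) \<le> u * (u * exp u)" using \<open>exp u - 1 \<le> u * exp u\<close> by (intro mult_left_mono)
    then show ?thesis using True by (simp add: power2_eq_square)
  next
    case False
    have "(- u) * (1 - exp u) \<le> (- u) * (- u)" using exp_ge_add_one_self[of u] False by (intro mult_left_mono) linarith+
    moreover have "u\<^sup>2 * 1 \<le> u\<^sup>2 * exp \<bar>u\<bar>" by (intro mult_left_mono) auto
    ultimately show ?thesis by (simp add: power2_eq_square algebra_simps)
  qed
  with a lo show ?thesis by linarith
qed

definition Laplace :: "(real \<Rightarrow> complex) \<Rightarrow> nat \<Rightarrow> real \<Rightarrow> complex" where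
  "Laplace F k x = (LBINT s:{0<..}. of_real (s ^ k * exp (- x * s)) * F s)"

lemma Laplace_deriv:
  assumes c: "continuous_on {0<..} F" and b: "\<And>s. s > 0 \<Longrightarrow> norm (F s) \<le> s powr (- 1/2)" and x: "x > 0"
  shows "(Laplace F k has_vector_derivative - Laplace F (Suc k) x) (at x)"
proof (rule quadratic_bound_imp_has_vector_derivative[where d = "x / 2"])
  have P: "s ^ j * s powr (- 1/2) = s powr (real j + 1/2 - 1)" if "s > 0" for j s
    using that by (simp add: powr_realpow[symmetric] powr_add[symmetric])
  have i: "set_integrable lborel {0<..} (\<lambda>s. of_real (s ^ j * exp (- y * s)) * F s)" if "y > 0" for j y
  proof (rule Laplace_bound(1)[where a = "real j + 1/2" and x = y and K = 1])
    fix s :: real assume s: "s > 0"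
    have "norm (of_real (s ^ j * exp (- y * s)) * F s) \<le> (s ^ j * exp (- y * s)) * s powr (- 1/2)"
      using s b[OF s] by (simp add: norm_mult norm_power mult_left_mono)
    also have "\<dots> = (s ^ j * s powr (- 1/2)) * exp (- y * s)" by (simp only: mult_ac)
    finally show "norm (of_real (s ^ j * exp (- y * s)) * F s) \<le> 1 * (s powr (real j + 1/2 - 1) * exp (- y * s))"
      unfolding P[OF s] by simp
  qed (use that c in \<open>auto intro!: continuous_intros\<close>)
  show "x / 2 > 0" using x by simp
  fix h :: real assume h: "\<bar>h\<bar> \<le> x / 2"
  let ?g = "\<lambda>s. of_real (s ^ k * exp (- (x + h) * s)) * F s - of_real (s ^ k * exp (- x * s)) * F s
      + of_real h * (of_real (s ^ Suc k * exp (- x * s)) * F s)"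
  have "x + h > 0" using h x by linarith
  then have "Laplace F k (x + h) - Laplace F k x - h *\<^sub>R (- Laplace F (Suc k) x) = (LBINT s:{0<..}. ?g s)"
  proof -
    let ?f = "\<lambda>j y s. of_real (s ^ j * exp (- y * s)) * F s"
    have "(LBINT s:{0<..}. ?g s) = (LBINT s:{0<..}. ?f k (x + h) s - ?f k x s)
        + (LBINT s:{0<..}. of_real h * ?f (Suc k) x s)"
      using i \<open>x + h > 0\<close> x by (intro set_integral_add(2) set_integral_diff(1) set_integrable_mult_right)
    also have "(LBINT s:{0<..}. ?f k (x + h) s - ?f k x s) = Laplace F k (x + h) - Laplace F k x"
      unfolding Laplace_def using i \<open>x + h > 0\<close> x by (intro set_integral_diff(2))
    also have "(LBINT s:{0<..}. of_real h * ?f (Suc k) x s) = of_real h * Laplace F (Suc k) x"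
      unfolding Laplace_def by (rule set_integral_mult_right)
    finally show ?thesis by (simp add: scaleR_conv_of_real)
  qed
  \<comment> \<open>Since |h| <= x/2, the factor exp |h s| of the remainder costs half of the decay
    exp (- x s), and the s^2 of the second order raises the Gamma exponent to k + 2 + 1/2.\<close>
  also have "norm \<dots> \<le> h\<^sup>2 * Gamma (real (k + 2) + 1/2) * (x / 2) powr (- (real (k + 2) + 1/2))"
  proof (rule Laplace_bound(2))
    fix s :: real assume s: "s > 0"
    have "exp (- (x + h) * s) = exp (- x * s) * exp (- h * s)"
      by (simp add: exp_add[symmetric] algebra_simps)
    then have "?g s = of_real (s ^ k * exp (- x * s) * (exp (- h * s) - 1 - (- h * s))) * F s"
      by (simp add: algebra_simps)
    then have "norm (?g s) = \<bar>s ^ k * exp (- x * s) * (exp (- h * s) - 1 - (- h * s))\<bar> * norm (F s)"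
      by (simp only: norm_mult norm_of_real)
    also have "\<dots> \<le> (s ^ k * exp (- x * s) * \<bar>exp (- h * s) - 1 - (- h * s)\<bar>) * s powr (- 1/2)"
      using s by (simp only: abs_mult) (intro mult_mono b, auto)
    also have "\<dots> \<le> (s ^ k * exp (- x * s) * ((- h * s)\<^sup>2 * exp (x / 2 * s))) * s powr (- 1/2)"
    proof -
      have "exp \<bar>- h * s\<bar> \<le> exp (x / 2 * s)" using h s by (simp add: abs_mult)
      then have "(- h * s)\<^sup>2 * exp \<bar>- h * s\<bar> \<le> (- h * s)\<^sup>2 * exp (x / 2 * s)" by (intro mult_left_mono) auto
      with exp_remainder_bound[of "- h * s"]
      have "\<bar>exp (- h * s) - 1 - (- h * s)\<bar> \<le> (- h * s)\<^sup>2 * exp (x / 2 * s)" by linarith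
      then show ?thesis using s by (intro mult_right_mono mult_left_mono) auto
    qed
    also have "\<dots> = h\<^sup>2 * (s ^ (k + 2) * s powr (- 1/2)) * (exp (- x * s) * exp (x / 2 * s))"
      by (simp add: power_mult_distrib power_add power2_eq_square mult_ac)
    also have "\<dots> = h\<^sup>2 * (s powr (real (k + 2) + 1/2 - 1) * exp (- (x / 2) * s))"
      unfolding P[OF s] by (simp add: exp_add[symmetric] field_simps)
    finally show "norm (?g s) \<le> h\<^sup>2 * (s powr (real (k + 2) + 1/2 - 1) * exp (- (x / 2) * s))" .
  qed (use x c in \<open>auto intro!: continuous_intros\<close>)
  finally show "norm (Laplace F k (x + h) - Laplace F k x - h *\<^sub>R (- Laplace F (Suc k) x))
     \<le> (Gamma (real (k + 2) + 1/2) * (x / 2) powr (- (real (k + 2) + 1/2))) * h\<^sup>2" by (simp add: mult_ac)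
qed

section \<open>An integral representation of the Hankel function\<close>

text \<open>Up to a constant, \<open>H 0 x * exp (- \<i> x)\<close> is the Laplace transform of this kernel; the Bessel
  equation for it is the vanishing of the integral of the derivative of \<open>exp (- x s) sqrt s csqrt (s - 2 \<i>)\<close>.\<close>

definition hk :: "real \<Rightarrow> complex" where
  "hk s = inverse (of_real (sqrt s) * csqrt (of_real s - 2 * \<i>))"

text \<open>The imaginary part -2 keeps the argument off the branch cut, so the principal square
  root is smooth along the whole real line.\<close>

lemma csqrt_arg_notin: "complex_of_real s - 2 * \<i> \<notin> \<real>\<^sub>\<le>\<^sub>0"
  by (auto simp: complex_nonpos_Reals_iff)

lemma of_real_neq_2i [simp]: "complex_of_real s \<noteq> 2 * \<i>" "complex_of_real s \<noteq> \<i> * 2"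
  by (auto simp: complex_eq_iff)

lemma csqrt_arg_nonzero [simp]: "complex_of_real s - 2 * \<i> \<noteq> 0" "csqrt (complex_of_real s - 2 * \<i>) \<noteq> 0"
  by (auto simp: complex_eq_iff)

lemma norm_csqrt_arg: "norm (complex_of_real s - 2 * \<i>) \<ge> 2"
  using abs_Im_le_cmod[of "complex_of_real s - 2 * \<i>"] by simp

lemma norm_csqrt_ge_1: "norm (csqrt (complex_of_real s - 2 * \<i>)) \<ge> 1"
proof -
  have "norm (csqrt (complex_of_real s - 2 * \<i>)) ^ 2 \<ge> 2"
    using norm_csqrt_arg[of s] by (simp add: norm_power[symmetric])
  then have "1\<^sup>2 \<le> norm (csqrt (complex_of_real s - 2 * \<i>)) ^ 2" by (simp only: power_one)
  then show ?thesis by (rule power2_le_imp_le) (rule norm_ge_zero)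
qed

lemma csqrt_has_vector_derivative:
  "((\<lambda>s. csqrt (complex_of_real s - 2 * \<i>)) has_vector_derivative
      inverse (2 * csqrt (of_real s - 2 * \<i>))) (at s)"
proof -
  have "((\<lambda>s. complex_of_real s - 2 * \<i>) has_vector_derivative 1) (at s)"
    by (auto intro!: derivative_eq_intros)
  from field_vector_diff_chain_at[OF this has_field_derivative_csqrt[OF csqrt_arg_notin]]
  show ?thesis by (simp add: o_def)
qed

lemma sqrt_has_vector_derivative:
  "s > 0 \<Longrightarrow> ((\<lambda>s. complex_of_real (sqrt s)) has_vector_derivative of_real (inverse (2 * sqrt s))) (at s)"
  by (intro has_vector_derivative_of_real) (auto intro!: derivative_eq_intros simp: has_real_derivative_iff_has_vector_derivative[symmetric] field_simps)

lemma continuous_csqrt_arg: "continuous_on A (\<lambda>s. csqrt (complex_of_real s - 2 * \<i>))"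
  by (intro continuous_at_imp_continuous_on ballI has_vector_derivative_continuous[OF csqrt_has_vector_derivative])

lemma continuous_hk: "continuous_on {0<..} hk"
  unfolding hk_def[abs_def] by (intro continuous_intros continuous_csqrt_arg) auto

lemma norm_hk: "s > 0 \<Longrightarrow> norm (hk s) \<le> s powr (- 1/2)"
proof -
  assume s: "s > 0"
  have "norm (hk s) = inverse (sqrt s) * inverse (norm (csqrt (complex_of_real s - 2 * \<i>)))"
    using s by (simp only: hk_def norm_inverse norm_mult inverse_mult_distrib) simp
  also have "\<dots> \<le> inverse (sqrt s) * 1"
    using s norm_csqrt_ge_1[of s] by (intro mult_left_mono inverse_le_1_iff[THEN iffD2]) auto
  finally show ?thesis using s by (simp add: powr_minus powr_half_sqrt)
qed

text \<open>The derivative of sqrt s / csqrt (s - 2 i) is (hk - hk2) / 2. As \<open>hk2\<close> is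
  bounded by s^(1/2), its Laplace transform decays by one power faster than the bound for that of
  \<open>hk\<close>.\<close>

definition hk2 :: "real \<Rightarrow> complex" where
  "hk2 s = hk s * of_real s / (of_real s - 2 * \<i>)"

lemma continuous_hk2: "continuous_on {0<..} hk2"
  unfolding hk2_def[abs_def] by (intro continuous_intros continuous_hk) auto

lemma norm_hk2: "s > 0 \<Longrightarrow> norm (hk2 s) \<le> 1 * s powr (3/2 - 1)"
proof -
  assume s: "s > 0"
  have "norm (hk2 s) = norm (hk s) * s / norm (complex_of_real s - 2 * \<i>)"
    using s by (simp add: hk2_def norm_mult norm_divide)
  also have "\<dots> \<le> s powr (- 1/2) * s / 1"
    using norm_hk[OF s] norm_csqrt_arg[of s] s by (intro frac_le mult_right_mono) auto
  also have "\<dots> = s powr (3/2 - 1)"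
    using s powr_add[of s "-1/2" 1] by simp
  finally show ?thesis by simp
qed

abbreviation LH :: "nat \<Rightarrow> real \<Rightarrow> complex" where "LH \<equiv> Laplace hk"

lemma LH_integrable: "x > 0 \<Longrightarrow> set_integrable lborel {0<..} (\<lambda>s. of_real (s ^ j * exp (- x * s)) * hk s)"
proof (rule Laplace_bound(1)[where a = "real j + 1/2" and x = x and K = 1])
  fix s :: real assume s: "s > 0"
  have "norm (of_real (s ^ j * exp (- x * s)) * hk s) \<le> (s ^ j * exp (- x * s)) * s powr (- 1/2)"
    using s norm_hk[OF s] by (simp add: norm_mult norm_power mult_left_mono)
  also have "\<dots> = (s ^ j * s powr (- 1/2)) * exp (- x * s)" by (simp only: mult_ac)
  also have "s ^ j * s powr (- 1/2) = s powr (real j + 1/2 - 1)"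
    using s by (simp add: powr_realpow[symmetric] powr_add[symmetric])
  finally show "norm (of_real (s ^ j * exp (- x * s)) * hk s) \<le> 1 * (s powr (real j + 1/2 - 1) * exp (- x * s))"
    by simp
qed (auto intro!: continuous_intros continuous_hk)

lemma hk_primitive_limits:
  assumes "x > 0"
  shows "((\<lambda>s. of_real (exp (- x * s)) * (of_real (sqrt s) * csqrt (of_real s - 2 * \<i>))) \<longlongrightarrow> 0) (at_right 0)"
    "((\<lambda>s. of_real (exp (- x * s)) * (of_real (sqrt s) * csqrt (of_real s - 2 * \<i>))) \<longlongrightarrow> 0) at_top"
    "((\<lambda>s. of_real (exp (- x * s)) * (of_real (sqrt s) / csqrt (of_real s - 2 * \<i>))) \<longlongrightarrow> 0) (at_right 0)"
    "((\<lambda>s. of_real (exp (- x * s)) * (of_real (sqrt s) / csqrt (of_real s - 2 * \<i>))) \<longlongrightarrow> 0) at_top"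
proof -
  have c: "((\<lambda>s. csqrt (complex_of_real s - 2 * \<i>)) \<longlongrightarrow> csqrt (of_real 0 - 2 * \<i>)) (at_right 0)"
    using has_vector_derivative_continuous[OF csqrt_has_vector_derivative[of 0]]
    unfolding continuous_within by (rule tendsto_within_subset) auto
  have e: "((\<lambda>s. complex_of_real (exp (- x * s))) \<longlongrightarrow> of_real (exp (- x * 0))) (at_right 0)"
    "((\<lambda>s. complex_of_real (sqrt s)) \<longlongrightarrow> of_real (sqrt 0)) (at_right 0)"
    by (intro tendsto_intros)+
  show "((\<lambda>s. of_real (exp (- x * s)) * (of_real (sqrt s) * csqrt (of_real s - 2 * \<i>))) \<longlongrightarrow> 0) (at_right 0)"
    using tendsto_mult[OF e(1) tendsto_mult[OF e(2) c]] by simp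
  show "((\<lambda>s. of_real (exp (- x * s)) * (of_real (sqrt s) / csqrt (of_real s - 2 * \<i>))) \<longlongrightarrow> 0) (at_right 0)"
    using tendsto_mult[OF e(1) tendsto_divide[OF e(2) c]] by simp
  have l1: "((\<lambda>s. exp (- x * s) * (sqrt s * sqrt (s + 2))) \<longlongrightarrow> 0) at_top"
    "((\<lambda>s. exp (- x * s) * sqrt s) \<longlongrightarrow> 0) at_top"
    using assms by real_asymp+
  have n: "norm (csqrt (complex_of_real s - 2 * \<i>)) \<le> sqrt (s + 2)" if "s > 0" for s
  proof -
    have "norm (csqrt (complex_of_real s - 2 * \<i>)) ^ 2 = norm (complex_of_real s - 2 * \<i>)"
      by (simp add: norm_power[symmetric])
    also have "\<dots> \<le> s + 2" using norm_triangle_ineq4[of "complex_of_real s" "2 * \<i>"] that by (simp add: norm_mult)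
    finally show ?thesis by (simp add: real_le_rsqrt)
  qed
  show "((\<lambda>s. of_real (exp (- x * s)) * (of_real (sqrt s) * csqrt (of_real s - 2 * \<i>))) \<longlongrightarrow> 0) at_top"
    by (rule Lim_null_comparison[OF _ l1(1)], rule eventually_mono[OF eventually_gt_at_top[of 0]])
       (use n in \<open>auto simp: norm_mult intro!: mult_left_mono\<close>)
  show "((\<lambda>s. of_real (exp (- x * s)) * (of_real (sqrt s) / csqrt (of_real s - 2 * \<i>))) \<longlongrightarrow> 0) at_top"
    by (rule Lim_null_comparison[OF _ l1(2)], rule eventually_mono[OF eventually_gt_at_top[of 0]])
       (use norm_csqrt_ge_1 in \<open>auto simp: norm_mult norm_divide divide_le_eq intro!: mult_left_mono\<close>)
qed

lemma exp_has_vector_derivative: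
  "((\<lambda>s. complex_of_real (exp (- x * s))) has_vector_derivative of_real (- x * exp (- x * s))) (at s)"
  by (intro has_vector_derivative_of_real) (auto intro!: derivative_eq_intros simp: has_real_derivative_iff_has_vector_derivative[symmetric])

text \<open>This is Bessel's equation of order zero for cis x * LH 0 x, multiplied by x and divided
  by cis x, with the first two derivatives of \<open>LH 0\<close> written as - \<open>LH 1\<close>
  and \<open>LH 2\<close>.\<close>

lemma LH_ode:
  assumes x: "x > 0"
  shows "of_real x * LH 2 x - 2 * \<i> * of_real x * LH 1 x + \<i> * LH 0 x - LH 1 x = 0"
proof -
  let ?T = "\<lambda>s. of_real (exp (- x * s)) * (of_real (sqrt s) * csqrt (of_real s - 2 * \<i>))"
  let ?g = "\<lambda>j s. of_real (s ^ j * exp (- x * s)) * hk s"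
  let ?f = "\<lambda>s. - of_real x * ?g 2 s + 2 * \<i> * of_real x * ?g 1 s + (?g 1 s - \<i> * ?g 0 s)"
  have i: "set_integrable lborel {0<..} (?g j)" for j by (rule LH_integrable[OF x])
  have "(LBINT s:{0<..}. ?f s) = 0 - 0"
  proof (rule FTC_0_inf)
    fix s :: real assume s: "s > 0"
    define p where "p = complex_of_real (sqrt s)"
    define w where "w = csqrt (of_real s - 2 * \<i>)"
    have pw: "p ^ 2 = of_real s" "w ^ 2 = of_real s - 2 * \<i>" "p \<noteq> 0" "w \<noteq> 0"
      using s by (simp_all add: p_def w_def of_real_power[symmetric] del: of_real_power)
    have "(?T has_vector_derivative
        of_real (exp (- x * s)) * (p * inverse (2 * w) + of_real (inverse (2 * sqrt s)) * w)
        + of_real (- x * exp (- x * s)) * (p * w)) (at s)"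
      unfolding p_def w_def
      by (intro has_vector_derivative_mult exp_has_vector_derivative sqrt_has_vector_derivative
          csqrt_has_vector_derivative s)
    moreover have "of_real (exp (- x * s)) * (p * inverse (2 * w) + of_real (inverse (2 * sqrt s)) * w)
        + of_real (- x * exp (- x * s)) * (p * w) = ?f s"
    proof -
      \<comment> \<open>Every term of the derivative is a polynomial in p^2 and w^2 times 1 / (p w),
        which is the kernel.\<close>
      have h: "inverse (p * w) = hk s" by (simp add: hk_def p_def w_def)
      have "p * inverse (2 * w) = p ^ 2 / 2 * inverse (p * w)"
          "of_real (inverse (2 * sqrt s)) * w = w ^ 2 / 2 * inverse (p * w)"
          "p * w = p ^ 2 * w ^ 2 * inverse (p * w)"
        using pw by (simp_all add: field_simps power2_eq_square p_def)
      note a = this[unfolded h]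
      show ?thesis unfolding a pw by (simp add: field_simps power2_eq_square)
    qed
    ultimately show "(?T has_vector_derivative ?f s) (at s)" by simp
  next
    show "continuous_on {0<..} ?f" by (intro continuous_intros continuous_hk)
    show "set_integrable lborel {0<..} ?f"
      using i by (intro set_integral_add set_integral_diff set_integrable_mult_right)
  qed (rule hk_primitive_limits[OF x])+
  moreover have "(LBINT s:{0<..}. ?f s) = - of_real x * LH 2 x + 2 * \<i> * of_real x * LH 1 x + (LH 1 x - \<i> * LH 0 x)"
    using i unfolding Laplace_def
    by (simp only: set_integral_add set_integral_diff set_integrable_mult_right set_integral_mult_right)
  ultimately show ?thesis by (simp add: algebra_simps)
qed

text \<open>Heuristically \<open>LH 0\<close> behaves like x^(-1/2), so x times its derivative is -
  1/2 times itself up to a smaller term. This is the quantitative outgoing condition from which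
  \<open>hank_asymp\<close> starts.\<close>

lemma LH_first_order:
  assumes x: "x > 0"
  shows "norm (LH 0 x / 2 - of_real x * LH 1 x) \<le> Gamma (3/2) * x powr (- 3/2)"
proof -
  let ?T = "\<lambda>s. of_real (exp (- x * s)) * (of_real (sqrt s) / csqrt (of_real s - 2 * \<i>))"
  let ?g = "\<lambda>j s. of_real (s ^ j * exp (- x * s)) * hk s"
  let ?k = "\<lambda>s. of_real (exp (- x * s)) * hk2 s"
  let ?f = "\<lambda>s. (1/2) * ?g 0 s - of_real x * ?g 1 s - (1/2) * ?k s"
  have i: "set_integrable lborel {0<..} (?g j)" for j by (rule LH_integrable[OF x])
  have kb: "norm (?k s) \<le> 1 * (s powr (3/2 - 1) * exp (- x * s))" if "s > 0" for s
    using norm_hk2[OF that] by (simp add: norm_mult mult.commute mult_right_mono)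
  have kc: "continuous_on {0<..} ?k" by (intro continuous_intros continuous_hk2)
  have ki: "set_integrable lborel {0<..} ?k"
    by (rule Laplace_bound(1)[OF _ x kc kb]) auto
  have "(LBINT s:{0<..}. ?f s) = 0 - 0"
  proof (rule FTC_0_inf)
    fix s :: real assume s: "s > 0"
    define p where "p = complex_of_real (sqrt s)"
    define w where "w = csqrt (of_real s - 2 * \<i>)"
    have pw: "p ^ 2 = of_real s" "w ^ 2 = of_real s - 2 * \<i>" "p \<noteq> 0" "w \<noteq> 0"
      using s by (simp_all add: p_def w_def of_real_power[symmetric] del: of_real_power)
    have wi: "((\<lambda>s. inverse (csqrt (of_real s - 2 * \<i>))) has_vector_derivative
        - (inverse w * inverse (2 * w) * inverse w)) (at s)"
      using field_vector_diff_chain_at[OF csqrt_has_vector_derivative[of s] DERIV_inverse[of "csqrt (of_real s - 2 * \<i>)"]]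
      by (simp add: o_def w_def field_simps power2_eq_square)
    have "((\<lambda>s. of_real (exp (- x * s)) * (of_real (sqrt s) * inverse (csqrt (of_real s - 2 * \<i>)))) has_vector_derivative
        of_real (exp (- x * s)) * (p * (- (inverse w * inverse (2 * w) * inverse w)) + of_real (inverse (2 * sqrt s)) * inverse w)
        + of_real (- x * exp (- x * s)) * (p * inverse w)) (at s)"
      unfolding p_def w_def
      by (intro has_vector_derivative_mult exp_has_vector_derivative sqrt_has_vector_derivative s
          wi[unfolded w_def])
    moreover have "of_real (exp (- x * s)) * (p * (- (inverse w * inverse (2 * w) * inverse w)) + of_real (inverse (2 * sqrt s)) * inverse w)
        + of_real (- x * exp (- x * s)) * (p * inverse w) = ?f s"
    proof -
      have h: "hk s = inverse (p * w)" "hk2 s = inverse (p * w) * p ^ 2 / w ^ 2"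
        using pw by (simp_all add: hk2_def hk_def p_def[symmetric] w_def[symmetric])
      have a: "p * (- (inverse w * inverse (2 * w) * inverse w)) = - (1/2) * (inverse (p * w) * p ^ 2 / w ^ 2)"
          "of_real (inverse (2 * sqrt s)) * inverse w = (1/2) * inverse (p * w)"
          "p * inverse w = p ^ 2 * inverse (p * w)"
        using pw by (simp_all add: field_simps power2_eq_square p_def)
      show ?thesis unfolding a h pw by (simp add: algebra_simps)
    qed
    ultimately show "(?T has_vector_derivative ?f s) (at s)" by (simp only: divide_inverse)
  next
    show "continuous_on {0<..} ?f" by (intro continuous_intros continuous_hk continuous_hk2)
    show "set_integrable lborel {0<..} ?f"
      using i ki by (intro set_integral_add set_integral_diff set_integrable_mult_right)
  qed (rule hk_primitive_limits[OF x])+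
  moreover have "(LBINT s:{0<..}. ?f s) = (1/2) * LH 0 x - of_real x * LH 1 x - (1/2) * (LBINT s:{0<..}. ?k s)"
    using i ki unfolding Laplace_def
    by (simp only: set_integral_diff set_integrable_mult_right set_integral_mult_right)
  ultimately have eq: "LH 0 x / 2 - of_real x * LH 1 x = (1/2) * (LBINT s:{0<..}. ?k s)"
    by (simp only: diff_zero) (simp add: algebra_simps)
  have "norm (LH 0 x / 2 - of_real x * LH 1 x) \<le> norm (LBINT s:{0<..}. ?k s)"
    unfolding eq norm_mult by simp
  also have "\<dots> \<le> 1 * Gamma (3/2) * x powr (- (3/2))"
    by (rule Laplace_bound(2)[OF _ x kc kb]) auto
  finally show ?thesis by simp
qed

lemma LH_bound: "x > 0 \<Longrightarrow> norm (LH 0 x) \<le> Gamma (1/2) * x powr (- 1/2)"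
proof -
  assume x: "x > 0"
  have "norm (LBINT s:{0<..}. of_real (s ^ 0 * exp (- x * s)) * hk s) \<le> 1 * Gamma (1/2) * x powr (- (1/2))"
    by (rule Laplace_bound(2)[OF _ x])
       (use norm_hk in \<open>auto simp: norm_mult mult.commute mult_right_mono intro!: continuous_intros continuous_hk\<close>)
  then show ?thesis by (simp add: Laplace_def)
qed

text \<open>The factor - 2 i / pi is fixed by the singularity at 0: by \<open>LH_small\<close> it
  turns \<open>LH 0\<close> into 1 + (2 i / pi) (ln (x/2) + gamma) to leading order, as required of
  J_0 + i Y_0.\<close>

definition hankel0 :: "real \<Rightarrow> complex" where
  "hankel0 x = - 2 * \<i> / pi * cis x * LH 0 x"

definition Dhankel0 :: "real \<Rightarrow> complex" where
  "Dhankel0 x = - 2 * \<i> / pi * of_real x * cis x * (\<i> * LH 0 x - LH 1 x)"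

lemma LH_deriv: "x > 0 \<Longrightarrow> (LH k has_vector_derivative - LH (Suc k) x) (at x)"
  by (rule Laplace_deriv[OF continuous_hk norm_hk])

lemma cis_has_vector_derivative: "(cis has_vector_derivative \<i> * cis x) (at x)"
  by (auto simp: has_vector_derivative_complex_iff has_real_derivative_iff_has_vector_derivative[symmetric]
      intro!: derivative_eq_intros)

lemma bessel_pair_hankel0: "bessel_pair 0 hankel0 Dhankel0"
proof -
  have "(hankel0 has_vector_derivative (1 / x) *\<^sub>R Dhankel0 x) (at x)"
       "(Dhankel0 has_vector_derivative (((real 0)\<^sup>2 - x\<^sup>2) / x) *\<^sub>R hankel0 x) (at x)"
    if x: "x > 0" for x
  proof -
    let ?C = "- 2 * \<i> / complex_of_real pi"
    have x1: "((\<lambda>x. complex_of_real x) has_vector_derivative 1) (at x)"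
      by (auto intro!: derivative_eq_intros)
    have "((\<lambda>x. ?C * (cis x * LH 0 x)) has_vector_derivative
        ?C * (cis x * - LH (Suc 0) x + \<i> * cis x * LH 0 x)) (at x)"
      by (intro has_vector_derivative_mult_right has_vector_derivative_mult cis_has_vector_derivative LH_deriv x)
    moreover have "?C * (cis x * - LH (Suc 0) x + \<i> * cis x * LH 0 x) = (1 / x) *\<^sub>R Dhankel0 x"
      using x by (simp add: Dhankel0_def scaleR_conv_of_real field_simps)
    ultimately show "(hankel0 has_vector_derivative (1 / x) *\<^sub>R Dhankel0 x) (at x)"
      by (simp add: hankel0_def[abs_def] mult.assoc)
    have "((\<lambda>x. ?C * (of_real x * (cis x * (\<i> * LH 0 x - LH 1 x)))) has_vector_derivative
        ?C * (of_real x * (cis x * (\<i> * - LH (Suc 0) x - - LH (Suc 1) x) + \<i> * cis x * (\<i> * LH 0 x - LH 1 x))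
          + 1 * (cis x * (\<i> * LH 0 x - LH 1 x)))) (at x)"
      by (intro has_vector_derivative_mult_right has_vector_derivative_mult has_vector_derivative_diff
          cis_has_vector_derivative LH_deriv x x1)
    moreover have "?C * (of_real x * (cis x * (\<i> * - LH (Suc 0) x - - LH (Suc 1) x) + \<i> * cis x * (\<i> * LH 0 x - LH 1 x))
          + 1 * (cis x * (\<i> * LH 0 x - LH 1 x))) = (((real 0)\<^sup>2 - x\<^sup>2) / x) *\<^sub>R hankel0 x"
    proof -
      have q: "((real 0)\<^sup>2 - x\<^sup>2) / x = - x" using x by (simp add: power2_eq_square)
      have "?C * (of_real x * (cis x * (\<i> * - LH (Suc 0) x - - LH (Suc 1) x) + \<i> * cis x * (\<i> * LH 0 x - LH 1 x))
          + 1 * (cis x * (\<i> * LH 0 x - LH 1 x)))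
        = ?C * cis x * ((of_real x * LH 2 x - 2 * \<i> * of_real x * LH 1 x + \<i> * LH 0 x - LH 1 x) - of_real x * LH 0 x)"
        by (simp add: algebra_simps numeral_2_eq_2)
      also have "\<dots> = ?C * cis x * (- of_real x * LH 0 x)"
        by (simp only: LH_ode[OF x]) simp
      finally show ?thesis unfolding q hankel0_def scaleR_conv_of_real by (simp add: algebra_simps)
    qed
    ultimately show "(Dhankel0 has_vector_derivative (((real 0)\<^sup>2 - x\<^sup>2) / x) *\<^sub>R hankel0 x) (at x)"
      by (simp add: Dhankel0_def[abs_def] mult.assoc)
  qed
  then show ?thesis unfolding bessel_pair_def by blast
qed

lemma norm_Ln_1_plus: "Re d \<ge> 0 \<Longrightarrow> norm (Ln (1 + d)) \<le> norm d"
proof -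
  assume d: "Re d \<ge> 0"
  have "norm (Ln (1 + d) - Ln 1) \<le> 1 * norm (1 + d - 1)"
  proof (rule field_differentiable_bound)
    show "convex {z. Re z \<ge> 1}" by (rule convex_halfspace_Re_ge)
    fix z assume z: "z \<in> {z. Re z \<ge> 1}"
    then have "z \<notin> \<real>\<^sub>\<le>\<^sub>0" by (auto simp: complex_nonpos_Reals_iff)
    then show "(Ln has_field_derivative inverse z) (at z within {z. Re z \<ge> 1})"
      by (rule has_field_derivative_Ln[THEN has_field_derivative_at_within])
    have "1 \<le> norm z" using complex_Re_le_cmod[of z] z by auto
    then show "norm (inverse z) \<le> 1" by (simp add: norm_inverse inverse_le_1_iff)
  qed (use d in auto)
  then show ?thesis by simp
qed

text \<open>A primitive of \<open>hk\<close>: integrating by parts with it exposes the logarithmic singularity at \<open>0\<close> which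
  identifies the integral with \<open>J 0 + \<i> Y 0\<close>.\<close>

definition hk_prim :: "real \<Rightarrow> complex" where
  "hk_prim s = 2 * Ln (of_real (sqrt s) + csqrt (of_real s - 2 * \<i>))"

lemma Re_csqrt_arg: "Re (csqrt (complex_of_real s - 2 * \<i>)) > 0"
proof -
  define w where "w = csqrt (complex_of_real s - 2 * \<i>)"
  have "w ^ 2 = complex_of_real s - 2 * \<i>" by (simp add: w_def)
  then have "Im (w ^ 2) = - 2" by simp
  then have "Re w \<noteq> 0" by (auto simp: power2_eq_square)
  then show ?thesis using csqrt_principal[of "complex_of_real s - 2 * \<i>"] by (auto simp: w_def)
qed

lemma hk_prim_arg: "s \<ge> 0 \<Longrightarrow> complex_of_real (sqrt s) + csqrt (complex_of_real s - 2 * \<i>) \<notin> \<real>\<^sub>\<le>\<^sub>0"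
  using Re_csqrt_arg[of s] by (auto simp: complex_nonpos_Reals_iff intro: add_nonneg_pos)

lemma hk_prim_deriv:
  assumes s: "s > 0"
  shows "(hk_prim has_vector_derivative hk s) (at s)"
proof -
  define p where "p = complex_of_real (sqrt s)"
  define w where "w = csqrt (of_real s - 2 * \<i>)"
  have pw: "p \<noteq> 0" "w \<noteq> 0" "p + w \<noteq> 0"
    using s hk_prim_arg[of s] by (auto simp: p_def w_def)
  have "((\<lambda>s. complex_of_real (sqrt s) + csqrt (of_real s - 2 * \<i>)) has_vector_derivative
      of_real (inverse (2 * sqrt s)) + inverse (2 * w)) (at s)"
    unfolding w_def by (intro has_vector_derivative_add sqrt_has_vector_derivative s csqrt_has_vector_derivative)
  from field_vector_diff_chain_at[OF this has_field_derivative_Ln[OF hk_prim_arg]] s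
  have "((\<lambda>s. Ln (complex_of_real (sqrt s) + csqrt (of_real s - 2 * \<i>))) has_vector_derivative
      (of_real (inverse (2 * sqrt s)) + inverse (2 * w)) * inverse (p + w)) (at s)"
    by (simp add: o_def p_def w_def)
  then have "(hk_prim has_vector_derivative 2 * ((of_real (inverse (2 * sqrt s)) + inverse (2 * w)) * inverse (p + w))) (at s)"
    unfolding hk_prim_def[abs_def] by (rule has_vector_derivative_mult_right)
  moreover have "2 * ((of_real (inverse (2 * sqrt s)) + inverse (2 * w)) * inverse (p + w)) = hk s"
  proof -
    have "of_real (inverse (2 * sqrt s)) = inverse (2 * p)" by (simp add: p_def)
    moreover have "2 * ((inverse (2 * p) + inverse (2 * w)) * inverse (p + w)) = inverse (p * w)"
    proof -
      have "inverse (2 * p) + inverse (2 * w) = (p + w) * (inverse (2 * (p * w)))"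
        using pw by (simp add: field_simps)
      then have "2 * ((inverse (2 * p) + inverse (2 * w)) * inverse (p + w))
          = 2 * ((p + w) * inverse (2 * (p * w)) * inverse (p + w))" by (simp only:)
      also have "\<dots> = inverse (p * w)" using pw by (simp add: divide_simps)
      finally show ?thesis .
    qed
    ultimately show ?thesis by (simp add: hk_def p_def w_def)
  qed
  ultimately show ?thesis by simp
qed

text \<open>With p = sqrt s the argument of the logarithm is 2 p (1 + d), and 2 ln (2 p) is the main
  term. The remainder 2 Ln (1 + d) has size |d|, because Re d >= 0 keeps 1 + d in the half-plane Re
  z >= 1, where Ln is 1-Lipschitz.\<close>

lemma hk_prim_asymp:
  assumes s: "s > 0"
  shows "norm (hk_prim s - of_real (ln s + 2 * ln 2)) \<le> 2 * s powr (- 1/2)"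
proof -
  define p where "p = sqrt s"
  define w where "w = csqrt (of_real s - 2 * \<i>)"
  have p: "p > 0" "p ^ 2 = s" using s by (simp_all add: p_def)
  have ww: "w ^ 2 = of_real s - 2 * \<i>" by (simp add: w_def)
  define d where "d = (w - of_real p) / of_real (2 * p)"
  have re: "Re w \<ge> p"
  proof -
    have "Re w = sqrt ((norm (complex_of_real s - 2 * \<i>) + s) / 2)"
      by (simp add: w_def)
    also have "\<dots> \<ge> sqrt s"
      using complex_Re_le_cmod[of "complex_of_real s - 2 * \<i>"] by (intro real_sqrt_le_mono) simp
    finally show ?thesis by (simp add: p_def)
  qed
  then have dre: "Re d \<ge> 0" using p by (simp add: d_def Re_divide_of_real)
  \<comment> \<open>The product (w - p) (w + p) is - 2 i, and Re w >= p makes w - p the factor of no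
    larger modulus; hence |w - p|^2 <= 2.\<close>
  have dn: "norm d \<le> s powr (- 1/2)"
  proof -
    have pr: "(w - of_real p) * (w + of_real p) = - 2 * \<i>"
      using ww p(2) by (simp add: algebra_simps power2_eq_square of_real_mult[symmetric] del: of_real_mult)
    have "(norm (w - of_real p))\<^sup>2 \<le> (norm (w + of_real p))\<^sup>2"
      using re p unfolding cmod_power2 by (simp add: power2_eq_square algebra_simps)
    then have "norm (w - of_real p) \<le> norm (w + of_real p)" by (rule power2_le_imp_le) simp
    then have "norm (w - of_real p) * norm (w - of_real p) \<le> norm (w - of_real p) * norm (w + of_real p)"
      by (intro mult_left_mono) auto
    also have "\<dots> = 2" unfolding norm_mult[symmetric] pr by (simp add: norm_mult)
    finally have "(norm (w - of_real p))\<^sup>2 \<le> 2\<^sup>2" by (simp add: power2_eq_square)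
    then have "norm (w - of_real p) \<le> 2" by (rule power2_le_imp_le) simp
    then have "norm (w - of_real p) / (2 * p) \<le> 2 / (2 * p)" using p by (intro divide_right_mono) auto
    moreover have "norm d = norm (w - of_real p) / (2 * p)" using p(1) unfolding d_def norm_divide norm_of_real by simp
    ultimately have "norm d \<le> 1 / p" by simp
    then show ?thesis using s by (simp add: p_def powr_minus powr_half_sqrt field_simps)
  qed
  have eq: "of_real p + w = of_real (2 * p) * (1 + d)" using p by (simp add: d_def field_simps)
  have nz: "1 + d \<noteq> 0" using dre by (auto simp: complex_eq_iff)
  have "hk_prim s = 2 * Ln (of_real (2 * p) * (1 + d))" unfolding hk_prim_def eq[symmetric] unfolding p_def w_def ..
  also have "Ln (of_real (2 * p) * (1 + d)) = of_real (ln (2 * p)) + Ln (1 + d)"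
    using p nz Ln_times_of_real[of "2 * p" "1 + d"] Ln_of_real[of "2 * p"] by simp
  also have "ln (2 * p) = ln 2 + ln s / 2"
    using s by (simp add: p_def ln_mult ln_sqrt)
  finally have "hk_prim s - of_real (ln s + 2 * ln 2) = 2 * Ln (1 + d)" by (simp add: algebra_simps)
  then show ?thesis using norm_Ln_1_plus[OF dre] dn by (simp add: norm_mult)
qed

text \<open>Integration by parts expresses LH 0 x as x times the Laplace transform of
  \<open>hk_prim\<close> minus its value at 0. The main part ln s + 2 ln 2 is transformed explicitly
  by \<open>Laplace_ln\<close>; the remainder of size s^(-1/2) contributes the error of order sqrt
  x.\<close>

lemma LH_small:
  assumes x: "x > 0"
  shows "norm (LH 0 x - (of_real (- euler_mascheroni - ln (x / 2)) + \<i> * pi / 2))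
     \<le> 2 * Gamma (1/2) * sqrt x"
proof -
  \<comment> \<open>The value of the primitive at 0, namely 2 Ln (csqrt (- 2 i)) = Ln (- 2 i); it
    supplies the term i pi / 2.\<close>
  define L0 where "L0 = Ln (- 2 * \<i>)"
  have L0: "L0 = of_real (ln 2) - \<i> * pi / 2"
  proof -
    have "Ln (of_real 2 * (- \<i>)) = of_real (ln 2) + Ln (- \<i>)"
      using Ln_times_of_real[of 2 "- \<i>"] Ln_of_real[of 2] by simp
    then show ?thesis by (simp add: L0_def)
  qed
  let ?T = "\<lambda>s. of_real (exp (- x * s)) * (hk_prim s - L0)"
  let ?g = "\<lambda>s. of_real (s ^ 0 * exp (- x * s)) * hk s"
  let ?r = "\<lambda>s. of_real (exp (- x * s)) * (hk_prim s - of_real (ln s + 2 * ln 2))"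
  let ?e = "\<lambda>s. exp (- x * s)"
  let ?l = "\<lambda>s. ln s * exp (- x * s)"
  have prim_c: "continuous_on {0<..} hk_prim"
    by (intro continuous_at_imp_continuous_on ballI has_vector_derivative_continuous[OF hk_prim_deriv]) auto
  have rc: "continuous_on {0<..} ?r" by (intro continuous_intros prim_c) auto
  have rb: "norm (?r s) \<le> 2 * (s powr (1/2 - 1) * exp (- x * s))" if "s > 0" for s
    using hk_prim_asymp[OF that] by (simp add: norm_mult)
  have ri: "set_integrable lborel {0<..} ?r" by (rule Laplace_bound(1)[OF _ x rc rb]) auto
  have rn: "norm (LBINT s:{0<..}. ?r s) \<le> 2 * Gamma (1/2) * x powr - (1/2)"
    by (rule Laplace_bound(2)[OF _ x rc rb]) auto
  have e0: "(\<lambda>s. s powr (1 - 1) * exp (- x * s)) = (\<lambda>s. if s = 0 then 0 else ?e s)" by auto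
  have ei: "set_integrable lborel {0<..} ?e"
    using Gamma_set_integrable[OF zero_less_one x] unfolding e0
    by (rule set_integrable_cong[THEN iffD1, rotated -1]) auto
  have ev: "(LBINT s:{0<..}. ?e s) = 1 / x"
  proof -
    have "(LBINT s:{0<..}. ?e s) = (LBINT s:{0<..}. s powr (1 - 1) * exp (- x * s))"
      by (rule set_lebesgue_integral_cong) auto
    then show ?thesis using Gamma_set_integral[OF zero_less_one x] x by (simp add: powr_minus field_simps)
  qed
  have li: "set_integrable lborel {0<..} ?l" and lv: "(LBINT s:{0<..}. ?l s) = (1 / x) * (- euler_mascheroni - ln x)"
  proof -
    have i1: "set_integrable lborel {0<..} (\<lambda>u::real. exp (- u))"
      using Gamma_set_integrable[of 1 1]
      by (rule set_integrable_cong[THEN iffD1, rotated -1]) auto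
    have v1: "(LBINT u:{0<..}. exp (- u::real)) = 1"
    proof -
      have "(LBINT u:{0<..}. exp (- u::real)) = (LBINT s:{0<..}. s powr (1 - 1) * exp (- 1 * s))"
        by (rule set_lebesgue_integral_cong) auto
      then show ?thesis using Gamma_set_integral[of 1 1] by simp
    qed
    show "set_integrable lborel {0<..} ?l"
    proof -
      have "set_integrable lborel {0<..} (\<lambda>s. ln (x * s) * exp (- (x * s)))"
      proof -
        have "integrable lborel (\<lambda>u. indicator {0<..} u *\<^sub>R (ln u * exp (- u::real)))"
          using Laplace_ln(1) unfolding set_integrable_def .
        then have "integrable lborel (\<lambda>s. indicator {0<..} (0 + x * s) *\<^sub>R (ln (0 + x * s) * exp (- (0 + x * s))))"
          by (rule lborel_integrable_real_affine) (use x in auto)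
        also have "(\<lambda>s. indicator {0<..} (0 + x * s) *\<^sub>R (ln (0 + x * s) * exp (- (0 + x * s))))
            = (\<lambda>s. indicator {0<..} s *\<^sub>R (ln (x * s) * exp (- (x * s))))"
          using x by (auto simp: indicator_def zero_less_mult_iff)
        finally show ?thesis unfolding set_integrable_def .
      qed
      then have "set_integrable lborel {0<..} (\<lambda>s. ln (x * s) * exp (- (x * s)) - ln x * ?e s)"
        using ei by (intro set_integral_diff(1) set_integrable_mult_right)
      then show ?thesis
        by (rule set_integrable_cong[THEN iffD1, rotated -1]) (use x in \<open>auto simp: ln_mult algebra_simps\<close>)
    qed
    have "(LBINT s:{0<..}. ?l s) = (1 / x) *\<^sub>R (LBINT u:{0<..}. ln (u / x) * exp (- x * (u / x)))"
      by (rule set_integral_scale[OF x])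
    also have "(LBINT u:{0<..}. ln (u / x) * exp (- x * (u / x))) = (LBINT u:{0<..}. ln u * exp (- u) - ln x * exp (- u))"
      using x by (intro set_lebesgue_integral_cong) (auto simp: ln_div algebra_simps)
    also have "\<dots> = - euler_mascheroni - ln x * 1"
      by (subst set_integral_diff(2)) (use i1 v1 Laplace_ln in \<open>auto intro!: set_integrable_mult_right\<close>)
    finally show "(LBINT s:{0<..}. ?l s) = (1 / x) * (- euler_mascheroni - ln x)" by simp
  qed
  let ?f = "\<lambda>s. ?g s - of_real x * (?r s + (of_real (?l s) + (of_real (2 * ln 2) - L0) * of_real (?e s)))"
  have oi: "set_integrable lborel {0<..} (\<lambda>s. complex_of_real (?l s))" "set_integrable lborel {0<..} (\<lambda>s. complex_of_real (?e s))"
  proof -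
    have e: "indicator A s *\<^sub>R complex_of_real v = of_real (indicator A s *\<^sub>R v)" for A and s v :: real
      by (simp add: scaleR_conv_of_real)
    show "set_integrable lborel {0<..} (\<lambda>s. complex_of_real (?l s))" "set_integrable lborel {0<..} (\<lambda>s. complex_of_real (?e s))"
      using li ei unfolding set_integrable_def e by - (rule integrable_of_real, assumption)+
  qed
  have gi: "set_integrable lborel {0<..} ?g" by (rule LH_integrable[OF x])
  have "(LBINT s:{0<..}. ?f s) = 0 - 0"
  proof (rule FTC_0_inf)
    fix s :: real assume s: "s > 0"
    have "(?T has_vector_derivative of_real (exp (- x * s)) * (hk s - 0) + of_real (- x * exp (- x * s)) * (hk_prim s - L0)) (at s)"
      by (intro has_vector_derivative_mult exp_has_vector_derivative has_vector_derivative_diff hk_prim_deriv s has_vector_derivative_const)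
    then show "(?T has_vector_derivative ?f s) (at s)"
      by (rule has_vector_derivative_eq_rhs) (simp add: algebra_simps)
  next
    show "continuous_on {0<..} ?f" by (intro continuous_intros continuous_hk rc) auto
    show "set_integrable lborel {0<..} ?f"
      using gi ri oi by (intro set_integral_add set_integral_diff set_integrable_mult_right)
    have c: "((\<lambda>s. csqrt (complex_of_real s - 2 * \<i>)) \<longlongrightarrow> csqrt (of_real 0 - 2 * \<i>)) (at_right 0)"
      using has_vector_derivative_continuous[OF csqrt_has_vector_derivative[of 0]]
      unfolding continuous_within by (rule tendsto_within_subset) auto
    have "(hk_prim \<longlongrightarrow> 2 * Ln (of_real (sqrt 0) + csqrt (of_real 0 - 2 * \<i>))) (at_right 0)"
      unfolding hk_prim_def[abs_def] by (intro tendsto_intros c hk_prim_arg) auto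
    moreover have "2 * Ln (of_real (sqrt 0) + csqrt (of_real 0 - 2 * \<i>)) = L0"
    proof -
      have "csqrt (- 2 * \<i>) = exp (L0 / 2)" unfolding L0_def by (rule csqrt_exp_Ln) simp
      moreover have "Ln (exp (L0 / 2)) = L0 / 2"
        by (rule Ln_exp) (use pi_ge_two in \<open>auto simp: L0\<close>)
      ultimately show ?thesis by (simp add: mult.commute)
    qed
    ultimately have "(?T \<longlongrightarrow> of_real (exp (- x * 0)) * (L0 - L0)) (at_right 0)"
      by (intro tendsto_intros) auto
    then show "(?T \<longlongrightarrow> 0) (at_right 0)" by simp
    have l: "((\<lambda>s. exp (- x * s) * (\<bar>ln s\<bar> + (2 + 2 * ln 2 + norm L0))) \<longlongrightarrow> 0) at_top"
    proof -
      have "((\<lambda>s. exp (- x * s) * ln s) \<longlongrightarrow> 0) at_top" "((\<lambda>s. exp (- x * s)) \<longlongrightarrow> 0) at_top"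
        using x by real_asymp+
      then have "((\<lambda>s. exp (- x * s) * ln s + exp (- x * s) * (2 + 2 * ln 2 + norm L0)) \<longlongrightarrow> 0 + 0 * (2 + 2 * ln 2 + norm L0)) at_top"
        by (intro tendsto_intros)
      then have "((\<lambda>s. exp (- x * s) * ln s + exp (- x * s) * (2 + 2 * ln 2 + norm L0)) \<longlongrightarrow> 0) at_top" by simp
      then show ?thesis
        by (rule Lim_transform_eventually) (rule eventually_mono[OF eventually_ge_at_top[of 1]], auto simp: algebra_simps)
    qed
    show "(?T \<longlongrightarrow> 0) at_top"
    proof (rule Lim_null_comparison[OF _ l], rule eventually_mono[OF eventually_ge_at_top[of 1]])
      fix s :: real assume s: "1 \<le> s"
      have "norm (hk_prim s - of_real (ln s + 2 * ln 2)) \<le> 2 * 1"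
        using hk_prim_asymp[of s] powr_mono[of "-1/2" 0 s] s by auto
      moreover have "norm (hk_prim s - L0) \<le> norm (hk_prim s - of_real (ln s + 2 * ln 2)) + norm (complex_of_real (ln s + 2 * ln 2)) + norm L0"
        using norm_triangle_ineq[of "hk_prim s - of_real (ln s + 2 * ln 2)" "of_real (ln s + 2 * ln 2)"]
          norm_triangle_ineq4[of "hk_prim s" L0] by simp
      moreover have "norm (complex_of_real (ln s + 2 * ln 2)) \<le> \<bar>ln s\<bar> + 2 * ln 2"
        unfolding norm_of_real using s by simp
      ultimately have "norm (hk_prim s - L0) \<le> \<bar>ln s\<bar> + (2 + 2 * ln 2 + norm L0)" by linarith
      then show "norm (?T s) \<le> exp (- x * s) * (\<bar>ln s\<bar> + (2 + 2 * ln 2 + norm L0))"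
        by (simp add: norm_mult)
    qed
  qed
  note fz = this
  have cv: "(LBINT s:{0<..}. complex_of_real (?l s)) = of_real ((1 / x) * (- euler_mascheroni - ln x))"
      "(LBINT s:{0<..}. complex_of_real (?e s)) = of_real (1 / x)"
    by (simp_all only: set_integral_complex_of_real lv ev)
  define R where "R = (LBINT s:{0<..}. ?r s)"
  have iv: "(LBINT s:{0<..}. ?f s) = LH 0 x - of_real x * (R
      + (of_real ((1 / x) * (- euler_mascheroni - ln x)) + (of_real (2 * ln 2) - L0) * of_real (1 / x)))"
    unfolding Laplace_def R_def cv[symmetric]
    using gi ri oi
    by (simp only: set_integral_add set_integral_diff set_integrable_mult_right set_integral_mult_right)
  have "LH 0 x = of_real x * (R
      + (of_real ((1 / x) * (- euler_mascheroni - ln x)) + (of_real (2 * ln 2) - L0) * of_real (1 / x)))"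
    using trans[OF iv[symmetric] fz] by (simp only: diff_zero right_minus_eq)
  also have "\<dots> = of_real x * R + of_real (x * (1 / x) * (- euler_mascheroni - ln x))
      + (of_real (2 * ln 2) - L0) * of_real (x * (1 / x))"
    by (simp only: of_real_mult distrib_left mult_ac add_ac)
  also have "x * (1 / x) = 1" using x by simp
  finally have "LH 0 x = of_real x * R + of_real (- euler_mascheroni - ln x) + (of_real (2 * ln 2) - L0)"
    by (simp only: mult_1_left of_real_1 mult_1_right)
  then have "LH 0 x - (of_real (- euler_mascheroni - ln (x / 2)) + \<i> * pi / 2) = of_real x * (LBINT s:{0<..}. ?r s)"
    using x unfolding R_def[symmetric] by (simp add: L0 ln_div)
  then have "norm (LH 0 x - (of_real (- euler_mascheroni - ln (x / 2)) + \<i> * pi / 2)) = x * norm (LBINT s:{0<..}. ?r s)"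
    using x by (simp add: norm_mult)
  also have "\<dots> \<le> x * (2 * Gamma (1/2) * x powr - (1/2))" using x rn by (intro mult_left_mono) auto
  also have "\<dots> = 2 * Gamma (1/2) * sqrt x"
    using x real_sqrt_mult_self[of x] by (simp add: powr_minus powr_half_sqrt field_simps)
  finally show ?thesis .
qed

section \<open>Wronskians, and identification of the integral with J_0 + i Y_0\<close>

lemma bessel_pair_D:
  assumes "bessel_pair n f g" "x > 0"
  shows "(f has_vector_derivative (1 / x) *\<^sub>R g x) (at x)"
    "(g has_vector_derivative (((real n)\<^sup>2 - x\<^sup>2) / x) *\<^sub>R f x) (at x)"
  using assms by (auto simp: bessel_pair_def)

lemma bessel_pair_lincomb:
  fixes f :: "real \<Rightarrow> 'a::real_normed_algebra"
  assumes "bessel_pair n f Df" "bessel_pair n g Dg"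
  shows "bessel_pair n (\<lambda>x. a * f x + b * g x) (\<lambda>x. a * Df x + b * Dg x)"
  unfolding bessel_pair_def
proof (intro allI impI)
  fix x :: real assume x: "x > 0"
  have "((\<lambda>x. a * f x + b * g x) has_vector_derivative a * ((1 / x) *\<^sub>R Df x) + b * ((1 / x) *\<^sub>R Dg x)) (at x)"
    "((\<lambda>x. a * Df x + b * Dg x) has_vector_derivative
      a * ((((real n)\<^sup>2 - x\<^sup>2) / x) *\<^sub>R f x) + b * ((((real n)\<^sup>2 - x\<^sup>2) / x) *\<^sub>R g x)) (at x)"
    by (intro has_vector_derivative_add has_vector_derivative_mult_right bessel_pair_D[OF assms(1) x] bessel_pair_D[OF assms(2) x])+
  then show "((\<lambda>x. a * f x + b * g x) has_vector_derivative (1 / x) *\<^sub>R (a * Df x + b * Dg x)) (at x) \<and>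
     ((\<lambda>x. a * Df x + b * Dg x) has_vector_derivative (((real n)\<^sup>2 - x\<^sup>2) / x) *\<^sub>R (a * f x + b * g x)) (at x)"
    by (simp add: scaleR_right_distrib)
qed

lemma bessel_pair_of_real:
  assumes "bessel_pair n f Df"
  shows "bessel_pair n (\<lambda>x. complex_of_real (f x)) (\<lambda>x. complex_of_real (Df x))"
  unfolding bessel_pair_def
proof (intro allI impI)
  fix x :: real assume x: "x > 0"
  show "((\<lambda>x. complex_of_real (f x)) has_vector_derivative (1 / x) *\<^sub>R complex_of_real (Df x)) (at x) \<and>
     ((\<lambda>x. complex_of_real (Df x)) has_vector_derivative (((real n)\<^sup>2 - x\<^sup>2) / x) *\<^sub>R complex_of_real (f x)) (at x)"
    using bessel_pair_D[OF assms x]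
    unfolding has_real_derivative_iff_has_vector_derivative[symmetric]
    by (auto dest: has_vector_derivative_of_real[where 'a = complex] simp: scaleR_conv_of_real)
qed

lemma bessel_wronskian_const:
  fixes f g :: "real \<Rightarrow> 'a::{real_normed_field}"
  assumes "bessel_pair n f Df" "bessel_pair n g Dg" "x > 0" "y > 0"
  shows "f x * Dg x - g x * Df x = f y * Dg y - g y * Df y"
proof -
  have "((\<lambda>x. f x * Dg x - g x * Df x) has_vector_derivative 0) (at x)" if x: "x > 0" for x
  proof -
    have "((\<lambda>x. f x * Dg x - g x * Df x) has_vector_derivative
      (f x * ((((real n)\<^sup>2 - x\<^sup>2) / x) *\<^sub>R g x) + ((1 / x) *\<^sub>R Df x) * Dg x)
      - (g x * ((((real n)\<^sup>2 - x\<^sup>2) / x) *\<^sub>R f x) + ((1 / x) *\<^sub>R Dg x) * Df x)) (at x)"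
      by (intro has_vector_derivative_diff has_vector_derivative_mult
          bessel_pair_D[OF assms(1) x] bessel_pair_D[OF assms(2) x])
    then show ?thesis by (rule has_vector_derivative_eq_rhs) (simp add: algebra_simps)
  qed
  then have "\<exists>c. \<forall>x\<in>{0<..}. f x * Dg x - g x * Df x = c"
    by - (rule has_vector_derivative_zero_constant[of "{0<..}" "\<lambda>x. f x * Dg x - g x * Df x"],
       auto intro: has_vector_derivative_at_within)
  then show ?thesis using assms(3,4) by auto
qed

text \<open>The constant is read off at 0: the singularity of Y_0 is only logarithmic and is killed
  by \<open>DJ 0\<close>, while J_0 tends to 1 and \<open>DY0\<close> to 2 / pi.\<close>

lemma wronskian_J0_Y0:
  assumes "x > 0"
  shows "bessel_J_nat 0 x * DY0 x - bessel_Y_nat 0 x * DJ 0 x = 2 / pi"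
proof -
  let ?W = "\<lambda>x. bessel_J_nat 0 x * DY0 x - bessel_Y_nat 0 x * DJ 0 x"
  have "((\<lambda>x. (bessel_Y_nat 0 x - 2 / pi * (ln (x / 2) + euler_mascheroni)) * DJ 0 x
      + (2 / pi * (ln (x / 2) * DJ 0 x) + 2 / pi * euler_mascheroni * DJ 0 x))
     \<longlongrightarrow> 0 * 0 + (2 / pi * 0 + 2 / pi * euler_mascheroni * 0)) (at_right 0)"
    by (intro tendsto_intros tendsto_Y0_0 tendsto_DJ_0 tendsto_ln_DJ0)
  then have "((\<lambda>x. bessel_Y_nat 0 x * DJ 0 x) \<longlongrightarrow> 0) (at_right 0)"
    by (simp add: algebra_simps)
  then have "(?W \<longlongrightarrow> (if (0::nat) = 0 then 1 else 0) * (2 / pi) - 0) (at_right 0)"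
    by (intro tendsto_intros tendsto_J_0 tendsto_DY0_0)
  moreover have "(?W \<longlongrightarrow> ?W x) (at_right 0)"
  proof (rule Lim_transform_eventually[OF tendsto_const])
    show "eventually (\<lambda>y. ?W x = ?W y) (at_right 0)"
      by (rule eventually_mono[OF eventually_at_right_less[of 0]])
         (rule bessel_wronskian_const[OF bessel_pair_J bessel_pair_Y0 assms])
  qed
  ultimately show ?thesis using tendsto_unique[OF trivial_limit_at_right_real] by fastforce
qed

lemma filterlim_Y0: "filterlim (bessel_Y_nat 0) at_bot (at_right 0)"
proof -
  have "filterlim (\<lambda>x::real. - (2 / pi * (ln (x / 2) + euler_mascheroni))) at_top (at_right 0)"
    by real_asymp
  from filterlim_tendsto_add_at_top[OF tendsto_minus[OF tendsto_Y0_0] this]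
  show ?thesis unfolding filterlim_uminus_at_bot by simp
qed

lemma hankel0_small:
  "((\<lambda>x. hankel0 x - of_real (bessel_J_nat 0 x) - \<i> * of_real (bessel_Y_nat 0 x)) \<longlongrightarrow> 0) (at_right 0)"
proof -
  let ?l = "\<lambda>x::real. 2 / pi * (ln (x / 2) + euler_mascheroni)"
  let ?t = "\<lambda>x::real. of_real (- euler_mascheroni - ln (x / 2)) + \<i> * pi / 2 :: complex"
  have 1: "((\<lambda>x. - 2 * \<i> / pi * cis x * (LH 0 x - ?t x)) \<longlongrightarrow> 0) (at_right 0)"
  proof (rule Lim_null_comparison)
    show "eventually (\<lambda>x. norm (- 2 * \<i> / pi * cis x * (LH 0 x - ?t x)) \<le> 2 / pi * (2 * Gamma (1/2) * sqrt x)) (at_right 0)"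
      by (rule eventually_mono[OF eventually_at_right_less[of 0]])
         (use mult_left_mono[OF LH_small, of _ "2 / pi"] in \<open>simp only: norm_mult norm_divide norm_cis, simp\<close>)
    show "((\<lambda>x. 2 / pi * (2 * Gamma (1/2) * sqrt x)) \<longlongrightarrow> 0) (at_right 0)"
      by (rule tendsto_eq_intros refl | simp)+
  qed
  have 2: "((\<lambda>x. (cis x - 1) * (1 + \<i> * of_real (?l x))) \<longlongrightarrow> 0) (at_right 0)"
  proof (rule Lim_null_comparison)
    show "eventually (\<lambda>x. norm ((cis x - 1) * (1 + \<i> * of_real (?l x))) \<le> x * (1 + \<bar>?l x\<bar>)) (at_right 0)"
    proof (rule eventually_mono[OF eventually_at_right_less[of 0]])
      fix x :: real assume x: "0 < x"
      have "norm (cis x - 1) \<le> \<bar>x\<bar>"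
      proof -
        have c: "cos x = 1 - 2 * (sin (x / 2))\<^sup>2" using cos_double_sin[of "x / 2"] by simp
        have "(norm (cis x - 1))\<^sup>2 = 2 - 2 * cos x"
          using sin_cos_squared_add[of x] unfolding cmod_power2 by (simp add: power2_eq_square algebra_simps)
        also have "\<dots> = (2 * \<bar>sin (x / 2)\<bar>)\<^sup>2" unfolding c by (simp add: power_mult_distrib)
        finally have "norm (cis x - 1) = 2 * \<bar>sin (x / 2)\<bar>"
          by (rule power2_eq_imp_eq) auto
        then show ?thesis using abs_sin_x_le_abs_x[of "x / 2"] by simp
      qed
      moreover have "norm (1 + \<i> * of_real (?l x)) \<le> 1 + \<bar>?l x\<bar>"
        using norm_triangle_ineq[of 1 "\<i> * of_real (?l x)"] by (simp only: norm_mult norm_of_real norm_ii norm_one mult_1)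
      ultimately show "norm ((cis x - 1) * (1 + \<i> * of_real (?l x))) \<le> x * (1 + \<bar>?l x\<bar>)"
        unfolding norm_mult using x by (intro mult_mono) auto
    qed
    have "((\<lambda>x. x + \<bar>2 / pi * (x * ln (x / 2) + euler_mascheroni * x)\<bar>) \<longlongrightarrow> 0 + \<bar>2 / pi * (0 + euler_mascheroni * 0)\<bar>) (at_right 0)"
      by (intro tendsto_intros tendsto_x_ln_0)
    then have "((\<lambda>x. x + \<bar>2 / pi * (x * ln (x / 2) + euler_mascheroni * x)\<bar>) \<longlongrightarrow> 0) (at_right 0)" by simp
    then show "((\<lambda>x. x * (1 + \<bar>?l x\<bar>)) \<longlongrightarrow> 0) (at_right 0)"
    proof (rule Lim_transform_eventually, intro eventually_mono[OF eventually_at_right_less[of 0]])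
      fix x :: real assume "0 < x"
      then have "x * \<bar>?l x\<bar> = \<bar>x * ?l x\<bar>" by (simp add: abs_mult)
      then show "x + \<bar>2 / pi * (x * ln (x / 2) + euler_mascheroni * x)\<bar> = x * (1 + \<bar>?l x\<bar>)"
        by (simp add: algebra_simps)
    qed
  qed
  have 3: "((\<lambda>x. of_real (1 - bessel_J_nat 0 x) - \<i> * of_real (bessel_Y_nat 0 x - ?l x)) \<longlongrightarrow>
      of_real (1 - (if (0::nat) = 0 then 1 else 0)) - \<i> * of_real 0) (at_right 0)"
    by (intro tendsto_intros tendsto_J_0 tendsto_Y0_0)
  \<comment> \<open>Three errors: that of \<open>LH_small\<close>, the replacement of cis x by 1 in
    front of the logarithm, and those of the expansions of J_0 and Y_0.\<close>
  have e: "hankel0 x - of_real (bessel_J_nat 0 x) - \<i> * of_real (bessel_Y_nat 0 x)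
      = - 2 * \<i> / pi * cis x * (LH 0 x - ?t x) + (cis x - 1) * (1 + \<i> * of_real (?l x))
        + (of_real (1 - bessel_J_nat 0 x) - \<i> * of_real (bessel_Y_nat 0 x - ?l x))" for x
  proof -
    have "- 2 * \<i> / pi * ?t x = 1 + \<i> * of_real (?l x)"
      by (simp add: field_simps)
    moreover have "- 2 * \<i> / pi * cis x * (LH 0 x - ?t x) = hankel0 x - cis x * (- 2 * \<i> / pi * ?t x)"
      unfolding hankel0_def by (simp only: right_diff_distrib mult_ac)
    ultimately have *: "- 2 * \<i> / pi * cis x * (LH 0 x - ?t x) = hankel0 x - cis x * (1 + \<i> * of_real (?l x))"
      by (simp only:)
    define l where "l = ?l x"
    show ?thesis unfolding * unfolding l_def[symmetric] by (simp add: algebra_simps)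
  qed
  show ?thesis unfolding e using tendsto_add[OF tendsto_add[OF 1 2] 3] by simp
qed

text \<open>The difference of both sides solves Bessel's equation and tends to 0 at 0. Wronskians
  write it as a combination of J_0 and Y_0; the unboundedness of Y_0 removes one coefficient, and
  J_0 -> 1 the other.\<close>

lemma hankel0_eq:
  assumes x: "x > 0"
  shows "hankel0 x = of_real (bessel_J_nat 0 x) + \<i> * of_real (bessel_Y_nat 0 x)"
    and "Dhankel0 x = of_real (DJ 0 x) + \<i> * of_real (DY0 x)"
proof -
  let ?J = "\<lambda>x. complex_of_real (bessel_J_nat 0 x)" and ?Y = "\<lambda>x. complex_of_real (bessel_Y_nat 0 x)"
  let ?DJ = "\<lambda>x. complex_of_real (DJ 0 x)" and ?DY = "\<lambda>x. complex_of_real (DY0 x)"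
  define d where "d = (\<lambda>x. hankel0 x - ?J x - \<i> * ?Y x)"
  define e where "e = (\<lambda>x. Dhankel0 x - ?DJ x - \<i> * ?DY x)"
  have pJ: "bessel_pair 0 ?J ?DJ" and pY: "bessel_pair 0 ?Y ?DY"
    by (intro bessel_pair_of_real bessel_pair_J bessel_pair_Y0)+
  have "bessel_pair 0 (\<lambda>x. 1 * hankel0 x + (-1) * (1 * ?J x + \<i> * ?Y x)) (\<lambda>x. 1 * Dhankel0 x + (-1) * (1 * ?DJ x + \<i> * ?DY x))"
    by (intro bessel_pair_lincomb pJ pY bessel_pair_hankel0)
  then have p: "bessel_pair 0 d e" by (simp add: d_def e_def algebra_simps)
  define a where "a = d 1 * ?DY 1 - ?Y 1 * e 1"
  define b where "b = d 1 * ?DJ 1 - ?J 1 * e 1"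
  have c: "d x * of_real (2 / pi) = ?J x * a - ?Y x * b" if x: "x > 0" for x
  proof -
    have "a = d x * ?DY x - ?Y x * e x" "b = d x * ?DJ x - ?J x * e x"
      unfolding a_def b_def
      using bessel_wronskian_const[OF p pY zero_less_one x] bessel_wronskian_const[OF p pJ zero_less_one x] by auto
    moreover have "complex_of_real (2 / pi) = ?J x * ?DY x - ?Y x * ?DJ x"
      unfolding wronskian_J0_Y0[OF x, symmetric] by simp
    ultimately show ?thesis by (simp only:) (simp add: algebra_simps)
  qed
  have d0: "(d \<longlongrightarrow> 0) (at_right 0)" unfolding d_def by (rule hankel0_small)
  have J1: "(?J \<longlongrightarrow> 1) (at_right 0)" using tendsto_of_real[OF tendsto_J_0[of 0], where 'a = complex] by simp
  have "((\<lambda>x. ?J x * a - d x * of_real (2 / pi)) \<longlongrightarrow> 1 * a - 0 * of_real (2 / pi)) (at_right 0)"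
    by (intro tendsto_intros J1 d0)
  then have "((\<lambda>x. ?Y x * b) \<longlongrightarrow> 1 * a - 0 * of_real (2 / pi)) (at_right 0)"
    by (rule Lim_transform_eventually)
       (rule eventually_mono[OF eventually_at_right_less[of 0]], simp only: c, simp)
  then have lim: "((\<lambda>x. ?Y x * b) \<longlongrightarrow> a) (at_right 0)" by simp
  have b0: "b = 0"
  proof (rule ccontr)
    assume "b \<noteq> 0"
    have "filterlim (\<lambda>x. \<bar>bessel_Y_nat 0 x\<bar>) at_top (at_right 0)"
      using filterlim_compose[OF filterlim_norm_at_top filterlim_at_bot_imp_at_infinity[OF filterlim_Y0]] by simp
    then have "filterlim (\<lambda>x. norm b * \<bar>bessel_Y_nat 0 x\<bar>) at_top (at_right 0)"
      by (intro filterlim_tendsto_pos_mult_at_top[OF tendsto_const]) (use \<open>b \<noteq> 0\<close> in auto)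
    moreover have "((\<lambda>x. norm b * \<bar>bessel_Y_nat 0 x\<bar>) \<longlongrightarrow> norm a) (at_right 0)"
      using tendsto_norm[OF lim] by (simp add: norm_mult mult.commute)
    ultimately show False
      using not_tendsto_and_filterlim_at_infinity[OF trivial_limit_at_right_real] filterlim_at_top_imp_at_infinity by blast
  qed
  have a0: "a = 0" using lim b0 by (simp add: tendsto_const_iff)
  have dz: "d x = 0" if "x > 0" for x using c[OF that] a0 b0 by simp
  then show "hankel0 x = of_real (bessel_J_nat 0 x) + \<i> * of_real (bessel_Y_nat 0 x)"
    using x by (simp add: d_def algebra_simps)
  have "(d has_vector_derivative 0) (at x)"
    by (rule has_vector_derivative_transform_within_open[OF has_vector_derivative_const[of 0] open_greaterThan[of 0]])
       (use x dz in auto)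
  from vector_derivative_unique_at[OF bessel_pair_D(1)[OF p x] this] x have "e x = 0" by simp
  then show "Dhankel0 x = of_real (DJ 0 x) + \<i> * of_real (DY0 x)" by (simp add: e_def algebra_simps)
qed

section \<open>Hankel functions of higher order\<close>

text \<open>Generated upwards from order zero, so that the equation, the Wronskian and the
  asymptotics pass from one order to the next by induction. A Neumann series has to be compared with
  the integral at order zero only.\<close>

fun hank :: "nat \<Rightarrow> real \<Rightarrow> complex" where
  "hank 0 x = hankel0 x"
| "hank (Suc 0) x = - Dhankel0 x / of_real x"
| "hank (Suc (Suc n)) x = of_real (2 * (real n + 1) / x) * hank (Suc n) x - hank n x"

definition DH :: "nat \<Rightarrow> real \<Rightarrow> complex" where
  "DH n x = of_nat n * hank n x - of_real x * hank (Suc n) x"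

text \<open>The two ladder relations go through the induction together, since differentiating the
  recurrence takes the derivatives of both predecessors.\<close>

lemma hank_derivs:
  assumes x: "x > 0"
  shows "(hank n has_vector_derivative of_real (real n / x) * hank n x - hank (Suc n) x) (at x) \<and>
    (hank (Suc n) has_vector_derivative hank n x - of_real ((real n + 1) / x) * hank (Suc n) x) (at x)"
proof (induction n)
  case 0
  have h0: "hank 0 = hankel0" by (rule ext) simp
  have h1: "hank (Suc 0) = (\<lambda>x. of_real (- 1 / x) * Dhankel0 x)" by (rule ext) simp
  have "(hank 0 has_vector_derivative of_real (real 0 / x) * hank 0 x - hank (Suc 0) x) (at x)"
    using bessel_pair_D(1)[OF bessel_pair_hankel0 x] unfolding h0 by (simp add: scaleR_conv_of_real)
  moreover have "((\<lambda>x. - 1 / x) has_field_derivative 1 / x\<^sup>2) (at x)"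
    using x by (auto intro!: derivative_eq_intros simp: power2_eq_square)
  from has_vector_derivative_mult[OF has_vector_derivative_of_real[OF this, where 'a = complex] bessel_pair_D(2)[OF bessel_pair_hankel0 x]]
  have "(hank (Suc 0) has_vector_derivative hank 0 x - of_real ((real 0 + 1) / x) * hank (Suc 0) x) (at x)"
    unfolding h1 by (rule has_vector_derivative_eq_rhs)
      (use x in \<open>simp add: scaleR_conv_of_real field_simps power2_eq_square\<close>)
  ultimately show ?case by blast
next
  case (Suc n)
  have h: "hank (Suc (Suc n)) = (\<lambda>x. of_real (2 * (real n + 1) / x) * hank (Suc n) x - hank n x)"
    by (rule ext) simp
  have "((\<lambda>x. 2 * (real n + 1) / x) has_field_derivative - 2 * (real n + 1) / x\<^sup>2) (at x)"
    using x by (auto intro!: derivative_eq_intros simp: power2_eq_square)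
  from has_vector_derivative_diff[OF has_vector_derivative_mult[OF
      has_vector_derivative_of_real[OF this, where 'a = complex] conjunct2[OF Suc.IH]] conjunct1[OF Suc.IH]]
  have "(hank (Suc (Suc n)) has_vector_derivative hank (Suc n) x - of_real ((real (Suc n) + 1) / x) * hank (Suc (Suc n)) x) (at x)"
    unfolding h by (rule has_vector_derivative_eq_rhs)
      (use x in \<open>simp add: field_simps power2_eq_square\<close>)
  moreover have "(hank (Suc n) has_vector_derivative of_real (real (Suc n) / x) * hank (Suc n) x - hank (Suc (Suc n)) x) (at x)"
    using conjunct2[OF Suc.IH] by (rule has_vector_derivative_eq_rhs) (use x in \<open>simp add: field_simps\<close>)
  ultimately show ?case by blast
qed

lemma bessel_pair_hank: "bessel_pair n (hank n) (DH n)"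
proof -
  have "(hank n has_vector_derivative (1 / x) *\<^sub>R DH n x) (at x)"
       "(DH n has_vector_derivative (((real n)\<^sup>2 - x\<^sup>2) / x) *\<^sub>R hank n x) (at x)"
    if x: "x > 0" for x
  proof -
    show "(hank n has_vector_derivative (1 / x) *\<^sub>R DH n x) (at x)"
      using conjunct1[OF hank_derivs[OF x]] by (rule has_vector_derivative_eq_rhs)
        (use x in \<open>simp add: DH_def scaleR_conv_of_real field_simps\<close>)
    have "((\<lambda>x. complex_of_real x) has_vector_derivative 1) (at x)"
      by (auto intro!: derivative_eq_intros)
    from has_vector_derivative_diff[OF has_vector_derivative_mult_right[OF conjunct1[OF hank_derivs[OF x]], of "of_nat n" n]
       has_vector_derivative_mult[OF this conjunct2[OF hank_derivs[OF x]], of n]]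
    show "(DH n has_vector_derivative (((real n)\<^sup>2 - x\<^sup>2) / x) *\<^sub>R hank n x) (at x)"
      unfolding DH_def[abs_def] by (rule has_vector_derivative_eq_rhs)
        (use x in \<open>simp add: scaleR_conv_of_real field_simps power2_eq_square\<close>)
  qed
  then show ?thesis unfolding bessel_pair_def by blast
qed

lemma Re_hank: "x > 0 \<Longrightarrow> Re (hank n x) = bessel_J_nat n x"
proof (induction n rule: induct_nat_012)
  case 0
  then show ?case by (simp add: hankel0_eq)
next
  case 1
  then show ?case by (simp add: hankel0_eq DJ_def Re_divide_of_real)
next
  case (ge2 n)
  then show ?case by (simp add: bessel_J_nat_recurrence del: of_real_mult of_real_divide of_real_add)
qed

lemma Re_DH: "x > 0 \<Longrightarrow> Re (DH n x) = DJ n x"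
  by (simp add: DH_def DJ_def Re_hank)

lemma hank_0_eq_hankel1: "x > 0 \<Longrightarrow> hank 0 x = hankel1 0 x"
  by (simp add: hankel0_eq hankel1_def bessel_J_def bessel_Y_def)

definition YY :: "nat \<Rightarrow> real \<Rightarrow> real" where "YY n x = Im (hank n x)"
definition DYY :: "nat \<Rightarrow> real \<Rightarrow> real" where "DYY n x = Im (DH n x)"

text \<open>Expressed through H_n and H_{n+1}, the Wronskians of orders n and n + 1 are the same
  bilinear form; so the value 2 / pi is inherited from order zero.\<close>

lemma wronskian_hank: "x > 0 \<Longrightarrow> bessel_J_nat n x * DYY n x - YY n x * DJ n x = 2 / pi"
proof (induction n)
  case 0
  have "DH 0 x = Dhankel0 x" using 0 by (simp add: DH_def)
  then show ?case using wronskian_J0_Y0[of x] 0 by (simp add: YY_def DYY_def hankel0_eq)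
next
  case (Suc n)
  have "DH (Suc n) x = of_real x * hank n x - of_nat (Suc n) * hank (Suc n) x"
    using Suc.prems by (simp add: DH_def field_simps)
  then have "DYY (Suc n) x = x * YY n x - (real n + 1) * YY (Suc n) x"
    "DJ (Suc n) x = x * bessel_J_nat n x - (real n + 1) * bessel_J_nat (Suc n) x"
    using Re_DH[OF Suc.prems, of "Suc n"]
    by (simp_all add: DYY_def YY_def Re_hank[OF Suc.prems, symmetric] Re_DH[OF Suc.prems, symmetric])
  note 1 = this
  have 2: "DYY n x = real n * YY n x - x * YY (Suc n) x" by (simp add: DYY_def YY_def DH_def)
  have 3: "DJ n x = real n * bessel_J_nat n x - x * bessel_J_nat (Suc n) x" by (simp add: DJ_def)
  have "bessel_J_nat (Suc n) x * DYY (Suc n) x - YY (Suc n) x * DJ (Suc n) x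
      = bessel_J_nat n x * DYY n x - YY n x * DJ n x"
    unfolding 1 2 3 by (simp add: algebra_simps)
  then show ?case using Suc.IH[OF Suc.prems] by simp
qed

text \<open>The second estimate is the radiation condition of a single mode in sharp form: x H' = (i
  x - 1/2) H up to O(x^(-3/2)). The term 1/2 makes sqrt x * H nearly a pure exponential, as the form
  z'' + q z = 0 will need.\<close>

lemma hank_asymp:
  "\<exists>K. \<forall>x\<ge>1. norm (hank n x) \<le> K * x powr (- 1/2) \<and>
     norm (DH n x + (1/2 - \<i> * of_real x) * hank n x) \<le> K * x powr (- 3/2)"
proof (induction n)
  case 0
  let ?K = "Gamma (1/2) + Gamma (3/2) :: real"
  have G: "Gamma (1/2) \<ge> (0::real)" "Gamma (3/2) \<ge> (0::real)" by (auto intro!: less_imp_le Gamma_real_pos)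
  have p: "2 / pi \<le> 1" using pi_ge_two by (simp add: field_simps)
  have "norm (hank 0 x) \<le> ?K * x powr (- 1/2) \<and>
     norm (DH 0 x + (1/2 - \<i> * of_real x) * hank 0 x) \<le> ?K * x powr (- 3/2)" if x: "x \<ge> 1" for x
  proof
    have x0: "x > 0" using x by simp
    have "norm (hank 0 x) = 2 / pi * norm (LH 0 x)" by (simp add: hankel0_def norm_mult norm_divide)
    also have "\<dots> \<le> 1 * (Gamma (1/2) * x powr (- 1/2))" using LH_bound[OF x0] p by (intro mult_mono) auto
    also have "\<dots> \<le> ?K * x powr (- 1/2)" using G by (simp add: mult_right_mono)
    finally show "norm (hank 0 x) \<le> ?K * x powr (- 1/2)" .
    have "DH 0 x + (1/2 - \<i> * of_real x) * hank 0 x = - 2 * \<i> / pi * cis x * (LH 0 x / 2 - of_real x * LH 1 x)"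
    proof -
      have D: "DH 0 x = Dhankel0 x" using x0 by (simp add: DH_def)
      define C where "C = - 2 * \<i> / complex_of_real pi"
      show ?thesis unfolding D hank.simps hankel0_def Dhankel0_def unfolding C_def[symmetric]
        by (simp add: algebra_simps)
    qed
    then have "norm (DH 0 x + (1/2 - \<i> * of_real x) * hank 0 x) = 2 / pi * norm (LH 0 x / 2 - of_real x * LH 1 x)"
      by (simp only: norm_mult norm_divide norm_cis) simp
    also have "\<dots> \<le> 1 * (Gamma (3/2) * x powr (- 3/2))" using LH_first_order[OF x0] p by (intro mult_mono) auto
    also have "\<dots> \<le> ?K * x powr (- 3/2)" using G by (simp add: mult_right_mono)
    finally show "norm (DH 0 x + (1/2 - \<i> * of_real x) * hank 0 x) \<le> ?K * x powr (- 3/2)" .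
  qed
  then show ?case by blast
next
  case (Suc n)
  then obtain K where K: "\<And>x. x \<ge> 1 \<Longrightarrow> norm (hank n x) \<le> K * x powr (- 1/2)"
    "\<And>x. x \<ge> 1 \<Longrightarrow> norm (DH n x + (1/2 - \<i> * of_real x) * hank n x) \<le> K * x powr (- 3/2)" by blast
  define m where "m = real n + 1/2"
  have m: "m \<ge> 0" by (simp add: m_def)
  have K0: "K \<ge> 0" using order_trans[OF norm_ge_zero K(1)[of 1]] by simp
  define L where "L = (m + 1) ^ 2 * K + (m + 2) * K"
  have "norm (hank (Suc n) x) \<le> L * x powr (- 1/2) \<and>
     norm (DH (Suc n) x + (1/2 - \<i> * of_real x) * hank (Suc n) x) \<le> L * x powr (- 3/2)" if x: "x \<ge> 1" for x
  proof
    have x0: "x > 0" using x by simp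
    define e where "e = DH n x + (1/2 - \<i> * of_real x) * hank n x"
    have e: "norm e \<le> K * x powr (- 3/2)" unfolding e_def by (rule K(2)[OF x])
    have pw: "x powr (- 1/2) = x * x powr (- 3/2)" using x0 powr_add[of x 1 "- 3/2"] by simp
    have le: "x powr (- 3/2) \<le> x powr (- 1/2)" using x by (intro powr_mono) auto
    have z: "norm (of_real m - \<i> * of_real x) \<le> (m + 1) * x" "norm (of_real m + \<i> * of_real x) \<le> (m + 1) * x"
    proof -
      have "m * 1 \<le> m * x" using m x by (intro mult_left_mono) auto
      then show "norm (of_real m - \<i> * of_real x) \<le> (m + 1) * x" "norm (of_real m + \<i> * of_real x) \<le> (m + 1) * x"
        using norm_triangle_ineq4[of "of_real m" "\<i> * of_real x"] norm_triangle_ineq[of "of_real m" "\<i> * of_real x"] m x0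
        by (auto simp: norm_mult algebra_simps)
    qed
    have h: "hank (Suc n) x = ((of_real m - \<i> * of_real x) * hank n x - e) / of_real x"
      using x0 by (simp add: e_def DH_def m_def field_simps)
    have "norm (hank (Suc n) x) = norm ((of_real m - \<i> * of_real x) * hank n x - e) / x"
      unfolding h norm_divide using x0 by simp
    also have "\<dots> \<le> ((m + 1) * x * (K * x powr (- 1/2)) + K * x powr (- 3/2)) / x"
    proof -
      have "norm ((of_real m - \<i> * of_real x) * hank n x) \<le> (m + 1) * x * (K * x powr (- 1/2))"
        unfolding norm_mult by (intro mult_mono z K x) (use m x0 in auto)
      then show ?thesis
        using x0 by (intro divide_right_mono order_trans[OF norm_triangle_ineq4] add_mono e) auto
    qed
    also have "\<dots> = (m + 1) * K * x powr (- 1/2) + K * x powr (- 3/2) / x" using x0 by (simp add: field_simps)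
    also have "\<dots> \<le> (m + 1) * K * x powr (- 1/2) + K * x powr (- 1/2)"
    proof -
      have "K * x powr (- 3/2) / x \<le> K * x powr (- 3/2) / 1" using x K0 by (intro divide_left_mono) auto
      also have "\<dots> \<le> K * x powr (- 1/2)" using le K0 by (simp add: mult_left_mono)
      finally show ?thesis by simp
    qed
    also have "\<dots> = ((m + 2) * K) * x powr (- 1/2)" by (simp add: algebra_simps)
    also have "\<dots> \<le> L * x powr (- 1/2)" using m K0 by (intro mult_right_mono) (auto simp: L_def)
    finally show "norm (hank (Suc n) x) \<le> L * x powr (- 1/2)" .
    have "DH (Suc n) x = of_real x * hank n x - of_nat (Suc n) * hank (Suc n) x"
      using x0 by (simp add: DH_def field_simps)
    then have "DH (Suc n) x + (1/2 - \<i> * of_real x) * hank (Suc n) x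
       = of_real x * hank n x - (of_real m + \<i> * of_real x) * hank (Suc n) x"
      by (simp add: m_def algebra_simps)
    \<comment> \<open>Here (m + i x) (m - i x) = m^2 + x^2, and the x^2 cancels the leading term x *
      hank n x.\<close>
    also have "\<dots> = ((of_real m + \<i> * of_real x) * e - of_real (m ^ 2) * hank n x) / of_real x"
      unfolding h using x0 by (simp add: field_simps power2_eq_square)
    finally have "norm (DH (Suc n) x + (1/2 - \<i> * of_real x) * hank (Suc n) x)
        = norm ((of_real m + \<i> * of_real x) * e - of_real (m ^ 2) * hank n x) / x"
      using x0 by (simp add: norm_divide)
    also have "\<dots> \<le> ((m + 1) * x * (K * x powr (- 3/2)) + m ^ 2 * (K * x powr (- 1/2))) / x"
    proof -
      have "norm ((of_real m + \<i> * of_real x) * e) \<le> (m + 1) * x * (K * x powr (- 3/2))"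
        unfolding norm_mult by (intro mult_mono z e) (use m x0 in auto)
      moreover have "norm (of_real (m ^ 2) * hank n x) \<le> m ^ 2 * (K * x powr (- 1/2))"
        unfolding norm_mult norm_of_real using K(1)[OF x] by (simp add: mult_left_mono)
      ultimately show ?thesis
        using x0 by (intro divide_right_mono order_trans[OF norm_triangle_ineq4] add_mono) auto
    qed
    also have "\<dots> = (m + 1) * K * x powr (- 3/2) + m ^ 2 * K * x powr (- 3/2)" unfolding pw using x0 by (simp add: field_simps)
    also have "\<dots> = ((m + 1) * K + m ^ 2 * K) * x powr (- 3/2)" by (simp add: algebra_simps)
    also have "\<dots> \<le> L * x powr (- 3/2)" using m K0
      by (intro mult_right_mono) (auto simp: L_def power2_eq_square algebra_simps)
    finally show "norm (DH (Suc n) x + (1/2 - \<i> * of_real x) * hank (Suc n) x) \<le> L * x powr (- 3/2)" .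
  qed
  then show ?case by blast
qed

section \<open>Monotonicity of the modulus\<close>

text \<open>\<open>z = sqrt t * f t\<close> turns Bessel's equation into \<open>z'' + qq z = 0\<close>.\<close>

definition qnu :: "nat \<Rightarrow> real" where "qnu n = (real n)\<^sup>2 - 1/4"

definition qq :: "nat \<Rightarrow> real \<Rightarrow> real" where "qq n t = 1 - qnu n / t\<^sup>2"

lemma qq_deriv: "t > 0 \<Longrightarrow> (qq n has_field_derivative 2 * qnu n / t ^ 3) (at t)"
  unfolding qq_def[abs_def]
  by (auto intro!: derivative_eq_intros simp: power2_eq_square power3_eq_cube mult_ac)

definition zf :: "(real \<Rightarrow> real) \<Rightarrow> real \<Rightarrow> real" where "zf f t = sqrt t * f t"
definition zfd :: "(real \<Rightarrow> real) \<Rightarrow> (real \<Rightarrow> real) \<Rightarrow> real \<Rightarrow> real" where "zfd f Df t = (Df t + f t / 2) / sqrt t"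

lemma bessel_pair_DERIV:
  fixes f :: "real \<Rightarrow> real"
  assumes "bessel_pair n f Df" "t > 0"
  shows "(f has_field_derivative Df t / t) (at t)"
    "(Df has_field_derivative ((real n)\<^sup>2 - t\<^sup>2) * f t / t) (at t)"
  using bessel_pair_D[OF assms] by (simp_all add: has_real_derivative_iff_has_vector_derivative)

lemma zf_deriv:
  assumes "bessel_pair n f Df" "t > 0"
  shows "(zf f has_field_derivative zfd f Df t) (at t)"
    "(zfd f Df has_field_derivative - qq n t * zf f t) (at t)"
proof -
  define r where "r = sqrt t"
  have r: "r > 0" "t = r * r" using assms(2) by (simp_all add: r_def)
  have s: "(sqrt has_field_derivative 1 / (2 * r)) (at t)"
    using DERIV_real_sqrt[OF assms(2)] by (simp add: r_def field_simps)
  have "((\<lambda>t. sqrt t * f t) has_field_derivative 1 / (2 * r) * f t + Df t / t * r) (at t)"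
    unfolding r_def by (rule DERIV_mult[OF s[unfolded r_def] bessel_pair_DERIV(1)[OF assms]])
  moreover have "1 / (2 * r) * f t + Df t / t * r = zfd f Df t"
    unfolding zfd_def r_def[symmetric] using r by (simp add: field_simps)
  ultimately show "(zf f has_field_derivative zfd f Df t) (at t)" by (simp add: zf_def[abs_def])
  have "((\<lambda>t. (Df t + f t / 2) / sqrt t) has_field_derivative
      (((((real n)\<^sup>2 - t\<^sup>2) * f t / t + Df t / t / 2) * r - (Df t + f t / 2) * (1 / (2 * r))) / (r * r))) (at t)"
    unfolding r_def
    by (intro DERIV_divide DERIV_add DERIV_cdivide bessel_pair_DERIV[OF assms] s[unfolded r_def])
       (use assms in auto)
  moreover have "((((real n)\<^sup>2 - t\<^sup>2) * f t / t + Df t / t / 2) * r - (Df t + f t / 2) * (1 / (2 * r))) / (r * r)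
      = - qq n t * zf f t"
    unfolding zf_def qq_def qnu_def r_def[symmetric] using r by (simp add: field_simps power2_eq_square)
  ultimately show "(zfd f Df has_field_derivative - qq n t * zf f t) (at t)" by (simp add: zfd_def[abs_def])
qed

text \<open>The product \<open>S\<^sup>2\<close> of solutions of \<open>S'' + q S = 0\<close> solves the Appell equation
  \<open>v''' + 4 q v' + 2 q' v = 0\<close>; the quantity below is the bilinear concomitant of \<open>S\<^sup>2\<close> and \<open>m\<close>.\<close>

lemma concomitant_nonneg:
  fixes m m1 m2 g S S1 :: "real \<Rightarrow> real"
  assumes x1: "x1 > 0"
    and m: "\<And>t. t > 0 \<Longrightarrow> (m has_field_derivative m1 t) (at t)"
    and m1: "\<And>t. t > 0 \<Longrightarrow> (m1 has_field_derivative m2 t) (at t)"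
    and m2: "\<And>t. t > 0 \<Longrightarrow> (m2 has_field_derivative - 4 * qq n t * m1 t - 2 * (2 * qnu n / t ^ 3) * m t + g t) (at t)"
    and S: "\<And>t. t > 0 \<Longrightarrow> (S has_field_derivative S1 t) (at t)"
    and S1: "\<And>t. t > 0 \<Longrightarrow> (S1 has_field_derivative - qq n t * S t) (at t)"
    and g: "\<And>t. t \<ge> x1 \<Longrightarrow> g t \<le> 0"
    and S0: "S x1 = 0" "S1 x1 \<noteq> 0"
    and lim: "((\<lambda>t. (S t)\<^sup>2 * m2 t - 2 * S t * S1 t * m1 t + 2 * (S1 t)\<^sup>2 * m t + 2 * qq n t * (S t)\<^sup>2 * m t) \<longlongrightarrow> 0) at_top"
  shows "m x1 \<ge> 0"
proof -
  let ?P = "\<lambda>t. (S t)\<^sup>2 * m2 t - 2 * S t * S1 t * m1 t + 2 * (S1 t)\<^sup>2 * m t + 2 * qq n t * (S t)\<^sup>2 * m t"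
  \<comment> \<open>The Appell operator is skew-adjoint and S^2 solves its homogeneous equation, so
    only the source g of m survives.\<close>
  have d: "(?P has_field_derivative (S t)\<^sup>2 * g t) (at t)" if "t > 0" for t
    by (rule derivative_eq_intros refl m[OF that] m1[OF that] m2[OF that] S[OF that] S1[OF that] qq_deriv[OF that])+
       (simp add: algebra_simps power2_eq_square)
  have dec: "?P y \<le> ?P x1" if "y \<ge> x1" for y
  proof (rule DERIV_nonpos_imp_nonincreasing[OF that])
    fix t assume "x1 \<le> t" "t \<le> y"
    then show "\<exists>y. (?P has_real_derivative y) (at t) \<and> y \<le> 0"
      using d[of t] x1 g[of t] by (intro exI[of _ "(S t)\<^sup>2 * g t"]) (auto intro: mult_nonneg_nonpos)
  qed
  have "0 \<le> ?P x1"
    by (rule tendsto_upperbound[OF lim]) (auto intro!: eventually_mono[OF eventually_ge_at_top[of x1]] dec)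
  \<comment> \<open>At \<open>x1\<close> every term that contains S itself vanishes.\<close>
  then have "0 \<le> 2 * (S1 x1)\<^sup>2 * m x1" using S0 by simp
  then show ?thesis using S0 by (simp add: zero_le_mult_iff)
qed

lemma bessel_pair_YY: "bessel_pair n (YY n) (DYY n)"
  unfolding bessel_pair_def YY_def[abs_def] DYY_def[abs_def]
proof (intro allI impI)
  fix x :: real assume x: "x > 0"
  show "((\<lambda>x. Im (hank n x)) has_vector_derivative (1 / x) *\<^sub>R Im (DH n x)) (at x) \<and>
     ((\<lambda>x. Im (DH n x)) has_vector_derivative (((real n)\<^sup>2 - x\<^sup>2) / x) *\<^sub>R Im (hank n x)) (at x)"
    using bessel_pair_D[OF bessel_pair_hank x, of n]
    unfolding has_vector_derivative_complex_iff has_real_derivative_iff_has_vector_derivative by auto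
qed

abbreviation "zX n \<equiv> zf (bessel_J_nat n)"
abbreviation "zXd n \<equiv> zfd (bessel_J_nat n) (DJ n)"
abbreviation "zY n \<equiv> zf (YY n)"
abbreviation "zYd n \<equiv> zfd (YY n) (DYY n)"

lemmas zX_deriv = zf_deriv[OF bessel_pair_J]
lemmas zY_deriv = zf_deriv[OF bessel_pair_YY]

lemma hank_split: "x > 0 \<Longrightarrow> hank n x = Complex (bessel_J_nat n x) (YY n x)"
  "x > 0 \<Longrightarrow> DH n x = Complex (DJ n x) (DYY n x)"
  by (auto simp: complex_eq_iff Re_hank Re_DH YY_def DYY_def)

lemma zf_zfd: "t > 0 \<Longrightarrow> zf f t * zfd g Dg t = f t * (Dg t + g t / 2)"
  by (simp add: zf_def zfd_def)

lemma z_wronskian: "t > 0 \<Longrightarrow> zX n t * zYd n t - zY n t * zXd n t = 2 / pi"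
  using wronskian_hank[of t n] by (simp add: zf_zfd algebra_simps)

lemma norm_hank_sq: "x > 0 \<Longrightarrow> (norm (hank n x))\<^sup>2 = (bessel_J_nat n x)\<^sup>2 + (YY n x)\<^sup>2"
  by (simp add: hank_split cmod_power2)

declare hank.simps [simp del]

text \<open>This is t times the squared modulus of H_n, see \<open>hw_eq\<close>. \<open>hw1\<close>
  and \<open>hw2\<close> are its first two derivatives, with second derivatives of the factors
  eliminated by z'' = - q z.\<close>

definition hw :: "nat \<Rightarrow> real \<Rightarrow> real" where "hw n t = (zX n t)\<^sup>2 + (zY n t)\<^sup>2"
definition hw1 :: "nat \<Rightarrow> real \<Rightarrow> real" where "hw1 n t = 2 * (zX n t * zXd n t + zY n t * zYd n t)"
definition hw2 :: "nat \<Rightarrow> real \<Rightarrow> real" where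
  "hw2 n t = 2 * ((zXd n t)\<^sup>2 + (zYd n t)\<^sup>2) - 2 * qq n t * hw n t"

lemma hw_deriv: "t > 0 \<Longrightarrow> (hw n has_field_derivative hw1 n t) (at t)"
  unfolding hw_def[abs_def]
  by (rule derivative_eq_intros refl zX_deriv zY_deriv | assumption)+ (simp add: hw1_def algebra_simps)

lemma hw1_deriv: "t > 0 \<Longrightarrow> (hw1 n has_field_derivative hw2 n t) (at t)"
  unfolding hw1_def[abs_def]
  by (rule derivative_eq_intros refl zX_deriv zY_deriv | assumption)+
     (simp add: hw2_def hw_def algebra_simps power2_eq_square)

lemma hw2_deriv: "t > 0 \<Longrightarrow> (hw2 n has_field_derivative - 4 * qq n t * hw1 n t - 2 * (2 * qnu n / t ^ 3) * hw n t) (at t)"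
  unfolding hw2_def[abs_def]
  by (rule derivative_eq_intros refl zX_deriv zY_deriv hw_deriv qq_deriv | assumption)+
     (simp add: hw1_def hw_def algebra_simps power2_eq_square)

section \<open>Limits at infinity of the modulus and its derivatives\<close>

lemma z_asymp:
  "\<exists>K\<ge>0. \<forall>t\<ge>1. \<bar>zX n t\<bar> \<le> K \<and> \<bar>zY n t\<bar> \<le> K \<and> \<bar>zXd n t + zY n t\<bar> \<le> K / t\<^sup>2 \<and> \<bar>zYd n t - zX n t\<bar> \<le> K / t\<^sup>2"
proof -
  obtain K where K: "\<And>x. x \<ge> 1 \<Longrightarrow> norm (hank n x) \<le> K * x powr (- 1/2)"
    "\<And>x. x \<ge> 1 \<Longrightarrow> norm (DH n x + (1/2 - \<i> * of_real x) * hank n x) \<le> K * x powr (- 3/2)"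
    using hank_asymp[of n] by blast
  have "\<bar>zX n t\<bar> \<le> K \<and> \<bar>zY n t\<bar> \<le> K \<and> \<bar>zXd n t + zY n t\<bar> \<le> K / t\<^sup>2 \<and> \<bar>zYd n t - zX n t\<bar> \<le> K / t\<^sup>2"
    if t: "t \<ge> 1" for t
  proof -
    have t0: "t > 0" using t by simp
    define r where "r = sqrt t"
    have r: "r > 0" "t = r * r" using t0 by (simp_all add: r_def)
    have p1: "t powr (- 1/2) = 1 / r" using t0 by (simp add: r_def powr_minus powr_half_sqrt field_simps)
    have p3: "t powr (- 3/2) = 1 / r / t" using t0 powr_add[of t "- 1/2" "- 1"] p1
      by (simp add: powr_minus field_simps)
    have a: "norm (hank n t) * r \<le> K" using K(1)[OF t] r unfolding p1 by (simp add: field_simps)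
    have "\<bar>bessel_J_nat n t\<bar> \<le> norm (hank n t)" "\<bar>YY n t\<bar> \<le> norm (hank n t)"
      using abs_Re_le_cmod[of "hank n t"] abs_Im_le_cmod[of "hank n t"] t0 by (simp_all add: hank_split)
    then have "r * \<bar>bessel_J_nat n t\<bar> \<le> K" "r * \<bar>YY n t\<bar> \<le> K"
      using r a by (auto intro: order_trans[OF mult_left_mono] simp: mult.commute)
    then have 1: "\<bar>zX n t\<bar> \<le> K" "\<bar>zY n t\<bar> \<le> K"
      using r by (simp_all add: zf_def r_def[symmetric] abs_mult)
    define e where "e = DH n t + (1/2 - \<i> * of_real t) * hank n t"
    have e: "norm e / r \<le> K / t\<^sup>2"
      using K(2)[OF t] r t0 unfolding p3 e_def by (simp add: field_simps power2_eq_square)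
    have "zXd n t + zY n t = Re e / r" "zYd n t - zX n t = Im e / r"
      using r t0 by (simp_all add: e_def hank_split zf_def zfd_def r_def[symmetric] field_simps)
    then have "\<bar>zXd n t + zY n t\<bar> \<le> norm e / r" "\<bar>zYd n t - zX n t\<bar> \<le> norm e / r"
      using r abs_Re_le_cmod[of e] abs_Im_le_cmod[of e] by (simp_all add: abs_divide divide_right_mono)
    with 1 e show ?thesis by linarith
  qed
  moreover have "K \<ge> 0" using order_trans[OF norm_ge_zero K(1)[of 1]] by simp
  ultimately show ?thesis by blast
qed

lemma Bfun_tendsto_0_mult:
  fixes f g :: "real \<Rightarrow> real"
  assumes "(f \<longlongrightarrow> 0) at_top" "\<And>t. t \<ge> 1 \<Longrightarrow> \<bar>g t\<bar> \<le> B"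
  shows "((\<lambda>t. g t * f t) \<longlongrightarrow> 0) at_top"
proof (rule Lim_null_comparison)
  have "((\<lambda>t. B * \<bar>f t\<bar>) \<longlongrightarrow> B * \<bar>0\<bar>) at_top" by (intro tendsto_intros assms)
  then show "((\<lambda>t. B * \<bar>f t\<bar>) \<longlongrightarrow> 0) at_top" by simp
  show "eventually (\<lambda>t. norm (g t * f t) \<le> B * \<bar>f t\<bar>) at_top"
    by (rule eventually_mono[OF eventually_ge_at_top[of 1]])
       (use assms(2) in \<open>auto simp: abs_mult intro!: mult_right_mono\<close>)
qed

text \<open>Asymptotically zX' = - zY and zY' = zX, so the Wronskian of zX and zY turns into zX^2 +
  zY^2. This identifies the limit 2 / pi.\<close>

lemma hw_limits:
  "(hw n \<longlongrightarrow> 2 / pi) at_top" "((\<lambda>t. t * hw1 n t) \<longlongrightarrow> 0) at_top" "(hw1 n \<longlongrightarrow> 0) at_top" "(hw2 n \<longlongrightarrow> 0) at_top"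
  and z_bounded: "\<exists>K. \<forall>t\<ge>1. \<bar>zX n t\<bar> \<le> K \<and> \<bar>zY n t\<bar> \<le> K \<and> \<bar>zXd n t\<bar> \<le> K \<and> \<bar>zYd n t\<bar> \<le> K"
  and qq_limit: "(qq n \<longlongrightarrow> 1) at_top"
proof -
  obtain K where K0: "K \<ge> 0" and K: "\<And>t. t \<ge> 1 \<Longrightarrow> \<bar>zX n t\<bar> \<le> K" "\<And>t. t \<ge> 1 \<Longrightarrow> \<bar>zY n t\<bar> \<le> K"
    "\<And>t. t \<ge> 1 \<Longrightarrow> \<bar>zXd n t + zY n t\<bar> \<le> K / t\<^sup>2" "\<And>t. t \<ge> 1 \<Longrightarrow> \<bar>zYd n t - zX n t\<bar> \<le> K / t\<^sup>2"
    using z_asymp[of n] by blast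
  define a where "a t = zXd n t + zY n t" for t
  define b where "b t = zYd n t - zX n t" for t
  have d1: "zXd n t = a t - zY n t" "zYd n t = b t + zX n t" for t by (simp_all add: a_def b_def)
  have i1: "((\<lambda>t. K / t) \<longlongrightarrow> 0) at_top" by (rule real_tendsto_divide_at_top[OF tendsto_const filterlim_ident])
  have ta: "((\<lambda>t. t * a t) \<longlongrightarrow> 0) at_top" "((\<lambda>t. t * b t) \<longlongrightarrow> 0) at_top"
  proof -
    have "\<bar>t * c\<bar> \<le> K / t" if "t \<ge> 1" "\<bar>c\<bar> \<le> K / t\<^sup>2" for t c
    proof -
      have "\<bar>t\<bar> * \<bar>c\<bar> \<le> \<bar>t\<bar> * (K / t\<^sup>2)" by (rule mult_left_mono[OF that(2)]) simp
      then have "\<bar>t * c\<bar> \<le> t * (K / t\<^sup>2)" using that(1) by (simp only: abs_mult abs_of_nonneg)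
      also have "\<dots> = K / t" using that by (simp add: power2_eq_square)
      finally show ?thesis .
    qed
    then show "((\<lambda>t. t * a t) \<longlongrightarrow> 0) at_top" "((\<lambda>t. t * b t) \<longlongrightarrow> 0) at_top"
      using K(3,4) by (auto intro!: Lim_null_comparison[OF _ i1] eventually_mono[OF eventually_ge_at_top[of 1]] simp: a_def b_def)
  qed
  have inv: "((\<lambda>t::real. 1 / t) \<longlongrightarrow> 0) at_top" by (rule real_tendsto_divide_at_top[OF tendsto_const filterlim_ident])
  have a0: "(a \<longlongrightarrow> 0) at_top" "(b \<longlongrightarrow> 0) at_top"
  proof -
    have "((\<lambda>t. 1 / t * (t * a t)) \<longlongrightarrow> 0 * 0) at_top" "((\<lambda>t. 1 / t * (t * b t)) \<longlongrightarrow> 0 * 0) at_top"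
      by (intro tendsto_mult inv ta)+
    moreover have "eventually (\<lambda>t. 1 / t * (t * f t) = f t) at_top" for f :: "real \<Rightarrow> real"
      by (rule eventually_mono[OF eventually_gt_at_top[of 0]]) simp
    ultimately show "(a \<longlongrightarrow> 0) at_top" "(b \<longlongrightarrow> 0) at_top"
      unfolding mult_zero_left by (blast intro: Lim_transform_eventually)+
  qed
  have "((\<lambda>t. 2 / pi - (zX n t * b t - zY n t * a t)) \<longlongrightarrow> 2 / pi - (0 - 0)) at_top"
    by (intro tendsto_diff tendsto_const Bfun_tendsto_0_mult[OF a0(1)] Bfun_tendsto_0_mult[OF a0(2)]) (use K in auto)
  then show hw: "(hw n \<longlongrightarrow> 2 / pi) at_top"
    by (auto elim!: Lim_transform_eventually intro!: eventually_mono[OF eventually_gt_at_top[of 0]]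
        simp: z_wronskian[of _ n, symmetric] hw_def d1 power2_eq_square algebra_simps)
  have "((\<lambda>t. 2 * (zX n t * (t * a t) + zY n t * (t * b t))) \<longlongrightarrow> 2 * (0 + 0)) at_top"
    by (intro tendsto_mult tendsto_add tendsto_const Bfun_tendsto_0_mult[OF ta(1)] Bfun_tendsto_0_mult[OF ta(2)]) (use K in auto)
  moreover have "2 * (zX n t * (t * a t) + zY n t * (t * b t)) = t * hw1 n t" for t
    by (simp add: hw1_def d1 algebra_simps)
  ultimately show tw: "((\<lambda>t. t * hw1 n t) \<longlongrightarrow> 0) at_top" by simp
  have "((\<lambda>t. 1 / t * (t * hw1 n t)) \<longlongrightarrow> 0 * 0) at_top" by (intro tendsto_mult inv tw)
  then show "(hw1 n \<longlongrightarrow> 0) at_top"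
    by (auto elim!: Lim_transform_eventually intro: eventually_mono[OF eventually_gt_at_top[of 0]])
  have "((\<lambda>t. 1 - qnu n * (1 / t * (1 / t))) \<longlongrightarrow> 1 - qnu n * (0 * 0)) at_top" by (intro tendsto_intros inv)
  then show q: "(qq n \<longlongrightarrow> 1) at_top" by (simp add: qq_def[abs_def] power2_eq_square)
  have "((\<lambda>t. 2 * ((a t)\<^sup>2 - 2 * (zY n t * a t) + (b t)\<^sup>2 + 2 * (zX n t * b t)) + 2 * (1 - qq n t) * hw n t)
     \<longlongrightarrow> 2 * (0\<^sup>2 - 2 * 0 + 0\<^sup>2 + 2 * 0) + 2 * (1 - 1) * (2 / pi)) at_top"
    by (intro tendsto_intros hw q a0 Bfun_tendsto_0_mult[OF a0(1)] Bfun_tendsto_0_mult[OF a0(2)]) (use K in auto)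
  moreover have "2 * ((a t)\<^sup>2 - 2 * (zY n t * a t) + (b t)\<^sup>2 + 2 * (zX n t * b t)) + 2 * (1 - qq n t) * hw n t = hw2 n t" for t
    by (simp add: hw2_def hw_def d1 algebra_simps power2_eq_square)
  ultimately show "(hw2 n \<longlongrightarrow> 0) at_top" by simp
  have "\<bar>zX n t\<bar> \<le> 2 * K \<and> \<bar>zY n t\<bar> \<le> 2 * K \<and> \<bar>zXd n t\<bar> \<le> 2 * K \<and> \<bar>zYd n t\<bar> \<le> 2 * K" if t: "t \<ge> 1" for t
  proof -
    have "1 \<le> t\<^sup>2" using t by simp
    then have "K / t\<^sup>2 \<le> K / 1" using K0 by (intro divide_left_mono) auto
    then show ?thesis using K[OF t] K0 by linarith
  qed
  then show "\<exists>K. \<forall>t\<ge>1. \<bar>zX n t\<bar> \<le> K \<and> \<bar>zY n t\<bar> \<le> K \<and> \<bar>zXd n t\<bar> \<le> K \<and> \<bar>zYd n t\<bar> \<le> K" by blast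
qed

text \<open>S is taken as the solution that vanishes at \<open>x1\<close>. Solutions stay bounded at
  infinity, so the concomitant tends to 0 as soon as m and its two derivatives do. The sign
  statements for \<open>hw\<close> and \<open>hw1\<close> below are instances with different
  m.\<close>

lemma Appell_sign:
  fixes m m1 m2 g :: "real \<Rightarrow> real"
  assumes x1: "x1 > 0"
    and m: "\<And>t. t > 0 \<Longrightarrow> (m has_field_derivative m1 t) (at t)"
    and m1: "\<And>t. t > 0 \<Longrightarrow> (m1 has_field_derivative m2 t) (at t)"
    and m2: "\<And>t. t > 0 \<Longrightarrow> (m2 has_field_derivative - 4 * qq n t * m1 t - 2 * (2 * qnu n / t ^ 3) * m t + g t) (at t)"
    and g: "\<And>t. t \<ge> x1 \<Longrightarrow> g t \<le> 0"
    and l: "(m \<longlongrightarrow> 0) at_top" "(m1 \<longlongrightarrow> 0) at_top" "(m2 \<longlongrightarrow> 0) at_top"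
  shows "m x1 \<ge> 0"
proof -
  define S where "S t = zX n x1 * zY n t - zY n x1 * zX n t" for t
  define S1 where "S1 t = zX n x1 * zYd n t - zY n x1 * zXd n t" for t
  obtain K where K: "\<And>t. t \<ge> 1 \<Longrightarrow> \<bar>zX n t\<bar> \<le> K" "\<And>t. t \<ge> 1 \<Longrightarrow> \<bar>zY n t\<bar> \<le> K"
    "\<And>t. t \<ge> 1 \<Longrightarrow> \<bar>zXd n t\<bar> \<le> K" "\<And>t. t \<ge> 1 \<Longrightarrow> \<bar>zYd n t\<bar> \<le> K"
    using z_bounded[of n] by blast
  define B where "B = \<bar>zX n x1\<bar> * K + \<bar>zY n x1\<bar> * K"
  have SB: "\<bar>S t\<bar> \<le> B" "\<bar>S1 t\<bar> \<le> B" if "t \<ge> 1" for t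
  proof -
    have "\<bar>\<alpha> * y - \<beta> * z\<bar> \<le> \<bar>\<alpha>\<bar> * K + \<bar>\<beta>\<bar> * K" if "\<bar>y\<bar> \<le> K" "\<bar>z\<bar> \<le> K" for \<alpha> \<beta> y z :: real
    proof -
      have "\<bar>\<alpha> * y - \<beta> * z\<bar> \<le> \<bar>\<alpha> * y\<bar> + \<bar>\<beta> * z\<bar>" by (rule abs_triangle_ineq4)
      also have "\<dots> \<le> \<bar>\<alpha>\<bar> * K + \<bar>\<beta>\<bar> * K" unfolding abs_mult using that by (intro add_mono mult_left_mono) auto
      finally show ?thesis .
    qed
    then show "\<bar>S t\<bar> \<le> B" "\<bar>S1 t\<bar> \<le> B" using K that by (auto simp: S_def S1_def B_def)
  qed
  have BB: "\<bar>S t * S t\<bar> \<le> B * B" "\<bar>S t * S1 t\<bar> \<le> B * B" "\<bar>S1 t * S1 t\<bar> \<le> B * B" if "t \<ge> 1" for t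
    unfolding abs_mult by (intro mult_mono SB that abs_ge_zero order_trans[OF abs_ge_zero SB(1)[OF that]])+
  show ?thesis
  proof (rule concomitant_nonneg[OF x1 m m1 m2, where S = S and ?S1.0 = S1])
    show "(S has_real_derivative S1 t) (at t)" if "t > 0" for t
      unfolding S_def[abs_def] S1_def by (rule derivative_eq_intros refl zX_deriv zY_deriv that)+ simp
    show "(S1 has_real_derivative - qq n t * S t) (at t)" if "t > 0" for t
      unfolding S1_def[abs_def] S_def by (rule derivative_eq_intros refl zX_deriv zY_deriv that)+ (simp add: algebra_simps)
    show "S x1 = 0" by (simp add: S_def)
    show "S1 x1 \<noteq> 0" unfolding S1_def z_wronskian[OF x1] by simp
    have "((\<lambda>t. (S t * S t) * m2 t - 2 * ((S t * S1 t) * m1 t) + 2 * ((S1 t * S1 t) * m t) + 2 * qq n t * ((S t * S t) * m t))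
       \<longlongrightarrow> 0 - 2 * 0 + 2 * 0 + 2 * 1 * 0) at_top"
      by (intro tendsto_intros qq_limit Bfun_tendsto_0_mult[OF l(3) BB(1)] Bfun_tendsto_0_mult[OF l(2) BB(2)]
          Bfun_tendsto_0_mult[OF l(1) BB(3)] Bfun_tendsto_0_mult[OF l(1) BB(1)])
    then show "((\<lambda>t. (S t)\<^sup>2 * m2 t - 2 * S t * S1 t * m1 t + 2 * (S1 t)\<^sup>2 * m t + 2 * qq n t * (S t)\<^sup>2 * m t) \<longlongrightarrow> 0) at_top"
      by (simp add: power2_eq_square mult_ac)
  qed (use g in auto)
qed

lemma qnu_pos: "n > 0 \<Longrightarrow> qnu n > 0"
proof -
  assume "n > 0"
  then have "1\<^sup>2 \<le> (real n)\<^sup>2" by (intro power_mono) auto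
  then show ?thesis by (simp add: qnu_def)
qed

lemma Appell_shift: "k - 2 * r * w = k - 2 * r * (w - c) + - (2 * r * c)" for k r w c :: real
  by (simp add: algebra_simps)

lemma Appell_shift_minus:
  "- (- 4 * p * d - 2 * r * w) = - 4 * p * - d - 2 * r * (c - w) + 2 * r * c" for p d r w c :: real
  by (simp add: algebra_simps)

text \<open>A constant c leaves the defect 2 q' c in the Appell equation, with the sign of
  \<open>qnu n\<close> for c > 0: positive for n > 0, negative for n = 0. Hence the modulus lies
  above its limit 2 / pi here and below it in \<open>hw_0_le\<close>.\<close>

lemma hw_ge: "n > 0 \<Longrightarrow> x > 0 \<Longrightarrow> hw n x \<ge> 2 / pi"
proof -
  assume n: "n > 0" and x: "x > 0"
  have "hw n x - 2 / pi \<ge> 0"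
  proof (rule Appell_sign[OF x, where m = "\<lambda>t. hw n t - 2 / pi" and ?m1.0 = "hw1 n" and ?m2.0 = "hw2 n" and g = "\<lambda>t. - (2 * (2 * qnu n / t ^ 3) * (2 / pi))" and n = n])
    show "((\<lambda>t. hw n t - 2 / pi) has_real_derivative hw1 n t) (at t)" if "t > 0" for t
      using hw_deriv[OF that, of n] by (auto intro!: derivative_eq_intros)
    show "(hw2 n has_real_derivative - 4 * qq n t * hw1 n t - 2 * (2 * qnu n / t ^ 3) * (hw n t - 2 / pi) + - (2 * (2 * qnu n / t ^ 3) * (2 / pi))) (at t)" if "t > 0" for t
      using hw2_deriv[OF that, of n] by (rule DERIV_cong) (rule Appell_shift)
    show "- (2 * (2 * qnu n / t ^ 3) * (2 / pi)) \<le> 0" if "x \<le> t" for t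
      using qnu_pos[OF n] that x by simp
    show "((\<lambda>t. hw n t - 2 / pi) \<longlongrightarrow> 0) at_top" using tendsto_diff[OF hw_limits(1)[of n] tendsto_const[of "2 / pi"]] by simp
  qed (use hw1_deriv hw_limits in auto)
  then show ?thesis by simp
qed

lemma hw_0_le: "x > 0 \<Longrightarrow> hw 0 x \<le> 2 / pi"
proof -
  assume x: "x > 0"
  have "2 / pi - hw 0 x \<ge> 0"
  proof (rule Appell_sign[OF x, where m = "\<lambda>t. 2 / pi - hw 0 t" and ?m1.0 = "\<lambda>t. - hw1 0 t" and ?m2.0 = "\<lambda>t. - hw2 0 t" and g = "\<lambda>t. 2 * (2 * qnu 0 / t ^ 3) * (2 / pi)" and n = 0])
    show "((\<lambda>t. 2 / pi - hw 0 t) has_real_derivative - hw1 0 t) (at t)" if "t > 0" for t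
      using hw_deriv[OF that, of 0] by (auto intro!: derivative_eq_intros)
    show "((\<lambda>t. - hw1 0 t) has_real_derivative - hw2 0 t) (at t)" if "t > 0" for t
      using hw1_deriv[OF that, of 0] by (auto intro!: derivative_eq_intros)
    show "((\<lambda>t. - hw2 0 t) has_real_derivative - 4 * qq 0 t * - hw1 0 t - 2 * (2 * qnu 0 / t ^ 3) * (2 / pi - hw 0 t) + 2 * (2 * qnu 0 / t ^ 3) * (2 / pi)) (at t)" if "t > 0" for t
      using DERIV_minus[OF hw2_deriv[OF that, of 0]] by (rule DERIV_cong) (rule Appell_shift_minus)
    show "2 * (2 * qnu 0 / t ^ 3) * (2 / pi) \<le> 0" if "x \<le> t" for t
      using that x by (simp add: qnu_def)
    show "((\<lambda>t. 2 / pi - hw 0 t) \<longlongrightarrow> 0) at_top" using tendsto_diff[OF tendsto_const[of "2 / pi"] hw_limits(1)[of 0]] by simp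
    show "((\<lambda>t. - hw1 0 t) \<longlongrightarrow> 0) at_top" "((\<lambda>t. - hw2 0 t) \<longlongrightarrow> 0) at_top"
      using tendsto_minus[OF hw_limits(3)[of 0]] tendsto_minus[OF hw_limits(4)[of 0]] by simp_all
  qed
  then show ?thesis by simp
qed

text \<open>The Appell equation differentiated once: \<open>hw1\<close> solves it again, with a
  source whose sign is governed by t hw1 - 3/2 hw. The function differentiated here is the second
  derivative of \<open>hw1\<close>, by \<open>hw2_deriv\<close>.\<close>

lemma hw1_aux_deriv:
  assumes "t > 0"
  shows "((\<lambda>t. - (4 * qq n t * hw1 n t + 2 * (2 * qnu n / t ^ 3) * hw n t)) has_field_derivative
    - 4 * qq n t * hw2 n t - 2 * (2 * qnu n / t ^ 3) * hw1 n t - 8 * qnu n / t ^ 4 * (t * hw1 n t - 3/2 * hw n t)) (at t)"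
proof -
  have c: "((\<lambda>t. 2 * (2 * qnu n / t ^ 3)) has_field_derivative - 12 * qnu n / t ^ 4) (at t)"
    using assms by (auto intro!: derivative_eq_intros simp: field_simps power_numeral_reduce)
  show ?thesis
    by (rule DERIV_cong[OF DERIV_minus[OF DERIV_add[OF DERIV_mult[OF DERIV_cmult[OF qq_deriv] hw1_deriv] DERIV_mult[OF c hw_deriv]]]])
       (use assms in \<open>simp_all add: field_simps power_numeral_reduce\<close>)
qed

lemma hw1_aux_limit: "((\<lambda>t. 4 * qq n t * hw1 n t + 2 * (2 * qnu n / t ^ 3) * hw n t) \<longlongrightarrow> 0) at_top"
proof -
  have "((\<lambda>t::real. 1 / t) \<longlongrightarrow> 0) at_top" by (rule real_tendsto_divide_at_top[OF tendsto_const filterlim_ident])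
  then have "((\<lambda>t. 4 * qq n t * hw1 n t + 2 * (2 * qnu n * (1 / t) ^ 3) * hw n t) \<longlongrightarrow> 4 * 1 * 0 + 2 * (2 * qnu n * 0 ^ 3) * (2 / pi)) at_top"
    by (intro tendsto_intros qq_limit hw_limits)
  then show ?thesis by (simp add: power_one_over)
qed

text \<open>A one-sided step: control of the source to the right of x settles the sign of
  \<open>hw1\<close> at x, which permits an argument running in from infinity.\<close>

lemma hw1_sign_step:
  assumes n: "n > 0" and x: "x > 0" and P: "\<And>t. t \<ge> x \<Longrightarrow> t * hw1 n t - 3/2 * hw n t \<le> 0"
  shows "hw1 n x \<le> 0"
proof -
  have "- hw1 n x \<ge> 0"
  proof (rule Appell_sign[OF x, where m = "\<lambda>t. - hw1 n t" and ?m1.0 = "\<lambda>t. - hw2 n t" and n = n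
      and ?m2.0 = "\<lambda>t. 4 * qq n t * hw1 n t + 2 * (2 * qnu n / t ^ 3) * hw n t"
      and g = "\<lambda>t. 8 * qnu n / t ^ 4 * (t * hw1 n t - 3/2 * hw n t)"])
    show "((\<lambda>t. - hw1 n t) has_real_derivative - hw2 n t) (at t)" if "t > 0" for t
      using hw1_deriv[OF that, of n] by (auto intro!: derivative_eq_intros)
    show "((\<lambda>t. - hw2 n t) has_real_derivative 4 * qq n t * hw1 n t + 2 * (2 * qnu n / t ^ 3) * hw n t) (at t)" if "t > 0" for t
      using DERIV_minus[OF hw2_deriv[OF that, of n]] by (rule DERIV_cong) (simp add: algebra_simps)
    show "((\<lambda>t. 4 * qq n t * hw1 n t + 2 * (2 * qnu n / t ^ 3) * hw n t) has_real_derivative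
       - 4 * qq n t * - hw2 n t - 2 * (2 * qnu n / t ^ 3) * - hw1 n t + 8 * qnu n / t ^ 4 * (t * hw1 n t - 3/2 * hw n t)) (at t)" if "t > 0" for t
      using DERIV_minus[OF hw1_aux_deriv[OF that, of n]] by (simp add: algebra_simps)
    show "8 * qnu n / t ^ 4 * (t * hw1 n t - 3/2 * hw n t) \<le> 0" if "x \<le> t" for t
      using P[OF that] qnu_pos[OF n] that x by (intro mult_nonneg_nonpos) auto
    show "((\<lambda>t. - hw1 n t) \<longlongrightarrow> 0) at_top" "((\<lambda>t. - hw2 n t) \<longlongrightarrow> 0) at_top"
      using tendsto_minus[OF hw_limits(3)[of n]] tendsto_minus[OF hw_limits(4)[of n]] by simp_all
  qed (rule hw1_aux_limit)
  then show ?thesis by simp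
qed

lemma hw_pos: "x > 0 \<Longrightarrow> hw n x > 0"
proof -
  assume x: "x > 0"
  have "hw n x \<noteq> 0"
  proof
    assume "hw n x = 0"
    then have "zX n x = 0" "zY n x = 0" unfolding hw_def by (auto simp: add_nonneg_eq_0_iff)
    then show False using z_wronskian[OF x, of n] by simp
  qed
  moreover have "hw n x \<ge> 0" by (simp add: hw_def)
  ultimately show ?thesis by simp
qed

text \<open>The condition P = t hw1 - 3/2 hw <= 0 is known near infinity, where P tends to - 3 / pi.
  If the claim failed, the sign step would give a point with P > 0, hence a last point T with P >=
  0. To the right of T the step applies and yields hw1 T <= 0; since hw > 0, this makes P T
  negative, a contradiction.\<close>

lemma hw1_nonpos:
  assumes n: "n > 0" and x: "x > 0"
  shows "hw1 n x \<le> 0"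
proof (rule ccontr)
  assume neg: "\<not> hw1 n x \<le> 0"
  define P where "P t = t * hw1 n t - 3/2 * hw n t" for t
  have "(P \<longlongrightarrow> 0 - 3/2 * (2 / pi)) at_top" unfolding P_def by (intro tendsto_intros hw_limits)
  then have "eventually (\<lambda>t. P t < 0) at_top" by (rule order_tendstoD(2)) simp
  then obtain N where N: "\<And>t. t \<ge> N \<Longrightarrow> P t < 0" by (auto simp: eventually_at_top_linorder)
  define A where "A = {t \<in> {x..max x N}. P t \<ge> 0}"
  have cont: "continuous_on {0<..} P"
    unfolding P_def
    by (intro continuous_intros continuous_at_imp_continuous_on ballI)
       (auto intro: DERIV_isCont[OF hw_deriv] DERIV_isCont[OF hw1_deriv])
  have "\<exists>t\<ge>x. P t > 0"
  proof (rule ccontr)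
    assume "\<not> (\<exists>t\<ge>x. P t > 0)"
    then have "\<And>t. t \<ge> x \<Longrightarrow> t * hw1 n t - 3/2 * hw n t \<le> 0" by (metis P_def not_le)
    then show False using hw1_sign_step[OF n x] neg by blast
  qed
  then obtain t0 where t0: "t0 \<ge> x" "P t0 > 0" by blast
  then have "t0 < N" using N[of t0] by (cases "N \<le> t0") auto
  with t0 have "t0 \<in> A" by (auto simp: A_def)
  then have "A \<noteq> {}" by blast
  have "closed A"
    unfolding A_def by (intro continuous_closed_preimage_constant continuous_on_closed_Collect_le[where f = "\<lambda>_. 0", simplified] continuous_on_subset[OF cont])
      (use x in auto)
  moreover have "bounded A" by (rule bounded_subset[OF bounded_closed_interval[of x "max x N"]]) (auto simp: A_def)
  ultimately have "compact A" by (simp add: compact_eq_bounded_closed)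
  then obtain T where T: "T \<in> A" "\<And>t. t \<in> A \<Longrightarrow> t \<le> T" using compact_attains_sup[OF _ \<open>A \<noteq> {}\<close>] by blast
  have T0: "T > 0" "T \<ge> x" using T(1) x by (auto simp: A_def)
  have after: "P t < 0" if "t > T" for t
  proof (rule ccontr)
    assume "\<not> P t < 0"
    then have "t < N" using N[of t] by (cases "N \<le> t") auto
    with \<open>\<not> P t < 0\<close> have "t \<in> A" using that T0 by (auto simp: A_def)
    then show False using T(2) that by force
  qed
  have "isCont P T" using cont T0 by (simp add: continuous_on_eq_continuous_at)
  then have "(P \<longlongrightarrow> P T) (at_right T)" by (simp add: isCont_def filterlim_at_split)
  then have "P T \<le> 0"
    by (rule tendsto_upperbound) (auto simp: eventually_at_filter after intro!: always_eventually less_imp_le)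
  then have "hw1 n T \<le> 0"
    using after by (intro hw1_sign_step[OF n T0(1)]) (force simp: P_def dest: le_imp_less_or_eq)
  moreover have "P T \<ge> 0" using T(1) by (simp add: A_def)
  ultimately show False using hw_pos[OF T0(1), of n] T0 mult_nonneg_nonpos[of T "hw1 n T"] by (simp add: P_def)
qed

lemma hw_eq: "x > 0 \<Longrightarrow> hw n x = x * (norm (hank n x))\<^sup>2"
  by (simp add: hw_def zf_def hank_split cmod_power2 power_mult_distrib algebra_simps)

lemma hw1_eq: "x > 0 \<Longrightarrow> hw1 n x = 2 * (bessel_J_nat n x * DJ n x + YY n x * DYY n x) + (norm (hank n x))\<^sup>2"
  unfolding norm_hank_sq hw1_def by (simp add: zf_zfd norm_hank_sq algebra_simps power2_eq_square)

lemma hw_antimono: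
  assumes "n > 0" "0 < x" "x \<le> y"
  shows "hw n y \<le> hw n x"
proof (rule DERIV_nonpos_imp_nonincreasing[OF assms(3)])
  fix t assume "x \<le> t" "t \<le> y"
  then show "\<exists>y. (hw n has_real_derivative y) (at t) \<and> y \<le> 0"
    using hw_deriv[of t n] hw1_nonpos[OF assms(1), of t] assms by auto
qed

lemma norm_sq_hank_deriv:
  assumes x: "x > 0"
  shows "((\<lambda>x. (bessel_J_nat n x)\<^sup>2 + (YY n x)\<^sup>2) has_field_derivative
    2 * (bessel_J_nat n x * DJ n x + YY n x * DYY n x) / x) (at x)"
  by (rule derivative_eq_intros refl bessel_pair_DERIV[OF bessel_pair_J x] bessel_pair_DERIV[OF bessel_pair_YY x])+
     (simp add: add_divide_distrib algebra_simps)

text \<open>The expression is x/2 times the derivative of |H_0|^2. Its own derivative is t (|H_1|^2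
  - |H_0|^2), which is nonnegative because 2 / pi separates t |H_0|^2 from t |H_1|^2; being
  increasing with limit 0, it is nonpositive.\<close>

lemma cross_0_nonpos:
  assumes x: "x > 0"
  shows "bessel_J_nat 0 x * DJ 0 x + YY 0 x * DYY 0 x \<le> 0"
proof -
  define C where "C x = bessel_J_nat 0 x * DJ 0 x + YY 0 x * DYY 0 x" for x
  have d: "(C has_field_derivative t * ((norm (hank 1 t))\<^sup>2 - (norm (hank 0 t))\<^sup>2)) (at t)" if t: "t > 0" for t
  proof -
    have D: "DJ 0 t = - t * bessel_J_nat 1 t" "DYY 0 t = - t * YY 1 t"
      by (simp_all add: DJ_def DYY_def DH_def YY_def)
    show ?thesis unfolding C_def[abs_def] norm_hank_sq[OF t]
      by (rule derivative_eq_intros refl bessel_pair_DERIV[OF bessel_pair_J t] bessel_pair_DERIV[OF bessel_pair_YY t])+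
         (use t in \<open>simp add: D field_simps power2_eq_square\<close>)
  qed
  have mono: "C x \<le> C y" if "x \<le> y" for y
  proof (rule DERIV_nonneg_imp_nondecreasing[OF that])
    fix t assume "x \<le> t" "t \<le> y"
    then have t: "t > 0" using x by simp
    have "t * (norm (hank 0 t))\<^sup>2 \<le> t * (norm (hank 1 t))\<^sup>2"
      using order_trans[OF hw_0_le[OF t] hw_ge[of 1 t]] t by (simp only: hw_eq zero_less_one)
    then show "\<exists>y. (C has_real_derivative y) (at t) \<and> 0 \<le> y"
      using d[OF t] by (auto simp: right_diff_distrib)
  qed
  have lim: "(C \<longlongrightarrow> 0) at_top"
  proof -
    have "((\<lambda>t::real. 1 / t) \<longlongrightarrow> 0) at_top" by (rule real_tendsto_divide_at_top[OF tendsto_const filterlim_ident])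
    then have "((\<lambda>t. (hw1 0 t - 1 / t * hw 0 t) / 2) \<longlongrightarrow> (0 - 0 * (2 / pi)) / 2) at_top"
      by (intro tendsto_intros hw_limits) auto
    then have "((\<lambda>t. (hw1 0 t - 1 / t * hw 0 t) / 2) \<longlongrightarrow> 0) at_top" by simp
    then show ?thesis
      by (rule Lim_transform_eventually) (rule eventually_mono[OF eventually_gt_at_top[of 0]], simp add: hw_eq hw1_eq C_def)
  qed
  have "C x \<le> 0"
    by (rule tendsto_lowerbound[OF lim]) (auto intro!: eventually_mono[OF eventually_ge_at_top[of x]] mono)
  then show ?thesis by (simp add: C_def)
qed

text \<open>For order zero the sign of the source is available everywhere: t hw1 - 3/2 hw is 2 t
  times the expression of \<open>cross_0_nonpos\<close> minus half of t |H_0|^2. So the argument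
  from infinity of \<open>hw1_nonpos\<close> is not repeated.\<close>

lemma hw1_0_nonneg:
  assumes x: "x > 0"
  shows "hw1 0 x \<ge> 0"
proof (rule Appell_sign[OF x, where m = "hw1 0" and ?m1.0 = "hw2 0" and n = 0
      and ?m2.0 = "\<lambda>t. - (4 * qq 0 t * hw1 0 t + 2 * (2 * qnu 0 / t ^ 3) * hw 0 t)"
      and g = "\<lambda>t. - (8 * qnu 0 / t ^ 4 * (t * hw1 0 t - 3/2 * hw 0 t))"])
  show "(hw2 0 has_real_derivative - (4 * qq 0 t * hw1 0 t + 2 * (2 * qnu 0 / t ^ 3) * hw 0 t)) (at t)" if "t > 0" for t
    using hw2_deriv[OF that, of 0] by (simp add: algebra_simps)
  show "((\<lambda>t. - (4 * qq 0 t * hw1 0 t + 2 * (2 * qnu 0 / t ^ 3) * hw 0 t)) has_real_derivative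
     - 4 * qq 0 t * hw2 0 t - 2 * (2 * qnu 0 / t ^ 3) * hw1 0 t + - (8 * qnu 0 / t ^ 4 * (t * hw1 0 t - 3/2 * hw 0 t))) (at t)" if "t > 0" for t
    using hw1_aux_deriv[OF that, of 0] by (simp add: algebra_simps)
  show "- (8 * qnu 0 / t ^ 4 * (t * hw1 0 t - 3/2 * hw 0 t)) \<le> 0" if "x \<le> t" for t
  proof -
    have t: "t > 0" using that x by simp
    have "t * hw1 0 t - 3/2 * hw 0 t = 2 * (t * (bessel_J_nat 0 t * DJ 0 t + YY 0 t * DYY 0 t)) - 1/2 * (t * (norm (hank 0 t))\<^sup>2)"
      using t by (simp add: hw_eq hw1_eq algebra_simps)
    also have "\<dots> \<le> 0"
    proof -
      have "t * (bessel_J_nat 0 t * DJ 0 t + YY 0 t * DYY 0 t) \<le> 0"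
        using cross_0_nonpos[OF t] t by (intro mult_nonneg_nonpos) auto
      moreover have "t * (norm (hank 0 t))\<^sup>2 \<ge> 0" using t by simp
      ultimately show ?thesis by linarith
    qed
    finally have "t * hw1 0 t - 3/2 * hw 0 t \<le> 0" .
    moreover have "8 * qnu 0 / t ^ 4 \<le> 0" by (simp add: qnu_def)
    ultimately have "0 \<le> 8 * qnu 0 / t ^ 4 * (t * hw1 0 t - 3/2 * hw 0 t)" by (intro mult_nonpos_nonpos)
    then show ?thesis by (simp only: neg_le_0_iff_le)
  qed
  show "((\<lambda>t. - (4 * qq 0 t * hw1 0 t + 2 * (2 * qnu 0 / t ^ 3) * hw 0 t)) \<longlongrightarrow> 0) at_top"
    using tendsto_minus[OF hw1_aux_limit] by simp
qed (use hw1_deriv hw_limits in auto)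

lemma hw_0_mono:
  assumes "0 < x" "x \<le> y"
  shows "hw 0 x \<le> hw 0 y"
proof (rule DERIV_nonneg_imp_nondecreasing[OF assms(2)])
  fix t assume "x \<le> t" "t \<le> y"
  then show "\<exists>y. (hw 0 has_real_derivative y) (at t) \<and> 0 \<le> y"
    using hw_deriv[of t 0] hw1_0_nonneg[of t] assms by auto
qed

text \<open>For n > 0 the derivative of x |H|^2 is twice this expression plus |H|^2, so its sign
  carries over.\<close>

lemma cross_nonpos:
  assumes x: "x > 0"
  shows "bessel_J_nat n x * DJ n x + YY n x * DYY n x \<le> 0"
proof (cases "n = 0")
  case True
  then show ?thesis using cross_0_nonpos[OF x] by simp
next
  case False
  then have "hw1 n x \<le> 0" using hw1_nonpos x by simp
  then have "2 * (bessel_J_nat n x * DJ n x + YY n x * DYY n x) + (norm (hank n x))\<^sup>2 \<le> 0"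
    by (simp only: hw1_eq[OF x])
  moreover have "2 * a \<le> 0" if "2 * a + b\<^sup>2 \<le> 0" for a b :: real using that zero_le_power2[of b] by linarith
  ultimately have "2 * (bessel_J_nat n x * DJ n x + YY n x * DYY n x) \<le> 0" by blast
  then show ?thesis by (simp only: mult_le_0_iff) simp
qed

lemma norm_hank_antimono:
  assumes "0 < x" "x \<le> y"
  shows "norm (hank n y) \<le> norm (hank n x)"
proof -
  have "(bessel_J_nat n y)\<^sup>2 + (YY n y)\<^sup>2 \<le> (bessel_J_nat n x)\<^sup>2 + (YY n x)\<^sup>2"
  proof (rule DERIV_nonpos_imp_nonincreasing[OF assms(2)])
    fix t assume "x \<le> t" "t \<le> y"
    then show "\<exists>y. ((\<lambda>x. (bessel_J_nat n x)\<^sup>2 + (YY n x)\<^sup>2) has_real_derivative y) (at t) \<and> y \<le> 0"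
      using norm_sq_hank_deriv[of t n] cross_nonpos[of t n] assms
      by (intro exI[of _ "2 * (bessel_J_nat n t * DJ n t + YY n t * DYY n t) / t"]) (auto intro!: divide_nonpos_pos)
  qed
  then have "(norm (hank n y))\<^sup>2 \<le> (norm (hank n x))\<^sup>2" using assms by (simp add: hank_split cmod_power2)
  then show ?thesis by (rule power2_le_imp_le) simp
qed

section \<open>The scattering coefficient\<close>

text \<open>This is x D_n(x, l): \<open>DH\<close> and \<open>DJ\<close> carry the factor of their
  argument, so x H'(x) and l x J'(l x) appear. The scattering coefficient - Re D / D is unchanged by
  this factor.\<close>

definition scat_den :: "nat \<Rightarrow> real \<Rightarrow> real \<Rightarrow> complex" where
  "scat_den n l x = DH n x * of_real (bessel_J_nat n (l * x)) - hank n x * of_real (DJ n (l * x))"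

lemma Re_scat_den: "x > 0 \<Longrightarrow> Re (scat_den n l x) = DJ n x * bessel_J_nat n (l * x) - bessel_J_nat n x * DJ n (l * x)"
  by (simp add: scat_den_def hank_split)

lemma Im_scat_den: "x > 0 \<Longrightarrow> Im (scat_den n l x) = DYY n x * bessel_J_nat n (l * x) - YY n x * DJ n (l * x)"
  by (simp add: scat_den_def hank_split)

lemma scat_den_rel:
  assumes "x > 0"
  shows "bessel_J_nat n x * Im (scat_den n l x) - YY n x * Re (scat_den n l x) = 2 / pi * bessel_J_nat n (l * x)"
    "DJ n x * Im (scat_den n l x) - DYY n x * Re (scat_den n l x) = 2 / pi * DJ n (l * x)"
  unfolding wronskian_hank[OF assms, of n, symmetric] Re_scat_den[OF assms] Im_scat_den[OF assms]
  by (simp_all add: algebra_simps)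

lemma scat_den_nonzero:
  assumes "x > 0" "l > 0"
  shows "scat_den n l x \<noteq> 0"
proof
  assume z: "scat_den n l x = 0"
  have "l * x > 0" using assms by simp
  moreover have "bessel_J_nat n (l * x) = 0" "DJ n (l * x) = 0"
    using scat_den_rel[OF assms(1), of n l] z by auto
  ultimately show False using wronskian_hank[of "l * x" n] by simp
qed

section \<open>Signs of J and Y up to their first zeros\<close>

lemma J_cont: "continuous_on {0<..} (bessel_J_nat n)" and DJ_cont: "continuous_on {0<..} (DJ n)"
  and YY_cont: "continuous_on {0<..} (YY n)" and DYY_cont: "continuous_on {0<..} (DYY n)"
  by (intro continuous_at_imp_continuous_on ballI, rule DERIV_isCont, rule bessel_pair_DERIV[OF bessel_pair_J] bessel_pair_DERIV[OF bessel_pair_YY], simp)+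

lemma first_zero:
  fixes f :: "real \<Rightarrow> real"
  assumes c: "continuous_on {0<..} f" and near: "eventually (\<lambda>x. f x > 0) (at_right 0)"
    and x: "x > 0" "f x \<le> 0"
  shows "\<exists>s. 0 < s \<and> s \<le> x \<and> f s = 0 \<and> (\<forall>t. 0 < t \<and> t < s \<longrightarrow> f t > 0)"
proof -
  obtain b where b: "b > 0" "\<And>t. 0 < t \<Longrightarrow> t < b \<Longrightarrow> f t > 0"
    using near unfolding eventually_at_right_field by auto
  define a where "a = min b x / 2"
  have a: "0 < a" "a < b" "a < x" "f a > 0" using b x by (auto simp: a_def min_def)
  define A where "A = {t \<in> {a..x}. f t \<le> 0}"
  have ca: "continuous_on {a..x} f" by (rule continuous_on_subset[OF c]) (use a in auto)
  have "closed A" unfolding A_def by (intro continuous_on_closed_Collect_le ca continuous_on_const) auto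
  moreover have "bounded A" by (rule bounded_subset[OF bounded_closed_interval[of a x]]) (auto simp: A_def)
  ultimately have "compact A" by (simp add: compact_eq_bounded_closed)
  moreover have "A \<noteq> {}" using x a by (auto simp: A_def)
  ultimately have "\<exists>s\<in>A. \<forall>t\<in>A. s \<le> t" by (rule compact_attains_inf)
  then obtain s where s: "s \<in> A" "\<And>t. t \<in> A \<Longrightarrow> s \<le> t" by blast
  have s1: "a \<le> s" "s \<le> x" "f s \<le> 0" using s by (auto simp: A_def)
  have before: "f t > 0" if "0 < t" "t < s" for t
  proof (cases "t < a")
    case True
    then show ?thesis using b(2)[of t] a that by auto
  next
    case False
    then show ?thesis using s(2)[of t] that s1 by (force simp: A_def)
  qed
  have "\<exists>u\<ge>a. u \<le> s \<and> f u = 0"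
    by (rule IVT2'[OF s1(3) less_imp_le[OF a(4)] s1(1) continuous_on_subset[OF ca]]) (use s1 in auto)
  then obtain u where "a \<le> u" "u \<le> s" "f u = 0" by blast
  then have "u = s" using before[of u] a by force
  then show ?thesis using \<open>f u = 0\<close> s1 a before by (intro exI[of _ s]) auto
qed

text \<open>Minus the derivative of \<open>DJ\<close> / J_n is F / (x J_n^2). As F increases from 0,
  the logarithmic derivative decreases as long as J_n > 0. In \<open>scat_lower\<close> the same
  quantity, rescaled, compares the amplitudes at successive zeros and critical points.\<close>

definition bessel_F :: "nat \<Rightarrow> real \<Rightarrow> real" where
  "bessel_F n x = (DJ n x)\<^sup>2 + (x\<^sup>2 - (real n)\<^sup>2) * (bessel_J_nat n x)\<^sup>2"

lemma bessel_F_deriv: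
  assumes x: "x > 0"
  shows "(bessel_F n has_field_derivative 2 * x * (bessel_J_nat n x)\<^sup>2) (at x)"
  unfolding bessel_F_def[abs_def]
  by (rule derivative_eq_intros refl bessel_pair_DERIV[OF bessel_pair_J x])+
     (use x in \<open>simp add: field_simps power2_eq_square\<close>)

lemma bessel_F_mono: "0 < x \<Longrightarrow> x \<le> y \<Longrightarrow> bessel_F n x \<le> bessel_F n y"
proof -
  assume "0 < x" "x \<le> y"
  show ?thesis
  proof (rule DERIV_nonneg_imp_nondecreasing[OF \<open>x \<le> y\<close>])
    fix t assume "x \<le> t" "t \<le> y"
    then show "\<exists>z. (bessel_F n has_real_derivative z) (at t) \<and> 0 \<le> z"
      using bessel_F_deriv[of t n] \<open>0 < x\<close> by (intro exI[of _ "2 * t * (bessel_J_nat n t)\<^sup>2"]) auto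
  qed
qed

lemma bessel_F_nonneg:
  assumes x: "x > 0"
  shows "bessel_F n x \<ge> 0"
proof -
  have "((\<lambda>t. (DJ n t)\<^sup>2 + (t\<^sup>2 - (real n)\<^sup>2) * (bessel_J_nat n t)\<^sup>2) \<longlongrightarrow>
     0\<^sup>2 + (0\<^sup>2 - (real n)\<^sup>2) * (if n = 0 then 1 else 0)\<^sup>2) (at_right 0)"
    by (intro tendsto_intros tendsto_J_0 tendsto_DJ_0)
  then have l: "(bessel_F n \<longlongrightarrow> 0) (at_right 0)" by (simp add: bessel_F_def[abs_def] split: if_splits)
  show ?thesis
    by (rule tendsto_upperbound[OF l]) (use bessel_F_mono x in \<open>auto simp: eventually_at_right_field intro!: exI[of _ x]\<close>)
qed

lemma log_deriv_antimono:
  assumes "0 < s" "s \<le> x" and J: "\<And>t. 0 < t \<Longrightarrow> t \<le> x \<Longrightarrow> bessel_J_nat n t > 0"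
  shows "DJ n x / bessel_J_nat n x \<le> DJ n s / bessel_J_nat n s"
proof (rule DERIV_nonpos_imp_nonincreasing[OF assms(2)])
  fix t assume t: "s \<le> t" "t \<le> x"
  then have t0: "t > 0" "bessel_J_nat n t > 0" using assms by auto
  have "((\<lambda>t. DJ n t / bessel_J_nat n t) has_field_derivative - bessel_F n t / (t * (bessel_J_nat n t)\<^sup>2)) (at t)"
    by (rule derivative_eq_intros refl bessel_pair_DERIV[OF bessel_pair_J t0(1)])+
       (use t0 in \<open>simp_all add: bessel_F_def field_simps power2_eq_square\<close>)
  moreover have "- bessel_F n t / (t * (bessel_J_nat n t)\<^sup>2) \<le> 0"
    using bessel_F_nonneg[OF t0(1), of n] t0 by (simp add: divide_nonneg_pos)
  ultimately show "\<exists>y. ((\<lambda>t. DJ n t / bessel_J_nat n t) has_real_derivative y) (at t) \<and> y \<le> 0" by blast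
qed

lemma YJ_deriv:
  assumes "t > 0" "bessel_J_nat n t \<noteq> 0"
  shows "((\<lambda>t. YY n t / bessel_J_nat n t) has_field_derivative (2 / pi) / (t * (bessel_J_nat n t)\<^sup>2)) (at t)"
  unfolding wronskian_hank[OF assms(1), of n, symmetric]
  by (rule derivative_eq_intros refl bessel_pair_DERIV[OF bessel_pair_J assms(1)] bessel_pair_DERIV[OF bessel_pair_YY assms(1)])+
     (use assms in \<open>simp_all add: field_simps power2_eq_square\<close>)

lemma const_sign:
  fixes f :: "real \<Rightarrow> real"
  assumes c: "continuous_on {0<..} f" and nz: "\<And>s. 0 < s \<Longrightarrow> s \<le> x \<Longrightarrow> f s \<noteq> 0"
    and "0 < s" "s \<le> x" "0 < t" "t \<le> x" "f s < 0"
  shows "f t < 0"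
proof (rule ccontr)
  assume "\<not> f t < 0"
  then have ft: "f t \<ge> 0" by simp
  have "\<exists>u>0. u \<le> x \<and> f u = 0"
  proof (cases "s \<le> t")
    case True
    have "\<exists>u\<ge>s. u \<le> t \<and> f u = 0"
      by (rule IVT'[OF less_imp_le[OF assms(7)] ft True continuous_on_subset[OF c]]) (use assms(3) in auto)
    then show ?thesis using assms by force
  next
    case False
    have "\<exists>u\<ge>t. u \<le> s \<and> f u = 0"
      by (rule IVT2'[OF less_imp_le[OF assms(7)] ft _ continuous_on_subset[OF c]]) (use False assms(5) in auto)
    then show ?thesis using assms by force
  qed
  then show False using nz by blast
qed

lemma YY_0_eq: "x > 0 \<Longrightarrow> YY 0 x = bessel_Y_nat 0 x"
  by (simp add: YY_def hank.simps hankel0_eq)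

text \<open>It suffices to find one point with Y < 0. For n = 0 the logarithm provides it. For n > 0
  the Wronskian gives (Y/J)' = (2 / pi) / (x J^2), and J increases near 0, so Y/J minus a positive
  multiple k of ln x increases; hence Y/J becomes negative near 0.\<close>

lemma YY_neg:
  assumes x: "x > 0" and nz: "\<And>s. 0 < s \<Longrightarrow> s \<le> x \<Longrightarrow> YY n s \<noteq> 0" and s: "0 < s" "s \<le> x"
  shows "YY n s < 0"
proof -
  have "\<exists>s>0. s \<le> x \<and> YY n s < 0"
  proof (cases "n = 0")
    case True
    have "eventually (\<lambda>t. bessel_Y_nat 0 t < 0) (at_right 0)"
      using filterlim_Y0 unfolding filterlim_at_bot_dense by blast
    then obtain b where b: "b > 0" "\<And>t. 0 < t \<Longrightarrow> t < b \<Longrightarrow> bessel_Y_nat 0 t < 0"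
      unfolding eventually_at_right_field by auto
    define t where "t = min b x / 2"
    have "0 < t" "t < b" "t \<le> x" using b x by (auto simp: t_def min_def)
    then show ?thesis using b(2)[of t] True by (auto simp: YY_0_eq intro!: exI[of _ t])
  next
    case False
    obtain b1 where b1: "b1 > 0" "\<And>t. 0 < t \<Longrightarrow> t < b1 \<Longrightarrow> bessel_J_nat n t > 0"
      using J_pos_near_0 unfolding eventually_at_right_field by auto
    obtain b2 where b2: "b2 > 0" "\<And>t. 0 < t \<Longrightarrow> t < b2 \<Longrightarrow> DJ n t > 0"
      using DJ_pos_near_0[of n] False unfolding eventually_at_right_field by auto
    define b where "b = min (min b1 b2) x / 2"
    have b: "0 < b" "b < b1" "b < b2" "b \<le> x" using b1 b2 x by (auto simp: b_def min_def)
    define j where "j = bessel_J_nat n b"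
    have j: "j > 0" using b b1 by (auto simp: j_def)
    define a where "a = YY n b / j"
    define k where "k = 2 / pi / j\<^sup>2"
    have k: "k > 0" using j by (simp add: k_def)
    \<comment> \<open>Chosen so that k ln s0 = k ln b - (|a| + 1), which pushes Y/J below 0 at
      s0.\<close>
    define s0 where "s0 = b * exp (- (\<bar>a\<bar> + 1) / k)"
    have s0: "0 < s0" "s0 \<le> b" using b k by (auto simp: s0_def mult_le_cancel_left1 divide_le_0_iff)
    have Jle: "bessel_J_nat n t \<le> j" if "0 < t" "t \<le> b" for t
      unfolding j_def
    proof (rule DERIV_nonneg_imp_nondecreasing[OF that(2)])
      fix u assume "t \<le> u" "u \<le> b"
      then have "u > 0" "DJ n u > 0" using that b b2 by auto
      then show "\<exists>y. (bessel_J_nat n has_real_derivative y) (at u) \<and> 0 \<le> y"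
        using bessel_pair_DERIV(1)[OF bessel_pair_J, of u n] by (auto intro!: exI[of _ "DJ n u / u"])
    qed
    have "YY n s0 / bessel_J_nat n s0 - k * ln s0 \<le> YY n b / bessel_J_nat n b - k * ln b"
    proof (rule DERIV_nonneg_imp_nondecreasing[OF s0(2)])
      fix u assume u: "s0 \<le> u" "u \<le> b"
      then have u0: "u > 0" "bessel_J_nat n u > 0" using s0 b b1 by auto
      have "((\<lambda>t. YY n t / bessel_J_nat n t - k * ln t) has_field_derivative
         (2 / pi) / (u * (bessel_J_nat n u)\<^sup>2) - k * (1 / u)) (at u)"
        by (intro DERIV_diff DERIV_cmult YJ_deriv) (use u0 in \<open>auto intro!: derivative_eq_intros\<close>)
      moreover have "k * (1 / u) \<le> (2 / pi) / (u * (bessel_J_nat n u)\<^sup>2)"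
      proof -
        have "(bessel_J_nat n u)\<^sup>2 \<le> j\<^sup>2" using Jle[OF u0(1) u(2)] u0 by (intro power_mono) auto
        then have "2 / pi / j\<^sup>2 \<le> 2 / pi / (bessel_J_nat n u)\<^sup>2" using u0 j by (intro divide_left_mono) auto
        then have "2 / pi / j\<^sup>2 / u \<le> 2 / pi / (bessel_J_nat n u)\<^sup>2 / u" using u0 by (intro divide_right_mono) auto
        then show ?thesis by (simp add: k_def mult_ac)
      qed
      ultimately show "\<exists>y. ((\<lambda>t. YY n t / bessel_J_nat n t - k * ln t) has_real_derivative y) (at u) \<and> 0 \<le> y"
        by (intro exI conjI) (assumption, simp)
    qed
    moreover have "k * ln s0 = k * ln b - (\<bar>a\<bar> + 1)"
    proof -
      have "ln s0 = ln b + - (\<bar>a\<bar> + 1) / k" using b unfolding s0_def by (subst ln_mult) auto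
      then show ?thesis using k by (simp add: distrib_left)
    qed
    moreover have "YY n b / bessel_J_nat n b = a" by (simp add: a_def j_def)
    ultimately have "YY n s0 / bessel_J_nat n s0 \<le> a - (\<bar>a\<bar> + 1)" by linarith
    then have "YY n s0 / bessel_J_nat n s0 < 0" by linarith
    moreover have "bessel_J_nat n s0 > 0" using s0 b b1 by auto
    ultimately have "YY n s0 < 0" by (simp add: divide_less_0_iff)
    then show ?thesis using s0 b by (intro exI[of _ s0]) auto
  qed
  then show ?thesis using const_sign[OF YY_cont nz] s by blast
qed

text \<open>Y has a zero no later than J: at a first zero of J the Wronskian reads - Y x J' = 2 /
  pi, so Y < 0 would give J' > 0, impossible where J comes down to 0 from positive values.\<close>

lemma J_pos_of_YY_neg:
  assumes Y: "\<And>s. 0 < s \<Longrightarrow> s \<le> x \<Longrightarrow> YY n s < 0" and s: "0 < s" "s \<le> x"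
  shows "bessel_J_nat n s > 0"
proof (rule ccontr)
  assume "\<not> bessel_J_nat n s > 0"
  then obtain u where u: "0 < u" "u \<le> s" "bessel_J_nat n u = 0" "\<And>t. 0 < t \<Longrightarrow> t < u \<Longrightarrow> bessel_J_nat n t > 0"
    using first_zero[OF J_cont J_pos_near_0, of s n] s by force
  have "- YY n u * DJ n u = 2 / pi" using wronskian_hank[OF u(1), of n] u(3) by simp
  have "YY n u < 0" using Y u s by auto
  have "DJ n u > 0"
  proof (rule ccontr)
    assume "\<not> DJ n u > 0"
    then have "0 \<le> YY n u * DJ n u" using \<open>YY n u < 0\<close> by (intro mult_nonpos_nonpos) auto
    moreover have "0 < 2 / pi" by simp
    ultimately show False using \<open>- YY n u * DJ n u = 2 / pi\<close> by linarith
  qed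
  then have "DJ n u / u > 0" using u by simp
  from DERIV_pos_inc_left[OF bessel_pair_DERIV(1)[OF bessel_pair_J u(1)] this]
  obtain d where d: "d > 0" "\<And>h. 0 < h \<Longrightarrow> h < d \<Longrightarrow> bessel_J_nat n (u - h) < bessel_J_nat n u" by auto
  define h where "h = min d u / 2"
  have "0 < h" "h < d" "h < u" using d u by (auto simp: h_def min_def)
  then show False using d(2)[of h] u(3) u(4)[of "u - h"] by auto
qed

lemma norm_hank_at_zero: "x > 0 \<Longrightarrow> YY n x = 0 \<Longrightarrow> norm (hank n x) = \<bar>bessel_J_nat n x\<bar>"
  using norm_hank_sq[of x n] by (metis abs_norm_cancel add.right_neutral power2_abs power2_eq_iff_nonneg abs_ge_zero norm_ge_zero zero_power2)

text \<open>Adding a^2 c^2 to the squared inequality turns a comparison of cross products into one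
  of moduli. With a, b the real and imaginary part of D and c, d those of H, it bounds |Re D| |H| by
  |J| |D|.\<close>

lemma sq_mult_le:
  fixes a b c d :: real
  assumes "\<bar>a * d\<bar> \<le> \<bar>c * b\<bar>"
  shows "\<bar>a\<bar> * sqrt (c\<^sup>2 + d\<^sup>2) \<le> \<bar>c\<bar> * sqrt (a\<^sup>2 + b\<^sup>2)"
proof -
  have "(a * d)\<^sup>2 \<le> (c * b)\<^sup>2" using assms by (simp add: abs_le_square_iff)
  then have "(\<bar>a\<bar> * sqrt (c\<^sup>2 + d\<^sup>2))\<^sup>2 \<le> (\<bar>c\<bar> * sqrt (a\<^sup>2 + b\<^sup>2))\<^sup>2"
    by (simp add: power_mult_distrib algebra_simps)
  then show ?thesis by (rule power2_le_imp_le) simp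
qed

lemma scat_upper_aux:
  assumes x: "x > 0" and l: "0 < l" "l \<le> 1"
  shows "\<exists>y>0. \<bar>Re (scat_den n l x)\<bar> * norm (hank n x) \<le> \<bar>bessel_J_nat n y\<bar> * norm (scat_den n l x)"
proof (cases "\<exists>s>0. s \<le> x \<and> YY n s = 0")
  case True
  then obtain s where s: "0 < s" "s \<le> x" "YY n s = 0" by blast
  have "\<bar>Re (scat_den n l x)\<bar> * norm (hank n x) \<le> norm (scat_den n l x) * norm (hank n s)"
    by (intro mult_mono abs_Re_le_cmod norm_hank_antimono s) auto
  then show ?thesis using norm_hank_at_zero[OF s(1,3)] s by (intro exI[of _ s]) (simp add: mult.commute)
next
  case False
  have Y: "YY n s < 0" if "0 < s" "s \<le> x" for s by (rule YY_neg[OF x _ that]) (use False in auto)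
  have J: "bessel_J_nat n s > 0" if "0 < s" "s \<le> x" for s by (rule J_pos_of_YY_neg[OF Y that])
  have lx: "0 < l * x" "l * x \<le> x" using x l by (auto simp: mult_le_cancel_right1)
  define A where "A = Re (scat_den n l x)"
  define B where "B = Im (scat_den n l x)"
  have Jl: "bessel_J_nat n (l * x) > 0" "bessel_J_nat n x > 0" using J lx x by auto
  \<comment> \<open>Since l x <= x and the logarithmic derivative decreases, Re D <= 0. Then both
    terms on the right of \<open>rel\<close> are nonnegative, so J |Im D| dominates |Y Re
    D|.\<close>
  have "A = bessel_J_nat n x * bessel_J_nat n (l * x) * (DJ n x / bessel_J_nat n x - DJ n (l * x) / bessel_J_nat n (l * x))"
    unfolding A_def Re_scat_den[OF x] using Jl by (simp add: field_simps)
  moreover have "DJ n x / bessel_J_nat n x - DJ n (l * x) / bessel_J_nat n (l * x) \<le> 0"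
    using log_deriv_antimono[OF lx J] by simp
  ultimately have A: "A \<le> 0" using Jl by (simp add: mult_nonneg_nonpos)
  have rel: "bessel_J_nat n x * B = YY n x * A + 2 / pi * bessel_J_nat n (l * x)"
    using scat_den_rel(1)[OF x, of n l] by (simp add: A_def B_def)
  have "0 \<le> YY n x * A" using Y[of x] x A by (simp add: mult_nonpos_nonpos)
  then have "\<bar>A * YY n x\<bar> \<le> \<bar>bessel_J_nat n x * B\<bar>" unfolding rel using Jl by (simp add: mult.commute)
  from sq_mult_le[OF this]
  have "\<bar>A\<bar> * norm (hank n x) \<le> \<bar>bessel_J_nat n x\<bar> * norm (scat_den n l x)"
    unfolding cmod_def A_def B_def using x by (simp add: hank_split)
  then show ?thesis using x by (auto simp: A_def)
qed

lemma scat_upper: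
  assumes n: "n > 0" and x: "x > 0" and l: "0 < l" "l \<le> 1" and r: "r \<ge> 1"
  shows "\<exists>y>0. \<bar>Re (scat_den n l x)\<bar> * norm (hank n (x * r)) \<le> sqrt (1 / r) * \<bar>bessel_J_nat n y\<bar> * norm (scat_den n l x)"
proof -
  have "x * r * (norm (hank n (x * r)))\<^sup>2 \<le> x * (norm (hank n x))\<^sup>2"
    using hw_antimono[OF n x, of "x * r"] x r by (simp add: hw_eq mult_le_cancel_left1)
  then have "(norm (hank n (x * r)))\<^sup>2 \<le> (sqrt (1 / r) * norm (hank n x))\<^sup>2"
    using x r by (simp add: power_mult_distrib field_simps)
  then have h: "norm (hank n (x * r)) \<le> sqrt (1 / r) * norm (hank n x)"
    by (rule power2_le_imp_le) (use r in auto)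
  obtain y where y: "y > 0" "\<bar>Re (scat_den n l x)\<bar> * norm (hank n x) \<le> \<bar>bessel_J_nat n y\<bar> * norm (scat_den n l x)"
    using scat_upper_aux[OF x l] by blast
  have "\<bar>Re (scat_den n l x)\<bar> * norm (hank n (x * r)) \<le> \<bar>Re (scat_den n l x)\<bar> * (sqrt (1 / r) * norm (hank n x))"
    by (intro mult_left_mono h) auto
  also have "\<dots> = sqrt (1 / r) * (\<bar>Re (scat_den n l x)\<bar> * norm (hank n x))" by simp
  also have "\<dots> \<le> sqrt (1 / r) * (\<bar>bessel_J_nat n y\<bar> * norm (scat_den n l x))"
    using y r by (intro mult_left_mono) auto
  finally show ?thesis using y by (auto simp: mult.assoc)
qed

section \<open>The mode of order zero before the first zero of Y_0\<close>

lemma J0_sq_le_1: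
  assumes x: "x > 0"
  shows "(bessel_J_nat 0 x)\<^sup>2 \<le> 1"
proof -
  \<comment> \<open>The derivative of J_0^2 + J_1^2 is - 2 J_1^2 / t, and the value at 0 is
    1.\<close>
  define E where "E t = (bessel_J_nat 0 t)\<^sup>2 + (bessel_J_nat 1 t)\<^sup>2" for t
  have E: "E y \<le> E s" if "0 < s" "s \<le> y" for s y
  proof (rule DERIV_nonpos_imp_nonincreasing[OF that(2)])
    fix t assume "s \<le> t" "t \<le> y"
    then have t: "t > 0" using that by simp
    have "(E has_field_derivative - 2 * (bessel_J_nat 1 t)\<^sup>2 / t) (at t)"
      unfolding E_def[abs_def]
      by (rule derivative_eq_intros refl bessel_J_nat_deriv[OF t, of 0] bessel_J_nat_deriv_Suc[OF t, of 0, unfolded One_nat_def[symmetric]])+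
         (use t in \<open>simp add: field_simps power2_eq_square\<close>)
    then show "\<exists>y. (E has_real_derivative y) (at t) \<and> y \<le> 0" using t by (intro exI conjI) (assumption, simp)
  qed
  have "(E \<longlongrightarrow> (if (0::nat) = 0 then 1 else 0)\<^sup>2 + (if (1::nat) = 0 then 1 else 0)\<^sup>2) (at_right 0)"
    unfolding E_def by (intro tendsto_intros tendsto_J_0)
  then have "E x \<le> (if (0::nat) = 0 then 1 else 0)\<^sup>2 + (if (1::nat) = 0 then 1 else 0)\<^sup>2"
    by (rule tendsto_lowerbound) (use E x in \<open>auto simp: eventually_at_right_field intro!: exI[of _ x]\<close>)
  moreover have "(bessel_J_nat 0 x)\<^sup>2 \<le> E x" by (simp add: E_def)
  ultimately show ?thesis by simp
qed

text \<open>Since (x J_0')' = - x J_0, both bounds follow by integration from 0, one from J_0 <= 1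
  and the other from J_0 > 0.\<close>

lemma DJ0_bounds:
  assumes x: "x > 0"
  shows "DJ 0 x \<ge> - x\<^sup>2 / 2" and "(\<And>t. 0 < t \<Longrightarrow> t \<le> x \<Longrightarrow> bessel_J_nat 0 t > 0) \<Longrightarrow> DJ 0 x \<le> 0"
proof -
  have d: "(DJ 0 has_field_derivative - t * bessel_J_nat 0 t) (at t)" if "t > 0" for t
    using bessel_pair_DERIV(2)[OF bessel_pair_J that, of 0] that by (simp add: power2_eq_square)
  have mono: "DJ 0 s + s\<^sup>2 / 2 \<le> DJ 0 x + x\<^sup>2 / 2" if "0 < s" "s \<le> x" for s
  proof (rule DERIV_nonneg_imp_nondecreasing[OF that(2)])
    fix t assume "s \<le> t" "t \<le> x"
    then have t: "t > 0" using that by simp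
    have "((\<lambda>t. DJ 0 t + t\<^sup>2 / 2) has_field_derivative t * (1 - bessel_J_nat 0 t)) (at t)"
    proof -
      have "((\<lambda>t. t\<^sup>2 / 2) has_field_derivative t) (at t)" by (auto intro!: derivative_eq_intros)
      from DERIV_add[OF d[OF t] this] show ?thesis by (rule DERIV_cong) (simp add: algebra_simps)
    qed
    moreover have "bessel_J_nat 0 t \<le> 1" using J0_sq_le_1[OF t] by (simp add: abs_square_le_1 abs_le_iff)
    ultimately show "\<exists>y. ((\<lambda>t. DJ 0 t + t\<^sup>2 / 2) has_real_derivative y) (at t) \<and> 0 \<le> y"
      using t by (intro exI conjI) (assumption, simp)
  qed
  have "((\<lambda>t. DJ 0 t + t\<^sup>2 / 2) \<longlongrightarrow> 0 + 0\<^sup>2 / 2) (at_right 0)" by (intro tendsto_intros tendsto_DJ_0) auto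
  then have "0 + 0\<^sup>2 / 2 \<le> DJ 0 x + x\<^sup>2 / 2"
    by (rule tendsto_upperbound) (use mono x in \<open>auto simp: eventually_at_right_field intro!: exI[of _ x]\<close>)
  then show "DJ 0 x \<ge> - x\<^sup>2 / 2" by simp
  assume J: "\<And>t. 0 < t \<Longrightarrow> t \<le> x \<Longrightarrow> bessel_J_nat 0 t > 0"
  have mono: "DJ 0 x \<le> DJ 0 s" if "0 < s" "s \<le> x" for s
  proof (rule DERIV_nonpos_imp_nonincreasing[OF that(2)])
    fix t assume "s \<le> t" "t \<le> x"
    then show "\<exists>y. (DJ 0 has_real_derivative y) (at t) \<and> y \<le> 0"
      using d[of t] J[of t] that by (intro exI[of _ "- t * bessel_J_nat 0 t"]) auto
  qed
  show "DJ 0 x \<le> 0"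
    by (rule tendsto_lowerbound[OF tendsto_DJ_0[of 0]]) (use mono x in \<open>auto simp: eventually_at_right_field intro!: exI[of _ x]\<close>)
qed

text \<open>As J_0^2 <= 1, the function Y_0/J_0 - (2 / pi) ln t increases. Its limit at 0 is (2 /
  pi) (gamma - ln 2) and its value at y is - (2 / pi) ln y, whence y <= 2 exp (- gamma). With gamma
  > 19/33 and exp gamma >= 1 + gamma this is below 1.27.\<close>

lemma first_zero_Y0_bound:
  assumes y: "y > 0" "bessel_Y_nat 0 y = 0" "\<And>x. 0 < x \<Longrightarrow> x < y \<Longrightarrow> bessel_Y_nat 0 x \<noteq> 0"
  shows "y \<le> 1.27" and "\<And>x. 0 < x \<Longrightarrow> x < y \<Longrightarrow> YY 0 x < 0"
proof -
  show neg: "YY 0 x < 0" if "0 < x" "x < y" for x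
    by (rule YY_neg[OF that(1) _ that(1)]) (use y(3) that in \<open>auto simp: YY_0_eq\<close>)
  have J: "bessel_J_nat 0 x > 0" if "0 < x" "x < y" for x
    by (rule J_pos_of_YY_neg[where x = x]) (use neg that in auto)
  have "(bessel_J_nat 0 \<longlongrightarrow> bessel_J_nat 0 y) (at_left y)"
    using DERIV_isCont[OF bessel_pair_DERIV(1)[OF bessel_pair_J y(1)], of 0] by (simp add: isCont_def filterlim_at_split)
  then have "bessel_J_nat 0 y \<ge> 0"
    by (rule tendsto_lowerbound) (use J y in \<open>auto simp: eventually_at_left_field intro!: exI[of _ 0] less_imp_le\<close>)
  moreover have "bessel_J_nat 0 y \<noteq> 0" using wronskian_hank[OF y(1), of 0] y(1,2) by (auto simp: YY_0_eq)
  ultimately have Jy: "bessel_J_nat 0 x > 0" if "0 < x" "x \<le> y" for x using J[of x] that by force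
  define g where "g t = YY 0 t / bessel_J_nat 0 t - 2 / pi * ln t" for t
  have mono: "g s \<le> g y" if "0 < s" "s \<le> y" for s
  proof (rule DERIV_nonneg_imp_nondecreasing[OF that(2)])
    fix t assume "s \<le> t" "t \<le> y"
    then have t: "t > 0" "bessel_J_nat 0 t > 0" using that Jy by auto
    have "(g has_field_derivative (2 / pi) / (t * (bessel_J_nat 0 t)\<^sup>2) - 2 / pi * (1 / t)) (at t)"
      unfolding g_def[abs_def]
      by (intro DERIV_diff DERIV_cmult YJ_deriv) (use t in \<open>auto intro!: derivative_eq_intros\<close>)
    moreover have "2 / pi * (1 / t) \<le> (2 / pi) / (t * (bessel_J_nat 0 t)\<^sup>2)"
    proof -
      have "t * (bessel_J_nat 0 t)\<^sup>2 \<le> t * 1" using J0_sq_le_1[OF t(1)] t by (intro mult_left_mono) auto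
      then have "(2 / pi) / (t * 1) \<le> (2 / pi) / (t * (bessel_J_nat 0 t)\<^sup>2)" using t by (intro divide_left_mono) auto
      then show ?thesis by simp
    qed
    ultimately show "\<exists>y. (g has_real_derivative y) (at t) \<and> 0 \<le> y" by (intro exI conjI) (assumption, simp)
  qed
  have J1: "(bessel_J_nat 0 \<longlongrightarrow> 1) (at_right 0)" using tendsto_J_0[of 0] by simp
  have "((\<lambda>t. (bessel_Y_nat 0 t - 2 / pi * (ln (t / 2) + euler_mascheroni)) / bessel_J_nat 0 t
      + 2 / pi * euler_mascheroni / bessel_J_nat 0 t - 2 / pi * (ln (t / 2) * (bessel_J_nat 0 t - 1)) / bessel_J_nat 0 t - 2 / pi * ln 2)
     \<longlongrightarrow> 0 / 1 + 2 / pi * euler_mascheroni / 1 - 2 / pi * 0 / 1 - 2 / pi * ln 2) (at_right 0)"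
    by (intro tendsto_intros tendsto_Y0_0 J1 tendsto_ln_J0) auto
  then have "(g \<longlongrightarrow> 0 / 1 + 2 / pi * euler_mascheroni / 1 - 2 / pi * 0 / 1 - 2 / pi * ln 2) (at_right 0)"
  proof (rule Lim_transform_eventually)
    show "eventually (\<lambda>t. (bessel_Y_nat 0 t - 2 / pi * (ln (t / 2) + euler_mascheroni)) / bessel_J_nat 0 t
      + 2 / pi * euler_mascheroni / bessel_J_nat 0 t - 2 / pi * (ln (t / 2) * (bessel_J_nat 0 t - 1)) / bessel_J_nat 0 t - 2 / pi * ln 2 = g t) (at_right 0)"
      unfolding eventually_at_right_field
    proof (intro exI[of _ y] conjI allI impI y(1))
      fix t assume t: "0 < t" "t < y"
      then show "(bessel_Y_nat 0 t - 2 / pi * (ln (t / 2) + euler_mascheroni)) / bessel_J_nat 0 t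
        + 2 / pi * euler_mascheroni / bessel_J_nat 0 t - 2 / pi * (ln (t / 2) * (bessel_J_nat 0 t - 1)) / bessel_J_nat 0 t - 2 / pi * ln 2 = g t"
        using J[OF t] by (simp add: g_def YY_0_eq ln_div divide_simps) (simp add: algebra_simps)
    qed
  qed
  then have "2 / pi * euler_mascheroni - 2 / pi * ln 2 \<le> g y"
    using tendsto_upperbound[of g _ "at_right 0" "g y"] mono y(1)
    by (force simp: eventually_at_right_field intro!: exI[of _ y])
  also have "g y = - (2 / pi) * ln y" using y by (simp add: g_def YY_0_eq)
  finally have "2 / pi * (euler_mascheroni - ln 2 + ln y) \<le> 0" by (simp only: distrib_left right_diff_distrib)
  moreover have "c * X \<le> 0 \<Longrightarrow> c > 0 \<Longrightarrow> X \<le> 0" for c X :: real by (simp add: mult_le_0_iff)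
  ultimately have "euler_mascheroni - ln 2 + ln y \<le> 0" by fastforce
  then have "ln y \<le> ln 2 - euler_mascheroni" by linarith
  then have "y \<le> exp (ln 2 - euler_mascheroni)" using y(1) by (simp add: ln_ge_iff ln_le_cancel_iff flip: ln_le_cancel_iff)
  also have "\<dots> = 2 / exp euler_mascheroni" by (simp add: exp_diff)
  also have "\<dots> \<le> 2 / (1 + 19/33)"
  proof (rule divide_left_mono)
    show "1 + 19/33 \<le> exp (euler_mascheroni :: real)"
      using exp_ge_add_one_self[of "euler_mascheroni :: real"] euler_mascheroni_gt_19_over_33 by linarith
  qed auto
  finally show "y \<le> 1.27" by simp
qed

text \<open>For x < y the relation with derivatives is used: x J_0' <= 0 and x Y_0' > 0 give |Re D|
  |x H_0'| <= |x J_0'| |D|. With |x J_0'| <= x^2 / 2 and |x H_0'|^2 = x hw 1 x >= 2 x / pi, the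
  coefficient satisfies |R|^2 <= pi x^3 / 8, and this is at most x / y because pi x^2 y <=
  8.\<close>

lemma scat_upper_0:
  assumes y: "y > 0" "bessel_Y_nat 0 y = 0" "\<And>x. 0 < x \<Longrightarrow> x < y \<Longrightarrow> bessel_Y_nat 0 x \<noteq> 0"
    and x: "x > 0" and l: "0 < l" "l \<le> 1" and r: "r \<ge> 1"
  shows "\<bar>Re (scat_den 0 l x)\<bar> * norm (hank 0 (x * r)) \<le> norm (hank 0 (y * r)) * norm (scat_den 0 l x)"
proof (cases "x \<ge> y")
  case True
  have "\<bar>Re (scat_den 0 l x)\<bar> * norm (hank 0 (x * r)) \<le> norm (scat_den 0 l x) * norm (hank 0 (y * r))"
    by (intro mult_mono abs_Re_le_cmod norm_hank_antimono) (use True y r in auto)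
  then show ?thesis by (simp add: mult.commute)
next
  case False
  then have xy: "x < y" by simp
  note y127 = first_zero_Y0_bound(1)[OF y] and neg = first_zero_Y0_bound(2)[OF y]
  have J: "bessel_J_nat 0 t > 0" if "0 < t" "t \<le> x" for t
    by (rule J_pos_of_YY_neg[where x = t]) (use neg that xy in auto)
  have lx: "0 < l * x" "l * x \<le> x" using x l by (auto simp: mult_le_cancel_right1)
  define A where "A = Re (scat_den 0 l x)"
  define B where "B = Im (scat_den 0 l x)"
  have Jl: "bessel_J_nat 0 (l * x) > 0" "bessel_J_nat 0 x > 0" using J lx x by auto
  have "A = bessel_J_nat 0 x * bessel_J_nat 0 (l * x) * (DJ 0 x / bessel_J_nat 0 x - DJ 0 (l * x) / bessel_J_nat 0 (l * x))"
    unfolding A_def Re_scat_den[OF x] using Jl by (simp add: field_simps)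
  moreover have "DJ 0 x / bessel_J_nat 0 x - DJ 0 (l * x) / bessel_J_nat 0 (l * x) \<le> 0"
    using log_deriv_antimono[OF lx J] by simp
  ultimately have A: "A \<le> 0" using Jl by (simp add: mult_nonneg_nonpos)
  have DJn: "DJ 0 x \<le> 0" "DJ 0 (l * x) \<le> 0"
    using DJ0_bounds(2)[OF x J] DJ0_bounds(2)[OF lx(1)] J lx(2) by auto
  have DYp: "DYY 0 x > 0"
  proof -
    have "0 \<le> YY 0 x * DJ 0 x" using neg[of x] x xy DJn by (simp add: mult_nonpos_nonpos)
    then have "bessel_J_nat 0 x * DYY 0 x > 0" using wronskian_hank[OF x, of 0] divide_pos_pos[of 2 pi, OF _ pi_gt_zero]
      by linarith
    then show ?thesis using Jl by (simp add: zero_less_mult_iff)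
  qed
  have rel: "DJ 0 x * B = DYY 0 x * A + 2 / pi * DJ 0 (l * x)"
    using scat_den_rel(2)[OF x, of 0 l] by (simp add: A_def B_def)
  have "DYY 0 x * A \<le> 0" using DYp A by (simp add: mult_nonneg_nonpos)
  moreover have "2 / pi * DJ 0 (l * x) \<le> 0" using DJn(2) by (intro mult_nonneg_nonpos) auto
  ultimately have "\<bar>A * DYY 0 x\<bar> \<le> \<bar>DJ 0 x * B\<bar>" unfolding rel by (simp add: mult.commute)
  from sq_mult_le[OF this] have 1: "\<bar>A\<bar> * norm (DH 0 x) \<le> \<bar>DJ 0 x\<bar> * norm (scat_den 0 l x)"
    unfolding cmod_def A_def B_def using x by (simp add: hank_split)
  have DJb: "\<bar>DJ 0 x\<bar> \<le> x\<^sup>2 / 2" using DJ0_bounds(1)[OF x] DJn by simp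
  have DHb: "(norm (DH 0 x))\<^sup>2 \<ge> 2 / pi * x"
  proof -
    have "norm (DH 0 x) = x * norm (hank 1 x)" using x by (simp add: DH_def norm_mult)
    then have "(norm (DH 0 x))\<^sup>2 = x * hw 1 x" using x by (simp add: hw_eq power_mult_distrib power2_eq_square)
    moreover have "x * (2 / pi) \<le> x * hw 1 x" using hw_ge[of 1 x] x by (intro mult_left_mono) auto
    ultimately show ?thesis by (simp only: mult.commute)
  qed
  have h0: "x * (norm (hank 0 (x * r)))\<^sup>2 \<le> y * (norm (hank 0 (y * r)))\<^sup>2"
  proof -
    have "x * r * (norm (hank 0 (x * r)))\<^sup>2 \<le> y * r * (norm (hank 0 (y * r)))\<^sup>2"
      using hw_0_mono[of "x * r" "y * r"] x y r xy by (simp add: hw_eq)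
    then have "r * (x * (norm (hank 0 (x * r)))\<^sup>2) \<le> r * (y * (norm (hank 0 (y * r)))\<^sup>2)" by (simp add: mult_ac)
    then show ?thesis using r by simp
  qed
  \<comment> \<open>The crude bound 1.27 for the zero is enough: 3.2 * 1.27^3 is below 7.\<close>
  have num: "pi * (x\<^sup>2 * y) \<le> 8"
  proof -
    have x1: "x \<le> 127/100" and y1: "y \<le> 127/100" using xy y127 by auto
    have a: "x\<^sup>2 * y \<le> (127/100)\<^sup>2 * (127/100)"
      by (rule mult_mono[OF power_mono[OF x1] y1]) (use x y in auto)
    have p: "pi \<le> 32/10" using pi_less_4 pi_approx by simp
    have "pi * (x\<^sup>2 * y) \<le> 32/10 * ((127/100)\<^sup>2 * (127/100))" by (rule mult_mono[OF p a]) (use x y in auto)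
    then show ?thesis by (simp add: power2_eq_square)
  qed
  define s where "s = norm (scat_den 0 l x)"
  have "\<bar>DJ 0 x\<bar> * s \<le> x\<^sup>2 / 2 * s" using DJb by (intro mult_right_mono) (auto simp: s_def)
  then have "\<bar>A\<bar> * norm (DH 0 x) \<le> x\<^sup>2 / 2 * s" using 1 unfolding s_def by linarith
  then have "(\<bar>A\<bar> * norm (DH 0 x))\<^sup>2 \<le> (x\<^sup>2 / 2 * s)\<^sup>2" by (intro power_mono) auto
  then have "A\<^sup>2 * (norm (DH 0 x))\<^sup>2 \<le> x ^ 4 / 4 * s\<^sup>2" by (simp add: power_mult_distrib power_divide flip: power_mult)
  moreover have "A\<^sup>2 * (2 / pi * x) \<le> A\<^sup>2 * (norm (DH 0 x))\<^sup>2" by (intro mult_left_mono DHb) auto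
  ultimately have "A\<^sup>2 * (2 / pi * x) \<le> x ^ 4 / 4 * s\<^sup>2" by linarith
  then have "x * (8 * A\<^sup>2) \<le> x * (pi * x ^ 3 * s\<^sup>2)" by (simp add: field_simps power_numeral_reduce)
  then have A2: "8 * A\<^sup>2 \<le> pi * x ^ 3 * s\<^sup>2" using x by simp
  have "8 * A\<^sup>2 * (x * (norm (hank 0 (x * r)))\<^sup>2) \<le> pi * x ^ 3 * s\<^sup>2 * (y * (norm (hank 0 (y * r)))\<^sup>2)"
    by (intro mult_mono A2 h0) (use x in auto)
  also have "\<dots> = x * (pi * (x\<^sup>2 * y)) * (s\<^sup>2 * (norm (hank 0 (y * r)))\<^sup>2)" by (simp add: power_numeral_reduce)
  also have "\<dots> \<le> x * 8 * (s\<^sup>2 * (norm (hank 0 (y * r)))\<^sup>2)" using num x by (intro mult_right_mono mult_left_mono) auto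
  finally have "8 * x * (A\<^sup>2 * (norm (hank 0 (x * r)))\<^sup>2) \<le> 8 * x * (s\<^sup>2 * (norm (hank 0 (y * r)))\<^sup>2)" by (simp add: mult_ac)
  then have "A\<^sup>2 * (norm (hank 0 (x * r)))\<^sup>2 \<le> s\<^sup>2 * (norm (hank 0 (y * r)))\<^sup>2"
    using x by (simp add: mult_le_cancel_left_pos)
  then have "(\<bar>A\<bar> * norm (hank 0 (x * r)))\<^sup>2 \<le> (norm (hank 0 (y * r)) * s)\<^sup>2" by (simp add: power_mult_distrib mult.commute)
  then show ?thesis unfolding A_def s_def by (rule power2_le_imp_le) simp
qed

section \<open>The first zero and the first maximum of the Bessel function\<close>

text \<open>Picone's identity: the derivative of phi^2 g / f - A is - (phi g / f - phi')^2 - (V - 2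
  t) phi^2. Thus a function f without zeros excludes test functions of negative energy A b - A a,
  provided that the boundary terms have the right sign.\<close>

lemma Picone:
  fixes f g V phi phi1 A :: "real \<Rightarrow> real"
  assumes ab: "a \<le> b"
    and f: "\<And>t. a \<le> t \<Longrightarrow> t \<le> b \<Longrightarrow> (f has_field_derivative g t) (at t)"
    and g: "\<And>t. a \<le> t \<Longrightarrow> t \<le> b \<Longrightarrow> (g has_field_derivative - V t * f t) (at t)"
    and nz: "\<And>t. a \<le> t \<Longrightarrow> t \<le> b \<Longrightarrow> f t \<noteq> 0"
    and V: "\<And>t. a \<le> t \<Longrightarrow> t \<le> b \<Longrightarrow> 2 * t \<le> V t"
    and phi: "\<And>t. (phi has_field_derivative phi1 t) (at t)"
    and A: "\<And>t. (A has_field_derivative (phi1 t)\<^sup>2 - 2 * t * (phi t)\<^sup>2) (at t)"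
  shows "(phi b)\<^sup>2 * (g b / f b) - A b \<le> (phi a)\<^sup>2 * (g a / f a) - A a"
proof (rule DERIV_nonpos_imp_nonincreasing[OF ab])
  fix t assume t: "a \<le> t" "t \<le> b"
  let ?d = "2 * phi t * phi1 t * (g t / f t) + (phi t)\<^sup>2 * ((- V t * f t * f t - g t * g t) / (f t * f t))
      - ((phi1 t)\<^sup>2 - 2 * t * (phi t)\<^sup>2)"
  have "((\<lambda>t. (phi t)\<^sup>2 * (g t / f t) - A t) has_field_derivative ?d) (at t)"
    by (rule derivative_eq_intros refl f[OF t] g[OF t] nz[OF t] phi A)+ (simp add: algebra_simps)
  moreover have "?d = - (phi t * (g t / f t) - phi1 t)\<^sup>2 - (V t - 2 * t) * (phi t)\<^sup>2"
  proof -
    define k where "k = g t / f t"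
    have gk: "g t = k * f t" using nz[OF t] by (simp add: k_def)
    show ?thesis unfolding gk using nz[OF t] by (simp add: field_simps power2_eq_square)
  qed
  moreover have "0 \<le> (V t - 2 * t) * (phi t)\<^sup>2" using V[OF t] by simp
  moreover have "- (phi t * (g t / f t) - phi1 t)\<^sup>2 \<le> 0" by simp
  ultimately have "((\<lambda>t. (phi t)\<^sup>2 * (g t / f t) - A t) has_field_derivative ?d) (at t)" "?d \<le> 0"
    by - (assumption, linarith)
  then show "\<exists>y. ((\<lambda>t. (phi t)\<^sup>2 * (g t / f t) - A t) has_real_derivative y) (at t) \<and> y \<le> 0" by blast
qed

text \<open>For \<open>V t \<ge> 2 t\<close> the test function \<open>(t + 17/25) (51/25 - t)\<close>, extended by zero, has
  negative energy \<open>\<integral> \<phi>'\<^sup>2 - 2 t \<phi>\<^sup>2\<close>; this forces a zero of \<open>f\<close> before \<open>51/25\<close>.\<close>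

lemma Picone_zero:
  fixes f g V :: "real \<Rightarrow> real"
  assumes f: "\<And>t. (f has_field_derivative g t) (at t)"
    and g: "\<And>t. (g has_field_derivative - V t * f t) (at t)"
    and V: "\<And>t. 2 * t \<le> V t"
  shows "\<exists>t\<ge>-17/25. t \<le> 51/25 \<and> f t = 0"
proof (rule ccontr)
  assume *: "\<not> ?thesis"
  \<comment> \<open>On [-a, 3 a], of length L = 4 a, the function (t + a) (3 a - t) has energy L^3 /
    3 - a L^5 / 15, negative as soon as 16 a^3 > 5; a = 17/25 just satisfies this. \<open>B\<close>
    is a primitive of the energy density in s = t + 17/25.\<close>
  let ?L = "68/25 :: real"
  define phi where "phi t = (t + 17/25) * (51/25 - t)" for t :: real
  define B where "B s = - (1/6) * (?L - 2 * s) ^ 3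
      - 2 * ((?L * ?L / 4 * s ^ 4 - 2 * ?L / 5 * s ^ 5 + 1/6 * s ^ 6) - 17/25 * (?L * ?L / 3 * s ^ 3 - 2 * ?L / 4 * s ^ 4 + 1/5 * s ^ 5))" for s :: real
  define A where "A t = B (t + 17/25)" for t
  have "(phi (51/25))\<^sup>2 * (g (51/25) / f (51/25)) - A (51/25) \<le> (phi (-17/25))\<^sup>2 * (g (-17/25) / f (-17/25)) - A (-17/25)"
  proof (rule Picone[where V = V and ?phi1.0 = "\<lambda>t. ?L - 2 * (t + 17/25)"])
    show "(phi has_real_derivative ?L - 2 * (t + 17/25)) (at t)" for t
      unfolding phi_def by (auto intro!: derivative_eq_intros)
    show "(A has_real_derivative (?L - 2 * (t + 17/25))\<^sup>2 - 2 * t * (phi t)\<^sup>2) (at t)" for t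
    proof -
      define s where "s = t + 17/25"
      have t: "t = s - 17/25" by (simp add: s_def)
      have B: "(B has_field_derivative (?L - 2 * s)\<^sup>2 - 2 * ((?L * ?L * s ^ 3 - 2 * ?L * s ^ 4 + s ^ 5) - 17/25 * (?L * ?L * s\<^sup>2 - 2 * ?L * s ^ 3 + s ^ 4))) (at s)"
        unfolding B_def[abs_def]
        by (rule derivative_eq_intros refl)+ (simp add: algebra_simps power2_eq_square power_numeral_reduce)
      have "((\<lambda>t. t + 17/25) has_field_derivative 1) (at t)" by (auto intro!: derivative_eq_intros)
      from DERIV_chain2[of B _ "\<lambda>t. t + 17/25" t, folded s_def, OF B this]
      have "(A has_field_derivative ((?L - 2 * s)\<^sup>2 - 2 * ((?L * ?L * s ^ 3 - 2 * ?L * s ^ 4 + s ^ 5) - 17/25 * (?L * ?L * s\<^sup>2 - 2 * ?L * s ^ 3 + s ^ 4))) * 1) (at t)"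
        unfolding A_def[abs_def] .
      then show ?thesis
        by (rule DERIV_cong) (simp add: phi_def t field_simps power2_eq_square power_numeral_reduce)
    qed
  qed (use f g V * in auto)
  then have "A (-17/25) \<le> A (51/25)" by (simp add: phi_def)
  then show False by (simp add: A_def B_def power2_eq_square power_numeral_reduce)
qed

text \<open>If g stayed negative up to 69/25, f would be negative beyond j, so g / f > 0 at 69/25.
  The test function vanishes at 41/20, just beyond 51/25 >= j, and has slope 0 at 69/25 = 41/20 +
  71/100, the natural boundary condition for a critical point. Its energy is negative, which
  Picone's inequality forbids.\<close>

lemma Picone_critical:
  fixes f g V :: "real \<Rightarrow> real"
  assumes f: "\<And>t. (f has_field_derivative g t) (at t)"
    and g: "\<And>t. (g has_field_derivative - V t * f t) (at t)"
    and V: "\<And>t. 2 * t \<le> V t"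
    and j: "j \<le> 51/25" "f j = 0" "g j < 0"
  shows "\<exists>t\<ge>j. t \<le> 69/25 \<and> g t = 0"
proof (rule ccontr)
  assume *: "\<not> ?thesis"
  have gneg: "g t < 0" if "j \<le> t" "t \<le> 69/25" for t
  proof (rule ccontr)
    assume "\<not> g t < 0"
    then have "\<exists>u\<ge>j. u \<le> t \<and> g u = 0"
      by (intro IVT'[of g]) (use j that in \<open>auto intro!: continuous_at_imp_continuous_on DERIV_isCont[OF g]\<close>)
    then show False using * that by force
  qed
  have fneg: "f t < 0" if "j < t" "t \<le> 69/25" for t
  proof -
    have "f t < f j"
      by (rule DERIV_neg_imp_decreasing[OF that(1)]) (use f gneg that in force)
    then show ?thesis using j by simp
  qed
  let ?l = "71/100 :: real"
  let ?a = "41/20 :: real"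
  define phi where "phi t = (t - ?a) * (2 * ?l - (t - ?a))" for t :: real
  define B where "B s = - (4/3) * (?l - s) ^ 3
      - 2 * (?a * (4/3 * ?l * ?l * s ^ 3 - ?l * s ^ 4 + 1/5 * s ^ 5) + (?l * ?l * s ^ 4 - 4/5 * ?l * s ^ 5 + 1/6 * s ^ 6))" for s :: real
  define A where "A t = B (t - ?a)" for t
  have "(phi (69/25))\<^sup>2 * (g (69/25) / f (69/25)) - A (69/25) \<le> (phi ?a)\<^sup>2 * (g ?a / f ?a) - A ?a"
  proof (rule Picone[where V = V and ?phi1.0 = "\<lambda>t. 2 * ?l - 2 * (t - ?a)"])
    show "(phi has_real_derivative 2 * ?l - 2 * (t - ?a)) (at t)" for t
      unfolding phi_def by (auto intro!: derivative_eq_intros)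
    show "(A has_real_derivative (2 * ?l - 2 * (t - ?a))\<^sup>2 - 2 * t * (phi t)\<^sup>2) (at t)" for t
    proof -
      define s where "s = t - ?a"
      have t: "t = s + ?a" by (simp add: s_def)
      have B: "(B has_field_derivative 4 * (?l - s)\<^sup>2 - 2 * (?a * (4 * ?l * ?l * s\<^sup>2 - 4 * ?l * s ^ 3 + s ^ 4) + (4 * ?l * ?l * s ^ 3 - 4 * ?l * s ^ 4 + s ^ 5))) (at s)"
        unfolding B_def[abs_def]
        by (rule derivative_eq_intros refl)+ (simp add: algebra_simps power2_eq_square power_numeral_reduce)
      have "((\<lambda>t. t - ?a) has_field_derivative 1) (at t)" by (auto intro!: derivative_eq_intros)
      from DERIV_chain2[of B _ "\<lambda>t. t - ?a" t, folded s_def, OF B this]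
      have "(A has_field_derivative (4 * (?l - s)\<^sup>2 - 2 * (?a * (4 * ?l * ?l * s\<^sup>2 - 4 * ?l * s ^ 3 + s ^ 4) + (4 * ?l * ?l * s ^ 3 - 4 * ?l * s ^ 4 + s ^ 5))) * 1) (at t)"
        unfolding A_def[abs_def] .
      then show ?thesis
        by (rule DERIV_cong) (simp add: phi_def t field_simps power2_eq_square power_numeral_reduce)
    qed
    show "f t \<noteq> 0" if "?a \<le> t" "t \<le> 69/25" for t using fneg[of t] that j by force
  qed (use f g V in auto)
  moreover have "0 \<le> (phi (69/25))\<^sup>2 * (g (69/25) / f (69/25))"
    using fneg[of "69/25"] gneg[of "69/25"] j by (intro mult_nonneg_nonneg divide_nonpos_nonpos) auto
  ultimately have "A ?a \<le> A (69/25)" by (simp add: phi_def)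
  then show False by (simp add: A_def B_def power2_eq_square power_numeral_reduce)
qed

text \<open>This is the bound 10 for the rescaled potential. By convexity in h it need only be
  checked at h = 9/49, where 2 h t is at most about 1.014.\<close>

lemma exp_le_1_plus_10:
  fixes h t :: real
  assumes h: "0 < h" "h \<le> 9/49" and t: "t \<le> 69/25"
  shows "exp (2 * h * t) \<le> 1 + 10 * h"
proof -
  have e: "exp (2 * (9/49) * (69/25)) \<le> 1 + 10 * (9/49 :: real)"
  proof -
    have a: "exp (17/1000 :: real) \<le> 1 + 17/1000 + (17/1000)\<^sup>2" by (rule exp_bound) auto
    have "exp (2 * (9/49) * (69/25) :: real) \<le> exp (1 + 17/1000)" by simp
    also have "\<dots> = exp 1 * exp (17/1000 :: real)" by (rule exp_add)
    also have "\<dots> \<le> 272/100 * (1 + 17/1000 + (17/1000)\<^sup>2)"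
      using a less_imp_le[OF e_less_272] by (intro mult_mono) auto
    finally show ?thesis by (simp add: power2_eq_square)
  qed
  define u where "u = h / (9/49)"
  have u: "0 \<le> u" "u \<le> 1" "h = u * (9/49)" using h by (auto simp: u_def)
  have "exp (2 * h * t) \<le> exp (2 * h * (69/25))" using h t by simp
  also have "\<dots> = exp ((1 - u) *\<^sub>R 0 + u *\<^sub>R (2 * (9/49) * (69/25)))" by (simp add: u(3))
  also have "\<dots> \<le> (1 - u) * exp 0 + u * exp (2 * (9/49) * (69/25))"
    by (rule convex_onD[OF exp_convex]) (use u in auto)
  also have "\<dots> \<le> (1 - u) * 1 + u * (1 + 10 * (9/49))"
    using e u by (intro add_mono mult_left_mono) auto
  also have "\<dots> = 1 + 10 * h" by (simp add: u(3) algebra_simps)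
  finally show ?thesis .
qed

text \<open>The derivative of J x J' is ((x J')^2 + (n^2 - x^2) J^2) / x, nonnegative for x <= n; so
  the product, positive near 0, cannot vanish there.\<close>

lemma J_DJ_pos_up_to_order:
  assumes n: "n > 0" and x: "0 < x" "x \<le> real n"
  shows "bessel_J_nat n x > 0" "DJ n x > 0"
proof -
  obtain b1 where b1: "b1 > 0" "\<And>t. 0 < t \<Longrightarrow> t < b1 \<Longrightarrow> bessel_J_nat n t > 0"
    using J_pos_near_0 unfolding eventually_at_right_field by auto
  obtain b2 where b2: "b2 > 0" "\<And>t. 0 < t \<Longrightarrow> t < b2 \<Longrightarrow> DJ n t > 0"
    using DJ_pos_near_0[OF n] unfolding eventually_at_right_field by auto
  define b where "b = min (min b1 b2) x / 2"
  have b: "0 < b" "b < b1" "b < b2" "b \<le> x" using b1 b2 x by (auto simp: b_def min_def)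
  have d: "((\<lambda>t. bessel_J_nat n t * DJ n t) has_field_derivative
      ((DJ n t)\<^sup>2 + ((real n)\<^sup>2 - t\<^sup>2) * (bessel_J_nat n t)\<^sup>2) / t) (at t)" if "t > 0" for t
    by (rule derivative_eq_intros refl bessel_pair_DERIV[OF bessel_pair_J that])+
       (use that in \<open>simp add: field_simps power2_eq_square\<close>)
  have prod: "bessel_J_nat n t * DJ n t > 0" if t: "b \<le> t" "t \<le> x" for t
  proof -
    have "bessel_J_nat n b * DJ n b \<le> bessel_J_nat n t * DJ n t"
    proof (rule DERIV_nonneg_imp_nondecreasing[OF t(1)])
      fix u assume u: "b \<le> u" "u \<le> t"
      then have "u > 0" "u\<^sup>2 \<le> (real n)\<^sup>2" using b t x by (auto intro!: power_mono)
      then show "\<exists>y. ((\<lambda>t. bessel_J_nat n t * DJ n t) has_real_derivative y) (at u) \<and> 0 \<le> y"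
        using d[of u] by (intro exI[of _ "((DJ n u)\<^sup>2 + ((real n)\<^sup>2 - u\<^sup>2) * (bessel_J_nat n u)\<^sup>2) / u"]) auto
    qed
    moreover have "bessel_J_nat n b * DJ n b > 0" using b b1 b2 by simp
    ultimately show ?thesis by linarith
  qed
  show J: "bessel_J_nat n x > 0"
  proof (rule ccontr)
    assume "\<not> bessel_J_nat n x > 0"
    then have "bessel_J_nat n x \<le> 0" by linarith
    from first_zero[OF J_cont J_pos_near_0 x(1) this]
    obtain s where s: "0 < s" "s \<le> x" "bessel_J_nat n s = 0" by blast
    have "b \<le> s"
    proof (rule ccontr)
      assume "\<not> b \<le> s"
      then have "s < b1" using b(2) by linarith
      then show False using b1(2)[OF s(1)] s(3) by linarith
    qed
    then show False using prod[of s] s(2,3) by simp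
  qed
  show "DJ n x > 0" using prod[of x] J b by (simp add: zero_less_mult_iff)
qed

text \<open>In the new variable let t be the first critical point of f = J_n, j its first zero and w
  the next critical point; g = f'. As g^2 + V f^2 increases, f(t)^2 <= V(t) f(t)^2 <= g(j)^2 <= V(w)
  f(w)^2 <= 10 |H(x_j)|^2. This chain rests on 1 <= V(t) and V(w) <= 10.\<close>

lemma scat_lower:
  assumes n: "n > 0" and l: "0 < l" "l\<^sup>2 \<le> 1 - 49 / (9 * real n powr (2/3))"
  shows "\<exists>x>0. Im (scat_den n l x) = 0 \<and> (\<forall>y>0. \<bar>bessel_J_nat n y\<bar> \<le> sqrt 10 * norm (hank n x))"
proof -
  define N where "N = real n"
  have N: "N > 0" using n by (simp add: N_def)
  \<comment> \<open>The scaling h^3 n^2 = 1 makes the potential (exp (2 h t) - 1) / h, which is 2 t,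
    as in Airy's equation, up to terms of order h. The hypothesis on l together with l^2 >= 0 bounds
    h by 9/49.\<close>
  define h where "h = 1 / N powr (2/3)"
  have h0: "h > 0" using N by (simp add: h_def)
  have lh: "l\<^sup>2 \<le> 1 - 49/9 * h" using l(2) by (simp add: h_def N_def)
  have h1: "h \<le> 9/49" using lh zero_le_power2[of l] by linarith
  have h3: "h ^ 3 * N\<^sup>2 = 1"
  proof -
    have "(N powr (2/3)) ^ 3 = N\<^sup>2" using N by (simp add: powr_power)
    then show ?thesis using N by (simp add: h_def power_divide)
  qed
  define xx where "xx t = N * exp (h * t)" for t
  have xx0: "xx t > 0" for t using N by (simp add: xx_def)
  have xx_mono: "xx s < xx t \<longleftrightarrow> s < t" "xx s \<le> xx t \<longleftrightarrow> s \<le> t" for s t using N h0 by (simp_all add: xx_def)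
  have xx_inv: "xx (ln (x / N) / h) = x" if "x > 0" for x using that N h0 by (simp add: xx_def)
  define V where "V t = (exp (2 * h * t) - 1) / h" for t
  define f where "f t = bessel_J_nat n (xx t)" for t
  define g where "g t = h * DJ n (xx t)" for t
  have xxd: "(xx has_field_derivative h * xx t) (at t)" for t
    unfolding xx_def by (auto intro!: derivative_eq_intros)
  have VQ: "V t = h\<^sup>2 * ((xx t)\<^sup>2 - N\<^sup>2)" for t
  proof -
    have "(xx t)\<^sup>2 = N\<^sup>2 * exp (2 * h * t)" by (simp add: xx_def power_mult_distrib exp_double[symmetric] mult.assoc)
    then have "h\<^sup>2 * ((xx t)\<^sup>2 - N\<^sup>2) = h\<^sup>2 * N\<^sup>2 * (exp (2 * h * t) - 1)" by (simp add: algebra_simps)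
    also have "h\<^sup>2 * N\<^sup>2 = 1 / h" using h3 h0 by (simp add: field_simps power_numeral_reduce)
    finally show ?thesis by (simp add: V_def)
  qed
  have fd: "(f has_field_derivative g t) (at t)" for t
  proof -
    have "(f has_field_derivative DJ n (xx t) / xx t * (h * xx t)) (at t)"
      unfolding f_def[abs_def] by (rule DERIV_chain2[OF bessel_pair_DERIV(1)[OF bessel_pair_J xx0] xxd])
    moreover have "DJ n (xx t) / xx t * (h * xx t) = g t" using xx0[of t] by (simp add: g_def)
    ultimately show ?thesis by simp
  qed
  have gd: "(g has_field_derivative - V t * f t) (at t)" for t
  proof -
    have "(g has_field_derivative h * (((real n)\<^sup>2 - (xx t)\<^sup>2) * bessel_J_nat n (xx t) / xx t * (h * xx t))) (at t)"
      unfolding g_def[abs_def] by (intro DERIV_cmult DERIV_chain2[OF bessel_pair_DERIV(2)[OF bessel_pair_J xx0] xxd])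
    moreover have "h * (((real n)\<^sup>2 - (xx t)\<^sup>2) * bessel_J_nat n (xx t) / xx t * (h * xx t)) = - V t * f t"
      using xx0[of t] by (simp add: VQ f_def N_def power2_eq_square field_simps)
    ultimately show ?thesis by simp
  qed
  have Vge: "2 * t \<le> V t" for t
    using exp_ge_add_one_self[of "2 * h * t"] h0 by (simp add: V_def field_simps)
  have Vmono: "V s \<le> V t" if "s \<le> t" for s t using that h0 by (simp add: V_def divide_right_mono)
  have F: "(g t)\<^sup>2 + V t * (f t)\<^sup>2 = h\<^sup>2 * bessel_F n (xx t)" for t
    by (simp add: g_def f_def VQ bessel_F_def N_def power_mult_distrib algebra_simps)
  have Fmono: "(g s)\<^sup>2 + V s * (f s)\<^sup>2 \<le> (g t)\<^sup>2 + V t * (f t)\<^sup>2" if "s \<le> t" for s t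
    unfolding F using bessel_F_mono[of "xx s" "xx t" n] xx0 xx_mono that by (simp add: mult_left_mono)
  have F0: "0 \<le> (g t)\<^sup>2 + V t * (f t)\<^sup>2" for t unfolding F using bessel_F_nonneg[OF xx0] by simp
  have neg: "f t > 0" "g t > 0" if "t \<le> 0" for t
  proof -
    have "xx t \<le> real n" using that N h0 by (simp add: xx_def N_def mult_le_0_iff mult_nonneg_nonpos)
    then show "f t > 0" "g t > 0" using J_DJ_pos_up_to_order[OF n xx0] h0 by (simp_all add: f_def g_def)
  qed
  have fc: "continuous_on A f" and gc: "continuous_on A g" for A
    by (intro continuous_at_imp_continuous_on ballI, rule DERIV_isCont, rule fd gd)+
  have first0: "\<exists>s>0. s \<le> t \<and> p s = 0 \<and> (\<forall>u<s. p u > 0)"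
    if p: "continuous_on UNIV p" "\<And>u. u \<le> 0 \<Longrightarrow> p u > 0" and t: "t > 0" "p t \<le> 0" for p :: "real \<Rightarrow> real" and t
  proof -
    have "\<exists>s. 0 < s \<and> s \<le> t \<and> p s = 0 \<and> (\<forall>u. 0 < u \<and> u < s \<longrightarrow> p u > 0)"
    proof (rule first_zero[OF continuous_on_subset[OF p(1)] _ t])
      have "isCont p 0" using p(1) by (simp add: continuous_on_eq_continuous_at)
      then have "(p \<longlongrightarrow> p 0) (at_right 0)" by (simp add: isCont_def filterlim_at_split)
      then show "eventually (\<lambda>x. p x > 0) (at_right 0)" by (rule order_tendstoD(1)) (use p(2) in auto)
    qed auto
    then obtain s where "0 < s" "s \<le> t" "p s = 0" "\<And>u. 0 < u \<Longrightarrow> u < s \<Longrightarrow> p u > 0" by blast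
    moreover have "p u > 0" if "u < s" for u using p(2)[of u] calculation(4)[of u] that by (cases "u \<le> 0") auto
    ultimately show ?thesis by blast
  qed
  obtain z where z: "-17/25 \<le> z" "z \<le> 51/25" "f z = 0" using Picone_zero[OF fd gd Vge] by blast
  have "z > 0" using neg(1)[of z] z by force
  then obtain j where j: "0 < j" "j \<le> z" "f j = 0" "\<And>u. u < j \<Longrightarrow> f u > 0"
    using first0[OF fc neg(1) \<open>z > 0\<close>] z by force
  have "\<exists>c>0. c < j \<and> f j - f 0 = (j - 0) * g c" by (rule MVT2) (use j fd in auto)
  then obtain c where c: "0 < c" "c < j" "f j - f 0 = j * g c" by auto
  have "j * g c < 0" using c(3) j(3) neg(1)[of 0] by simp
  then have "g c < 0" using j(1) by (simp add: mult_less_0_iff)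
  then obtain t where t: "0 < t" "t \<le> c" "g t = 0" "\<And>u. u < t \<Longrightarrow> g u > 0"
    using first0[OF gc neg(2) c(1)] by force
  have tj: "t < j" using t c by simp
  have gj: "g j < 0"
  proof -
    have gdec: "g j \<le> g c"
    proof (rule DERIV_nonpos_imp_nonincreasing[of c j])
      fix u assume "c \<le> u" "u \<le> j"
      then have "0 \<le> V u" "0 \<le> f u" using Vge[of u] c j(3) j(4)[of u] by (auto simp: order_le_less)
      then show "\<exists>y. (g has_real_derivative y) (at u) \<and> y \<le> 0" using gd[of u] by (intro exI[of _ "- V u * f u"]) auto
    qed (use c in auto)
    then show ?thesis using \<open>g c < 0\<close> by simp
  qed
  have fpos: "0 < f u" if "u \<le> t" for u using j(4)[of u] that tj by simp
  \<comment> \<open>Suppose V t < 1, so t <= 1/2. Convexity of f to the left of 0 bounds f(0) by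
    1.56 g(0), so on [0, t] the slope loses at most (1.56 t + t^2 / 2) g(0) <= 0.905 g(0) and cannot
    have reached 0 at t.\<close>
  have Vt: "V t \<ge> 1"
  proof (rule ccontr)
    assume "\<not> V t \<ge> 1"
    then have Vt: "V t < 1" by simp
    then have th: "t \<le> 1/2" using Vge[of t] by simp
    have gneg: "g (-1/2) \<le> g 0" "\<And>u. -1/2 \<le> u \<Longrightarrow> u \<le> 0 \<Longrightarrow> g u \<le> g 0"
    proof -
      have *: "g u \<le> g 0" if "u \<le> 0" for u
      proof (rule DERIV_nonneg_imp_nondecreasing[OF that])
        fix v :: real assume "u \<le> v" "v \<le> 0"
        then have "V v \<le> 0" "0 \<le> f v" using h0 neg(1)[of v] by (auto simp: V_def divide_le_0_iff mult_le_0_iff)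
        then show "\<exists>y. (g has_real_derivative y) (at v) \<and> 0 \<le> y" using gd[of v]
          by (intro exI[of _ "- V v * f v"]) (auto simp: mult_le_0_iff)
      qed
      show "g (-1/2) \<le> g 0" "\<And>u. -1/2 \<le> u \<Longrightarrow> u \<le> 0 \<Longrightarrow> g u \<le> g 0" by (auto intro: *)
    qed
    have g0: "g 0 > 0" "g (-1/2) > 0" using neg by auto
    have f1: "f (-1/2) \<le> 106/100 * g 0"
    proof -
      \<comment> \<open>A Taylor bound gives V(-1/2) <= -1 + h/2. Since g^2 + V f^2 >= 0, the value
        9/10 bounds f(-1/2) by sqrt (10/9) g(-1/2), and sqrt (10/9) < 1.06.\<close>
      have "V (-1/2) \<le> - (9/10)"
      proof -
        have "exp (- h) \<le> 1 - h + h\<^sup>2 / 2"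
        proof -
          have "exp (- h) = (\<Sum>k<3. (- h) ^ k / fact k) + (exp (- h) - (\<Sum>k<3. (- h) ^ k / fact k))" by simp
          have "\<exists>s. \<bar>s\<bar> \<le> \<bar>- h\<bar> \<and> exp (- h) = (\<Sum>m<3. (- h) ^ m / fact m) + exp s / fact 3 * (- h) ^ 3"
            using Maclaurin_exp_le[of "- h" 3] by blast
          then obtain s where s: "exp (- h) = (\<Sum>m<3. (- h) ^ m / fact m) + exp s / fact 3 * (- h) ^ 3" by blast
          have "exp s / fact 3 * (- h) ^ 3 \<le> 0" using h0 by (intro mult_nonneg_nonpos) (auto simp: power_numeral_reduce)
          then show ?thesis using s by (simp add: numeral_3_eq_3 power2_eq_square)
        qed
        then have "(exp (- h) - 1) / h \<le> (- h + h\<^sup>2 / 2) / h" using h0 by (intro divide_right_mono) auto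
        also have "\<dots> = - 1 + h / 2" using h0 by (simp add: field_simps power2_eq_square)
        also have "\<dots> \<le> - (9/10)" using h1 by simp
        finally show ?thesis by (simp add: V_def)
      qed
      then have "V (-1/2) * (f (-1/2))\<^sup>2 \<le> - (9/10) * (f (-1/2))\<^sup>2" by (intro mult_right_mono) auto
      then have "9/10 * (f (-1/2))\<^sup>2 \<le> (g (-1/2))\<^sup>2" using F0[of "-1/2"] by linarith
      also have "\<dots> \<le> (g 0)\<^sup>2" using gneg(1) g0 by (intro power_mono) auto
      finally have "9/10 * (f (-1/2))\<^sup>2 \<le> (g 0)\<^sup>2" .
      moreover have "(106/100 * g 0)\<^sup>2 = 11236/10000 * (g 0)\<^sup>2" by (simp add: power_mult_distrib power2_eq_square)
      ultimately have "(f (-1/2))\<^sup>2 \<le> (106/100 * g 0)\<^sup>2" using zero_le_power2[of "g 0"] by linarith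
      then show ?thesis by (rule power2_le_imp_le) (use g0 in simp)
    qed
    have f0: "f 0 \<le> 156/100 * g 0"
    proof -
      have "\<exists>c>-1/2. c < 0 \<and> f 0 - f (-1/2) = (0 - (-1/2)) * g c" by (rule MVT2) (use fd in auto)
      then obtain c where "-1/2 < c" "c < 0" "f 0 - f (-1/2) = 1/2 * g c" by auto
      then show ?thesis using gneg(2)[of c] f1 by simp
    qed
    have gle: "g u \<le> g 0" if "0 \<le> u" "u \<le> t" for u
    proof (rule DERIV_nonpos_imp_nonincreasing[OF that(1)])
      fix v assume "0 \<le> v" "v \<le> u"
      then have "0 \<le> V v" "0 \<le> f v" using Vge[of v] fpos[of v] that by auto
      then show "\<exists>y. (g has_real_derivative y) (at v) \<and> y \<le> 0" using gd[of v] by (intro exI[of _ "- V v * f v"]) auto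
    qed
    have fle: "f u \<le> 156/100 * g 0 + g 0 * u" if u: "0 \<le> u" "u \<le> t" for u
    proof -
      have "f u - g 0 * u \<le> f 0 - g 0 * 0"
      proof (rule DERIV_nonpos_imp_nonincreasing[OF u(1)])
        fix v assume "0 \<le> v" "v \<le> u"
        then show "\<exists>y. ((\<lambda>u. f u - g 0 * u) has_real_derivative y) (at v) \<and> y \<le> 0"
          using gle[of v] u fd[of v] by (intro exI[of _ "g v - g 0"]) (auto intro!: derivative_eq_intros)
      qed
      then show ?thesis using f0 by simp
    qed
    have "g 0 + (156/100 * g 0 * 0 + g 0 * 0\<^sup>2 / 2) \<le> g t + (156/100 * g 0 * t + g 0 * t\<^sup>2 / 2)"
    proof (rule DERIV_nonneg_imp_nondecreasing[of 0 t])
      fix v assume v: "0 \<le> v" "v \<le> t"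
      have "V v * f v \<le> 1 * (156/100 * g 0 + g 0 * v)"
        using Vmono[OF v(2)] Vt fle[OF v] Vge[of v] v fpos[OF v(2)] by (intro mult_mono) auto
      moreover have "((\<lambda>u. g u + (156/100 * g 0 * u + g 0 * u\<^sup>2 / 2)) has_field_derivative - V v * f v + (156/100 * g 0 + g 0 * v)) (at v)"
      proof -
        have "((\<lambda>u. 156/100 * g 0 * u + g 0 * u\<^sup>2 / 2) has_field_derivative 156/100 * g 0 + g 0 * v) (at v)"
          by (auto intro!: derivative_eq_intros)
        from DERIV_add[OF gd[of v] this] show ?thesis .
      qed
      ultimately show "\<exists>y. ((\<lambda>u. g u + (156/100 * g 0 * u + g 0 * u\<^sup>2 / 2)) has_real_derivative y) (at v) \<and> 0 \<le> y"
        by (intro exI conjI) (assumption, simp)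
    qed (use t in auto)
    then have "g 0 \<le> g 0 * (156/100 * t + t\<^sup>2 / 2)" using t(3) by (simp add: algebra_simps)
    moreover have "156/100 * t + t\<^sup>2 / 2 \<le> 156/100 * (1/2) + (1/2)\<^sup>2 / 2"
      using th t(1) by (intro add_mono mult_left_mono divide_right_mono power_mono) auto
    moreover have "156/100 * (1/2) + (1/2)\<^sup>2 / 2 < (1::real)" by (simp add: power2_eq_square)
    ultimately have "g 0 * 1 \<le> g 0 * (156/100 * t + t\<^sup>2 / 2)" "156/100 * t + t\<^sup>2 / 2 < 1" by auto
    then show False using g0(1) by (simp only: mult_le_cancel_left_pos)
  qed
  obtain w where w: "j \<le> w" "w \<le> 69/25" "g w = 0"
    using Picone_critical[OF fd gd Vge _ j(3) gj] j z by force
  define P where "P = norm (hank n (xx j))"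
  have Jj: "bessel_J_nat n (xx j) = 0" using j(3) by (simp add: f_def)
  have P: "P = \<bar>YY n (xx j)\<bar>"
    by (rule power2_eq_imp_eq) (use Jj norm_hank_sq[OF xx0, of n j] in \<open>simp_all add: P_def\<close>)
  have wr: "YY n (xx j) * DJ n (xx j) = - (2 / pi)" using wronskian_hank[OF xx0, of n j] Jj by simp
  have YYj: "YY n (xx j) > 0"
  proof -
    have "DJ n (xx j) < 0" using gj h0 by (simp add: g_def mult_less_0_iff)
    moreover have "YY n (xx j) * DJ n (xx j) < 0" unfolding wr by simp
    ultimately show ?thesis by (simp add: mult_less_0_iff)
  qed
  have Ppos: "P > 0" using P YYj by simp
  have S: "\<bar>bessel_J_nat n y\<bar> \<le> f t" if y: "y > 0" for y
  proof (cases "y \<le> xx t")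
    case True
    define u where "u = ln (y / N) / h"
    have yu: "y = xx u" using xx_inv[OF y] by (simp add: u_def)
    have ut: "u \<le> t" using True xx_mono(2) by (simp add: yu)
    have "f u \<le> f t"
    proof (rule DERIV_nonneg_imp_nondecreasing[OF ut])
      fix v assume "u \<le> v" "v \<le> t"
      then have "0 \<le> g v" using t(3) t(4)[of v] by (auto simp: order_le_less)
      then show "\<exists>y. (f has_real_derivative y) (at v) \<and> 0 \<le> y" using fd by blast
    qed
    then show ?thesis using fpos[OF ut] by (simp add: yu f_def)
  next
    case False
    define u where "u = ln (y / N) / h"
    have yu: "y = xx u" using xx_inv[OF y] by (simp add: u_def)
    have tu: "t \<le> u" using False xx_mono(2) by (simp add: yu)
    \<comment> \<open>Sonine's function: it decreases because V increases, and equals f^2 at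
      critical points, so no later value of |f| exceeds f t.\<close>
    define E where "E v = (f v)\<^sup>2 + (g v)\<^sup>2 / V v" for v
    have "E u \<le> E t"
    proof (rule DERIV_nonpos_imp_nonincreasing[OF tu])
      fix v assume "t \<le> v" "v \<le> u"
      then have V0: "V v > 0" using Vge[of v] t by simp
      have Vd: "(V has_field_derivative 2 * exp (2 * h * v)) (at v)"
        unfolding V_def[abs_def] using h0 by (auto intro!: derivative_eq_intros)
      have "(E has_field_derivative 2 * f v * g v + ((2 * g v * (- V v * f v)) * V v - (g v)\<^sup>2 * (2 * exp (2 * h * v))) / (V v * V v)) (at v)"
        unfolding E_def[abs_def]
        by (rule derivative_eq_intros refl fd gd Vd)+ (use V0 in \<open>simp_all add: algebra_simps\<close>)
      moreover have "2 * f v * g v + ((2 * g v * (- V v * f v)) * V v - (g v)\<^sup>2 * (2 * exp (2 * h * v))) / (V v * V v)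
          = - ((g v)\<^sup>2 * (2 * exp (2 * h * v)) / (V v * V v))"
        using V0 by (simp add: field_simps)
      ultimately show "\<exists>y. (E has_real_derivative y) (at v) \<and> y \<le> 0"
        by (intro exI conjI) (assumption, simp)
    qed
    moreover have "(f u)\<^sup>2 \<le> E u" using Vge[of u] tu t by (simp add: E_def)
    ultimately have "(f u)\<^sup>2 \<le> (f t)\<^sup>2" by (simp add: E_def t(3))
    then have "\<bar>f u\<bar> \<le> f t" using fpos[of t] by (simp add: abs_le_square_iff[symmetric])
    then show ?thesis by (simp add: yu f_def)
  qed
  have Vw: "V w \<le> 10" using exp_le_1_plus_10[OF h0 h1 w(2)] h0 by (simp add: V_def field_simps)
  have St: "f t \<le> sqrt 10 * P"
  proof -
    have fw: "(f w)\<^sup>2 \<le> P\<^sup>2"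
    proof -
      have "\<bar>f w\<bar> \<le> norm (hank n (xx w))" unfolding f_def using abs_Re_le_cmod[of "hank n (xx w)"] by (simp add: Re_hank xx0)
      also have "\<dots> \<le> P" unfolding P_def by (rule norm_hank_antimono) (use xx0 xx_mono w in auto)
      finally show ?thesis using Ppos by (simp add: abs_le_square_iff[symmetric])
    qed
    have 1: "(g j)\<^sup>2 \<le> 10 * P\<^sup>2"
    proof -
      have "(g j)\<^sup>2 \<le> V w * (f w)\<^sup>2" using Fmono[OF w(1)] j(3) w(3) by simp
      also have "\<dots> \<le> 10 * P\<^sup>2" using Vw fw by (intro mult_mono) auto
      finally show ?thesis .
    qed
    have 2: "(f t)\<^sup>2 \<le> (g j)\<^sup>2"
    proof -
      have "1 * (f t)\<^sup>2 \<le> V t * (f t)\<^sup>2" using Vt by (intro mult_right_mono) auto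
      then show ?thesis using Fmono[of t j] tj j(3) t(3) by simp
    qed
    have "(f t)\<^sup>2 \<le> (sqrt 10 * P)\<^sup>2" using 1 2 by (simp add: power_mult_distrib)
    then show ?thesis by (rule power2_le_imp_le) (use Ppos in simp)
  qed
  \<comment> \<open>From l^2 <= exp (- 49/9 h) and 2 j <= 102/25 < 49/9. So l x_j stays in the range
    where J_n and its derivative are positive.\<close>
  have lxj: "l * xx j \<le> real n"
  proof -
    have "l\<^sup>2 \<le> exp (- (49/9 * h))" using lh exp_ge_add_one_self[of "- (49/9 * h)"] by linarith
    then have "l\<^sup>2 * (exp (h * j))\<^sup>2 \<le> exp (- (49/9 * h)) * (exp (h * j))\<^sup>2" by (intro mult_right_mono) auto
    also have "\<dots> = exp (h * (2 * j - 49/9))" by (simp add: exp_double[symmetric] exp_add[symmetric] algebra_simps)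
    also have "\<dots> \<le> 1" using h0 j z by (simp add: mult_le_0_iff)
    finally have "(l * exp (h * j))\<^sup>2 \<le> 1\<^sup>2" by (simp add: power_mult_distrib)
    then have "l * exp (h * j) \<le> 1" by (rule power2_le_imp_le) simp
    then have "N * (l * exp (h * j)) \<le> N * 1" using N by (intro mult_left_mono) auto
    then show ?thesis by (simp add: xx_def N_def mult_ac)
  qed
  \<comment> \<open>At the first zero of J one has Y > 0 and, by monotonicity of the modulus, x Y'
    <= 0, so Im D < 0. At a zero of Y before it only x Y' J(l x) > 0 remains, and the intermediate
    value theorem applies.\<close>
  have ImJ: "Im (scat_den n l (xx j)) < 0"
  proof -
    have lj0: "0 < l * xx j" using l xx0 by simp
    have Jl: "bessel_J_nat n (l * xx j) > 0" "DJ n (l * xx j) > 0" using J_DJ_pos_up_to_order[OF n lj0 lxj] by auto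
    have "YY n (xx j) * DYY n (xx j) \<le> 0" using cross_nonpos[OF xx0, of n j] Jj by simp
    then have "DYY n (xx j) \<le> 0" using YYj by (simp add: mult_le_0_iff)
    then have "DYY n (xx j) * bessel_J_nat n (l * xx j) \<le> 0" using Jl by (simp add: mult_nonpos_nonneg)
    moreover have "YY n (xx j) * DJ n (l * xx j) > 0" using YYj Jl by simp
    ultimately show ?thesis unfolding Im_scat_den[OF xx0] by linarith
  qed
  have l1: "l \<le> 1"
  proof (rule power2_le_imp_le)
    show "l\<^sup>2 \<le> 1\<^sup>2" using lh h0 by simp
  qed simp
  obtain y where y: "0 < y" "y \<le> xx j" "YY n y = 0"
    using YY_neg[of "xx j" n "xx j"] xx0[of j] YYj by force
  have yj: "y < xx j" using y YYj by (cases "y = xx j") auto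
  have Jpos: "bessel_J_nat n u > 0" if "0 < u" "u < xx j" for u
  proof -
    have "ln (u / N) / h < j" using xx_mono(1)[of "ln (u / N) / h" j] xx_inv[OF that(1)] that by simp
    from j(4)[OF this] show ?thesis by (simp add: f_def xx_inv[OF that(1)])
  qed
  have Imy: "Im (scat_den n l y) > 0"
  proof -
    have "l * y \<le> y" using l1 y by (simp add: mult_le_cancel_right1)
    then have Jl: "bessel_J_nat n (l * y) > 0" "bessel_J_nat n y > 0" using Jpos[OF mult_pos_pos[OF l(1) y(1)] le_less_trans[OF _ yj]] Jpos[OF y(1) yj] by auto
    have "bessel_J_nat n y * DYY n y = 2 / pi" using wronskian_hank[OF y(1), of n] y(3) by simp
    then have "DYY n y > 0" using Jl pi_gt_zero by (metis divide_pos_pos zero_less_mult_pos zero_less_numeral)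
    then show ?thesis unfolding Im_scat_den[OF y(1)] using Jl y(3) by simp
  qed
  have "continuous_on {0<..} (\<lambda>x. DYY n x * bessel_J_nat n (l * x) - YY n x * DJ n (l * x))"
    by (intro continuous_intros continuous_on_compose2[OF J_cont] continuous_on_compose2[OF DJ_cont]
        DYY_cont YY_cont) (use l in auto)
  then have "continuous_on {y..xx j} (\<lambda>x. DYY n x * bessel_J_nat n (l * x) - YY n x * DJ n (l * x))"
    by (rule continuous_on_subset) (use y in auto)
  then have "continuous_on {y..xx j} (\<lambda>x. Im (scat_den n l x))"
    by (rule continuous_on_eq) (use y in \<open>simp add: Im_scat_den\<close>)
  then have "\<exists>x\<ge>y. x \<le> xx j \<and> Im (scat_den n l x) = 0"
    by (intro IVT2') (use ImJ Imy y in auto)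
  then obtain x where x: "y \<le> x" "x \<le> xx j" "Im (scat_den n l x) = 0" by blast
  have x0: "x > 0" using x y by simp
  have "\<bar>bessel_J_nat n u\<bar> \<le> sqrt 10 * norm (hank n x)" if "u > 0" for u
  proof -
    have "P \<le> norm (hank n x)" unfolding P_def by (rule norm_hank_antimono[OF x0 x(2)])
    then have "sqrt 10 * P \<le> sqrt 10 * norm (hank n x)" by simp
    then show ?thesis using S[OF that] St by linarith
  qed
  then show ?thesis using x x0 by blast
qed

section \<open>Radial test functions\<close>

text \<open>For \<open>s = \<plusminus>1\<close> the powers of \<open>zeta s\<close> are the harmonic polynomials \<open>r ^ m * cis (\<plusminus> m \<theta>)\<close>.\<close>

definition zeta :: "real \<Rightarrow> real ^ 2 \<Rightarrow> complex" where
  "zeta s x = Complex (x $ 1) (s * x $ 2)"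

definition rho :: "real ^ 2 \<Rightarrow> real" where "rho x = (norm x)\<^sup>2"

lemma rho_eq: "rho x = (x $ 1)\<^sup>2 + (x $ 2)\<^sup>2"
  by (simp add: rho_def norm_vec_def L2_set_def sum_2)

lemma rho_nonneg [simp]: "rho x \<ge> 0" by (simp add: rho_def)

lemma zeta_has_derivative: "(zeta s has_derivative zeta s) (at x)"
proof -
  have "bounded_linear (zeta s)"
    unfolding linear_conv_bounded_linear[symmetric]
    by (rule linearI) (auto simp: zeta_def complex_eq_iff algebra_simps)
  then show ?thesis by (rule bounded_linear_imp_has_derivative)
qed

lemma continuous_on_zeta: "continuous_on A (zeta s)"
  by (intro continuous_at_imp_continuous_on ballI has_derivative_continuous[OF zeta_has_derivative])

lemma rho_has_derivative: "(rho has_derivative (\<lambda>h. 2 * (x \<bullet> h))) (at x)"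
  unfolding rho_def[abs_def] power2_norm_eq_inner
  by (auto intro!: derivative_eq_intros simp: inner_commute)

lemma continuous_on_rho: "continuous_on A rho"
  by (intro continuous_at_imp_continuous_on ballI has_derivative_continuous[OF rho_has_derivative])

lemma test_functionI:
  assumes D: "\<And>x. (\<phi> has_derivative D x) (at x)"
    and c: "\<And>j. continuous_on UNIV (\<lambda>x. D x (axis j 1))"
    and K: "\<And>x. rho x \<ge> K \<Longrightarrow> \<phi> x = 0"
  shows "test_function \<phi>" "pderiv_at j \<phi> x = D x (axis j 1)"
proof -
  have p: "pderiv_at j \<phi> = (\<lambda>x. D x (axis j 1))" for j
    unfolding pderiv_at_def using frechet_derivative_at[OF D] by metis
  then show "pderiv_at j \<phi> x = D x (axis j 1)" by simp
  show "test_function \<phi>"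
    unfolding test_function_def p
  proof (intro conjI allI c)
    show "\<phi> differentiable (at x)" for x using D by (auto simp: differentiable_def)
    have "\<phi> x = 0" if "x \<notin> cball 0 (sqrt \<bar>K\<bar>)" for x
    proof (rule K)
      have "sqrt \<bar>K\<bar> \<le> norm x" using that by simp
      then have "(sqrt \<bar>K\<bar>)\<^sup>2 \<le> (norm x)\<^sup>2" by (intro power_mono) auto
      then show "K \<le> rho x" by (simp add: rho_def)
    qed
    then show "\<exists>K. compact K \<and> (\<forall>x. x \<notin> K \<longrightarrow> \<phi> x = 0)" by (intro exI[of _ "cball 0 (sqrt \<bar>K\<bar>)"]) auto
  qed
qed

text \<open>Profiles are functions of |x|^2 rather than |x|, so that composition with
  \<open>rho\<close> is differentiable at the origin. Two derivatives are prescribed because the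
  Laplacian of the test function will be taken.\<close>

locale radial_profile =
  fixes X X1 X2 :: "real \<Rightarrow> complex" and K :: real
  assumes X: "\<And>r. r \<ge> 0 \<Longrightarrow> (X has_vector_derivative X1 r) (at r)"
    and X1: "\<And>r. r \<ge> 0 \<Longrightarrow> (X1 has_vector_derivative X2 r) (at r)"
    and X2: "continuous_on {0..} X2"
    and zero: "\<And>r. r \<ge> K \<Longrightarrow> X r = 0" "\<And>r. r \<ge> K \<Longrightarrow> X1 r = 0" "\<And>r. r \<ge> K \<Longrightarrow> X2 r = 0"
begin

lemma X_rho: "((\<lambda>x. X (rho x)) has_derivative (\<lambda>h. (2 * (x \<bullet> h)) *\<^sub>R X1 (rho x))) (at x)"
  using diff_chain_at[OF rho_has_derivative X[unfolded has_vector_derivative_def], of x]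
  by (simp add: o_def)

lemma X1_rho: "((\<lambda>x. X1 (rho x)) has_derivative (\<lambda>h. (2 * (x \<bullet> h)) *\<^sub>R X2 (rho x))) (at x)"
  using diff_chain_at[OF rho_has_derivative X1[unfolded has_vector_derivative_def], of x]
  by (simp add: o_def)

lemma continuous_profiles:
  "continuous_on UNIV (\<lambda>x. X (rho x))" "continuous_on UNIV (\<lambda>x. X1 (rho x))" "continuous_on UNIV (\<lambda>x. X2 (rho x))"
  by (intro continuous_at_imp_continuous_on ballI has_derivative_continuous[OF X_rho]
      has_derivative_continuous[OF X1_rho] continuous_on_compose2[OF X2] continuous_on_rho; simp add: image_subset_iff)+

definition phi :: "real \<Rightarrow> nat \<Rightarrow> real ^ 2 \<Rightarrow> complex" where
  "phi s m x = zeta s x ^ m * X (rho x)"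

text \<open>The j-th partial derivative of \<open>phi\<close>. It serves as a test function itself,
  in the definition of the weak gradient.\<close>

definition psi :: "real \<Rightarrow> nat \<Rightarrow> 2 \<Rightarrow> real ^ 2 \<Rightarrow> complex" where
  "psi s m j x = of_real (2 * x $ j) * zeta s x ^ m * X1 (rho x)
     + of_nat m * zeta s (axis j 1) * zeta s x ^ (m - 1) * X (rho x)"

lemma zeta_pow_has_derivative:
  "((\<lambda>x. zeta s x ^ m) has_derivative (\<lambda>h. of_nat m * zeta s x ^ (m - 1) * zeta s h)) (at x)"
  by (rule has_derivative_eq_rhs[OF has_derivative_power[OF zeta_has_derivative]]) (auto simp: mult_ac)

lemma phi_has_derivative:
  "(phi s m has_derivative (\<lambda>h. zeta s x ^ m * ((2 * (x \<bullet> h)) *\<^sub>R X1 (rho x))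
     + of_nat m * zeta s x ^ (m - 1) * zeta s h * X (rho x))) (at x)"
  unfolding phi_def[abs_def] by (rule has_derivative_mult[OF zeta_pow_has_derivative X_rho])

lemma phi_test: "test_function (phi s m)" and pderiv_phi: "pderiv_at j (phi s m) x = psi s m j x"
proof -
  note T = test_functionI[where \<phi> = "phi s m" and K = K, OF phi_has_derivative]
  have c: "continuous_on UNIV (\<lambda>x. zeta s x ^ m * ((2 * (x \<bullet> axis j 1)) *\<^sub>R X1 (rho x))
     + of_nat m * zeta s x ^ (m - 1) * zeta s (axis j 1) * X (rho x))" for j
    by (intro continuous_intros continuous_profiles continuous_on_zeta)
  have z: "\<And>x. rho x \<ge> K \<Longrightarrow> phi s m x = 0" by (simp add: phi_def zero)
  show "test_function (phi s m)" by (rule T(1)[OF c z])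
  show "pderiv_at j (phi s m) x = psi s m j x"
    by (subst T(2)[OF c z]) (simp_all add: psi_def inner_axis scaleR_conv_of_real mult_ac)
qed

lemma psi_has_derivative:
  "(psi s m j has_derivative (\<lambda>h.
      (of_real (2 * x $ j) * zeta s x ^ m * ((2 * (x \<bullet> h)) *\<^sub>R X2 (rho x))
        + (of_real (2 * x $ j) * (of_nat m * zeta s x ^ (m - 1) * zeta s h) + of_real (2 * h $ j) * zeta s x ^ m) * X1 (rho x))
      + (of_nat m * zeta s (axis j 1) * zeta s x ^ (m - 1) * ((2 * (x \<bullet> h)) *\<^sub>R X1 (rho x))
        + of_nat m * zeta s (axis j 1) * (of_nat (m - 1) * zeta s x ^ (m - 1 - 1) * zeta s h) * X (rho x)))) (at x)"
proof -
  have "((\<lambda>x::real^2. complex_of_real (2 * x $ j)) has_derivative (\<lambda>h. complex_of_real (2 * h $ j))) (at x)"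
  proof -
    have "bounded_linear (\<lambda>x::real^2. complex_of_real (2 * x $ j))"
      by (intro bounded_linear_compose[OF bounded_linear_of_real] bounded_linear_const_mult bounded_linear_vec_nth)
    then show ?thesis by (rule bounded_linear_imp_has_derivative)
  qed
  then show ?thesis
    unfolding psi_def[abs_def]
    by (intro has_derivative_add has_derivative_mult X1_rho X_rho zeta_pow_has_derivative has_derivative_mult_right)
qed

definition psid :: "real \<Rightarrow> nat \<Rightarrow> 2 \<Rightarrow> 2 \<Rightarrow> real ^ 2 \<Rightarrow> complex" where
  "psid s m j k x = (of_real (2 * x $ j) * zeta s x ^ m * ((2 * (x $ k)) *\<^sub>R X2 (rho x))
        + (of_real (2 * x $ j) * (of_nat m * zeta s x ^ (m - 1) * zeta s (axis k 1)) + of_real (2 * (axis k 1 :: real^2) $ j) * zeta s x ^ m) * X1 (rho x))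
      + (of_nat m * zeta s (axis j 1) * zeta s x ^ (m - 1) * ((2 * (x $ k)) *\<^sub>R X1 (rho x))
        + of_nat m * zeta s (axis j 1) * (of_nat (m - 1) * zeta s x ^ (m - 1 - 1) * zeta s (axis k 1)) * X (rho x))"

lemma continuous_psid: "continuous_on UNIV (psid s m j k)"
  unfolding psid_def[abs_def] by (intro continuous_intros continuous_profiles continuous_on_zeta)

lemma continuous_psi: "continuous_on UNIV (psi s m j)"
  unfolding psi_def[abs_def] by (intro continuous_intros continuous_profiles continuous_on_zeta)

lemma psi_test: "test_function (psi s m j)" and pderiv_psi: "pderiv_at k (psi s m j) x = psid s m j k x"
proof -
  note T = test_functionI[where \<phi> = "psi s m j" and K = K, OF psi_has_derivative]
  have z: "\<And>x. rho x \<ge> K \<Longrightarrow> psi s m j x = 0" by (simp add: psi_def zero)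
  show "test_function (psi s m j)"
    by (rule T(1)[OF _ z]) (use continuous_psid in \<open>simp_all add: psid_def[abs_def] inner_axis\<close>)
  show "pderiv_at k (psi s m j) x = psid s m j k x"
    by (subst T(2)[OF _ z]) (use continuous_psid in \<open>simp_all add: psid_def[abs_def] inner_axis\<close>)
qed

text \<open>The factor zeta^m is harmonic and homogeneous of degree m; s^2 = 1 cancels the term with
  two derivatives on it, and Euler's relation turns the mixed term into a multiple of m.\<close>

lemma laplacian:
  assumes s: "s\<^sup>2 = 1"
  shows "psid s m 1 1 x + psid s m 2 2 x
    = zeta s x ^ m * (of_real (4 * (real m + 1)) * X1 (rho x) + of_real (4 * rho x) * X2 (rho x))"
proof -
  have a: "zeta s (axis 1 1) = 1" "zeta s (axis 2 1) = \<i> * of_real s"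
    by (auto simp: zeta_def complex_eq_iff axis_def)
  have z: "zeta s x = of_real (x $ 1) + \<i> * of_real s * of_real (x $ 2)" by (auto simp: zeta_def complex_eq_iff)
  have s2: "of_real s * of_real s = (1::complex)" using s by (simp add: power2_eq_square flip: of_real_mult)
  have ax: "(axis 1 1 :: real^2) $ 1 = 1" "(axis 2 1 :: real^2) $ 2 = 1" by (simp_all add: axis_def)
  have zz: "of_nat m * zeta s x ^ (m - 1) * zeta s x = of_nat m * zeta s x ^ m" by (cases m) auto
  define Z where "Z = zeta s x ^ (m - 1)"
  define W where "W = zeta s x ^ m"
  define Q where "Q = zeta s x ^ (m - 1 - 1)"
  have 1: "of_nat m * Z * (of_real (x $ 1) + \<i> * of_real s * of_real (x $ 2)) = of_nat m * W"
    using zz unfolding Z_def W_def z[symmetric] .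
  have "psid s m 1 1 x + psid s m 2 2 x =
    of_real (4 * ((x $ 1)\<^sup>2 + (x $ 2)\<^sup>2)) * W * X2 (rho x) + 4 * W * X1 (rho x)
    + 4 * (of_nat m * Z * (of_real (x $ 1) + \<i> * of_real s * of_real (x $ 2))) * X1 (rho x)
    + of_nat m * of_nat (m - 1) * Q * (1 - of_real s * of_real s) * X (rho x)"
    unfolding psid_def a ax Z_def[symmetric] W_def[symmetric] Q_def[symmetric]
    by (simp add: scaleR_conv_of_real algebra_simps power2_eq_square)
  then show ?thesis unfolding 1 s2 rho_eq W_def[symmetric] by (simp add: algebra_simps)
qed

end

lemma integrable_compact_support:
  fixes f :: "real ^ 2 \<Rightarrow> 'a::{banach,second_countable_topology}"
  assumes "continuous_on UNIV f" "\<And>x. rho x \<ge> K \<Longrightarrow> f x = 0"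
  shows "integrable lborel f"
proof -
  have "integrable lborel (\<lambda>x. indicator (cball 0 (sqrt \<bar>K\<bar>)) x *\<^sub>R f x)"
    by (rule borel_integrable_compact[OF compact_cball continuous_on_subset[OF assms(1)]]) auto
  also have "(\<lambda>x. indicator (cball 0 (sqrt \<bar>K\<bar>)) x *\<^sub>R f x) = f"
  proof
    fix x show "indicator (cball 0 (sqrt \<bar>K\<bar>)) x *\<^sub>R f x = f x"
    proof (cases "x \<in> cball 0 (sqrt \<bar>K\<bar>)")
      case False
      then have "(sqrt \<bar>K\<bar>)\<^sup>2 \<le> (norm x)\<^sup>2" by (intro power_mono) auto
      then show ?thesis using assms(2)[of x] by (simp add: rho_def)
    qed simp
  qed
  finally show ?thesis .
qed

lemma bounded_compact_support:
  fixes f :: "real ^ 2 \<Rightarrow> complex"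
  assumes c: "continuous_on UNIV f" and z: "\<And>x. rho x \<ge> K \<Longrightarrow> f x = 0"
  shows "\<exists>B\<ge>0. \<forall>x. norm (f x) \<le> B"
proof -
  have "compact (f ` cball 0 (sqrt \<bar>K\<bar>))"
    by (rule compact_continuous_image[OF continuous_on_subset[OF c]]) auto
  then have "bounded (f ` cball 0 (sqrt \<bar>K\<bar>))" by (rule compact_imp_bounded)
  then obtain B where B: "\<And>x. x \<in> cball 0 (sqrt \<bar>K\<bar>) \<Longrightarrow> norm (f x) \<le> B" unfolding bounded_iff by blast
  have "norm (f x) \<le> \<bar>B\<bar>" for x
  proof (cases "x \<in> cball 0 (sqrt \<bar>K\<bar>)")
    case True
    then show ?thesis using B[OF True] by simp
  next
    case False
    then have "(sqrt \<bar>K\<bar>)\<^sup>2 \<le> (norm x)\<^sup>2" by (intro power_mono) auto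
    then show ?thesis using z[of x] by (simp add: rho_def)
  qed
  then show ?thesis by (intro exI[of _ "\<bar>B\<bar>"]) auto
qed

lemma L2_loc_mult_integrable:
  fixes g :: "real ^ 2 \<Rightarrow> complex ^ 2"
  assumes g: "L2_loc g" and c: "continuous_on UNIV f" and z: "\<And>x. rho x \<ge> K \<Longrightarrow> f x = 0"
  shows "integrable lborel (\<lambda>x. g x $ j * f x)"
proof -
  obtain B where B: "B \<ge> 0" "\<And>x. norm (f x) \<le> B" using bounded_compact_support[OF c z] by blast
  let ?S = "cball 0 (sqrt \<bar>K\<bar>) :: (real^2) set"
  have gm: "g \<in> borel_measurable borel" using g by (simp add: L2_loc_def)
  have "set_integrable lborel ?S (\<lambda>x. (norm (g x))\<^sup>2)" using g by (auto simp: L2_loc_def)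
  moreover have "set_integrable lborel ?S (\<lambda>x. 1::real)"
    unfolding set_integrable_def by (rule borel_integrable_compact) auto
  ultimately have i: "set_integrable lborel ?S (\<lambda>x. B * ((norm (g x))\<^sup>2 + 1))"
    by (intro set_integrable_mult_right set_integral_add(1))
  show ?thesis
  proof (rule Bochner_Integration.integrable_bound[OF i[unfolded set_integrable_def]])
    have "(\<lambda>x. g x $ j) \<in> borel_measurable borel"
      by (rule measurable_compose[OF gm]) (intro borel_measurable_continuous_onI continuous_intros)
    moreover have "f \<in> borel_measurable borel" using c by (rule borel_measurable_continuous_onI)
    ultimately show "(\<lambda>x. g x $ j * f x) \<in> borel_measurable lborel" by simp
    show "AE x in lborel. norm (g x $ j * f x) \<le> norm (indicator ?S x *\<^sub>R (B * ((norm (g x))\<^sup>2 + 1)))"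
    proof (rule AE_I2)
      fix x :: "real^2"
      show "norm (g x $ j * f x) \<le> norm (indicator ?S x *\<^sub>R (B * ((norm (g x))\<^sup>2 + 1)))"
      proof (cases "x \<in> ?S")
        case True
        have n: "norm (g x $ j) \<le> (norm (g x))\<^sup>2 + 1"
        proof -
          have "norm (g x $ j) \<le> norm (g x)" by (rule Finite_Cartesian_Product.norm_nth_le)
          also have "\<dots> \<le> (norm (g x))\<^sup>2 + 1"
          proof -
            have "2 * norm (g x) \<le> (norm (g x))\<^sup>2 + 1"
              using zero_le_power2[of "norm (g x) - 1"] unfolding power2_diff by simp
            then show ?thesis using zero_le_power2[of "norm (g x)"] by linarith
          qed
          finally show ?thesis .
        qed
        have "norm (g x $ j * f x) \<le> ((norm (g x))\<^sup>2 + 1) * B"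
          unfolding norm_mult using n B by (intro mult_mono) auto
        then show ?thesis using True B by (simp add: mult.commute)
      next
        case False
        then have "(sqrt \<bar>K\<bar>)\<^sup>2 \<le> (norm x)\<^sup>2" by (intro power_mono) auto
        then show ?thesis using z[of x] by (simp add: rho_def)
      qed
    qed
  qed
qed

text \<open>The weak equation is tested with \<open>phi\<close> and the weak gradient with each
  \<open>psi\<close>; adding them puts all derivatives on the test function. From here on only the
  continuity of u is available, and it suffices.\<close>

lemma (in radial_profile) very_weak:
  assumes u: "helmholtz_solution V u" and s: "s\<^sup>2 = 1"
    and Vm: "V \<in> borel_measurable borel" and Vb: "\<And>x. \<bar>V x\<bar> \<le> B"
  shows "(LINT x|lborel. u x * zeta s x ^ m * (of_real (4 * (real m + 1)) * X1 (rho x)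
     + of_real (4 * rho x) * X2 (rho x) + of_real (V x) * X (rho x))) = 0"
proof -
  obtain g where g: "L2_loc g" "weak_gradient u g"
    "\<And>\<phi>. test_function \<phi> \<Longrightarrow> (LINT x|lborel. (\<Sum>j\<in>UNIV. g x $ j * pderiv_at j \<phi> x)) = (LINT x|lborel. complex_of_real (V x) * u x * \<phi> x)"
    and uc: "continuous_on UNIV u"
    using u unfolding helmholtz_solution_def by blast
  have psi0: "\<And>j x. rho x \<ge> K \<Longrightarrow> psi s m j x = 0" by (simp add: psi_def zero)
  have gi: "integrable lborel (\<lambda>x. g x $ j * psi s m j x)" for j
    by (rule L2_loc_mult_integrable[OF g(1) continuous_psi psi0])
  have 1: "(LINT x|lborel. g x $ 1 * psi s m 1 x) + (LINT x|lborel. g x $ 2 * psi s m 2 x)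
      = (LINT x|lborel. complex_of_real (V x) * u x * phi s m x)"
    using g(3)[OF phi_test[of s m]] unfolding pderiv_phi sum_2
    by (simp add: Bochner_Integration.integral_add[OF gi gi])
  have 2: "(LINT x|lborel. u x * psid s m j j x) = - (LINT x|lborel. g x $ j * psi s m j x)" for j
    using g(2)[unfolded weak_gradient_def, rule_format, OF psi_test[of s m j], of j] unfolding pderiv_psi .
  have di: "integrable lborel (\<lambda>x. u x * psid s m j j x)" for j
    by (rule integrable_compact_support[where K = K])
       (auto intro!: continuous_on_mult uc continuous_psid, simp add: psid_def zero)
  have 3: "(LINT x|lborel. u x * psid s m 1 1 x + u x * psid s m 2 2 x)
      = - (LINT x|lborel. complex_of_real (V x) * u x * phi s m x)"
    unfolding Bochner_Integration.integral_add[OF di di] 2 1[symmetric] by simp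
  have phic: "continuous_on UNIV (phi s m)"
    unfolding phi_def[abs_def] by (intro continuous_intros continuous_profiles continuous_on_zeta)
  have up: "integrable lborel (\<lambda>x. u x * phi s m x)"
    by (rule integrable_compact_support[where K = K]) (auto intro!: continuous_on_mult uc phic, simp add: phi_def zero)
  have vi: "integrable lborel (\<lambda>x. complex_of_real (V x) * u x * phi s m x)"
  proof (rule Bochner_Integration.integrable_bound[OF integrable_mult_right[OF up, of "of_real \<bar>B\<bar>"]])
    show "(\<lambda>x. complex_of_real (V x) * u x * phi s m x) \<in> borel_measurable lborel"
      using Vm borel_measurable_continuous_onI[OF uc] borel_measurable_continuous_onI[OF phic] by simp
    have "\<bar>V x\<bar> * (norm (u x) * norm (phi s m x)) \<le> \<bar>B\<bar> * (norm (u x) * norm (phi s m x))" for x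
      using Vb[of x] by (intro mult_right_mono) auto
    then show "AE x in lborel. norm (complex_of_real (V x) * u x * phi s m x) \<le> norm (complex_of_real \<bar>B\<bar> * (u x * phi s m x))"
      by (intro AE_I2) (simp add: norm_mult mult.assoc)
  qed
  have "(LINT x|lborel. (u x * psid s m 1 1 x + u x * psid s m 2 2 x) + complex_of_real (V x) * u x * phi s m x) = 0"
    by (subst Bochner_Integration.integral_add) (use di vi 3 in auto)
  moreover have "(u x * psid s m 1 1 x + u x * psid s m 2 2 x) + complex_of_real (V x) * u x * phi s m x
    = u x * zeta s x ^ m * (of_real (4 * (real m + 1)) * X1 (rho x)
     + of_real (4 * rho x) * X2 (rho x) + of_real (V x) * X (rho x))" for x
    unfolding distrib_left[symmetric] laplacian[OF s] phi_def by (simp add: algebra_simps)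
  ultimately show ?thesis by simp
qed

section \<open>Rotation averages\<close>

lemma polar_eq: "polar r \<theta> = (r * cos \<theta>) *\<^sub>R axis 1 1 + (r * sin \<theta>) *\<^sub>R axis 2 1"
  by (simp add: polar_def vec_eq_iff forall_2 axis_def)

lemma polar_nth [simp]: "polar r \<theta> $ 1 = r * cos \<theta>" "polar r \<theta> $ 2 = r * sin \<theta>"
  by (simp_all add: polar_def)

lemma rho_polar [simp]: "rho (polar r \<theta>) = r\<^sup>2"
  by (simp add: rho_eq power_mult_distrib flip: distrib_left)

lemma polar_exists: "\<exists>\<theta>. 0 \<le> \<theta> \<and> \<theta> < 2 * pi \<and> x = polar (norm x) \<theta>"
proof (cases "x = 0")
  case True
  then show ?thesis by (intro exI[of _ 0]) (simp add: vec_eq_iff forall_2)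
next
  case False
  then have n: "norm x > 0" by simp
  have "(x $ 1 / norm x)\<^sup>2 + (x $ 2 / norm x)\<^sup>2 = rho x / (norm x)\<^sup>2"
    by (simp add: rho_eq power_divide add_divide_distrib)
  then have "(x $ 1 / norm x)\<^sup>2 + (x $ 2 / norm x)\<^sup>2 = 1" using n by (simp add: rho_def)
  from sincos_total_2pi[OF this] obtain t where "0 \<le> t" "t < 2 * pi" "x $ 1 / norm x = cos t" "x $ 2 / norm x = sin t" by blast
  moreover from this have "norm x * cos t = x $ 1" "norm x * sin t = x $ 2"
    using n by (metis nonzero_mult_div_cancel_left times_divide_eq_right less_irrefl)+
  then have "x = polar (norm x) t" unfolding vec_eq_iff forall_2 polar_nth by simp
  ultimately show ?thesis by blast
qed

definition rot :: "real \<Rightarrow> real ^ 2 \<Rightarrow> real ^ 2" where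
  "rot a x = (cos a * x $ 1 - sin a * x $ 2) *\<^sub>R axis 1 1 + (sin a * x $ 1 + cos a * x $ 2) *\<^sub>R axis 2 1"

lemma rot_nth [simp]: "rot a x $ 1 = cos a * x $ 1 - sin a * x $ 2" "rot a x $ 2 = sin a * x $ 1 + cos a * x $ 2"
  by (simp_all add: rot_def axis_def)

lemma rho_rot [simp]: "rho (rot a x) = rho x"
proof -
  have "(c * p - s * q)\<^sup>2 + (s * p + c * q)\<^sup>2 = (s\<^sup>2 + c\<^sup>2) * (p\<^sup>2 + q\<^sup>2)" for c s p q :: real
    by (simp add: power2_eq_square algebra_simps)
  from this[of "cos a" _ "sin a"] show ?thesis by (simp add: rho_eq)
qed

lemma norm_rot [simp]: "norm (rot a x) = norm x"
  using rho_rot[of a x] unfolding rho_def by simp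

lemma rot_polar: "rot a (polar r \<theta>) = polar r (\<theta> + a)"
  by (simp add: vec_eq_iff forall_2 cos_add sin_add algebra_simps)

lemma rot_minus [simp]: "rot (- a) (rot a x) = x" "rot a (rot (- a) x) = x"
proof -
  have 1: "cos a * (cos a * t) + sin a * (sin a * t) = t" for t
    using sin_cos_squared_add3[of a] by (metis distrib_right mult.assoc mult_1)
  show "rot (- a) (rot a x) = x" "rot a (rot (- a) x) = x"
    by (simp_all add: vec_eq_iff forall_2 algebra_simps 1)
qed

lemma orthogonal_rot: "orthogonal_transformation (rot a)"
  unfolding orthogonal_transformation
proof
  show "linear (rot a)" by (rule linearI) (simp_all add: vec_eq_iff forall_2 algebra_simps)
qed simp

lemma continuous_rot: "continuous_on A (\<lambda>p. rot (fst p) (snd p))"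
  unfolding rot_def by (intro continuous_intros)

lemma rot_measurable: "rot a \<in> borel_measurable borel"
  unfolding rot_def[abs_def] by (intro borel_measurable_continuous_onI continuous_intros)

lemma distr_rot: "distr lborel borel (rot a) = lborel"
proof (rule lborel_eqI[symmetric])
  fix l u :: "real^2" assume lu: "\<And>b. b \<in> Basis \<Longrightarrow> l \<bullet> b \<le> u \<bullet> b"
  have v: "rot a -` box l u = rot (- a) ` box l u"
    by (auto intro: image_eqI[of _ _ "rot a _"])
  have o: "open (rot a -` box l u)"
    by (rule open_vimage) (auto simp: rot_def intro!: continuous_intros)
  have "bounded (rot (- a) ` box l u)"
    using orthogonal_rot[of "- a"] by (intro bounded_linear_image) (auto simp: orthogonal_transformation linear_conv_bounded_linear)
  then have fin: "emeasure lborel (rot a -` box l u) < \<infinity>" unfolding v by (rule emeasure_bounded_finite)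
  have "measure lebesgue (rot (- a) ` box l u) = measure lebesgue (box l u)"
    by (rule measure_orthogonal_image[OF orthogonal_rot]) simp
  then have "measure lborel (rot a -` box l u) = measure lborel (box l u)"
    unfolding v[symmetric] using o by (simp add: measure_completion)
  then have "emeasure lborel (rot a -` box l u) = emeasure lborel (box l u)"
    using fin emeasure_lborel_box_finite[of l u] by (simp add: emeasure_eq_ennreal_measure)
  also have "\<dots> = ennreal (\<Prod>b\<in>Basis. (u - l) \<bullet> b)" using lu by (rule emeasure_lborel_box)
  finally show "emeasure (distr lborel borel (rot a)) (box l u) = ennreal (\<Prod>b\<in>Basis. (u - l) \<bullet> b)"
    using rot_measurable[of a] by (simp add: emeasure_distr)
qed simp

lemma integral_rot:
  fixes F :: "real ^ 2 \<Rightarrow> complex"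
  assumes "F \<in> borel_measurable borel"
  shows "(LINT x|lborel. F (rot a x)) = (LINT x|lborel. F x)"
  using integral_distr[of "rot a" lborel borel F] rot_measurable assms by (simp add: distr_rot)

lemma rho_measurable [measurable]: "rho \<in> borel_measurable borel"
  by (intro borel_measurable_continuous_onI continuous_on_rho)

text \<open>The disc |x|^2 <= a has area pi a, linear in a. Hence |x|^2 is distributed with constant
  density pi on the half-line, and no Jacobian of polar coordinates appears.\<close>

lemma distr_rho: "distr lborel borel rho = density lborel (\<lambda>r. ennreal (pi * indicator {0<..} r))"
proof (rule measure_eqI_generator_eq[where E = "range (\<lambda>a::real. {..a})" and \<Omega> = UNIV and A = "\<lambda>i::nat. {..real i}"])
  show "Int_stable (range (\<lambda>a::real. {..a}))" by (auto simp: Int_stable_def intro: image_eqI)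
  fix X :: "real set" assume "X \<in> range (\<lambda>a. {..a})"
  then obtain a where X: "X = {..a}" by blast
  have r: "emeasure (density lborel (\<lambda>r. ennreal (pi * indicator {0<..} r))) {..a} = ennreal pi * emeasure lborel {0<..a}"
  proof -
    have "emeasure (density lborel (\<lambda>r. ennreal (pi * indicator {0<..} r))) {..a}
        = (\<integral>\<^sup>+ r. ennreal (pi * indicator {0<..} r) * indicator {..a} r \<partial>lborel)"
      by (subst emeasure_density) auto
    also have "\<dots> = (\<integral>\<^sup>+ r. ennreal pi * indicator {0<..a} r \<partial>lborel)"
      by (intro nn_integral_cong) (auto simp: indicator_def)
    also have "\<dots> = ennreal pi * emeasure lborel {0<..a}" by (rule nn_integral_cmult_indicator) simp
    finally show ?thesis .
  qed
  have l: "emeasure (distr lborel borel rho) {..a} = ennreal pi * emeasure lborel {0<..a}"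
  proof (cases "a \<ge> 0")
    case True
    have "rho -` {..a} = cball 0 (sqrt a)"
      using True by (auto simp: rho_def real_le_rsqrt sqrt_le_D real_sqrt_le_iff dest: real_le_rsqrt) (metis norm_ge_zero power_mono real_sqrt_pow2)
    then have "emeasure (distr lborel borel rho) {..a} = emeasure lborel (cball (0::real^2) (sqrt a))"
      by (simp add: emeasure_distr)
    also have "\<dots> = ennreal (pi * a)" using True using unit_ball_vol_even[of 1] by (subst emeasure_cball) auto
    finally show ?thesis using True by (simp add: ennreal_mult)
  next
    case False
    have "x \<notin> rho -` {..a}" for x using order.trans[OF rho_nonneg[of x], of a] False by auto
    then have "rho -` {..a} = {}" by blast
    then show ?thesis using False by (simp add: emeasure_distr)
  qed
  show "emeasure (distr lborel borel rho) X = emeasure (density lborel (\<lambda>r. ennreal (pi * indicator {0<..} r))) X"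
    unfolding X r l ..
next
  show "emeasure (distr lborel borel rho) {..real i} \<noteq> \<infinity>" for i :: nat
  proof -
    have "rho -` {..real i} \<subseteq> cball 0 (sqrt (real i))" by (auto simp: rho_def real_le_rsqrt)
    then have "bounded (rho -` {..real i})" using bounded_cball bounded_subset by blast
    from emeasure_bounded_finite[OF this] show ?thesis by (simp add: emeasure_distr)
  qed
  have "sets borel = sigma_sets UNIV (range (\<lambda>a::real. {..a}))"
    by (subst borel_eq_atMost) (auto simp: sets_measure_of)
  then show "sets (distr lborel borel rho) = sigma_sets UNIV (range (\<lambda>a::real. {..a}))"
    "sets (density lborel (\<lambda>r. ennreal (pi * indicator {0<..} r))) = sigma_sets UNIV (range (\<lambda>a::real. {..a}))" by simp_all
  show "(\<Union>i::nat. {..real i}) = UNIV" by (auto intro: real_arch_simple)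
  show "range (\<lambda>i::nat. {..real i}) \<subseteq> range (\<lambda>a::real. {..a})" by auto
  show "range (\<lambda>a::real. {..a}) \<subseteq> Pow UNIV" by auto
qed

lemma integral_rho:
  fixes f :: "real \<Rightarrow> complex"
  assumes f: "f \<in> borel_measurable borel"
  shows "(LINT x|lborel. f (rho x)) = pi * (LBINT r:{0<..}. f r)"
proof -
  have "(LINT x|lborel. f (rho x)) = (LINT r|distr lborel borel rho. f r)"
    using f by (subst integral_distr) auto
  also have "\<dots> = (LINT r|lborel. (pi * indicator {0<..} r) *\<^sub>R f r)"
    unfolding distr_rho using f by (subst integral_density) auto
  also have "\<dots> = pi *\<^sub>R (LBINT r:{0<..}. f r)"
    unfolding set_lebesgue_integral_def integral_scaleR_right[symmetric] by simp
  finally show ?thesis by (simp add: scaleR_conv_of_real)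
qed

definition cint :: "(real ^ 2 \<Rightarrow> complex) \<Rightarrow> real \<Rightarrow> complex" where
  "cint U r = integral {0..2 * pi} (\<lambda>\<theta>. U (polar r \<theta>))"

lemma continuous_polar: "continuous_on A (\<lambda>p. polar (f p) (g p))"
  if "continuous_on A f" "continuous_on A g" for A :: "'a::t2_space set"
  unfolding polar_eq by (intro continuous_intros that)

lemma integral_period_shift:
  fixes g :: "real \<Rightarrow> complex"
  assumes c: "continuous_on UNIV g" and per: "\<And>t. g (t + 2 * pi) = g t" and t: "0 \<le> t" "t \<le> 2 * pi"
  shows "integral {0..2 * pi} (\<lambda>a. g (t + a)) = integral {0..2 * pi} g"
proof -
  have sub: "continuous_on A g" for A using c by (rule continuous_on_subset) auto
  have i: "g integrable_on {a..b}" for a b by (rule integrable_continuous_interval[OF sub])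
  have sh: "integral {a..b} (\<lambda>x. g (x + c)) = integral {a + c..b + c} g" for a b c
    using integral_shift[of a c b g] sub by (simp add: o_def)
  have "integral {0..2 * pi} (\<lambda>a. g (t + a)) = integral {t..2 * pi + t} g"
    using sh[of 0 "2 * pi" t] by (simp add: add.commute)
  also have "\<dots> = integral {t..2 * pi} g + integral {2 * pi..2 * pi + t} g"
    by (rule Henstock_Kurzweil_Integration.integral_combine[symmetric]) (use t i in auto)
  also have "integral {2 * pi..2 * pi + t} g = integral {0..t} g"
    using sh[of 0 t "2 * pi"] per by (simp add: add.commute)
  also have "integral {t..2 * pi} g + integral {0..t} g = integral {0..2 * pi} g"
    using Henstock_Kurzweil_Integration.integral_combine[of 0 t "2 * pi" g] t i by (simp add: add.commute)
  finally show ?thesis .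
qed

lemma cint_rot:
  assumes U: "continuous_on UNIV U"
  shows "integral {0..2 * pi} (\<lambda>a. U (rot a x)) = cint U (sqrt (rho x))"
proof -
  obtain t where t: "0 \<le> t" "t < 2 * pi" "x = polar (norm x) t" using polar_exists by blast
  define r where "r = norm x"
  have r: "sqrt (rho x) = r" by (simp add: rho_def r_def)
  have "rot a x = polar r (t + a)" for a using t(3) rot_polar[of a r t] by (simp add: r_def)
  then have "integral {0..2 * pi} (\<lambda>a. U (rot a x)) = integral {0..2 * pi} (\<lambda>a. U (polar r (t + a)))" by simp
  also have "\<dots> = integral {0..2 * pi} (\<lambda>a. U (polar r a))"
  proof (rule integral_period_shift[of "\<lambda>a. U (polar r a)"])
    show "continuous_on UNIV (\<lambda>a. U (polar r a))"
      by (intro continuous_on_compose2[OF U] continuous_polar continuous_intros) auto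
    show "U (polar r (t + 2 * pi)) = U (polar r t)" for t by (simp add: polar_def)
  qed (use t in auto)
  finally show ?thesis by (simp add: cint_def r)
qed

lemma continuous_cint:
  assumes U: "continuous_on UNIV U"
  shows "continuous_on UNIV (cint U)"
proof -
  have "continuous_on UNIV (\<lambda>r. integral (cbox 0 (2 * pi)) (\<lambda>\<theta>. U (polar r \<theta>)))"
    by (rule integral_continuous_on_param)
       (auto simp: case_prod_beta intro!: continuous_on_compose2[OF U] continuous_polar continuous_intros)
  then show ?thesis by (simp add: cint_def[abs_def])
qed

text \<open>Polar coordinates by symmetry: rotation leaves the integral unchanged, Fubini moves the
  average over angles inside, and the average depends on |x|^2 only, whose distribution is known.
  The factor 2 is 2 pi from the average over pi from the density.\<close>

lemma integral_polar:
  assumes U: "continuous_on UNIV U" and P: "P \<in> borel_measurable borel"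
    and B: "\<And>r. norm (P r) \<le> B" and K: "\<And>r. r \<ge> K \<Longrightarrow> P r = 0"
  shows "2 * (LINT x|lborel. U x * P (rho x)) = (LBINT r:{0<..}. cint U (sqrt r) * P r)"
proof -
  have Um: "U \<in> borel_measurable borel" using U by (rule borel_measurable_continuous_onI)
  let ?S = "{0..2 * pi} \<times> cball (0::real^2) (sqrt \<bar>K\<bar>)"
  define W where "W a x = indicator {0..2 * pi} a *\<^sub>R (U (rot a x) * P (rho x))" for a x
  have Uc: "continuous_on A (\<lambda>p. U (rot (fst p) (snd p)))" for A
    by (intro continuous_on_compose2[OF U] continuous_rot) auto
  have W: "integrable (lborel \<Otimes>\<^sub>M lborel) (case_prod W)"
  proof (rule Bochner_Integration.integrable_bound)
    have "integrable lborel (\<lambda>p. indicator ?S p *\<^sub>R (U (rot (fst p) (snd p))))"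
      by (rule borel_integrable_compact[OF compact_Times[OF compact_Icc compact_cball] Uc])
    then show "integrable (lborel \<Otimes>\<^sub>M lborel) (\<lambda>p. of_real \<bar>B\<bar> * (indicator ?S p *\<^sub>R (U (rot (fst p) (snd p)))))"
      unfolding lborel_prod by (rule integrable_mult_right)
    have "(\<lambda>p. U (rot (fst p) (snd p))) \<in> borel_measurable borel"
      using Uc[of UNIV] by (rule borel_measurable_continuous_onI)
    then have "(\<lambda>p::real \<times> (real^2). U (rot (fst p) (snd p))) \<in> borel_measurable (borel \<Otimes>\<^sub>M borel)"
      by (simp add: borel_prod)
    then show "case_prod W \<in> borel_measurable (lborel \<Otimes>\<^sub>M lborel)"
      unfolding W_def case_prod_beta using P by measurable
    show "AE p in lborel \<Otimes>\<^sub>M lborel. norm (case_prod W p) \<le> norm (of_real \<bar>B\<bar> * (indicator ?S p *\<^sub>R (U (rot (fst p) (snd p)))))"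
    proof (rule AE_I2)
      fix p :: "real \<times> (real^2)"
      obtain a x where p: "p = (a, x)" by fastforce
      show "norm (case_prod W p) \<le> norm (of_real \<bar>B\<bar> * (indicator ?S p *\<^sub>R (U (rot (fst p) (snd p)))))"
      proof (cases "p \<in> ?S")
        case True
        have "norm (U (rot a x)) * norm (P (rho x)) \<le> norm (U (rot a x)) * \<bar>B\<bar>"
          using B[of "rho x"] by (intro mult_left_mono) auto
        then show ?thesis using True by (simp add: p W_def norm_mult mult.commute)
      next
        case False
        have "W a x = 0"
        proof (cases "a \<in> {0..2 * pi}")
          case True
          with False have "x \<notin> cball 0 (sqrt \<bar>K\<bar>)" by (simp add: p)
          then have "(sqrt \<bar>K\<bar>)\<^sup>2 \<le> (norm x)\<^sup>2" by (intro power_mono) auto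
          then show ?thesis using K[of "rho x"] by (simp add: rho_def W_def)
        qed (simp add: W_def)
        then show ?thesis by (simp add: p)
      qed
    qed
  qed
  have "(LINT a|lborel. (LINT x|lborel. W a x)) = (LINT x|lborel. (LINT a|lborel. W a x))"
    by (rule lborel_pair.Fubini_integral[OF W, symmetric])
  also have "(LINT a|lborel. (LINT x|lborel. W a x)) = (LINT a|lborel. indicator {0..2 * pi} a *\<^sub>R (LINT x|lborel. U x * P (rho x)))"
  proof (rule Bochner_Integration.integral_cong[OF refl])
    fix a
    have "(LINT x|lborel. U (rot a x) * P (rho (rot a x))) = (LINT x|lborel. U x * P (rho x))"
      by (rule integral_rot) (use Um P in measurable)
    then show "(LINT x|lborel. W a x) = indicator {0..2 * pi} a *\<^sub>R (LINT x|lborel. U x * P (rho x))"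
      unfolding W_def integral_scaleR_right by simp
  qed
  also have "\<dots> = of_real (2 * pi) * (LINT x|lborel. U x * P (rho x))"
    by (simp add: scaleR_conv_of_real)
  also have "(LINT x|lborel. (LINT a|lborel. W a x)) = (LINT x|lborel. cint U (sqrt (rho x)) * P (rho x))"
  proof (rule Bochner_Integration.integral_cong[OF refl])
    fix x
    have c: "continuous_on {0..2 * pi} (\<lambda>a. U (rot a x))"
      by (rule continuous_on_compose2[OF U]) (auto simp: rot_def intro!: continuous_intros)
    have "(LINT a|lborel. W a x) = (LBINT a:{0..2 * pi}. U (rot a x)) * P (rho x)"
      unfolding W_def set_lebesgue_integral_def integral_mult_left_zero[symmetric] by simp
    also have "(LBINT a:{0..2 * pi}. U (rot a x)) = integral {0..2 * pi} (\<lambda>a. U (rot a x))"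
      by (rule set_borel_integral_eq_integral(2)[OF borel_integrable_atLeastAtMost'[OF c]])
    finally show "(LINT a|lborel. W a x) = cint U (sqrt (rho x)) * P (rho x)" by (simp add: cint_rot[OF U])
  qed
  also have "\<dots> = pi * (LBINT r:{0<..}. cint U (sqrt r) * P r)"
  proof (rule integral_rho[of "\<lambda>r. cint U (sqrt r) * P r"])
    have "(\<lambda>r. cint U (sqrt r)) \<in> borel_measurable borel"
      by (intro borel_measurable_continuous_onI continuous_on_compose2[OF continuous_cint[OF U]] continuous_intros) auto
    then show "(\<lambda>r. cint U (sqrt r) * P r) \<in> borel_measurable borel" using P by measurable
  qed
  finally have "of_real pi * (2 * (LINT x|lborel. U x * P (rho x))) = of_real pi * (LBINT r:{0<..}. cint U (sqrt r) * P r)"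
    by (simp add: mult_ac)
  then show ?thesis by simp
qed

section \<open>Fourier modes of a weak solution\<close>

lemma antiderivative_UNIV:
  fixes f :: "real \<Rightarrow> complex"
  assumes "continuous_on UNIV f"
  shows "\<exists>F. F a = 0 \<and> (\<forall>x. (F has_vector_derivative f x) (at x))"
proof -
  obtain F where "\<And>x. (F has_vector_derivative f x) (at x)"
    using einterval_antiderivative[of "-\<infinity>" \<infinity> f] assms by (auto simp: continuous_on_eq_continuous_at)
  then show ?thesis by (intro exI[of _ "\<lambda>x. F x - F a"]) (auto intro!: derivative_eq_intros)
qed

lemma continuous_on_vector_derivative:
  assumes "\<And>x. (F has_vector_derivative f x) (at x)"
  shows "continuous_on A F"
  by (intro continuous_at_imp_continuous_on ballI has_vector_derivative_continuous[OF assms])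

text \<open>Applied twice to a function f, it produces a profile supported to the left of K whose
  second derivative is f.\<close>

lemma antiderivative_vanishing:
  fixes f :: "real \<Rightarrow> complex"
  assumes f: "continuous_on UNIV f" and K: "\<And>x. x \<ge> K \<Longrightarrow> f x = 0"
  shows "\<exists>F. (\<forall>x. (F has_vector_derivative f x) (at x)) \<and> (\<forall>x\<ge>K. F x = 0)"
proof -
  obtain F where F: "F K = 0" "\<And>x. (F has_vector_derivative f x) (at x)"
    using antiderivative_UNIV[OF f] by blast
  have "\<exists>c. \<forall>x\<in>{K..}. F x = c"
  proof (rule has_derivative_zero_constant)
    fix x assume "x \<in> {K..}"
    then have "(F has_vector_derivative 0) (at x)" using F(2)[of x] K[of x] by simp
    then show "(F has_derivative (\<lambda>h. 0)) (at x within {K..})"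
      by (simp add: has_vector_derivative_def has_derivative_at_withinI)
  qed simp
  then have "\<forall>x\<ge>K. F x = 0" using F(1) by force
  then show ?thesis using F(2) by blast
qed

lemma LBINT_halfline_eq_integral:
  fixes g :: "real \<Rightarrow> complex"
  assumes m: "g \<in> borel_measurable borel" and B: "\<And>r. norm (g r) \<le> B" and K: "\<And>r. r \<ge> K \<Longrightarrow> g r = 0"
    and pos: "K > 0"
  shows "(LBINT r:{0<..}. g r) = integral {0..K} g"
proof -
  have "(LBINT r:{0<..}. g r) = (LBINT r:{0..K}. g r)"
    unfolding set_lebesgue_integral_def
  proof (rule integral_cong_AE)
    show "AE x in lborel. indicator {0<..} x *\<^sub>R g x = indicator {0..K} x *\<^sub>R g x"
      using AE_lborel_singleton[of 0]
    proof eventually_elim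
      case (elim x)
      then show ?case using K[of x] by (auto simp: indicator_def)
    qed
  qed (use m in simp_all)
  also have "\<dots> = integral {0..K} g"
  proof (rule set_borel_integral_eq_integral(2))
    show "set_integrable lborel {0..K} g"
      unfolding set_integrable_def
    proof (rule Bochner_Integration.integrable_bound)
      show "integrable lborel (\<lambda>x. indicator {0..K} x *\<^sub>R B)"
        by (rule borel_integrable_compact) auto
      show "AE x in lborel. norm (indicator {0..K} x *\<^sub>R g x) \<le> norm (indicator {0..K} x *\<^sub>R B)"
        using order.trans[OF B abs_ge_self] by (intro AE_I2) (auto simp: indicator_def)
    qed (use m in simp)
  qed
  finally show ?thesis .
qed

definition two_step :: "real \<Rightarrow> real \<Rightarrow> real \<Rightarrow> real \<Rightarrow> real" where
  "two_step c k1 k2 r = (if r < c then k1 else k2)"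

text \<open>The equation for a single mode in the variable r = |x|^2, with the interface at
  \<epsilon>^2. The second derivative f of the profile is arbitrary, which is what du Bois-Reymond's
  argument asks for.\<close>

lemma radial_weak_form:
  fixes f C :: "real \<Rightarrow> complex"
  assumes \<epsilon>: "\<epsilon> > 0" and u: "helmholtz_solution (\<lambda>x. two_step \<epsilon> k1 k2 (norm x)) u" and s: "s\<^sup>2 = 1"
    and f: "continuous_on UNIV f" "\<And>x. x \<ge> K \<Longrightarrow> f x = 0"
    and X1: "\<And>x. (X1 has_vector_derivative f x) (at x)" "\<And>x. x \<ge> K \<Longrightarrow> X1 x = 0"
    and X: "\<And>x. (X has_vector_derivative X1 x) (at x)" "\<And>x. x \<ge> K \<Longrightarrow> X x = 0"
    and K: "K > 0"
    and C: "\<And>r. C r = cint (\<lambda>x. u x * zeta s x ^ m) (sqrt r)"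
  shows "integral {0..K} (\<lambda>r. C r * (of_real (4 * (real m + 1)) * X1 r + of_real (4 * r) * f r
     + of_real (two_step (\<epsilon>\<^sup>2) k1 k2 r) * X r)) = 0"
proof -
  interpret rp: radial_profile X X1 f K
    by unfold_locales (simp_all add: X X1 f continuous_on_subset[OF f(1)])
  have X1c: "continuous_on A X1" and Xc: "continuous_on A X" for A
    using continuous_on_vector_derivative X1(1) X(1) by blast+
  have fc: "continuous_on A f" for A using f(1) by (rule continuous_on_subset) auto
  define v where "v = two_step (\<epsilon>\<^sup>2) k1 k2"
  have vm: "v \<in> borel_measurable borel" unfolding v_def two_step_def by measurable
  have vb: "\<bar>v r\<bar> \<le> \<bar>k1\<bar> + \<bar>k2\<bar>" for r by (auto simp: v_def two_step_def)
  have vr: "two_step \<epsilon> k1 k2 (norm x) = v (rho x)" for x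
  proof -
    have "norm x < \<epsilon> \<longleftrightarrow> (norm x)\<^sup>2 < \<epsilon>\<^sup>2"
      using \<epsilon> by (metis abs_norm_cancel abs_of_pos abs_square_less_1 power2_less_eq_zero_iff norm_ge_zero power_less_imp_less_base power_strict_mono zero_less_numeral less_imp_le)
    then show ?thesis by (simp add: v_def two_step_def rho_def)
  qed
  define P0 where "P0 r = of_real (4 * (real m + 1)) * X1 r + of_real (4 * r) * f r + of_real (v r) * X r" for r
  \<comment> \<open>The profiles live on the whole line and may be unbounded to the left; cutting at
    0 gives the global bound that \<open>integral_polar\<close> expects and changes nothing on
    values of |x|^2.\<close>
  define P where "P r = (if r < 0 then 0 else P0 r)" for r
  have uc: "continuous_on UNIV u" using u by (simp add: helmholtz_solution_def)
  define U where "U = (\<lambda>x. u x * zeta s x ^ m)"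
  have Uc: "continuous_on UNIV U" unfolding U_def by (intro continuous_intros uc continuous_on_zeta)
  have P0m: "P0 \<in> borel_measurable borel"
    unfolding P0_def using borel_measurable_continuous_onI[OF X1c] borel_measurable_continuous_onI[OF Xc]
      borel_measurable_continuous_onI[OF fc] vm by measurable
  then have Pm: "P \<in> borel_measurable borel" unfolding P_def[abs_def] by measurable
  have P0: "P r = 0" if "r \<ge> K" for r using that f(2) X1(2) X(2) by (simp add: P_def P0_def)
  have cb: "\<exists>B\<ge>0. \<forall>r\<in>{0..K}. norm (h r) \<le> B" if "continuous_on {0..K} h" for h :: "real \<Rightarrow> complex"
  proof -
    have "bounded (h ` {0..K})" using that by (intro compact_imp_bounded compact_continuous_image) auto
    then show ?thesis unfolding bounded_pos by (meson imageI less_imp_le)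
  qed
  have c1: "continuous_on {0..K} (\<lambda>r. of_real (4 * (real m + 1)) * X1 r + of_real (4 * r) * f r)"
    by (intro continuous_intros X1c fc)
  obtain B1 where B1: "B1 \<ge> 0" "\<And>r. r \<in> {0..K} \<Longrightarrow> norm (of_real (4 * (real m + 1)) * X1 r + of_real (4 * r) * f r) \<le> B1"
    using cb[OF c1] by blast
  obtain B2 where B2: "B2 \<ge> 0" "\<And>r. r \<in> {0..K} \<Longrightarrow> norm (X r) \<le> B2" using cb[OF Xc] by blast
  define B where "B = B1 + (\<bar>k1\<bar> + \<bar>k2\<bar>) * B2"
  have Bn: "B \<ge> 0" unfolding B_def using B1(1) B2(1) by simp
  have PB: "norm (P r) \<le> B" for r
  proof (cases "r \<in> {0..K}")
    case True
    have "norm (P r) \<le> norm (of_real (4 * (real m + 1)) * X1 r + of_real (4 * r) * f r) + norm (of_real (v r) * X r)"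
      using True unfolding P_def P0_def by (auto intro: norm_triangle_ineq)
    also have "norm (of_real (v r) * X r) \<le> (\<bar>k1\<bar> + \<bar>k2\<bar>) * B2"
      unfolding norm_mult norm_of_real using vb[of r] B2(2)[OF True] by (intro mult_mono) auto
    finally show ?thesis using B1(2)[OF True] unfolding B_def by linarith
  next
    case False
    then have "P r = 0" using P0[of r] by (auto simp: P_def)
    then show ?thesis using Bn by simp
  qed
  have "(LINT x|lborel. u x * zeta s x ^ m * (of_real (4 * (real m + 1)) * X1 (rho x)
     + of_real (4 * rho x) * f (rho x) + of_real (two_step \<epsilon> k1 k2 (norm x)) * X (rho x))) = 0"
    by (rule rp.very_weak[OF u s, of "\<bar>k1\<bar> + \<bar>k2\<bar>"]) (unfold vr, use vm vb in measurable)
  then have "(LINT x|lborel. U x * P (rho x)) = 0"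
    unfolding vr U_def P_def P0_def using rho_nonneg by (simp add: not_less[symmetric] del: not_less)
  then have "(LBINT r:{0<..}. cint U (sqrt r) * P r) = 0"
    using integral_polar[OF Uc Pm PB P0] by simp
  then have z: "(LBINT r:{0<..}. C r * P r) = 0" by (simp add: C U_def)
  have Cc: "continuous_on A C" for A
    unfolding C[abs_def] U_def[symmetric]
    by (rule continuous_on_compose2[OF continuous_cint[OF Uc]]) (auto intro!: continuous_intros)
  obtain BC where BC: "BC \<ge> 0" "\<And>r. r \<in> {0..K} \<Longrightarrow> norm (C r) \<le> BC" using cb[OF Cc] by blast
  have "(LBINT r:{0<..}. C r * P r) = integral {0..K} (\<lambda>r. C r * P r)"
  proof (rule LBINT_halfline_eq_integral[OF _ _ _ K])
    show "(\<lambda>r. C r * P r) \<in> borel_measurable borel"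
      using borel_measurable_continuous_onI[OF Cc] Pm by measurable
    show "norm (C r * P r) \<le> BC * B" for r
    proof (cases "r \<in> {0..K}")
      case True
      then show ?thesis unfolding norm_mult using BC PB[of r] by (intro mult_mono) auto
    next
      case False
      then have "P r = 0" using P0[of r] by (auto simp: P_def)
      then show ?thesis using Bn BC(1) by simp
    qed
  qed (simp add: P0)
  also have "\<dots> = integral {0..K} (\<lambda>r. C r * P0 r)" by (rule integral_cong) (simp add: P_def)
  finally show ?thesis using z unfolding P0_def v_def by simp
qed

text \<open>du Bois-Reymond: the weak form says that \<open>4 r C - B\<close> is orthogonal to every continuous \<open>f\<close>, hence zero.\<close>

lemma radial_regularity:
  fixes C A B :: "real \<Rightarrow> complex"
  assumes \<epsilon>: "\<epsilon> > 0" and u: "helmholtz_solution (\<lambda>x. two_step \<epsilon> k1 k2 (norm x)) u" and s: "s\<^sup>2 = 1"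
    and C: "\<And>r. C r = cint (\<lambda>x. u x * zeta s x ^ m) (sqrt r)"
    and A: "A 0 = 0" "\<And>x. (A has_vector_derivative C x) (at x)"
    and P: "\<And>r. P r = of_real k1 * A (min r (\<epsilon>\<^sup>2)) + of_real k2 * (A (max r (\<epsilon>\<^sup>2)) - A (\<epsilon>\<^sup>2))"
    and B: "B 0 = 0" "\<And>x. (B has_vector_derivative of_real (4 * (real m + 1)) * C x - P x) (at x)"
    and r: "r \<ge> 0"
  shows "of_real (4 * r) * C r = B r"
proof -
  have uc: "continuous_on UNIV u" using u by (simp add: helmholtz_solution_def)
  define U where "U = (\<lambda>x. u x * zeta s x ^ m)"
  have Uc: "continuous_on UNIV U" unfolding U_def by (intro continuous_intros uc continuous_on_zeta)
  have Cc: "continuous_on S C" for S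
    unfolding C[abs_def] U_def[symmetric]
    by (rule continuous_on_compose2[OF continuous_cint[OF Uc]]) (auto intro!: continuous_intros)
  have Ac: "continuous_on S A" and Bc: "continuous_on S B" for S
    by (rule continuous_on_vector_derivative[OF A(2)], rule continuous_on_vector_derivative[OF B(2)])
  have Pc: "continuous_on S P" for S
    unfolding P[abs_def] by (intro continuous_intros continuous_on_compose2[OF Ac[of UNIV]]) auto
  have P': "(P has_vector_derivative of_real (two_step (\<epsilon>\<^sup>2) k1 k2 x) * C x) (at x)" if "x \<noteq> \<epsilon>\<^sup>2" for x
  proof (cases "x < \<epsilon>\<^sup>2")
    case True
    have "((\<lambda>r. of_real k1 * A r) has_vector_derivative of_real k1 * C x) (at x)"
      by (intro has_vector_derivative_mult_right A)
    then have "(P has_vector_derivative of_real k1 * C x) (at x)"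
      by (rule has_vector_derivative_transform_within_open[where S = "{..<\<epsilon>\<^sup>2}"]) (use True in \<open>auto simp: P min_def max_def\<close>)
    then show ?thesis using True by (simp add: two_step_def)
  next
    case False
    have "((\<lambda>r. of_real k1 * A (\<epsilon>\<^sup>2) + of_real k2 * (A r - A (\<epsilon>\<^sup>2))) has_vector_derivative of_real k2 * C x) (at x)"
      by (auto intro!: derivative_eq_intros A)
    then have "(P has_vector_derivative of_real k2 * C x) (at x)"
      by (rule has_vector_derivative_transform_within_open[where S = "{\<epsilon>\<^sup>2<..}"]) (use False that in \<open>auto simp: P min_def max_def\<close>)
    then show ?thesis using False by (simp add: two_step_def)
  qed
  define G where "G r = of_real (4 * r) * C r - B r" for r
  have Gc: "continuous_on S G" for S unfolding G_def by (intro continuous_intros Cc Bc)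
  define K where "K = r + 1"
  have K: "K > 0" "r < K" using r by (auto simp: K_def)
  \<comment> \<open>The conjugate of G times a weight positive on [0, K) makes G f nonnegative, so
    the vanishing of its integral forces G = 0 there.\<close>
  define f where "f x = cnj (G x) * of_real (max 0 (K - x))" for x
  have fc: "continuous_on UNIV f" unfolding f_def by (intro continuous_intros Gc)
  have f0: "f x = 0" if "x \<ge> K" for x using that by (simp add: f_def)
  obtain X1 where X1: "\<And>x. (X1 has_vector_derivative f x) (at x)" "\<And>x. x \<ge> K \<Longrightarrow> X1 x = 0"
    using antiderivative_vanishing[OF fc f0] by blast
  have X1c: "continuous_on S X1" for S by (rule continuous_on_vector_derivative[OF X1(1)])
  obtain X where X: "\<And>x. (X has_vector_derivative X1 x) (at x)" "\<And>x. x \<ge> K \<Longrightarrow> X x = 0"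
    using antiderivative_vanishing[OF X1c X1(2)] by blast
  have Xc: "continuous_on S X" for S by (rule continuous_on_vector_derivative[OF X(1)])
  define W where "W r = C r * (of_real (4 * (real m + 1)) * X1 r + of_real (4 * r) * f r
     + of_real (two_step (\<epsilon>\<^sup>2) k1 k2 r) * X r)" for r
  have W0: "integral {0..K} W = 0"
    unfolding W_def by (rule radial_weak_form[OF \<epsilon> u s fc f0 X1 X K(1) C])
  \<comment> \<open>Integrating by parts twice: Z' = W - G f away from \<epsilon>^2, where P has a
    corner, and Z vanishes at 0 and at K.\<close>
  define Z where "Z r = P r * X r + B r * X1 r" for r
  have "((\<lambda>r. W r - G r * f r) has_integral Z K - Z 0) {0..K}"
  proof (rule fundamental_theorem_of_calculus_interior_strong[of "{\<epsilon>\<^sup>2}"])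
    fix x assume x: "x \<in> {0<..<K} - {\<epsilon>\<^sup>2}"
    have "(Z has_vector_derivative (P x * X1 x + of_real (two_step (\<epsilon>\<^sup>2) k1 k2 x) * C x * X x)
       + (B x * f x + (of_real (4 * (real m + 1)) * C x - P x) * X1 x)) (at x)"
      unfolding Z_def[abs_def] by (intro has_vector_derivative_add has_vector_derivative_mult P' X X1 B) (use x in auto)
    then show "(Z has_vector_derivative W x - G x * f x) (at x)"
      by (rule has_vector_derivative_eq_rhs) (simp add: W_def G_def algebra_simps)
  next
    show "continuous_on {0..K} Z" unfolding Z_def by (intro continuous_intros Pc Xc Bc X1c)
  qed (use K in auto)
  moreover have "Z K = 0" "Z 0 = 0" using K X1(2) X(2) A B(1) \<epsilon> by (simp_all add: Z_def P min_def max_def)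
  ultimately have h: "((\<lambda>r. W r - G r * f r) has_integral 0) {0..K}" by simp
  have Gi: "(\<lambda>r. G r * f r) integrable_on {0..K}"
    by (intro integrable_continuous_interval continuous_intros Gc continuous_on_subset[OF fc]) auto
  then have Wi: "W integrable_on {0..K}"
    using integrable_add[OF has_integral_integrable[OF h] Gi] by simp
  have "integral {0..K} (\<lambda>r. G r * f r) = 0"
    using integral_unique[OF h] integral_diff[OF Wi Gi] W0 by simp
  moreover have "G x * f x = of_real ((norm (G x))\<^sup>2 * max 0 (K - x))" for x
    unfolding f_def by (simp add: complex_norm_square[symmetric] mult.assoc[symmetric])
  ultimately have i0: "integral {0..K} (\<lambda>x. complex_of_real ((norm (G x))\<^sup>2 * max 0 (K - x))) = 0" by simp
  have "(\<lambda>x. (norm (G x))\<^sup>2 * max 0 (K - x)) integrable_on {0..K}"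
    by (intro integrable_continuous_interval continuous_intros Gc)
  then have "((\<lambda>x. complex_of_real ((norm (G x))\<^sup>2 * max 0 (K - x))) has_integral
      of_real (integral {0..K} (\<lambda>x. (norm (G x))\<^sup>2 * max 0 (K - x)))) {0..K}"
    by (intro has_integral_of_real integrable_integral)
  from trans[OF integral_unique[OF this, symmetric] i0]
  have "integral {0..K} (\<lambda>x. (norm (G x))\<^sup>2 * max 0 (K - x)) = 0"
    by (simp only: of_real_eq_0_iff)
  then have "\<forall>x\<in>{0..K}. (norm (G x))\<^sup>2 * max 0 (K - x) = 0"
    using integral_eq_0_iff[of 0 K "\<lambda>x. (norm (G x))\<^sup>2 * max 0 (K - x)"] K
    by (simp add: continuous_intros Gc)
  from bspec[OF this, of r] have "G r = 0" using r K by (auto simp: max_def split: if_splits)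
  then show ?thesis by (simp add: G_def)
qed


section \<open>Ordinary differential equations for the Fourier coefficients\<close>

lemma circle_coeff_continuous:
  assumes "continuous_on UNIV u"
  shows "continuous_on UNIV (\<lambda>r. circle_coeff u r n)"
proof -
  have "continuous_on UNIV (\<lambda>r. integral (cbox 0 (2 * pi)) (\<lambda>\<theta>. u (polar r \<theta>) * cis (- of_int n * \<theta>)))"
    by (rule integral_continuous_on_param)
       (auto simp: case_prod_beta cis_conv_exp intro!: continuous_on_compose2[OF assms] continuous_polar continuous_intros)
  then show ?thesis by (auto simp: circle_coeff_def intro!: continuous_intros)
qed

lemma zeta_polar: "\<bar>s\<bar> = 1 \<Longrightarrow> zeta s (polar r \<theta>) = of_real r * cis (s * \<theta>)"
  by (auto simp: zeta_def complex_eq_iff abs_if split: if_splits)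

text \<open>The sign s is opposite to that of n, so that on the circle the harmonic polynomial is
  r^m exp (- i n theta), the kernel of \<open>circle_coeff\<close>.\<close>

lemma cint_zeta:
  assumes s: "s = (if n \<ge> 0 then - 1 else 1)" and m: "m = nat \<bar>n\<bar>"
  shows "cint (\<lambda>x. u x * zeta s x ^ m) r = (2 * pi * r ^ m) *\<^sub>R circle_coeff u r n"
proof -
  have "real m * s = - of_int n" using s m by auto
  then have "zeta s (polar r \<theta>) ^ m = of_real (r ^ m) * cis (- of_int n * \<theta>)" for \<theta>
    using s by (subst zeta_polar) (simp_all add: power_mult_distrib Complex.DeMoivre mult.assoc[symmetric] del: mult_minus_left mult_minus_right)
  then have "cint (\<lambda>x. u x * zeta s x ^ m) r = integral {0..2 * pi} (\<lambda>\<theta>. of_real (r ^ m) * (u (polar r \<theta>) * cis (- of_int n * \<theta>)))"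
    unfolding cint_def by (simp add: mult_ac)
  also have "\<dots> = of_real (r ^ m) * integral {0..2 * pi} (\<lambda>\<theta>. u (polar r \<theta>) * cis (- of_int n * \<theta>))"
    by (rule integral_mult_right)
  finally show ?thesis by (simp add: circle_coeff_def scaleR_conv_of_real)
qed

lemma scaled_square_has_vector_derivative:
  fixes g :: "real \<Rightarrow> complex"
  assumes "(g has_vector_derivative g') (at (r\<^sup>2))" "r > 0" "a > 0"
  shows "((\<lambda>r. (1 / (a * r ^ j)) *\<^sub>R g (r\<^sup>2)) has_vector_derivative
    (1 / (a * r ^ j)) *\<^sub>R ((2 * r) *\<^sub>R g') + (- real j / (a * r ^ Suc j)) *\<^sub>R g (r\<^sup>2)) (at r)"
proof (rule has_vector_derivative_scaleR)
  have "((\<lambda>r. r\<^sup>2) has_vector_derivative 2 * r) (at r)"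
    by (auto intro!: derivative_eq_intros simp flip: has_real_derivative_iff_has_vector_derivative)
  from vector_diff_chain_at[OF this assms(1)]
  show "((\<lambda>r. g (r\<^sup>2)) has_vector_derivative (2 * r) *\<^sub>R g') (at r)" by (simp add: o_def)
  have "((\<lambda>r. 1 / (a * r ^ j)) has_real_derivative - (a * (real j * r ^ (j - 1))) / (a * r ^ j)\<^sup>2) (at r)"
    using assms by (auto intro!: derivative_eq_intros simp: power2_eq_square)
  also have "- (a * (real j * r ^ (j - 1))) / (a * r ^ j)\<^sup>2 = - real j / (a * r ^ Suc j)"
    using assms by (cases j) (auto simp: field_simps power2_eq_square)
  finally show "((\<lambda>r. 1 / (a * r ^ j)) has_real_derivative - real j / (a * r ^ Suc j)) (at r)" .
qed

text \<open>By \<open>radial_regularity\<close> the coefficient is B(r^2) / (8 pi r^(m+2)) and so is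
  differentiable. Here \<open>c1\<close> is r c'; its continuity across r = \<epsilon> is the
  transmission condition, and the limit at 0 singles out the regular solution.\<close>

lemma circle_mode:
  assumes \<epsilon>: "\<epsilon> > 0" and u: "helmholtz_solution (\<lambda>x. two_step \<epsilon> k1 k2 (norm x)) u" and m: "m = nat \<bar>n\<bar>"
  defines "c \<equiv> \<lambda>r. circle_coeff u r n"
  shows "\<exists>c1. continuous_on {0<..} c1 \<and> ((\<lambda>r. c1 r - real m *\<^sub>R c r) \<longlongrightarrow> 0) (at_right 0) \<and>
    (\<forall>r>0. r \<noteq> \<epsilon> \<longrightarrow> (c has_vector_derivative (1 / r) *\<^sub>R c1 r) (at r) \<and>
      (c1 has_vector_derivative (((real m)\<^sup>2 - r\<^sup>2 * two_step \<epsilon> k1 k2 r) / r) *\<^sub>R c r) (at r))"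
proof -
  have uc: "continuous_on UNIV u" using u by (simp add: helmholtz_solution_def)
  define s :: real where "s = (if n \<ge> 0 then - 1 else 1)"
  have s2: "s\<^sup>2 = 1" by (simp add: s_def)
  define U where "U = (\<lambda>x. u x * zeta s x ^ m)"
  have Uc: "continuous_on UNIV U" unfolding U_def by (intro continuous_intros uc continuous_on_zeta)
  define C where "C r = cint U (sqrt r)" for r
  have Cc: "continuous_on S C" for S
    unfolding C_def by (rule continuous_on_compose2[OF continuous_cint[OF Uc]]) (auto intro!: continuous_intros)
  have Csq: "C (r\<^sup>2) = (2 * pi * r ^ m) *\<^sub>R c r" if "r \<ge> 0" for r
    using that cint_zeta[OF s_def m] by (simp add: C_def U_def c_def)
  obtain A where A: "A 0 = 0" "\<And>x. (A has_vector_derivative C x) (at x)" using antiderivative_UNIV[OF Cc] by blast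
  have Ac: "continuous_on S A" for S by (rule continuous_on_vector_derivative[OF A(2)])
  define P where "P r = of_real k1 * A (min r (\<epsilon>\<^sup>2)) + of_real k2 * (A (max r (\<epsilon>\<^sup>2)) - A (\<epsilon>\<^sup>2))" for r
  have Pc: "continuous_on S P" for S
    unfolding P_def[abs_def] by (intro continuous_intros continuous_on_compose2[OF Ac[of UNIV]]) auto
  have P': "(P has_vector_derivative of_real (two_step (\<epsilon>\<^sup>2) k1 k2 x) * C x) (at x)" if "x \<noteq> \<epsilon>\<^sup>2" for x
  proof (cases "x < \<epsilon>\<^sup>2")
    case True
    have "((\<lambda>r. of_real k1 * A r) has_vector_derivative of_real k1 * C x) (at x)"
      by (intro has_vector_derivative_mult_right A)
    then have "(P has_vector_derivative of_real k1 * C x) (at x)"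
      by (rule has_vector_derivative_transform_within_open[where S = "{..<\<epsilon>\<^sup>2}"]) (use True in \<open>auto simp: P_def min_def max_def\<close>)
    then show ?thesis using True by (simp add: two_step_def)
  next
    case False
    have "((\<lambda>r. of_real k1 * A (\<epsilon>\<^sup>2) + of_real k2 * (A r - A (\<epsilon>\<^sup>2))) has_vector_derivative of_real k2 * C x) (at x)"
      by (auto intro!: derivative_eq_intros A)
    then have "(P has_vector_derivative of_real k2 * C x) (at x)"
      by (rule has_vector_derivative_transform_within_open[where S = "{\<epsilon>\<^sup>2<..}"]) (use False that in \<open>auto simp: P_def min_def max_def\<close>)
    then show ?thesis using False by (simp add: two_step_def)
  qed
  have "continuous_on UNIV (\<lambda>x. of_real (4 * (real m + 1)) * C x - P x)" by (intro continuous_intros Cc Pc)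
  then obtain B where B: "B 0 = 0" "\<And>x. (B has_vector_derivative of_real (4 * (real m + 1)) * C x - P x) (at x)"
    using antiderivative_UNIV by blast
  have CB: "of_real (4 * r) * C r = B r" if "r \<ge> 0" for r
    by (rule radial_regularity[OF \<epsilon> u s2 C_def[unfolded U_def] A P_def B that])
  have Bsq: "B (r\<^sup>2) = (8 * pi * r ^ (m + 2)) *\<^sub>R c r" if "r \<ge> 0" for r
    unfolding CB[of "r\<^sup>2", symmetric, simplified] using Csq[OF that] by (simp add: scaleR_conv_of_real power_add power2_eq_square mult_ac)
  \<comment> \<open>This is r c', found by differentiating the formula for c through B and written
    without derivatives so that it makes sense at \<epsilon> too.\<close>
  define c1 where "c1 r = real m *\<^sub>R c r - (1 / (4 * pi * r ^ m)) *\<^sub>R P (r\<^sup>2)" for r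
  have cc: "continuous_on S c" for S
    unfolding c_def by (rule continuous_on_subset[OF circle_coeff_continuous[OF uc]]) simp
  have c': "(c has_vector_derivative (1 / r) *\<^sub>R c1 r) (at r)" if r: "r > 0" for r
  proof -
    have "((\<lambda>r. (1 / (8 * pi * r ^ (m + 2))) *\<^sub>R B (r\<^sup>2)) has_vector_derivative
      (1 / (8 * pi * r ^ (m + 2))) *\<^sub>R ((2 * r) *\<^sub>R (of_real (4 * (real m + 1)) * C (r\<^sup>2) - P (r\<^sup>2)))
       + (- real (m + 2) / (8 * pi * r ^ Suc (m + 2))) *\<^sub>R B (r\<^sup>2)) (at r)"
      by (rule scaled_square_has_vector_derivative[OF B(2) r]) simp
    also have "(1 / (8 * pi * r ^ (m + 2))) *\<^sub>R ((2 * r) *\<^sub>R (of_real (4 * (real m + 1)) * C (r\<^sup>2) - P (r\<^sup>2)))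
       + (- real (m + 2) / (8 * pi * r ^ Suc (m + 2))) *\<^sub>R B (r\<^sup>2)
      = (1 / (8 * pi * r ^ (m + 2)) * (2 * r) * (4 * (real m + 1)) * (2 * pi * r ^ m)
          - real (m + 2) / (8 * pi * r ^ Suc (m + 2)) * (8 * pi * r ^ (m + 2))) *\<^sub>R c r
        - (1 / (8 * pi * r ^ (m + 2)) * (2 * r)) *\<^sub>R P (r\<^sup>2)"
      unfolding Bsq[OF less_imp_le[OF r]] Csq[OF less_imp_le[OF r]]
      by (simp only: scaleR_conv_of_real of_real_mult of_real_diff of_real_divide of_real_minus right_diff_distrib left_diff_distrib minus_divide_left[symmetric] mult.assoc times_divide_eq_left mult_minus_left diff_add_eq) simp
    also have "1 / (8 * pi * r ^ (m + 2)) * (2 * r) * (4 * (real m + 1)) * (2 * pi * r ^ m)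
          - real (m + 2) / (8 * pi * r ^ Suc (m + 2)) * (8 * pi * r ^ (m + 2)) = real m / r"
      using r by (simp add: field_simps power_add power2_eq_square)
    also have "1 / (8 * pi * r ^ (m + 2)) * (2 * r) = 1 / r * (1 / (4 * pi * r ^ m))"
      using r by (simp add: field_simps power_add power2_eq_square)
    also have "(real m / r) *\<^sub>R c r - (1 / r * (1 / (4 * pi * r ^ m))) *\<^sub>R P (r\<^sup>2) = (1 / r) *\<^sub>R c1 r"
      by (simp add: c1_def scaleR_diff_right)
    finally show ?thesis
      by (rule has_vector_derivative_transform_within_open[where S = "{0<..}"]) (use r Bsq in auto)
  qed
  have c1': "(c1 has_vector_derivative (((real m)\<^sup>2 - r\<^sup>2 * two_step \<epsilon> k1 k2 r) / r) *\<^sub>R c r) (at r)"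
    if r: "r > 0" "r \<noteq> \<epsilon>" for r
  proof -
    have v: "two_step (\<epsilon>\<^sup>2) k1 k2 (r\<^sup>2) = two_step \<epsilon> k1 k2 r"
      using \<epsilon> r(1) power_mono_iff[of \<epsilon> r 2] by (simp add: two_step_def not_le[symmetric] del: power_mono_iff)
    have e: "r\<^sup>2 \<noteq> \<epsilon>\<^sup>2" using r \<epsilon> by simp
    have "((\<lambda>r. real m *\<^sub>R c r - (1 / (4 * pi * r ^ m)) *\<^sub>R P (r\<^sup>2)) has_vector_derivative
      real m *\<^sub>R ((1 / r) *\<^sub>R c1 r) - ((1 / (4 * pi * r ^ m)) *\<^sub>R ((2 * r) *\<^sub>R (of_real (two_step \<epsilon> k1 k2 r) * C (r\<^sup>2)))
       + (- real m / (4 * pi * r ^ Suc m)) *\<^sub>R P (r\<^sup>2))) (at r)"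
      by (intro has_vector_derivative_diff scaled_square_has_vector_derivative r
            bounded_linear.has_vector_derivative[OF bounded_linear_scaleR_right] c' P'[OF e, unfolded v]) simp
    also have "real m *\<^sub>R ((1 / r) *\<^sub>R c1 r) - ((1 / (4 * pi * r ^ m)) *\<^sub>R ((2 * r) *\<^sub>R (of_real (two_step \<epsilon> k1 k2 r) * C (r\<^sup>2)))
       + (- real m / (4 * pi * r ^ Suc m)) *\<^sub>R P (r\<^sup>2))
      = (real m * (1 / r) * real m - 1 / (4 * pi * r ^ m) * (2 * r) * two_step \<epsilon> k1 k2 r * (2 * pi * r ^ m)) *\<^sub>R c r
        + (real m / (4 * pi * r ^ Suc m) - real m * (1 / r) * (1 / (4 * pi * r ^ m))) *\<^sub>R P (r\<^sup>2)"
      unfolding c1_def Csq[OF less_imp_le[OF r(1)]] scaleR_diff_right scaleR_diff_left scaleR_add_left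
      by (simp add: scaleR_conv_of_real)
    also have "real m / (4 * pi * r ^ Suc m) - real m * (1 / r) * (1 / (4 * pi * r ^ m)) = 0"
      using r by (simp add: field_simps)
    also have "real m * (1 / r) * real m - 1 / (4 * pi * r ^ m) * (2 * r) * two_step \<epsilon> k1 k2 r * (2 * pi * r ^ m)
      = ((real m)\<^sup>2 - r\<^sup>2 * two_step \<epsilon> k1 k2 r) / r"
      using r by (simp add: field_simps power2_eq_square)
    finally show ?thesis unfolding c1_def[abs_def] by simp
  qed
  have c1c: "continuous_on {0<..} c1"
    unfolding c1_def by (intro continuous_intros cc continuous_on_compose2[OF Pc[of UNIV]]) auto
  have lim: "((\<lambda>r. c1 r - real m *\<^sub>R c r) \<longlongrightarrow> 0) (at_right 0)"
  proof -
    have "bounded (c ` {0..1})" by (intro compact_imp_bounded compact_continuous_image cc) auto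
    then obtain M where M: "M > 0" "\<And>r. 0 \<le> r \<Longrightarrow> r \<le> 1 \<Longrightarrow> norm (c r) \<le> M" by (auto simp: bounded_pos)
    \<comment> \<open>Near 0 the term P(r^2) is k1 times the integral of C up to r^2, of order
      r^(m+2), which leaves r^2 after division by r^m.\<close>
    have b: "norm (c1 r - real m *\<^sub>R c r) \<le> (\<bar>k1\<bar> * M / 2) * r\<^sup>2" if r: "0 < r" "r < min 1 \<epsilon>" for r
    proof -
      have "norm (A (r\<^sup>2)) \<le> (2 * pi * r ^ m * M) * measure lborel (cbox 0 (r\<^sup>2))"
      proof (rule has_integral_bound)
        show "0 \<le> 2 * pi * r ^ m * M" using r M(1) by simp
        show "(C has_integral A (r\<^sup>2)) (cbox 0 (r\<^sup>2))"
          using fundamental_theorem_of_calculus[of 0 "r\<^sup>2" A C] A by (auto intro: has_vector_derivative_at_within)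
        fix t assume "t \<in> cbox 0 (r\<^sup>2)"
        then have t: "0 \<le> t" "t \<le> r\<^sup>2" by auto
        have st: "0 \<le> sqrt t" "sqrt t \<le> r" using t r real_le_lsqrt[of r t] by auto
        then have "sqrt t \<le> 1" using r by linarith
        with M(2) st(1) have Mt: "norm (c (sqrt t)) \<le> M" by blast
        have "norm (C t) = 2 * pi * sqrt t ^ m * norm (c (sqrt t))" using Csq[OF st(1)] t by simp
        also have "\<dots> \<le> 2 * pi * r ^ m * M" using st r M(1) Mt by (intro mult_mono power_mono mult_nonneg_nonneg) auto
        finally show "norm (C t) \<le> 2 * pi * r ^ m * M" .
      qed
      then have nA: "norm (A (r\<^sup>2)) \<le> 2 * pi * r ^ m * M * r\<^sup>2" by simp
      have "r\<^sup>2 < \<epsilon>\<^sup>2" using r by (intro power_strict_mono) auto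
      then have "P (r\<^sup>2) = of_real k1 * A (r\<^sup>2)" by (simp add: P_def min_def max_def)
      then have "norm (c1 r - real m *\<^sub>R c r) = 1 / (4 * pi * r ^ m) * (\<bar>k1\<bar> * norm (A (r\<^sup>2)))"
        using r by (simp add: c1_def norm_mult)
      also have "\<dots> \<le> 1 / (4 * pi * r ^ m) * (\<bar>k1\<bar> * (2 * pi * r ^ m * M * r\<^sup>2))"
        using nA r by (intro mult_left_mono) auto
      also have "\<dots> = (\<bar>k1\<bar> * M / 2) * r\<^sup>2" using r by (simp add: field_simps)
      finally show ?thesis .
    qed
    have "((\<lambda>r::real. (\<bar>k1\<bar> * M / 2) * r\<^sup>2) \<longlongrightarrow> (\<bar>k1\<bar> * M / 2) * 0\<^sup>2) (at_right 0)" by (intro tendsto_intros)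
    then have "((\<lambda>r::real. (\<bar>k1\<bar> * M / 2) * r\<^sup>2) \<longlongrightarrow> 0) (at_right 0)" by simp
    moreover have "\<forall>\<^sub>F r in at_right 0. norm (c1 r - real m *\<^sub>R c r) \<le> (\<bar>k1\<bar> * M / 2) * r\<^sup>2"
      by (rule eventually_mono[OF eventually_at_right_real[of 0 "min 1 \<epsilon>"]], use \<epsilon> in simp, rule b) simp_all
    ultimately show ?thesis by (rule Lim_null_comparison[rotated])
  qed
  show ?thesis using c1c lim c' c1' by blast
qed


section \<open>Matching at the interface and at infinity\<close>

lemma wronskian_has_vector_derivative:
  fixes f g :: "real \<Rightarrow> complex"
  assumes "(f has_vector_derivative (1 / r) *\<^sub>R f1 r) (at r)" "(f1 has_vector_derivative a *\<^sub>R f r) (at r)"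
    "(g has_vector_derivative (1 / r) *\<^sub>R g1 r) (at r)" "(g1 has_vector_derivative a *\<^sub>R g r) (at r)"
  shows "((\<lambda>r. f r * g1 r - f1 r * g r) has_vector_derivative 0) (at r)"
proof -
  have "((\<lambda>r. f r * g1 r - f1 r * g r) has_vector_derivative
      (f r * (a *\<^sub>R g r) + (1 / r) *\<^sub>R f1 r * g1 r) - (f1 r * ((1 / r) *\<^sub>R g1 r) + a *\<^sub>R f r * g r)) (at r)"
    by (intro has_vector_derivative_diff has_vector_derivative_mult assms)
  then show ?thesis by (rule has_vector_derivative_eq_rhs) (simp add: scaleR_conv_of_real)
qed

lemma bessel_pair_scale:
  fixes f g :: "real \<Rightarrow> complex"
  assumes "bessel_pair n f g" and k: "k > 0" and r: "r > 0"
  shows "((\<lambda>r. f (k * r)) has_vector_derivative (1 / r) *\<^sub>R g (k * r)) (at r)"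
    "((\<lambda>r. g (k * r)) has_vector_derivative (((real n)\<^sup>2 - r\<^sup>2 * k\<^sup>2) / r) *\<^sub>R f (k * r)) (at r)"
proof -
  have kr: "((\<lambda>r. k * r) has_vector_derivative k) (at r)"
    by (auto intro!: derivative_eq_intros simp flip: has_real_derivative_iff_has_vector_derivative)
  have p: "(f has_vector_derivative (1 / (k * r)) *\<^sub>R g (k * r)) (at (k * r))"
    "(g has_vector_derivative (((real n)\<^sup>2 - (k * r)\<^sup>2) / (k * r)) *\<^sub>R f (k * r)) (at (k * r))"
    using assms unfolding bessel_pair_def by simp_all
  show "((\<lambda>r. f (k * r)) has_vector_derivative (1 / r) *\<^sub>R g (k * r)) (at r)"
    using vector_diff_chain_at[OF kr p(1)] k by (simp add: o_def)
  show "((\<lambda>r. g (k * r)) has_vector_derivative (((real n)\<^sup>2 - r\<^sup>2 * k\<^sup>2) / r) *\<^sub>R f (k * r)) (at r)"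
    using vector_diff_chain_at[OF kr p(2)] k by (simp add: o_def power_mult_distrib mult.commute)
qed

lemma const_on_halfline:
  fixes W :: "real \<Rightarrow> complex"
  assumes "continuous_on {a..} W" "\<And>r. r > a \<Longrightarrow> (W has_vector_derivative 0) (at r)" "r \<ge> a"
  shows "W r = W a"
proof (rule has_derivative_zero_unique_strong_convex[of "{a..}" "{a}" W])
  fix x assume "x \<in> {a..} - {a}"
  then have "(W has_vector_derivative 0) (at x)" using assms(2)[of x] by simp
  then show "(W has_derivative (\<lambda>h. 0)) (at x within {a..})"
    by (simp add: has_vector_derivative_def has_derivative_at_withinI)
qed (use assms in auto)

definition bJ :: "nat \<Rightarrow> real \<Rightarrow> complex" where "bJ n x = of_real (bessel_J_nat n x)"
definition bDJ :: "nat \<Rightarrow> real \<Rightarrow> complex" where "bDJ n x = of_real (DJ n x)"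

lemma bessel_pair_bJ: "bessel_pair n (bJ n) (bDJ n)"
  using bessel_pair_of_real[OF bessel_pair_J[of n]] by (simp add: bJ_def[abs_def] bDJ_def[abs_def])

text \<open>The incoming solution, which together with H_m spans all solutions outside the
  disc.\<close>

lemma bessel_pair_cnj_hank: "bessel_pair n (\<lambda>x. cnj (hank n x)) (\<lambda>x. cnj (DH n x))"
  unfolding bessel_pair_def
proof (intro allI impI conjI)
  fix x :: real assume "0 < x"
  then have d: "(hank n has_vector_derivative (1 / x) *\<^sub>R DH n x) (at x)"
    "(DH n has_vector_derivative (((real n)\<^sup>2 - x\<^sup>2) / x) *\<^sub>R hank n x) (at x)"
    using bessel_pair_hank[of n] unfolding bessel_pair_def by blast+
  show "((\<lambda>x. cnj (hank n x)) has_vector_derivative (1 / x) *\<^sub>R cnj (DH n x)) (at x)"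
    using bounded_linear.has_vector_derivative[OF bounded_linear_cnj d(1)] by simp
  show "((\<lambda>x. cnj (DH n x)) has_vector_derivative (((real n)\<^sup>2 - x\<^sup>2) / x) *\<^sub>R cnj (hank n x)) (at x)"
    using bounded_linear.has_vector_derivative[OF bounded_linear_cnj d(2)] by simp
qed

lemma bessel_pair_continuous:
  assumes "bessel_pair n f g"
  shows "continuous_on {0<..} f" "continuous_on {0<..} g"
  using assms unfolding bessel_pair_def
  by (auto intro!: continuous_at_imp_continuous_on intro: has_vector_derivative_continuous)

text \<open>The Wronskian of c with the regular solution J_m(k r) is constant inside the disc and
  tends to 0 at the centre, so it vanishes; by continuity it does so at \<epsilon> as well.\<close>

lemma inner_relation:
  assumes \<epsilon>: "\<epsilon> > 0" and k: "k > 0"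
    and cc: "continuous_on UNIV c" and c1c: "continuous_on {0<..} c1"
    and lim: "((\<lambda>r. c1 r - real m *\<^sub>R c r) \<longlongrightarrow> 0) (at_right 0)"
    and ode: "\<And>r. 0 < r \<Longrightarrow> r < \<epsilon> \<Longrightarrow> (c has_vector_derivative (1 / r) *\<^sub>R c1 r) (at r)"
      "\<And>r. 0 < r \<Longrightarrow> r < \<epsilon> \<Longrightarrow> (c1 has_vector_derivative (((real m)\<^sup>2 - r\<^sup>2 * k\<^sup>2) / r) *\<^sub>R c r) (at r)"
  shows "c \<epsilon> * bDJ m (k * \<epsilon>) = c1 \<epsilon> * bJ m (k * \<epsilon>)"
proof -
  define W where "W r = c r * bDJ m (k * r) - c1 r * bJ m (k * r)" for r
  have W': "(W has_vector_derivative 0) (at r)" if "0 < r" "r < \<epsilon>" for r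
    unfolding W_def[abs_def]
    by (rule wronskian_has_vector_derivative[OF ode bessel_pair_scale[OF bessel_pair_bJ k]]) (use that in auto)
  define w where "w = W (\<epsilon> / 2)"
  have Ww: "W r = w" if "0 < r" "r < \<epsilon>" for r
    unfolding w_def
    by (rule has_derivative_zero_unique_connected[of "{0<..<\<epsilon>}"])
       (use W' that \<epsilon> in \<open>auto simp: has_vector_derivative_def\<close>)
  have Jl: "((\<lambda>r. bJ m (k * r)) \<longlongrightarrow> of_real (if m = 0 then 1 else 0)) (at_right 0)"
    and J1l: "((\<lambda>r. bDJ m (k * r) - real m *\<^sub>R bJ m (k * r)) \<longlongrightarrow> 0) (at_right 0)"
  proof -
    have k0: "filterlim (\<lambda>r. k * r) (at_right 0) (at_right 0)"
      using filterlim_times_pos[of "\<lambda>r. r" 0 "at_right 0" k 0] k by (simp add: filterlim_ident)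
    show 1: "((\<lambda>r. bJ m (k * r)) \<longlongrightarrow> of_real (if m = 0 then 1 else 0)) (at_right 0)"
      unfolding bJ_def by (intro tendsto_of_real filterlim_compose[OF tendsto_J_0 k0])
    have "((\<lambda>r. bDJ m (k * r)) \<longlongrightarrow> of_real 0) (at_right 0)"
      unfolding bDJ_def by (intro tendsto_of_real filterlim_compose[OF tendsto_DJ_0 k0])
    from tendsto_diff[OF this tendsto_scaleR[OF tendsto_const[of "real m"] 1]]
    show "((\<lambda>r. bDJ m (k * r) - real m *\<^sub>R bJ m (k * r)) \<longlongrightarrow> 0) (at_right 0)" by (auto split: if_splits)
  qed
  have cl: "(c \<longlongrightarrow> c 0) (at_right 0)"
    using cc by (simp add: continuous_on_eq_continuous_at continuous_at_imp_continuous_at_within continuous_within[symmetric])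
  \<comment> \<open>Subtracting m c J from both products leaves the Wronskian unchanged and makes
    each term tend to 0, for m = 0 and m > 0 alike.\<close>
  have "((\<lambda>r. c r * (bDJ m (k * r) - real m *\<^sub>R bJ m (k * r)) - (c1 r - real m *\<^sub>R c r) * bJ m (k * r))
      \<longlongrightarrow> c 0 * 0 - 0 * of_real (if m = 0 then 1 else 0)) (at_right 0)"
    by (intro tendsto_intros cl Jl J1l lim)
  moreover have "c r * (bDJ m (k * r) - real m *\<^sub>R bJ m (k * r)) - (c1 r - real m *\<^sub>R c r) * bJ m (k * r) = W r" for r
    by (simp add: W_def algebra_simps)
  ultimately have W0: "(W \<longlongrightarrow> 0) (at_right 0)" by simp
  have "(W \<longlongrightarrow> w) (at_right 0)"
    by (rule tendsto_eventually, rule eventually_mono[OF eventually_at_right_real[OF \<epsilon>]]) (use Ww in auto)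
  from tendsto_unique[OF _ W0 this] have w: "w = 0" by simp
  have kc: "continuous_on {0<..} (\<lambda>r. f (k * r))" if "continuous_on {0<..} f" for f :: "real \<Rightarrow> complex"
    by (rule continuous_on_compose2[OF that]) (use k in \<open>auto intro!: continuous_intros\<close>)
  have "continuous_on {0<..} W" unfolding W_def
    by (intro continuous_intros kc bessel_pair_continuous[OF bessel_pair_bJ] c1c continuous_on_subset[OF cc]) auto
  then have "(W \<longlongrightarrow> W \<epsilon>) (at_left \<epsilon>)"
    using \<epsilon> by (auto simp: continuous_on_eq_continuous_at isCont_def intro: tendsto_within_subset)
  moreover have "(W \<longlongrightarrow> w) (at_left \<epsilon>)"
    by (rule tendsto_eventually, rule eventually_mono[OF eventually_at_left_real[OF \<epsilon>]]) (use Ww in auto)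
  ultimately have "W \<epsilon> = w" using tendsto_unique[of "at_left \<epsilon>"] by auto
  then show ?thesis using w by (simp add: W_def)
qed


section \<open>Outgoing solutions outside the disc\<close>

lemma wronskian_hank_cnj:
  assumes "x > 0"
  shows "hank n x * cnj (DH n x) - DH n x * cnj (hank n x) = - \<i> * of_real (4 / pi)"
proof -
  have "hank n x * cnj (DH n x) - DH n x * cnj (hank n x)
    = - \<i> * of_real (2 * (bessel_J_nat n x * DYY n x - YY n x * DJ n x))"
    by (simp add: hank_split[OF assms] complex_eq_iff algebra_simps)
  then show ?thesis using wronskian_hank[OF assms, of n] by simp
qed

lemma circle_coeff_diff:
  assumes "continuous_on UNIV f" "continuous_on UNIV g"
  shows "circle_coeff (\<lambda>x. f x - g x) r n = circle_coeff f r n - circle_coeff g r n"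
proof -
  have "(\<lambda>\<theta>. h (polar r \<theta>) * cis (- of_int n * \<theta>)) integrable_on {0..2 * pi}" if "continuous_on UNIV h" for h
    by (intro integrable_continuous_interval continuous_intros continuous_on_compose2[OF that] continuous_polar)
       (auto simp: cis_conv_exp intro!: continuous_intros)
  from integral_diff[OF this[OF assms(1)] this[OF assms(2)]]
  show ?thesis by (simp add: circle_coeff_def left_diff_distrib right_diff_distrib)
qed

lemma circle_coeff_lincomb:
  assumes "continuous_on UNIV w"
  shows "a * circle_coeff w r n - b * circle_coeff w s n
    = 1 / (2 * pi) * integral {0..2 * pi} (\<lambda>\<theta>. (a * w (polar r \<theta>) - b * w (polar s \<theta>)) * cis (- of_int n * \<theta>))"
proof -
  have i: "(\<lambda>\<theta>. w (polar r \<theta>) * cis (- of_int n * \<theta>)) integrable_on {0..2 * pi}" for r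
    by (intro integrable_continuous_interval continuous_intros continuous_on_compose2[OF assms] continuous_polar)
       (auto simp: cis_conv_exp intro!: continuous_intros)
  have "integral {0..2 * pi} (\<lambda>\<theta>. (a * w (polar r \<theta>) - b * w (polar s \<theta>)) * cis (- of_int n * \<theta>))
    = integral {0..2 * pi} (\<lambda>\<theta>. a * (w (polar r \<theta>) * cis (- of_int n * \<theta>)) - b * (w (polar s \<theta>) * cis (- of_int n * \<theta>)))"
    by (simp add: algebra_simps)
  also have "\<dots> = a * integral {0..2 * pi} (\<lambda>\<theta>. w (polar r \<theta>) * cis (- of_int n * \<theta>))
      - b * integral {0..2 * pi} (\<lambda>\<theta>. w (polar s \<theta>) * cis (- of_int n * \<theta>))"
    by (subst integral_diff) (use i in \<open>auto intro!: integrable_on_mult_right\<close>)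
  finally show ?thesis by (simp add: circle_coeff_def right_diff_distrib mult_ac)
qed

text \<open>The radial derivative in the radiation condition need not be integrable in \<open>\<theta>\<close>, so the bound is first
  transferred to increments of \<open>w * exp (- \<i> \<kappa> r)\<close>, which are then averaged.\<close>

lemma radiating_coeff:
  assumes w: "continuous_on UNIV w" and rad: "radiating \<kappa> w"
    and S: "\<And>r. r > \<epsilon> \<Longrightarrow> ((\<lambda>r. circle_coeff w r n) has_vector_derivative S r) (at r)"
    and e: "e > 0"
  shows "\<forall>\<^sub>F r in at_top. norm (S r - \<i> * of_real \<kappa> * circle_coeff w r n) \<le> e * r powr (- 1 / 2)"
proof -
  from rad e have "\<forall>\<^sub>F r in at_top. \<forall>\<theta>. \<exists>d. ((\<lambda>s. w (polar s \<theta>)) has_vector_derivative d) (at r) \<and>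
      norm (d - \<i> * of_real \<kappa> * w (polar r \<theta>)) \<le> e * r powr (- 1 / 2)"
    unfolding radiating_def by blast
  then obtain r0 where r0: "\<And>r \<theta>. r \<ge> r0 \<Longrightarrow> \<exists>d. ((\<lambda>s. w (polar s \<theta>)) has_vector_derivative d) (at r) \<and>
      norm (d - \<i> * of_real \<kappa> * w (polar r \<theta>)) \<le> e * r powr (- 1 / 2)"
    unfolding eventually_at_top_linorder by blast
  have cisd: "((\<lambda>r. cis (- \<kappa> * r)) has_vector_derivative - \<i> * of_real \<kappa> * cis (- \<kappa> * r)) (at r)" for r
  proof -
    have "((\<lambda>r. - \<kappa> * r) has_vector_derivative - \<kappa>) (at r)"
      by (auto intro!: derivative_eq_intros simp flip: has_real_derivative_iff_has_vector_derivative)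
    from vector_diff_chain_at[OF this cis_has_vector_derivative]
    show ?thesis by (simp add: o_def scaleR_conv_of_real mult_ac)
  qed
  show ?thesis
  proof (rule eventually_mono[OF eventually_gt_at_top[of "max 1 (max r0 \<epsilon>)"]])
    fix r assume r: "max 1 (max r0 \<epsilon>) < r"
    define b where "b = e * r powr (- 1 / 2)"
    have osc: "norm (cis (- \<kappa> * t) * circle_coeff w t n - cis (- \<kappa> * r) * circle_coeff w r n) \<le> b * (t - r)" if t: "t > r" for t
    proof -
      have pt: "norm (cis (- \<kappa> * t) * w (polar t \<theta>) - cis (- \<kappa> * r) * w (polar r \<theta>)) \<le> b * (t - r)" for \<theta>
      proof -
        \<comment> \<open>The derivative is picked separately for each angle; it is only used along
          one ray, to bound an increment.\<close>
        define D where "D s = (SOME d. ((\<lambda>s. w (polar s \<theta>)) has_vector_derivative d) (at s) \<and>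
          norm (d - \<i> * of_real \<kappa> * w (polar s \<theta>)) \<le> e * s powr (- 1 / 2))" for s
        have D: "((\<lambda>s. w (polar s \<theta>)) has_vector_derivative D s) (at s)"
          "norm (D s - \<i> * of_real \<kappa> * w (polar s \<theta>)) \<le> e * s powr (- 1 / 2)" if "s \<ge> r" for s
          using someI_ex[OF r0[of s \<theta>]] that r unfolding D_def by auto
        have "norm ((\<lambda>s. cis (- \<kappa> * s) * w (polar s \<theta>)) t - (\<lambda>s. cis (- \<kappa> * s) * w (polar s \<theta>)) r) \<le> b * norm (t - r)"
        proof (rule differentiable_bound[where S = "{r..}"])
          fix s assume s: "s \<in> {r..}"
          have "((\<lambda>s. cis (- \<kappa> * s) * w (polar s \<theta>)) has_vector_derivative
            cis (- \<kappa> * s) * D s + (- \<i> * of_real \<kappa> * cis (- \<kappa> * s)) * w (polar s \<theta>)) (at s)"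
            by (intro has_vector_derivative_mult cisd D) (use s in auto)
          then have "((\<lambda>s. cis (- \<kappa> * s) * w (polar s \<theta>)) has_vector_derivative
            cis (- \<kappa> * s) * (D s - \<i> * of_real \<kappa> * w (polar s \<theta>))) (at s)"
            by (rule has_vector_derivative_eq_rhs) (simp add: algebra_simps)
          then show "((\<lambda>s. cis (- \<kappa> * s) * w (polar s \<theta>)) has_derivative
            (\<lambda>h. h *\<^sub>R (cis (- \<kappa> * s) * (D s - \<i> * of_real \<kappa> * w (polar s \<theta>))))) (at s within {r..})"
            unfolding has_vector_derivative_def by (rule has_derivative_at_withinI)
          have "norm (D s - \<i> * of_real \<kappa> * w (polar s \<theta>)) \<le> b"
          proof -
            have "s powr (- 1 / 2) \<le> r powr (- 1 / 2)" using s r by (intro powr_mono2') auto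
            then have "e * s powr (- 1 / 2) \<le> b" unfolding b_def using e by (intro mult_left_mono) auto
            then show ?thesis using D(2)[of s] s by force
          qed
          then show "onorm (\<lambda>h. h *\<^sub>R (cis (- \<kappa> * s) * (D s - \<i> * of_real \<kappa> * w (polar s \<theta>)))) \<le> b"
            by (intro onorm_le) (simp add: norm_mult mult.commute[of b] mult_left_mono)
        qed (use t in auto)
        then show ?thesis using t by simp
      qed
      have c: "continuous_on UNIV (\<lambda>\<theta>. cis (- \<kappa> * t) * w (polar t \<theta>) - cis (- \<kappa> * r) * w (polar r \<theta>))"
        by (intro continuous_intros continuous_on_compose2[OF w] continuous_polar) auto
      have i: "(\<lambda>\<theta>. (cis (- \<kappa> * t) * w (polar t \<theta>) - cis (- \<kappa> * r) * w (polar r \<theta>)) * cis (- of_int n * \<theta>)) integrable_on {0..2 * pi}"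
        by (intro integrable_continuous_interval continuous_on_mult continuous_on_subset[OF c])
           (auto simp: cis_conv_exp intro!: continuous_intros)
      have "norm (integral {0..2 * pi} (\<lambda>\<theta>. (cis (- \<kappa> * t) * w (polar t \<theta>) - cis (- \<kappa> * r) * w (polar r \<theta>)) * cis (- of_int n * \<theta>)))
        \<le> integral {0..2 * pi} (\<lambda>\<theta>. b * (t - r))"
        by (rule integral_norm_bound_integral[OF i]) (use pt in \<open>auto simp: norm_mult\<close>)
      also have "\<dots> = 2 * pi * (b * (t - r))" by simp
      finally show ?thesis unfolding circle_coeff_lincomb[OF w] by (simp add: norm_mult norm_divide field_simps)
    qed
    let ?F = "\<lambda>s. cis (- \<kappa> * s) * circle_coeff w s n"
    have "(?F has_vector_derivative cis (- \<kappa> * r) * S r + (- \<i> * of_real \<kappa> * cis (- \<kappa> * r)) * circle_coeff w r n) (at r)"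
      by (intro has_vector_derivative_mult cisd S) (use r in auto)
    then have "(?F has_vector_derivative cis (- \<kappa> * r) * (S r - \<i> * of_real \<kappa> * circle_coeff w r n)) (at r)"
      by (rule has_vector_derivative_eq_rhs) (simp add: algebra_simps)
    then have "(?F has_vector_derivative cis (- \<kappa> * r) * (S r - \<i> * of_real \<kappa> * circle_coeff w r n)) (at r within {r<..})"
      by (rule has_vector_derivative_at_within)
    then have lim: "((\<lambda>t. (1 / norm (t - r)) *\<^sub>R (?F t - (?F r + (t - r) *\<^sub>R (cis (- \<kappa> * r) * (S r - \<i> * of_real \<kappa> * circle_coeff w r n))))) \<longlongrightarrow> 0) (at_right r)"
      unfolding has_vector_derivative_def has_derivative_within by blast
    \<comment> \<open>The increment bound is divided by t - r, and t decreases to r.\<close>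
    define d where "d = cis (- \<kappa> * r) * (S r - \<i> * of_real \<kappa> * circle_coeff w r n)"
    define X where "X t = ?F t - (?F r + (t - r) *\<^sub>R d)" for t
    have dX: "norm d \<le> b + norm ((1 / norm (t - r)) *\<^sub>R X t)" if "t > r" for t
    proof -
      have "(t - r) * norm d = norm ((t - r) *\<^sub>R d)" using that by simp
      also have "\<dots> = norm ((?F t - ?F r) - X t)" by (simp add: X_def)
      also have "\<dots> \<le> b * (t - r) + norm (X t)" using osc[OF that] by (intro order.trans[OF norm_triangle_ineq4]) simp
      finally show ?thesis using that by (simp add: field_simps)
    qed
    have "((\<lambda>t. b + norm ((1 / norm (t - r)) *\<^sub>R X t)) \<longlongrightarrow> b + 0) (at_right r)"
      using lim unfolding X_def d_def by (intro tendsto_add tendsto_const tendsto_norm_zero)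
    then have "norm d \<le> b + 0"
      by (rule tendsto_lowerbound) (use dX in \<open>auto simp: eventually_at_topological intro!: exI[of _ UNIV]\<close>)
    then have "norm (cis (- \<kappa> * r) * (S r - \<i> * of_real \<kappa> * circle_coeff w r n)) \<le> b" by (simp add: d_def)
    then show "norm (S r - \<i> * of_real \<kappa> * circle_coeff w r n) \<le> e * r powr (- 1 / 2)"
      by (simp add: norm_mult b_def)
  qed
qed


text \<open>The Wronskians W with H and W' with conj H are constant, so s is a combination of H and
  conj H and decays like |H|. Evaluating W at large r with the radiation conditions of s and of H
  shows that it is arbitrarily small. Thus W = 0, and s is a multiple of H.\<close>

lemma outer_relation:
  fixes s s1 :: "real \<Rightarrow> complex"
  assumes \<epsilon>: "\<epsilon> > 0" and \<kappa>: "\<kappa> > 0"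
    and sc: "continuous_on {0<..} s" "continuous_on {0<..} s1"
    and ode: "\<And>r. r > \<epsilon> \<Longrightarrow> (s has_vector_derivative (1 / r) *\<^sub>R s1 r) (at r)"
      "\<And>r. r > \<epsilon> \<Longrightarrow> (s1 has_vector_derivative (((real m)\<^sup>2 - r\<^sup>2 * \<kappa>\<^sup>2) / r) *\<^sub>R s r) (at r)"
    and rad: "\<And>e. e > 0 \<Longrightarrow> \<forall>\<^sub>F r in at_top. norm ((1 / r) *\<^sub>R s1 r - \<i> * of_real \<kappa> * s r) \<le> e * r powr (- 1 / 2)"
    and r: "r \<ge> \<epsilon>"
  shows "s r * hank m (\<kappa> * \<epsilon>) = s \<epsilon> * hank m (\<kappa> * r)" "s \<epsilon> * DH m (\<kappa> * \<epsilon>) = s1 \<epsilon> * hank m (\<kappa> * \<epsilon>)"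
proof -
  have kc: "continuous_on {0<..} (\<lambda>r. f (\<kappa> * r))" if "continuous_on {0<..} f" for f :: "real \<Rightarrow> complex"
    by (rule continuous_on_compose2[OF that]) (use \<kappa> in \<open>auto intro!: continuous_intros\<close>)
  have const: "s r * g (\<kappa> * r) - s1 r * f (\<kappa> * r) = s \<epsilon> * g (\<kappa> * \<epsilon>) - s1 \<epsilon> * f (\<kappa> * \<epsilon>)"
    if p: "bessel_pair m f g" and r: "r \<ge> \<epsilon>" for f g r
  proof (rule const_on_halfline[OF _ _ r, of "\<lambda>r. s r * g (\<kappa> * r) - s1 r * f (\<kappa> * r)"])
    have "continuous_on {0<..} (\<lambda>r. s r * g (\<kappa> * r) - s1 r * f (\<kappa> * r))"
      by (intro continuous_intros sc kc bessel_pair_continuous[OF p])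
    then show "continuous_on {\<epsilon>..} (\<lambda>r. s r * g (\<kappa> * r) - s1 r * f (\<kappa> * r))"
      by (rule continuous_on_subset) (use \<epsilon> in auto)
    show "((\<lambda>r. s r * g (\<kappa> * r) - s1 r * f (\<kappa> * r)) has_vector_derivative 0) (at r)" if "r > \<epsilon>" for r
      by (rule wronskian_has_vector_derivative[OF ode bessel_pair_scale[OF p \<kappa>]]) (use that \<epsilon> in auto)
  qed
  define W where "W = s \<epsilon> * DH m (\<kappa> * \<epsilon>) - s1 \<epsilon> * hank m (\<kappa> * \<epsilon>)"
  define W' where "W' = s \<epsilon> * cnj (DH m (\<kappa> * \<epsilon>)) - s1 \<epsilon> * cnj (hank m (\<kappa> * \<epsilon>))"
  have W: "s r * DH m (\<kappa> * r) - s1 r * hank m (\<kappa> * r) = W"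
    and W': "s r * cnj (DH m (\<kappa> * r)) - s1 r * cnj (hank m (\<kappa> * r)) = W'" if "r \<ge> \<epsilon>" for r
    unfolding W_def W'_def using const[OF bessel_pair_hank that] const[OF bessel_pair_cnj_hank that] by simp_all
  define L where "L = (norm W + norm W') * (pi / 4)"
  have L0: "L \<ge> 0" by (simp add: L_def)
  have sW: "s r * (- \<i> * of_real (4 / pi)) = W' * hank m (\<kappa> * r) - W * cnj (hank m (\<kappa> * r))"
    if r: "r \<ge> \<epsilon>" for r
  proof -
    have x: "\<kappa> * r > 0" using \<epsilon> \<kappa> r by simp
    have "s r * (hank m (\<kappa> * r) * cnj (DH m (\<kappa> * r)) - DH m (\<kappa> * r) * cnj (hank m (\<kappa> * r)))
      = W' * hank m (\<kappa> * r) - W * cnj (hank m (\<kappa> * r))"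
      unfolding W[OF r, symmetric] W'[OF r, symmetric] by (simp add: algebra_simps)
    then show ?thesis unfolding wronskian_hank_cnj[OF x] .
  qed
  have sL: "norm (s r) \<le> L * norm (hank m (\<kappa> * r))" if r: "r \<ge> \<epsilon>" for r
  proof -
    have "norm (s r) * (4 / pi) = norm (s r * (- \<i> * of_real (4 / pi)))" by (simp add: norm_mult norm_divide)
    also have "\<dots> = norm (W' * hank m (\<kappa> * r) - W * cnj (hank m (\<kappa> * r)))" unfolding sW[OF r] ..
    also have "\<dots> \<le> (norm W + norm W') * norm (hank m (\<kappa> * r))"
      by (rule order.trans[OF norm_triangle_ineq4]) (simp add: norm_mult algebra_simps)
    finally show ?thesis by (simp add: L_def field_simps)
  qed
  obtain K where K: "\<And>x. x \<ge> 1 \<Longrightarrow> norm (hank m x) \<le> K * x powr (- 1 / 2)"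
    "\<And>x. x \<ge> 1 \<Longrightarrow> norm (DH m x + (1 / 2 - \<i> * of_real x) * hank m x) \<le> K * x powr (- 3 / 2)"
    using hank_asymp[of m] by auto
  have K0: "K \<ge> 0" using order.trans[OF norm_ge_zero K(1)[of 1]] by simp
  have W0: "norm W \<le> e" if e: "e > 0" for e
  proof -
    \<comment> \<open>\<open>d\<close> and \<open>T\<close> distribute e over the three terms of W
      below: at most e/4, e/8 and e/2.\<close>
    define d where "d = e * sqrt \<kappa> / (2 * (K + 1))"
    have d: "d > 0" using e \<kappa> K0 by (simp add: d_def)
    define T where "T = max \<epsilon> (max (1 / \<kappa>) (4 * L * K\<^sup>2 / (e * \<kappa>)))"
    have "\<forall>\<^sub>F r in at_top. norm ((1 / r) *\<^sub>R s1 r - \<i> * of_real \<kappa> * s r) \<le> d * r powr (- 1 / 2) \<and> r \<ge> T"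
      using rad[OF d] eventually_ge_at_top[of T] by eventually_elim simp
    then obtain r where r: "norm ((1 / r) *\<^sub>R s1 r - \<i> * of_real \<kappa> * s r) \<le> d * r powr (- 1 / 2)" "r \<ge> T"
      using eventually_happens'[OF trivial_limit_at_top_linorder] by blast
    have re: "r \<ge> \<epsilon>" and r1: "1 / \<kappa> \<le> r" and r2: "4 * L * K\<^sup>2 / (e * \<kappa>) \<le> r" using r(2) by (simp_all add: T_def)
    have rp: "r > 0" using \<epsilon> re by simp
    define x where "x = \<kappa> * r"
    have x1: "x \<ge> 1" using r1 \<kappa> by (simp add: x_def field_simps)
    have Lx: "4 * L * K\<^sup>2 \<le> e * x" using r2 e \<kappa> by (simp add: x_def field_simps)
    define H where "H = hank m x"
    have Hn: "norm H \<le> K * x powr (- 1 / 2)" unfolding H_def by (rule K(1)[OF x1])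
    have sn: "norm (s r) \<le> L * (K * x powr (- 1 / 2))"
      using order.trans[OF sL[OF re] mult_left_mono[OF Hn[unfolded H_def x_def] L0]] by (simp add: x_def)
    have A0: "K * x powr (- 1 / 2) \<ge> 0" using K0 by simp
    have xx: "x powr (- 1 / 2) * x powr (- 1 / 2) = 1 / x" and xxx: "x powr (- 1 / 2) * x powr (- 3 / 2) \<le> 1 / x"
    proof -
      show "x powr (- 1 / 2) * x powr (- 1 / 2) = 1 / x"
        using x1 by (simp add: powr_add[symmetric] powr_minus field_simps)
      have "x powr (- 1 / 2) * x powr (- 3 / 2) = x powr (- 2)" by (simp add: powr_add[symmetric])
      also have "\<dots> \<le> x powr (- 1)" using x1 by (intro powr_mono) auto
      finally show "x powr (- 1 / 2) * x powr (- 3 / 2) \<le> 1 / x" using x1 by (simp add: powr_minus field_simps)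
    qed
    \<comment> \<open>The defects of H and of s in the radiation condition are inserted; the
      oscillating parts cancel, and every remaining term is small.\<close>
    have "W = s r * (DH m x + (1 / 2 - \<i> * of_real x) * H) - s r * H / 2
        - of_real r * ((1 / r) *\<^sub>R s1 r - \<i> * of_real \<kappa> * s r) * H"
      using W[OF re] rp by (simp add: H_def x_def scaleR_conv_of_real algebra_simps)
    also have "norm \<dots> \<le> norm (s r) * norm (DH m x + (1 / 2 - \<i> * of_real x) * H) + norm (s r) * norm H / 2
        + r * norm ((1 / r) *\<^sub>R s1 r - \<i> * of_real \<kappa> * s r) * norm H"
      using rp by (intro order.trans[OF norm_triangle_ineq4] add_mono) (simp_all add: norm_mult norm_divide)
    also have "norm (s r) * norm (DH m x + (1 / 2 - \<i> * of_real x) * H) \<le> (L * (K * x powr (- 1 / 2))) * (K * x powr (- 3 / 2))"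
      unfolding H_def using K(2)[OF x1] sn L0 A0 by (intro mult_mono) auto
    also have "\<dots> = L * K\<^sup>2 * (x powr (- 1 / 2) * x powr (- 3 / 2))" by (simp add: power2_eq_square)
    also have "\<dots> \<le> L * K\<^sup>2 * (1 / x)" using L0 xxx by (intro mult_left_mono) auto
    also have "norm (s r) * norm H \<le> (L * (K * x powr (- 1 / 2))) * (K * x powr (- 1 / 2))"
      using Hn sn L0 A0 by (intro mult_mono) auto
    also have "\<dots> = L * K\<^sup>2 * (x powr (- 1 / 2) * x powr (- 1 / 2))" by (simp add: power2_eq_square)
    also have "\<dots> = L * K\<^sup>2 * (1 / x)" unfolding xx ..
    also have "r * norm ((1 / r) *\<^sub>R s1 r - \<i> * of_real \<kappa> * s r) * norm H \<le> r * (d * r powr (- 1 / 2)) * (K * x powr (- 1 / 2))"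
      using r(1) rp Hn d A0 by (intro mult_mono mult_left_mono) auto
    also have "\<dots> = d * K * (r powr 1 * r powr (- 1 / 2) * x powr (- 1 / 2))" using rp by simp
    also have "r powr 1 * r powr (- 1 / 2) * x powr (- 1 / 2) = 1 / sqrt \<kappa>"
      using rp \<kappa> by (simp add: x_def powr_mult powr_minus powr_half_sqrt powr_add[symmetric] field_simps)
    finally have "norm W \<le> L * K\<^sup>2 * (1 / x) + L * K\<^sup>2 * (1 / x) / 2 + d * K * (1 / sqrt \<kappa>)" by simp
    moreover have "L * K\<^sup>2 * (1 / x) \<le> e / 4" using Lx x1 by (simp add: field_simps)
    moreover have "d * K * (1 / sqrt \<kappa>) \<le> e / 2" using K0 \<kappa> e by (simp add: d_def field_simps)
    ultimately show ?thesis using e by simp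
  qed
  have "norm W = 0" using W0[of "norm W / 2"] by (cases "W = 0") auto
  then have W00: "W = 0" by simp
  then show "s \<epsilon> * DH m (\<kappa> * \<epsilon>) = s1 \<epsilon> * hank m (\<kappa> * \<epsilon>)" by (simp add: W_def)
  have "s r * hank m (\<kappa> * \<epsilon>) * (- \<i> * of_real (4 / pi)) = s \<epsilon> * hank m (\<kappa> * r) * (- \<i> * of_real (4 / pi))"
  proof -
    have "x * w = b * h \<Longrightarrow> y * w = b * k \<Longrightarrow> x * k * w = y * h * w" for x y w b h k :: complex
      by (metis mult.assoc mult.commute)
    from this[OF sW[OF r, unfolded W00 mult_zero_left diff_zero] sW[OF order_refl, unfolded W00 mult_zero_left diff_zero]]
    show ?thesis .
  qed
  then show "s r * hank m (\<kappa> * \<epsilon>) = s \<epsilon> * hank m (\<kappa> * r)" by simp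
qed


section \<open>Coefficients of the incident and of the scattered field\<close>

lemma incident_coeff:
  assumes ui: "incident_field q0 \<omega> a ui" and r: "r \<ge> 0"
  shows "circle_coeff ui r n = a n * of_real (bessel_J n (sqrt q0 * \<omega> * r))"
proof -
  define b where "b n = a n * complex_of_real (bessel_J n (sqrt q0 * \<omega> * r))" for n
  have hs: "((\<lambda>n. b n * cis (of_int n * \<theta>)) has_sum ui (polar r \<theta>)) UNIV" for \<theta>
    using ui r unfolding incident_field_def b_def by blast
  have uc: "continuous_on UNIV ui" using ui unfolding incident_field_def helmholtz_solution_def by blast
  \<comment> \<open>At theta = 0 all exponentials are 1. Unconditional convergence of complex series
    is absolute, so the tails are small uniformly in theta, and finite sums may be integrated
    instead.\<close>
  have "b summable_on UNIV" using hs[of 0] by (auto simp: summable_on_def)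
  then have abs: "(\<lambda>n. norm (b n)) summable_on UNIV"
    by (simp add: summable_on_iff_abs_summable_on_complex)
  define t where "t = (\<Sum>\<^sub>\<infinity>n. norm (b n))"
  have ort: "integral {0..2 * pi} (\<lambda>\<theta>. cis (of_int k * \<theta>) * cis (- of_int n * \<theta>)) = (if k = n then 2 * pi else 0)" for k :: int
  proof (cases "k = n")
    case True
    then show ?thesis by (simp add: cis_mult scaleR_conv_of_real)
  next
    case False
    define j where "j = k - n"
    have j: "j \<noteq> 0" using False by (simp add: j_def)
    have "((\<lambda>\<theta>. cis (of_int j * \<theta>)) has_integral
        cis (of_int j * (2 * pi)) / (\<i> * of_int j) - cis (of_int j * 0) / (\<i> * of_int j)) {0..2 * pi}"
    proof (rule fundamental_theorem_of_calculus)
      fix x :: real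
      have "((\<lambda>r. of_int j * r) has_vector_derivative of_int j) (at x)"
        by (auto intro!: derivative_eq_intros simp flip: has_real_derivative_iff_has_vector_derivative)
      from vector_diff_chain_at[OF this cis_has_vector_derivative]
      have "((\<lambda>r. cis (of_int j * r)) has_vector_derivative of_int j * (\<i> * cis (of_int j * x))) (at x)"
        by (simp add: o_def scaleR_conv_of_real)
      then have "((\<lambda>r. cis (of_int j * r) / (\<i> * of_int j)) has_vector_derivative of_int j * (\<i> * cis (of_int j * x)) / (\<i> * of_int j)) (at x)"
        by (rule has_vector_derivative_divide)
      then show "((\<lambda>r. cis (of_int j * r) / (\<i> * of_int j)) has_vector_derivative cis (of_int j * x)) (at x within {0..2 * pi})"
        using j by (auto intro: has_vector_derivative_at_within)
    qed simp
    moreover have "cis (of_int j * (2 * pi)) = 1" using cis_multiple_2pi[of "of_int j"] by (simp add: mult_ac)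
    ultimately have "((\<lambda>\<theta>. cis (of_int j * \<theta>)) has_integral 0) {0..2 * pi}" by simp
    then show ?thesis using False by (simp add: cis_mult j_def integral_unique algebra_simps)
  qed
  have le: "norm (circle_coeff ui r n - b n) \<le> e" if e: "e > 0" for e
  proof -
    have "(sum (\<lambda>n. norm (b n)) \<longlongrightarrow> t) (finite_subsets_at_top UNIV)"
      using abs unfolding t_def by (simp add: has_sum_def[symmetric])
    then have "\<forall>\<^sub>F F in finite_subsets_at_top UNIV. dist (\<Sum>n\<in>F. norm (b n)) t < e"
      using e by (rule tendstoD)
    then obtain F0 where F0: "finite F0" "\<And>F. finite F \<Longrightarrow> F0 \<subseteq> F \<Longrightarrow> dist (\<Sum>n\<in>F. norm (b n)) t < e"
      unfolding eventually_finite_subsets_at_top by auto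
    define F where "F = insert n F0"
    have F: "finite F" "n \<in> F" using F0(1) by (simp_all add: F_def)
    have tail: "t - (\<Sum>n\<in>F. norm (b n)) \<le> e"
    proof -
      have "dist (\<Sum>n\<in>F. norm (b n)) t < e" using F0(2)[OF F(1)] by (auto simp: F_def)
      then show ?thesis unfolding dist_real_def by linarith
    qed
    define p where "p x = (\<Sum>k\<in>F. b k * cis (of_int k * x))" for x
    have d: "norm (ui (polar r \<theta>) - p \<theta>) \<le> e" for \<theta>
    proof -
      have 1: "((\<lambda>n. b n * cis (of_int n * \<theta>)) has_sum (ui (polar r \<theta>) - p \<theta>)) (UNIV - F)"
        unfolding p_def by (rule has_sum_Diff[OF hs has_sum_finite[OF F(1)]]) simp
      have 2: "((\<lambda>n. norm (b n)) has_sum (t - (\<Sum>n\<in>F. norm (b n)))) (UNIV - F)"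
        by (rule has_sum_Diff[OF _ has_sum_finite[OF F(1)]]) (use abs in \<open>simp_all add: t_def\<close>)
      have "norm (ui (polar r \<theta>) - p \<theta>) \<le> t - (\<Sum>n\<in>F. norm (b n))"
        by (rule norm_infsum_le[OF 1 2]) (simp add: norm_mult)
      then show ?thesis using tail by simp
    qed
    have ci: "(\<lambda>\<theta>. cis (of_int k * \<theta>) * cis (- of_int n * \<theta>)) integrable_on {0..2 * pi}" for k
      by (intro integrable_continuous_interval) (auto simp: cis_conv_exp intro!: continuous_intros)
    have "integral {0..2 * pi} (\<lambda>\<theta>. p \<theta> * cis (- of_int n * \<theta>))
      = integral {0..2 * pi} (\<lambda>\<theta>. \<Sum>k\<in>F. b k * (cis (of_int k * \<theta>) * cis (- of_int n * \<theta>)))"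
      unfolding p_def by (simp add: sum_distrib_right mult.assoc)
    also have "\<dots> = (\<Sum>k\<in>F. b k * integral {0..2 * pi} (\<lambda>\<theta>. cis (of_int k * \<theta>) * cis (- of_int n * \<theta>)))"
      by (subst integral_sum) (use F ci in \<open>auto intro!: integrable_on_mult_right simp del: mult_minus_left\<close>)
    also have "\<dots> = of_real (2 * pi) * b n"
      unfolding ort using F by (simp add: if_distrib cong: if_cong)
    finally have ip: "integral {0..2 * pi} (\<lambda>\<theta>. p \<theta> * cis (- of_int n * \<theta>)) = of_real (2 * pi) * b n" .
    have c1: "(\<lambda>\<theta>. ui (polar r \<theta>) * cis (- of_int n * \<theta>)) integrable_on {0..2 * pi}"
      by (intro integrable_continuous_interval continuous_intros continuous_on_compose2[OF uc] continuous_polar)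
         (auto simp: cis_conv_exp intro!: continuous_intros)
    have c2: "(\<lambda>\<theta>. p \<theta> * cis (- of_int n * \<theta>)) integrable_on {0..2 * pi}"
      unfolding p_def by (intro integrable_continuous_interval) (auto simp: cis_conv_exp intro!: continuous_intros)
    have "norm (integral {0..2 * pi} (\<lambda>\<theta>. ui (polar r \<theta>) * cis (- of_int n * \<theta>) - p \<theta> * cis (- of_int n * \<theta>)))
      \<le> integral {0..2 * pi} (\<lambda>\<theta>. e)"
      by (rule integral_norm_bound_integral[OF integrable_diff[OF c1 c2]])
         (use d in \<open>auto simp: norm_mult left_diff_distrib[symmetric]\<close>)
    then have i: "norm (integral {0..2 * pi} (\<lambda>\<theta>. ui (polar r \<theta>) * cis (- of_int n * \<theta>)) - of_real (2 * pi) * b n) \<le> 2 * pi * e"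
      by (simp only: integral_diff[OF c1 c2] ip) simp
    have "circle_coeff ui r n - b n = of_real (1 / (2 * pi)) *
       (integral {0..2 * pi} (\<lambda>\<theta>. ui (polar r \<theta>) * cis (- of_int n * \<theta>)) - of_real (2 * pi) * b n)"
      by (simp add: circle_coeff_def right_diff_distrib)
    then have "norm (circle_coeff ui r n - b n) \<le> 1 / (2 * pi) * (2 * pi * e)"
      using mult_left_mono[OF i, of "1 / (2 * pi)"] by (simp only: norm_mult norm_of_real) simp
    then show ?thesis by simp
  qed
  have "norm (circle_coeff ui r n - b n) \<le> 0"
    using le[of "norm (circle_coeff ui r n - b n) / 2"] by (cases "circle_coeff ui r n - b n = 0") auto
  then show ?thesis by (simp add: b_def)
qed


text \<open>The inner relation and the outer relations at \<epsilon> eliminate the unknown interior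
  mode; the combination of J_m and its derivative at the two arguments that is left is - Re D.
  Moduli absorb the sign (-1)^m of negative orders, and the product form avoids the quotient by
  D.\<close>

lemma scattered_coeff:
  assumes \<epsilon>: "\<epsilon> > 0" and q: "q > 0" "q0 > 0" and \<omega>: "\<omega> > 0"
    and ui: "incident_field q0 \<omega> a ui" and u: "total_field \<epsilon> q q0 \<omega> ui u" and r: "r \<ge> \<epsilon>"
  shows "norm (circle_coeff (\<lambda>x. u x - ui x) r n) * norm (scat_den (nat \<bar>n\<bar>) (sqrt (q / q0)) (sqrt q0 * \<omega> * \<epsilon>))
    = norm (a n) * \<bar>Re (scat_den (nat \<bar>n\<bar>) (sqrt (q / q0)) (sqrt q0 * \<omega> * \<epsilon>))\<bar> * norm (hank (nat \<bar>n\<bar>) (sqrt q0 * \<omega> * r))"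
proof -
  define m where "m = nat \<bar>n\<bar>"
  define \<kappa> where "\<kappa> = sqrt q0 * \<omega>"
  define k where "k = sqrt q * \<omega>"
  define l where "l = sqrt (q / q0)"
  have pos: "\<kappa> > 0" "k > 0" "l > 0" and lk: "l * \<kappa> = k" and \<kappa>2: "\<kappa>\<^sup>2 = \<omega>\<^sup>2 * q0" and k2: "k\<^sup>2 = \<omega>\<^sup>2 * q"
    using q \<omega> by (simp_all add: \<kappa>_def k_def l_def real_sqrt_divide power_mult_distrib)
  have V: "(\<lambda>x. \<omega>\<^sup>2 * disc_index \<epsilon> q q0 x) = (\<lambda>x. two_step \<epsilon> (k\<^sup>2) (\<kappa>\<^sup>2) (norm x))"
    by (auto simp: disc_index_def two_step_def \<kappa>2 k2)
  have hu: "helmholtz_solution (\<lambda>x. two_step \<epsilon> (k\<^sup>2) (\<kappa>\<^sup>2) (norm x)) u"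
    and rad: "radiating \<kappa> (\<lambda>x. u x - ui x)"
    using u unfolding total_field_def V by (simp_all add: \<kappa>_def mult.commute)
  have uc: "continuous_on UNIV u" using hu by (simp add: helmholtz_solution_def)
  have uic: "continuous_on UNIV ui" using ui unfolding incident_field_def helmholtz_solution_def by blast
  define c where "c = (\<lambda>r. circle_coeff u r n)"
  obtain c1 where c1: "continuous_on {0<..} c1" "((\<lambda>r. c1 r - real m *\<^sub>R c r) \<longlongrightarrow> 0) (at_right 0)"
    "\<And>r. r > 0 \<Longrightarrow> r \<noteq> \<epsilon> \<Longrightarrow> (c has_vector_derivative (1 / r) *\<^sub>R c1 r) (at r)"
    "\<And>r. r > 0 \<Longrightarrow> r \<noteq> \<epsilon> \<Longrightarrow> (c1 has_vector_derivative (((real m)\<^sup>2 - r\<^sup>2 * two_step \<epsilon> (k\<^sup>2) (\<kappa>\<^sup>2) r) / r) *\<^sub>R c r) (at r)"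
    using circle_mode[OF \<epsilon> hu m_def] unfolding c_def by blast
  have cc: "continuous_on S c" for S
    unfolding c_def by (rule continuous_on_subset[OF circle_coeff_continuous[OF uc]]) simp
  have inner: "c \<epsilon> * bDJ m (k * \<epsilon>) = c1 \<epsilon> * bJ m (k * \<epsilon>)"
  proof (rule inner_relation[OF \<epsilon> pos(2) cc c1(1,2)])
    fix r assume r: "0 < r" "r < \<epsilon>"
    then show "(c has_vector_derivative (1 / r) *\<^sub>R c1 r) (at r)" using c1(3)[of r] by simp
    show "(c1 has_vector_derivative (((real m)\<^sup>2 - r\<^sup>2 * k\<^sup>2) / r) *\<^sub>R c r) (at r)"
      using c1(4)[of r] r by (simp add: two_step_def)
  qed
  define a' where "a' = a n * (if n \<ge> 0 then 1 else (- 1) ^ m)"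
  have na': "norm a' = norm (a n)" by (simp add: a'_def norm_mult norm_power)
  have ic: "circle_coeff ui r n = a' * bJ m (\<kappa> * r)" if "r \<ge> 0" for r
    unfolding incident_coeff[OF ui that] by (simp add: a'_def bJ_def bessel_J_def m_def \<kappa>_def)
  define s where "s r = c r - a' * bJ m (\<kappa> * r)" for r
  define s1 where "s1 r = c1 r - a' * bDJ m (\<kappa> * r)" for r
  have sco: "circle_coeff (\<lambda>x. u x - ui x) r n = s r" if "r \<ge> 0" for r
    unfolding circle_coeff_diff[OF uc uic] ic[OF that] s_def c_def ..
  have kc: "continuous_on {0<..} (\<lambda>r. f (\<kappa> * r))" if "continuous_on {0<..} f" for f :: "real \<Rightarrow> complex"
    by (rule continuous_on_compose2[OF that]) (use pos in \<open>auto intro!: continuous_intros\<close>)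
  have sc: "continuous_on {0<..} s" "continuous_on {0<..} s1"
    unfolding s_def s1_def by (intro continuous_intros cc c1 kc bessel_pair_continuous[OF bessel_pair_bJ])+
  have s': "(s has_vector_derivative (1 / r) *\<^sub>R s1 r) (at r)" if "r > \<epsilon>" for r
  proof -
    have "(s has_vector_derivative (1 / r) *\<^sub>R c1 r - a' * ((1 / r) *\<^sub>R bDJ m (\<kappa> * r))) (at r)"
      unfolding s_def[abs_def] using that \<epsilon>
      by (intro has_vector_derivative_diff has_vector_derivative_mult_right c1(3) bessel_pair_scale[OF bessel_pair_bJ pos(1)]) auto
    then show ?thesis by (rule has_vector_derivative_eq_rhs) (simp add: s1_def scaleR_diff_right)
  qed
  have s1': "(s1 has_vector_derivative (((real m)\<^sup>2 - r\<^sup>2 * \<kappa>\<^sup>2) / r) *\<^sub>R s r) (at r)" if "r > \<epsilon>" for r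
  proof -
    have "(c1 has_vector_derivative (((real m)\<^sup>2 - r\<^sup>2 * \<kappa>\<^sup>2) / r) *\<^sub>R c r) (at r)"
      using c1(4)[of r] that \<epsilon> by (simp add: two_step_def)
    then have "(s1 has_vector_derivative (((real m)\<^sup>2 - r\<^sup>2 * \<kappa>\<^sup>2) / r) *\<^sub>R c r
        - a' * ((((real m)\<^sup>2 - r\<^sup>2 * \<kappa>\<^sup>2) / r) *\<^sub>R bJ m (\<kappa> * r))) (at r)"
      unfolding s1_def[abs_def] using that \<epsilon>
      by (intro has_vector_derivative_diff has_vector_derivative_mult_right bessel_pair_scale[OF bessel_pair_bJ pos(1)]) auto
    then show ?thesis by (rule has_vector_derivative_eq_rhs) (simp add: s_def scaleR_diff_right)
  qed
  have rd: "\<forall>\<^sub>F r in at_top. norm ((1 / r) *\<^sub>R s1 r - \<i> * of_real \<kappa> * s r) \<le> e * r powr (- 1 / 2)" if e: "e > 0" for e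
  proof -
    have "\<forall>\<^sub>F r in at_top. norm ((1 / r) *\<^sub>R s1 r - \<i> * of_real \<kappa> * circle_coeff (\<lambda>x. u x - ui x) r n) \<le> e * r powr (- 1 / 2)"
    proof (rule radiating_coeff[OF _ rad _ e])
      show "continuous_on UNIV (\<lambda>x. u x - ui x)" by (intro continuous_intros uc uic)
      fix r assume r: "r > \<epsilon>"
      show "((\<lambda>r. circle_coeff (\<lambda>x. u x - ui x) r n) has_vector_derivative (1 / r) *\<^sub>R s1 r) (at r)"
        by (rule has_vector_derivative_transform_within_open[OF s'[OF r], of "{0<..}"]) (use r \<epsilon> sco in auto)
    qed
    then show ?thesis using eventually_ge_at_top[of 0] by eventually_elim (simp add: sco)
  qed
  define x where "x = \<kappa> * \<epsilon>"
  have outer: "s r * hank m x = s \<epsilon> * hank m (\<kappa> * r)" "s \<epsilon> * DH m x = s1 \<epsilon> * hank m x"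
    unfolding x_def
    by (rule outer_relation(1)[OF \<epsilon> pos(1) sc s' s1' rd r], assumption+)
       (rule outer_relation(2)[OF \<epsilon> pos(1) sc s' s1' rd order_refl], assumption+)
  have x: "x > 0" using pos \<epsilon> by (simp add: x_def)
  have lx: "l * x = k * \<epsilon>" by (simp add: x_def lk[symmetric])
  have J: "of_real (bessel_J_nat m y) = bJ m y" "of_real (DJ m y) = bDJ m y" for y by (simp_all add: bJ_def bDJ_def)
  have "s \<epsilon> * scat_den m l x = s \<epsilon> * DH m x * bJ m (k * \<epsilon>) - s \<epsilon> * bDJ m (k * \<epsilon>) * hank m x"
    by (simp add: scat_den_def lx J algebra_simps)
  also have "\<dots> = hank m x * (s1 \<epsilon> * bJ m (k * \<epsilon>) - s \<epsilon> * bDJ m (k * \<epsilon>))"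
    unfolding outer(2) by (simp add: algebra_simps)
  also have "s1 \<epsilon> * bJ m (k * \<epsilon>) - s \<epsilon> * bDJ m (k * \<epsilon>)
      = a' * (bJ m x * bDJ m (k * \<epsilon>) - bDJ m x * bJ m (k * \<epsilon>)) + (c1 \<epsilon> * bJ m (k * \<epsilon>) - c \<epsilon> * bDJ m (k * \<epsilon>))"
    by (simp add: s_def s1_def x_def algebra_simps)
  also have "\<dots> = - a' * of_real (Re (scat_den m l x))"
    unfolding inner Re_scat_den[OF x] lx of_real_diff of_real_mult J by (simp add: algebra_simps)
  finally have e: "s \<epsilon> * scat_den m l x = hank m x * (- a' * of_real (Re (scat_den m l x)))" .
  have hn: "hank m x \<noteq> 0" using wronskian_hank_cnj[OF x, of m] by auto
  have "s r * hank m x * scat_den m l x = hank m (\<kappa> * r) * (s \<epsilon> * scat_den m l x)"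
    using outer(1) by (simp add: mult_ac)
  then have "hank m x * (s r * scat_den m l x) = hank m x * (- a' * of_real (Re (scat_den m l x)) * hank m (\<kappa> * r))"
    unfolding e by (simp add: mult_ac)
  then have "s r * scat_den m l x = - a' * of_real (Re (scat_den m l x)) * hank m (\<kappa> * r)" 
    using hn unfolding mult_cancel_left by blast
  then have "norm (s r) * norm (scat_den m l x) = norm (a n) * \<bar>Re (scat_den m l x)\<bar> * norm (hank m (\<kappa> * r))"
    unfolding norm_mult[symmetric] na'[symmetric] by (simp add: norm_mult)
  then show ?thesis using sco[of r] r \<epsilon> by (simp add: m_def l_def x_def \<kappa>_def)
qed

section \<open>Summing the modes\<close>

lemma infsum_cmult_right_ennreal:
  fixes f :: "'a \<Rightarrow> ennreal"
  shows "(\<Sum>\<^sub>\<infinity>x\<in>A. c * f x) = c * (\<Sum>\<^sub>\<infinity>x\<in>A. f x)"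
  by (simp add: nonneg_infsum_complete SUP_mult_left_ennreal sum_distrib_left)

lemma infsum_mono_ennreal:
  fixes f :: "'a \<Rightarrow> ennreal"
  assumes "\<And>x. x \<in> A \<Longrightarrow> f x \<le> g x"
  shows "(\<Sum>\<^sub>\<infinity>x\<in>A. f x) \<le> (\<Sum>\<^sub>\<infinity>x\<in>A. g x)"
  by (rule infsum_mono) (use assms in \<open>auto intro: nonneg_summable_on_complete\<close>)

lemma le_infsum_ennreal:
  fixes f :: "'a \<Rightarrow> ennreal"
  assumes "n \<in> A"
  shows "f n \<le> (\<Sum>\<^sub>\<infinity>x\<in>A. f x)"
proof -
  have "(\<Sum>\<^sub>\<infinity>x\<in>{n}. f x) \<le> (\<Sum>\<^sub>\<infinity>x\<in>A. f x)"
    by (rule infsum_mono_neutral) (use assms in \<open>auto intro: nonneg_summable_on_complete\<close>)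
  then show ?thesis by simp
qed

lemma infsum_split_ennreal:
  fixes f :: "'a \<Rightarrow> ennreal"
  shows "(\<Sum>\<^sub>\<infinity>x. f x) = f z + (\<Sum>\<^sub>\<infinity>x\<in>UNIV - {z}. f x)"
proof -
  have "(\<Sum>\<^sub>\<infinity>x\<in>{z} \<union> (UNIV - {z}). f x) = (\<Sum>\<^sub>\<infinity>x\<in>{z}. f x) + (\<Sum>\<^sub>\<infinity>x\<in>UNIV - {z}. f x)"
    by (rule infsum_Un_disjoint) (auto intro: nonneg_summable_on_complete)
  then show ?thesis by simp
qed

lemma esqrt_mono: "s \<le> t \<Longrightarrow> esqrt s \<le> esqrt t"
  by (cases s; cases t) (auto simp: esqrt_def top_unique intro!: ennreal_leI)

lemma esqrt_ennreal: "t \<ge> 0 \<Longrightarrow> esqrt (ennreal t) = ennreal (sqrt t)"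
  by (simp add: esqrt_def)

lemma esqrt_add_le: "esqrt (s + t) \<le> esqrt s + esqrt t"
proof (cases s; cases t)
  fix a b assume "s = ennreal a" "a \<ge> 0" "t = ennreal b" "b \<ge> 0"
  then show ?thesis
    using sqrt_add_le_add_sqrt[of a b] by (simp add: esqrt_ennreal ennreal_plus[symmetric] ennreal_leI del: ennreal_plus)
qed (auto simp: esqrt_def)

lemma esqrt_cmult: "c \<ge> 0 \<Longrightarrow> esqrt (ennreal (c\<^sup>2) * s) = ennreal c * esqrt s"
proof (cases s)
  case (real a)
  assume "c \<ge> 0"
  with real show ?thesis by (simp add: esqrt_ennreal ennreal_mult[symmetric] real_sqrt_mult)
next
  case top
  assume "c \<ge> 0"
  with top show ?thesis
    by (cases "c = 0") (auto simp: esqrt_def ennreal_mult_top ennreal_top_mult)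
qed

lemma weight_double: "weight (2 * s) n = (weight s n)\<^sup>2"
  by (simp add: weight_def power2_eq_square powr_add[symmetric])

lemma weight_nonneg: "weight s n \<ge> 0"
  by (simp add: weight_def)

lemma abs_bessel_J: "\<bar>bessel_J n x\<bar> = \<bar>bessel_J_nat (nat \<bar>n\<bar>) x\<bar>"
  by (simp add: bessel_J_def abs_mult power_abs)

theorem theorem2p4:
  fixes \<epsilon> R q q0 lam \<sigma> y01 :: real
    and a :: "int \<Rightarrow> complex"
    and ui u :: "real \<Rightarrow> real ^ 2 \<Rightarrow> complex"
  assumes "0 < \<epsilon>" and "\<epsilon> \<le> R" and "0 < q" and "0 < q0"
    and "lam = sqrt (q / q0)" and "lam \<le> 1"
    and "first_positive_zero (bessel_Y 0) y01"
    and "\<And>\<omega>. 0 < \<omega> \<Longrightarrow> incident_field q0 \<omega> a (ui \<omega>)"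
    and "\<And>\<omega>. 0 < \<omega> \<Longrightarrow> total_field \<epsilon> q q0 \<omega> (ui \<omega>) (u \<omega>)"
  shows "(SUP \<omega>\<in>{0<..}. Hs_norm \<sigma> (\<lambda>x. u \<omega> x - ui \<omega> x) R)
           \<le> ennreal (5 / 2 * sqrt (\<epsilon> / R)) * N_sum \<sigma> a
             + ennreal (sqrt (2 * pi) * norm (a 0) * norm (hankel1 0 (y01 * (R / \<epsilon>))))
       \<and> (lam < 1 \<longrightarrow>
           (\<forall>n0::nat.
              n0 = (LEAST p. 0 < p \<and> (\<forall>n\<ge>p. lam\<^sup>2 \<le> 1 - 49 / (9 * real n powr (2 / 3)))) \<longrightarrow>
              ennreal (1 / sqrt 10) * N_sup \<sigma> n0 a
                \<le> (SUP \<omega>\<in>{0<..}. Hs_star_norm \<sigma> (\<lambda>x. u \<omega> x - ui \<omega> x) \<epsilon>)))"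
proof -
  define c where "c \<omega> r n = circle_coeff (\<lambda>x. u \<omega> x - ui \<omega> x) r n" for \<omega> r n
  define D where "D n x = scat_den (nat \<bar>n\<bar>) lam x" for n :: int and x
  define x where "x \<omega> = sqrt q0 * \<omega> * \<epsilon>" for \<omega>
  have lam: "0 < lam" "lam \<le> 1" using assms by simp_all
  have xpos: "x \<omega> > 0" if "\<omega> > 0" for \<omega> using that assms by (simp add: x_def)
  have Dpos: "norm (D n (x \<omega>)) > 0" if "\<omega> > 0" for n \<omega>
    using scat_den_nonzero[OF xpos[OF that] lam(1)] by (simp add: D_def)
  have coeff: "norm (c \<omega> r n) * norm (D n (x \<omega>))
      = norm (a n) * \<bar>Re (D n (x \<omega>))\<bar> * norm (hank (nat \<bar>n\<bar>) (x \<omega> * (r / \<epsilon>)))"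
    if "\<omega> > 0" "r \<ge> \<epsilon>" for \<omega> r n
    using scattered_coeff[OF assms(1,3,4) that(1) assms(8)[OF that(1)] assms(9)[OF that(1)] that(2), of n] assms(1,5)
    by (simp add: c_def D_def x_def mult.assoc)
  have R: "R / \<epsilon> \<ge> 1" "R > 0" using assms by simp_all
  have y01: "y01 > 0" "bessel_Y_nat 0 y01 = 0" "\<And>x. 0 < x \<Longrightarrow> x < y01 \<Longrightarrow> bessel_Y_nat 0 x \<noteq> 0"
    using assms(7) by (auto simp: first_positive_zero_def bessel_Y_def)
  have upper: "Hs_norm \<sigma> (\<lambda>x. u \<omega> x - ui \<omega> x) R \<le> ennreal (5 / 2 * sqrt (\<epsilon> / R)) * N_sum \<sigma> a
             + ennreal (sqrt (2 * pi) * norm (a 0) * norm (hankel1 0 (y01 * (R / \<epsilon>))))" if \<omega>: "\<omega> > 0" for \<omega>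
  proof -
    let ?f = "\<lambda>n. ennreal ((norm (c \<omega> R n))\<^sup>2 * weight (2 * \<sigma>) n)"
    let ?g = "\<lambda>n. ennreal ((norm (a n))\<^sup>2) * (sup_J n)\<^sup>2 * ennreal (weight (2 * \<sigma>) n)"
    have n0: "norm (c \<omega> R 0) \<le> norm (a 0) * norm (hankel1 0 (y01 * (R / \<epsilon>)))"
    proof -
      have "norm (c \<omega> R 0) * norm (D 0 (x \<omega>)) \<le> norm (a 0) * (norm (hank 0 (y01 * (R / \<epsilon>))) * norm (D 0 (x \<omega>)))"
        using mult_left_mono[OF scat_upper_0[OF y01 xpos[OF \<omega>] lam R(1)] norm_ge_zero[of "a 0"]]
        unfolding coeff[OF \<omega> assms(2)] by (simp add: D_def mult.assoc)
      then show ?thesis using Dpos[OF \<omega>, of 0] y01(1) R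
        by (simp add: hank_0_eq_hankel1 mult.assoc[symmetric] assms(1))
    qed
    \<comment> \<open>For each frequency the mode is bounded by |J_n| at some point y depending on
      it; passing to the supremum over y removes the frequency.\<close>
    have star: "?f n \<le> ennreal ((sqrt (\<epsilon> / R))\<^sup>2) * ?g n" if n: "n \<noteq> 0" for n
    proof -
      have "nat \<bar>n\<bar> > 0" using n by simp
      from scat_upper[OF this xpos[OF \<omega>] lam R(1)] obtain y where y: "y > 0"
        "\<bar>Re (D n (x \<omega>))\<bar> * norm (hank (nat \<bar>n\<bar>) (x \<omega> * (R / \<epsilon>))) \<le> sqrt (\<epsilon> / R) * \<bar>bessel_J n y\<bar> * norm (D n (x \<omega>))"
        by (auto simp: D_def abs_bessel_J)
      have "norm (c \<omega> R n) * norm (D n (x \<omega>)) \<le> norm (a n) * (sqrt (\<epsilon> / R) * \<bar>bessel_J n y\<bar> * norm (D n (x \<omega>)))"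
        using mult_left_mono[OF y(2) norm_ge_zero[of "a n"]] unfolding coeff[OF \<omega> assms(2)] by (simp add: mult.assoc)
      then have "norm (c \<omega> R n) * norm (D n (x \<omega>)) \<le> sqrt (\<epsilon> / R) * norm (a n) * \<bar>bessel_J n y\<bar> * norm (D n (x \<omega>))"
        by (simp only: mult_ac)
      then have "norm (c \<omega> R n) \<le> sqrt (\<epsilon> / R) * norm (a n) * \<bar>bessel_J n y\<bar>"
        using Dpos[OF \<omega>, of n] by (simp only: mult_le_cancel_right_pos)
      then have "(norm (c \<omega> R n))\<^sup>2 \<le> (sqrt (\<epsilon> / R) * norm (a n) * \<bar>bessel_J n y\<bar>)\<^sup>2"
        by (intro power_mono) auto
      then have "?f n \<le> ennreal ((sqrt (\<epsilon> / R) * norm (a n) * \<bar>bessel_J n y\<bar>)\<^sup>2 * weight (2 * \<sigma>) n)"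
        by (intro ennreal_leI mult_right_mono weight_nonneg)
      also have "\<dots> = ennreal ((sqrt (\<epsilon> / R))\<^sup>2) * (ennreal ((norm (a n))\<^sup>2) * (ennreal \<bar>bessel_J n y\<bar>)\<^sup>2 * ennreal (weight (2 * \<sigma>) n))"
        using weight_nonneg[of "2 * \<sigma>" n] by (simp only: power_mult_distrib ennreal_power abs_ge_zero ennreal_mult zero_le_power2 mult_nonneg_nonneg mult.assoc)
      also have "\<dots> \<le> ennreal ((sqrt (\<epsilon> / R))\<^sup>2) * ?g n"
        unfolding sup_J_def using y(1) by (intro mult_mono power_mono SUP_upper) auto
      finally show ?thesis .
    qed
    have "esqrt (\<Sum>\<^sub>\<infinity>n. ?f n) \<le> esqrt (?f 0) + esqrt (\<Sum>\<^sub>\<infinity>n\<in>UNIV - {0}. ?f n)"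
      unfolding infsum_split_ennreal[of ?f 0] by (rule esqrt_add_le)
    also have "esqrt (?f 0) = ennreal (norm (c \<omega> R 0))" by (simp add: esqrt_ennreal weight_def)
    also have "\<dots> \<le> ennreal (norm (a 0) * norm (hankel1 0 (y01 * (R / \<epsilon>))))" by (rule ennreal_leI[OF n0])
    also have "esqrt (\<Sum>\<^sub>\<infinity>n\<in>UNIV - {0}. ?f n) \<le> esqrt (\<Sum>\<^sub>\<infinity>n\<in>UNIV - {0}. ennreal ((sqrt (\<epsilon> / R))\<^sup>2) * ?g n)"
      by (intro esqrt_mono infsum_mono_ennreal star) simp
    also have "\<dots> = ennreal (sqrt (\<epsilon> / R)) * esqrt (\<Sum>\<^sub>\<infinity>n\<in>UNIV - {0}. ?g n)"
      unfolding infsum_cmult_right_ennreal using assms(1) R by (intro esqrt_cmult) simp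
    \<comment> \<open>The estimate holds with factor 1 up to this point; it is enlarged to the
      stated 5/2.\<close>
    also have "ennreal (sqrt (\<epsilon> / R)) * esqrt (\<Sum>\<^sub>\<infinity>n\<in>UNIV - {0}. ?g n)
        \<le> ennreal (5 / 2 * sqrt (\<epsilon> / R)) * esqrt (\<Sum>\<^sub>\<infinity>n\<in>UNIV - {0}. ?g n)"
      using assms(1) R by (intro mult_right_mono ennreal_leI) auto
    finally have "Hs_norm \<sigma> (\<lambda>x. u \<omega> x - ui \<omega> x) R \<le> ennreal (sqrt (2 * pi)) *
        (ennreal (norm (a 0) * norm (hankel1 0 (y01 * (R / \<epsilon>)))) + ennreal (5 / 2 * sqrt (\<epsilon> / R)) * esqrt (\<Sum>\<^sub>\<infinity>n\<in>UNIV - {0}. ?g n))"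
      unfolding Hs_norm_def c_def by (intro mult_left_mono add_mono) auto
    also have "\<dots> = ennreal (5 / 2 * sqrt (\<epsilon> / R)) * N_sum \<sigma> a
             + ennreal (sqrt (2 * pi) * norm (a 0) * norm (hankel1 0 (y01 * (R / \<epsilon>))))"
      unfolding N_sum_def distrib_left by (simp add: ennreal_mult mult_ac add.commute)
    finally show ?thesis .
  qed
  have lower: "ennreal (1 / sqrt 10) * N_sup \<sigma> n0 a \<le> (SUP \<omega>\<in>{0<..}. Hs_star_norm \<sigma> (\<lambda>x. u \<omega> x - ui \<omega> x) \<epsilon>)"
    if l1: "lam < 1" and n0: "n0 = (LEAST p. 0 < p \<and> (\<forall>n\<ge>p. lam\<^sup>2 \<le> 1 - 49 / (9 * real n powr (2 / 3))))" for n0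
  proof -
    \<comment> \<open>The threshold tends to 1 while lam < 1, so the set is nonempty and the
      \<open>LEAST\<close> operator yields a member of it.\<close>
    have "\<exists>p. 0 < p \<and> (\<forall>n\<ge>p. lam\<^sup>2 \<le> 1 - 49 / (9 * real n powr (2 / 3)))"
    proof -
      have "lam\<^sup>2 < 1" using lam l1 by (simp add: power_less_one_iff abs_square_less_1)
      moreover have "((\<lambda>n. 1 - 49 / (9 * real n powr (2 / 3))) \<longlongrightarrow> 1) sequentially" by real_asymp
      ultimately have "\<forall>\<^sub>F n in sequentially. lam\<^sup>2 < 1 - 49 / (9 * real n powr (2 / 3))" by (rule order_tendstoD(1)[rotated])
      then obtain N where "\<And>n. n \<ge> N \<Longrightarrow> lam\<^sup>2 < 1 - 49 / (9 * real n powr (2 / 3))" by (auto simp: eventually_sequentially)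
      then show ?thesis by (intro exI[of _ "Suc N"]) (auto intro: less_imp_le)
    qed
    from LeastI_ex[OF this] have n0p: "0 < n0" "\<And>n. n \<ge> n0 \<Longrightarrow> lam\<^sup>2 \<le> 1 - 49 / (9 * real n powr (2 / 3))"
      unfolding n0 by blast+
    let ?S = "SUP \<omega>\<in>{0<..}. Hs_star_norm \<sigma> (\<lambda>x. u \<omega> x - ui \<omega> x) \<epsilon>"
    have "ennreal (1 / sqrt 10) * (ennreal (sqrt (2 * pi)) * (ennreal (norm (a n)) * sup_J n * ennreal (weight \<sigma> n))) \<le> ?S"
      if n: "int n0 \<le> \<bar>n\<bar>" for n
    proof -
      define m where "m = nat \<bar>n\<bar>"
      have m: "m > 0" "m \<ge> n0" "n \<noteq> 0" using n n0p(1) by (auto simp: m_def)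
      obtain z where z: "z > 0" "Im (scat_den m lam z) = 0" "\<And>y. y > 0 \<Longrightarrow> \<bar>bessel_J_nat m y\<bar> \<le> sqrt 10 * norm (hank m z)"
        using scat_lower[OF m(1) lam(1) n0p(2)[OF m(2)]] by blast
      \<comment> \<open>The frequency at which Im D vanishes for this mode. It may depend on n,
        since one mode alone bounds the norm from below and the supremum over frequencies is taken
        afterwards.\<close>
      define \<omega> where "\<omega> = z / (sqrt q0 * \<epsilon>)"
      have \<omega>: "\<omega> > 0" and x\<omega>: "x \<omega> = z" using z assms(1,4) by (simp_all add: \<omega>_def x_def)
      have "norm (D n z) = \<bar>Re (D n z)\<bar>" using z(2) by (simp add: D_def m_def[symmetric] cmod_eq_Re)
      then have cn: "norm (c \<omega> \<epsilon> n) = norm (a n) * norm (hank m z)"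
        using coeff[OF \<omega> order_refl, of n] Dpos[OF \<omega>, of n] assms(1) by (simp add: x\<omega> m_def)
      have sJ: "sup_J n \<le> ennreal (sqrt 10 * norm (hank m z))"
        unfolding sup_J_def by (intro SUP_least ennreal_leI) (use z(3) in \<open>auto simp: abs_bessel_J m_def\<close>)
      have "ennreal (1 / sqrt 10) * (ennreal (norm (a n)) * sup_J n * ennreal (weight \<sigma> n))
        \<le> ennreal (1 / sqrt 10) * (ennreal (norm (a n)) * ennreal (sqrt 10 * norm (hank m z)) * ennreal (weight \<sigma> n))"
        by (intro mult_mono sJ) auto
      also have "\<dots> = ennreal (1 / sqrt 10 * (norm (a n) * (sqrt 10 * norm (hank m z)) * weight \<sigma> n))"
        using weight_nonneg[of \<sigma> n] by (simp only: ennreal_mult norm_ge_zero mult_nonneg_nonneg zero_le_divide_1_iff real_sqrt_ge_zero zero_le_numeral)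
      also have "1 / sqrt 10 * (norm (a n) * (sqrt 10 * norm (hank m z)) * weight \<sigma> n) = norm (c \<omega> \<epsilon> n) * weight \<sigma> n"
        by (simp add: cn)
      also have "ennreal \<dots> = esqrt (ennreal ((norm (c \<omega> \<epsilon> n))\<^sup>2 * weight (2 * \<sigma>) n))"
        using weight_nonneg[of \<sigma> n] by (simp add: esqrt_ennreal weight_double real_sqrt_mult)
      also have "\<dots> \<le> esqrt (\<Sum>\<^sub>\<infinity>n\<in>UNIV - {0}. ennreal ((norm (c \<omega> \<epsilon> n))\<^sup>2 * weight (2 * \<sigma>) n))"
        by (intro esqrt_mono le_infsum_ennreal) (use m in auto)
      finally have "ennreal (sqrt (2 * pi)) * (ennreal (1 / sqrt 10) * (ennreal (norm (a n)) * sup_J n * ennreal (weight \<sigma> n)))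
        \<le> Hs_star_norm \<sigma> (\<lambda>x. u \<omega> x - ui \<omega> x) \<epsilon>"
        unfolding Hs_star_norm_def c_def by (rule mult_left_mono) simp
      also have "\<dots> \<le> ?S" using \<omega> by (intro SUP_upper) simp
      finally show ?thesis by (simp only: mult_ac)
    qed
    then show ?thesis unfolding N_sup_def SUP_mult_left_ennreal by (intro SUP_least) simp
  qed
  show ?thesis using upper lower by (auto intro!: SUP_least)
qed

end
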